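(* Suppose that the map $f$ is partially captive (and $m<0$ is small enough, i.e. sufficiently negative). Then the spectral radius $r_s(\hat F_\nu)$ of the operator $\hat F_\nu:H^m(S^1)\to H^m(S^1)$ does not depend on $m$ and satisfies, in the semiclassical limit $\nu\to\infty$, $$r_s(\hat F_\nu)\le\frac{1}{\sqrt{E_{\min}}}+o(1),$$ where $\frac{1}{\sqrt{E_{\min}}}$ is strictly smaller than $1$ because $E_{\min}>1$.
   Context: Let $S^1=\mathbb R/\mathbb Z$ and let $g:S^1\to S^1$ be a $C^\infty$ diffeomorphism, written as $g:\mathbb R\to\mathbb R$ with $g(x+1)=g(x)+1$. Let $k\ge 2$ be an integer and $E:S^1\to S^1$, $E(x)=k\,g(x)\bmod 1$. Put $E_{\min}:=\min_x E'(x)=k\min_x g'(x)$ and assume $E_{\min}>1$. Let $\tau:S^1\to\mathbb R$ be $C^\infty$, and let $f:\mathbb T^2\to\mathbb T^2$ (with $\mathbb T^2=S^1\times S^1$) be $f(x,s)=(E(x),\,s+\frac{1}{2\pi}\tau(x))\bmod 1$. For a real parameter $\nu$, $\hat F_\nu$ is the operator $(\hat F_\nu\varphi)(x)=\varphi(E(x))e^{i\nu\tau(x)}$, extended to distributions $\mathcal D'(S^1)$ by duality with its $L^2$-adjoint $(\hat F_\nu^*\varphi)(y)=\sum_{x\in E^{-1}(y)}\frac{e^{-i\nu\tau(x)}}{E'(x)}\varphi(x)$. For $m<0$ it restricts to a bounded operator on the Sobolev space $H^m(S^1)=\langle -i\,d/dx\rangle^{-m}(L^2(S^1))$, where $\langle\xi\rangle=(1+\xi^2)^{1/2}$.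 Partial captivity. For $\varepsilon\in\{0,\dots,k-1\}$ let $E_\varepsilon^{-1}(x)=g^{-1}\left(\frac{x+\varepsilon}{k}\right)$, $x\in[0,1)$, be the inverse branches of $E$, and define $F_\varepsilon:S^1\times\mathbb R\to S^1\times\mathbb R$ by $F_\varepsilon(x,\xi)=(x'_\varepsilon,\xi'_\varepsilon)$, with $x'_\varepsilon=E_\varepsilon^{-1}(x)$ and $\xi'_\varepsilon=E'(x'_\varepsilon)\,\xi+\tau'(x'_\varepsilon)$. For a word $\varepsilon=(\varepsilon_n,\dots,\varepsilon_1)\in\{0,\dots,k-1\}^n$ put $F^n_\varepsilon=F_{\varepsilon_n}\circ\cdots\circ F_{\varepsilon_1}$. Fix $1<\kappa<E_{\min}$ and $R\ge0$ such that $|\xi'_\varepsilon|>\kappa|\xi|$ for all $x$, all $|\xi|>R$ and all $\varepsilon$ (such $R$ exists), and let $\mathcal Z=S^1\times[-R,R]$. Set $$\mathcal N(n)=\max_{(x,\xi)\in S^1\times\mathbb R}\ \sharp\{\varepsilon\in\{0,\dots,k-1\}^n:\ F^n_\varepsilon(x,\xi)\in\mathcal Z\}.$$ The map $f$ is called partially captive if $\frac{\log\mathcal N(n)}{n}\to0$ as $n\to\infty$. (This property does not depend on the choice of $\mathcal Z$.) *)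

theory Defs
  imports "HOL-Analysis.Analysis"
begin

text \<open>
  Functions on the circle \<open>\<real>/\<int>\<close> are 1-periodic functions on \<open>\<real>\<close>; points of the circle are
  represented in \<open>[0,1)\<close>.
\<close>

definition nderiv :: "nat \<Rightarrow> (real \<Rightarrow> 'a::real_normed_vector) \<Rightarrow> real \<Rightarrow> 'a" where
  "nderiv n f = ((\<lambda>h x. vector_derivative h (at x)) ^^ n) f"

definition smooth :: "(real \<Rightarrow> 'a::real_normed_vector) \<Rightarrow> bool" where
  "smooth f \<longleftrightarrow> (\<forall>n x. nderiv n f differentiable (at x))"

definition periodic1 :: "(real \<Rightarrow> 'a) \<Rightarrow> bool" where
  "periodic1 f \<longleftrightarrow> (\<forall>x. f (x + 1) = f x)"

definition circle_diffeo_lift :: "(real \<Rightarrow> real) \<Rightarrow> bool" where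
  "circle_diffeo_lift g \<longleftrightarrow>
     smooth g \<and> (\<forall>x. g (x + 1) = g x + 1) \<and> bij g \<and> smooth (inv g)"

definition expanding_map :: "nat \<Rightarrow> (real \<Rightarrow> real) \<Rightarrow> real \<Rightarrow> real" where
  "expanding_map k g x = real k * g x"

text \<open>The minimum of the continuous periodic function \<open>E'\<close>, as an infimum.\<close>

definition E_min :: "nat \<Rightarrow> (real \<Rightarrow> real) \<Rightarrow> real" where
  "E_min k g = (INF x. deriv (expanding_map k g) x)"


subsection \<open>Distributions on the circle\<close>

definition test_functions :: "(real \<Rightarrow> complex) set" where
  "test_functions = {\<phi>. smooth \<phi> \<and> periodic1 \<phi>}"

type_synonym distribution = "(real \<Rightarrow> complex) \<Rightarrow> complex"

text \<open>
  The pairing of a distribution with a test function is bilinear. A distribution takes the value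
  0 outside the test functions, so that distributions that agree on all test functions are equal.
\<close>

definition distributions :: "distribution set" where
  "distributions = {u.
     (\<forall>\<phi>\<in>test_functions. \<forall>\<psi>\<in>test_functions. \<forall>a b.
        u (\<lambda>x. a * \<phi> x + b * \<psi> x) = a * u \<phi> + b * u \<psi>) \<and>
     (\<exists>C N. \<forall>\<phi>\<in>test_functions.
        cmod (u \<phi>) \<le> C * (\<Sum>j\<le>N. SUP x. cmod (nderiv j \<phi> x))) \<and>
     (\<forall>\<phi>. \<phi> \<notin> test_functions \<longrightarrow> u \<phi> = 0)}"

definition L2_circle :: "(real \<Rightarrow> complex) set" where
  "L2_circle = {v. v \<in> borel_measurable borel \<and> periodic1 v \<and>
     set_integrable lborel {0..1} (\<lambda>x. (cmod (v x))\<^sup>2)}"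

definition L2_norm_circle :: "(real \<Rightarrow> complex) \<Rightarrow> real" where
  "L2_norm_circle v = sqrt (LINT x:{0..1}|lborel. (cmod (v x))\<^sup>2)"

definition distribution_of :: "(real \<Rightarrow> complex) \<Rightarrow> distribution" where
  "distribution_of v \<phi> =
     (if \<phi> \<in> test_functions then LINT x:{0..1}|lborel. v x * \<phi> x else 0)"


subsection \<open>Sobolev spaces\<close>

definition japanese :: "real \<Rightarrow> real" where
  "japanese \<xi> = sqrt (1 + \<xi>\<^sup>2)"

definition fourier_coeff :: "(real \<Rightarrow> complex) \<Rightarrow> int \<Rightarrow> complex" where
  "fourier_coeff \<phi> n = (LINT x:{0..1}|lborel. cis (- 2 * pi * real_of_int n * x) * \<phi> x)"

text \<open>
  The operator \<open>\<langle>-i d/dx\<rangle>\<^sup>s\<close>. On the circle of length 1 the frequencies are \<open>2\<pi>n\<close> with \<open>n\<close> an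
  integer. The symbol is even, so the operator is its own transpose for the bilinear pairing.
\<close>

definition bessel_test :: "real \<Rightarrow> (real \<Rightarrow> complex) \<Rightarrow> real \<Rightarrow> complex" where
  "bessel_test s \<phi> x =
     (\<Sum>\<^sub>\<infinity>n::int. of_real (japanese (2 * pi * real_of_int n) powr s) *
        fourier_coeff \<phi> n * cis (2 * pi * real_of_int n * x))"

definition bessel :: "real \<Rightarrow> distribution \<Rightarrow> distribution" where
  "bessel s u \<phi> = (if \<phi> \<in> test_functions then u (bessel_test s \<phi>) else 0)"

definition sobolev :: "real \<Rightarrow> distribution set" where
  "sobolev m = (\<lambda>v. bessel (- m) (distribution_of v)) ` L2_circle"

text \<open>
  The norm that makes \<open>\<langle>-i d/dx\<rangle>\<^sup>-\<^sup>m\<close> an isometry from \<open>L\<^sup>2\<close> onto \<open>H\<^sup>m\<close>; the function \<open>v\<close> is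
  determined by \<open>u\<close> almost everywhere.
\<close>

definition sobolev_norm :: "real \<Rightarrow> distribution \<Rightarrow> real" where
  "sobolev_norm m u =
     (THE r. \<exists>v\<in>L2_circle. u = bessel (- m) (distribution_of v) \<and> r = L2_norm_circle v)"


subsection \<open>Spectral radius of a bounded operator on a normed space of distributions\<close>

definition bounded_operator_on ::
  "distribution set \<Rightarrow> (distribution \<Rightarrow> real) \<Rightarrow> (distribution \<Rightarrow> distribution) \<Rightarrow> bool" where
  "bounded_operator_on X N A \<longleftrightarrow>
     A ` X \<subseteq> X \<and>
     (\<forall>u\<in>X. \<forall>v\<in>X. \<forall>a b.
        A (\<lambda>\<phi>. a * u \<phi> + b * v \<phi>) = (\<lambda>\<phi>. a * A u \<phi> + b * A v \<phi>)) \<and>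
     (\<exists>C. \<forall>u\<in>X. N (A u) \<le> C * N u)"

definition resolvent_set ::
  "distribution set \<Rightarrow> (distribution \<Rightarrow> real) \<Rightarrow> (distribution \<Rightarrow> distribution) \<Rightarrow> complex set" where
  "resolvent_set X N A = {z. \<exists>B. bounded_operator_on X N B \<and>
     (\<forall>u\<in>X. B (\<lambda>\<phi>. z * u \<phi> - A u \<phi>) = u \<and> (\<lambda>\<phi>. z * B u \<phi> - A (B u) \<phi>) = u)}"

definition spectral_radius_on ::
  "distribution set \<Rightarrow> (distribution \<Rightarrow> real) \<Rightarrow> (distribution \<Rightarrow> distribution) \<Rightarrow> real" where
  "spectral_radius_on X N A = (SUP z \<in> - resolvent_set X N A. cmod z)"


subsection \<open>The transfer operator\<close>

definition transfer_adjoint ::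
  "nat \<Rightarrow> (real \<Rightarrow> real) \<Rightarrow> (real \<Rightarrow> real) \<Rightarrow> real \<Rightarrow> (real \<Rightarrow> complex) \<Rightarrow> real \<Rightarrow> complex" where
  "transfer_adjoint k g \<tau> \<nu> \<phi> y =
     (\<Sum>x | x \<in> {0..<1} \<and> expanding_map k g x - y \<in> \<int>.
        cis (- \<nu> * \<tau> x) / of_real (deriv (expanding_map k g) x) * \<phi> x)"

text \<open>
  The extension of \<open>\<phi> \<mapsto> (\<phi> \<circ> E) e\<^sup>i\<^sup>\<nu>\<^sup>\<tau>\<close> to distributions. The \<open>L\<^sup>2\<close> product of \<open>u\<close> with \<open>\<psi>\<close> is the
  bilinear pairing of \<open>u\<close> with the conjugate of \<open>\<psi>\<close>; duality therefore conjugates the test function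
  before and after the adjoint is applied.
\<close>

definition transfer_op ::
  "nat \<Rightarrow> (real \<Rightarrow> real) \<Rightarrow> (real \<Rightarrow> real) \<Rightarrow> real \<Rightarrow> distribution \<Rightarrow> distribution" where
  "transfer_op k g \<tau> \<nu> u \<phi> =
     (if \<phi> \<in> test_functions
      then u (\<lambda>y. cnj (transfer_adjoint k g \<tau> \<nu> (\<lambda>x. cnj (\<phi> x)) y))
      else 0)"

definition transfer_spectral_radius ::
  "nat \<Rightarrow> (real \<Rightarrow> real) \<Rightarrow> (real \<Rightarrow> real) \<Rightarrow> real \<Rightarrow> real \<Rightarrow> real" where
  "transfer_spectral_radius k g \<tau> \<nu> m =
     spectral_radius_on (sobolev m) (sobolev_norm m) (transfer_op k g \<tau> \<nu>)"


subsection \<open>Partial captivity\<close>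

text \<open>
  The phase space \<open>S\<^sup>1 \<times> \<real>\<close> is represented by \<open>[0,1) \<times> \<real>\<close>, hence the fractional part.
\<close>

definition phase_space :: "(real \<times> real) set" where
  "phase_space = {0..<1} \<times> UNIV"

definition inverse_branch :: "nat \<Rightarrow> (real \<Rightarrow> real) \<Rightarrow> nat \<Rightarrow> real \<Rightarrow> real" where
  "inverse_branch k g \<epsilon> x = frac (inv g ((x + real \<epsilon>) / real k))"

definition canonical_map ::
  "nat \<Rightarrow> (real \<Rightarrow> real) \<Rightarrow> (real \<Rightarrow> real) \<Rightarrow> nat \<Rightarrow> real \<times> real \<Rightarrow> real \<times> real" where
  "canonical_map k g \<tau> \<epsilon> p =
     (let x' = inverse_branch k g \<epsilon> (fst p)
      in (x', deriv (expanding_map k g) x' * snd p + deriv \<tau> x'))"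

definition trapping_zone :: "real \<Rightarrow> (real \<times> real) set" where
  "trapping_zone R = {0..<1} \<times> {-R..R}"

definition escape_radius ::
  "nat \<Rightarrow> (real \<Rightarrow> real) \<Rightarrow> (real \<Rightarrow> real) \<Rightarrow> real \<Rightarrow> real \<Rightarrow> bool" where
  "escape_radius k g \<tau> \<kappa> R \<longleftrightarrow>
     (\<forall>x\<in>{0..<1}. \<forall>\<xi>. \<forall>\<epsilon><k. \<bar>\<xi>\<bar> > R \<longrightarrow> \<bar>snd (canonical_map k g \<tau> \<epsilon> (x, \<xi>))\<bar> > \<kappa> * \<bar>\<xi>\<bar>)"

text \<open>
  Words are listed as \<open>(\<epsilon>\<^sub>n, \<dots>, \<epsilon>\<^sub>1)\<close>, so the last letter acts first, as \<open>foldr\<close> does. The maximum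
  is over a finite set, since the cardinalities are at most \<open>k\<^sup>n\<close>.
\<close>

definition captive_count ::
  "nat \<Rightarrow> (real \<Rightarrow> real) \<Rightarrow> (real \<Rightarrow> real) \<Rightarrow> real \<Rightarrow> nat \<Rightarrow> nat" where
  "captive_count k g \<tau> R n =
     (MAX p\<in>phase_space. card {w. length w = n \<and> set w \<subseteq> {..<k} \<and>
        foldr (canonical_map k g \<tau>) w p \<in> trapping_zone R})"

definition partially_captive ::
  "nat \<Rightarrow> (real \<Rightarrow> real) \<Rightarrow> (real \<Rightarrow> real) \<Rightarrow> real \<Rightarrow> bool" where
  "partially_captive k g \<tau> R \<longleftrightarrow>
     (\<lambda>n. ln (real (captive_count k g \<tau> R n)) / real n) \<longlonglongrightarrow> 0"

end

theory Submission
  imports Defs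
begin

text \<open>
  In the Fourier basis, the \<open>n\<close>-th power of the operator is the matrix \<open>T n \<nu> j l\<close> of oscillatory
  integrals with phase \<open>\<nu> \<theta>\<^sub>n + 2\<pi>(l E\<^sup>n - j x)\<close>. Since \<open>E\<close> expands, this phase is not stationary for
  high frequencies \<open>l\<close> unless \<open>j\<close> is larger than \<open>\<kappa>\<^sup>n l\<close>, where the weight of \<open>H\<^sup>m\<close> gains a factor \<open>\<kappa>\<^sup>n\<^sup>m\<close>.
  Hence for \<open>m\<close> very negative the operator is small on high frequencies, up to a smoothing remainder.
  This makes the spectrum outside a given disc independent of \<open>m\<close>.

  On the frequencies of size \<open>O(\<nu>)\<close>, cut off in phase space: up to \<open>O(1/\<nu>)\<close> only the words whose
  trajectory is still in the trapping zone contribute to \<open>T T\<^sup>*\<close>, so the square of the \<open>L\<^sup>2\<close> norm of the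
  \<open>n\<close>-th power is at most a constant times \<open>N(n) / E\<^sub>m\<^sub>i\<^sub>n\<^sup>n\<close>. Partial captivity removes \<open>N(n)\<close> in the
  limit of large \<open>n\<close>, and the resolvent bound follows from a Neumann series for the \<open>n\<close>-th power.

  Sobolev spaces are identified with weighted sequence spaces by the Riesz-Fischer theorem. The
  spectrum is not empty, so that the supremum in the spectral radius is meaningful: \<open>0\<close> belongs to it
  because the adjoint has a nontrivial kernel when \<open>k \<ge> 2\<close>.
\<close>

text \<open>Partial captivity reaches a given accuracy only for some number \<open>n\<close> of
  iterations, and the admissible exponents \<open>m\<close> depend on \<open>n\<close>, hence on the
  accuracy. A bound on \<open>m\<close> that serves every accuracy is recovered because the spectra
  for two exponents coincide outside a disc. This holds only outside discs, and a smaller disc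
  requires a more negative exponent: hence the \<open>\<delta>\<close> in the first claim. Constants
  must be uniform in \<open>\<nu>\<close> although the phase and the number of relevant frequencies
  both grow with \<open>\<nu>\<close>. Two devices achieve this. Oscillatory integrals are estimated
  for whole families, normalized so that the phase derivatives stay bounded. At low frequencies the
  rescaled variable \<open>2 * pi * l / \<nu>\<close> stays in a fixed interval, which is cut into a
  number of cells independent of \<open>\<nu>\<close>, with one cutoff for each cell. The weight of
  \<open>H^m\<close> is flattened below a threshold, of order \<open>\<nu>\<close> for the radius
  bound, so that L2 estimates apply there. Resolvent sets do not see such a change of norm. The
  estimates divide by \<open>R\<close>. Captivity itself excludes \<open>R = 0\<close>, which would
  force \<open>\<tau>\<close> to be constant and every trajectory of the zero section to be
  trapped.\<close>

section \<open>Oscillatory integrals\<close>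

text \<open>The index set collects the parameters of an estimate, such as \<open>\<nu>\<close>, the
  frequencies or the label of a cutoff. One constant bounds all members of the family, and this is
  where the uniformity of the later estimates comes from. Derivatives are existentially quantified
  so that closure under products and quotients follows by induction on the order.\<close>

primrec CB :: "nat \<Rightarrow> 'i set \<Rightarrow> ('i \<Rightarrow> real \<Rightarrow> complex) \<Rightarrow> bool" where
  "CB 0 I b \<longleftrightarrow> (\<exists>C. \<forall>i\<in>I. \<forall>x. cmod (b i x) \<le> C) \<and> (\<forall>i\<in>I. continuous_on UNIV (b i))"
| "CB (Suc N) I b \<longleftrightarrow> (\<exists>C. \<forall>i\<in>I. \<forall>x. cmod (b i x) \<le> C) \<and>
     (\<exists>b'. (\<forall>i\<in>I. \<forall>x. (b i has_vector_derivative b' i x) (at x)) \<and> CB N I b')"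

lemma CB_bounded: "CB N I b \<Longrightarrow> \<exists>C\<ge>0. \<forall>i\<in>I. \<forall>x. cmod (b i x) \<le> C"
  by (cases N; simp) (meson dual_order.trans linorder_le_cases)+

lemma CB_continuous: "CB N I b \<Longrightarrow> i \<in> I \<Longrightarrow> continuous_on UNIV (b i)"
  by (cases N) (auto intro!: continuous_at_imp_continuous_on dest!: bspec intro: has_vector_derivative_continuous)

lemma CB_Suc_D: "CB (Suc N) I b \<Longrightarrow> CB N I b"
proof (induction N arbitrary: b)
  case 0
  then show ?case using CB_continuous[OF 0] by auto
next
  case (Suc N)
  from Suc.prems obtain b' where b': "\<forall>i\<in>I. \<forall>x. (b i has_vector_derivative b' i x) (at x)"
    and "CB (Suc N) I b'" by auto
  with Suc.IH[of b'] Suc.prems show ?case by auto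
qed

lemma CB_mono: "CB N I b \<Longrightarrow> M \<le> N \<Longrightarrow> CB M I b"
  by (induction N) (auto simp: le_Suc_eq dest: CB_Suc_D simp del: CB.simps)

lemma CB_SucI:
  assumes "CB 0 I b" "\<And>i x. i \<in> I \<Longrightarrow> (b i has_vector_derivative b' i x) (at x)" "CB N I b'"
  shows "CB (Suc N) I b"
  using assms by auto

lemma CB_cong:
  "CB N I b \<Longrightarrow> (\<And>i x. i \<in> I \<Longrightarrow> b i x = c i x) \<Longrightarrow> CB N I c"
proof (induction N)
  case 0
  have "\<forall>i\<in>I. b i = c i" using 0 by blast
  then show ?case using 0 by auto
next
  case (Suc N)
  have "\<forall>i\<in>I. b i = c i" using Suc by blast
  then show ?case using Suc(2) by auto
qed

lemma CB_reindex: "CB N I b \<Longrightarrow> (\<And>j. j \<in> J \<Longrightarrow> h j \<in> I) \<Longrightarrow> CB N J (\<lambda>j. b (h j))"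
proof (induction N arbitrary: b)
  case 0
  then show ?case by (auto, blast)
next
  case (Suc N)
  from Suc.prems(1) obtain b' C where b': "\<forall>i\<in>I. \<forall>x. (b i has_vector_derivative b' i x) (at x)"
    and C: "\<forall>i\<in>I. \<forall>x. cmod (b i x) \<le> C" and 1: "CB N I b'" by auto
  have "CB N J (\<lambda>j. b' (h j))" using Suc.IH[OF 1] Suc.prems(2) by auto
  then show ?case using b' C Suc.prems(2) by (auto intro!: exI[of _ C] exI[of _ "\<lambda>j. b' (h j)"])
qed

lemma CB_const:
  assumes "\<And>i. i \<in> I \<Longrightarrow> cmod (c i) \<le> C"
  shows "CB N I (\<lambda>i x. c i)"
proof -
  have z: "CB N I (\<lambda>i x. 0)" for N
    by (induction N) (auto intro!: exI[of _ "\<lambda>i x. 0"] derivative_eq_intros)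
  show ?thesis
  proof (cases N)
    case 0
    then show ?thesis using assms by auto
  next
    case (Suc M)
    have "CB (Suc M) I (\<lambda>i x. c i)"
      by (rule CB_SucI[where b'="\<lambda>i x. 0"]) (use assms z in \<open>auto intro!: exI[of _ C] derivative_eq_intros\<close>)
    then show ?thesis using Suc by simp
  qed
qed

lemma CB_0_add: "CB 0 I b \<Longrightarrow> CB 0 I c \<Longrightarrow> CB 0 I (\<lambda>i x. b i x + c i x)"
proof -
  assume a: "CB 0 I b" "CB 0 I c"
  then obtain B C where "\<forall>i\<in>I. \<forall>x. cmod (b i x) \<le> B" "\<forall>i\<in>I. \<forall>x. cmod (c i x) \<le> C" by auto
  then have "\<forall>i\<in>I. \<forall>x. cmod (b i x + c i x) \<le> B + C"
    by (meson add_mono norm_triangle_ineq order_trans)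
  with a show ?thesis by (auto intro!: continuous_intros)
qed

lemma CB_0_mult: "CB 0 I b \<Longrightarrow> CB 0 I c \<Longrightarrow> CB 0 I (\<lambda>i x. b i x * c i x)"
proof -
  assume a: "CB 0 I b" "CB 0 I c"
  obtain B where B: "B \<ge> 0" "\<forall>i\<in>I. \<forall>x. cmod (b i x) \<le> B" using CB_bounded[OF a(1)] by auto
  obtain C where C: "\<forall>i\<in>I. \<forall>x. cmod (c i x) \<le> C" using CB_bounded[OF a(2)] by auto
  have "\<forall>i\<in>I. \<forall>x. cmod (b i x * c i x) \<le> B * C"
    using B C by (auto simp: norm_mult intro!: mult_mono)
  with a show ?thesis by (auto intro!: continuous_intros)
qed

lemma CB_add: "CB N I b \<Longrightarrow> CB N I c \<Longrightarrow> CB N I (\<lambda>i x. b i x + c i x)"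
proof (induction N arbitrary: b c)
  case 0
  then show ?case by (rule CB_0_add)
next
  case (Suc N)
  from Suc.prems obtain b' c' where
    d: "\<forall>i\<in>I. \<forall>x. (b i has_vector_derivative b' i x) (at x)" "CB N I b'"
       "\<forall>i\<in>I. \<forall>x. (c i has_vector_derivative c' i x) (at x)" "CB N I c'" by auto
  have "CB 0 I (\<lambda>i x. b i x + c i x)"
    using Suc.prems CB_0_add CB_mono[of "Suc N" _ _ 0] by blast
  moreover have "((\<lambda>x. b i x + c i x) has_vector_derivative (b' i x + c' i x)) (at x)" if "i \<in> I" for i x
    using d that by (intro has_vector_derivative_add) auto
  ultimately show ?case using Suc.IH[OF d(2,4)] by (intro CB_SucI)
qed

lemma CB_mult: "CB N I b \<Longrightarrow> CB N I c \<Longrightarrow> CB N I (\<lambda>i x. b i x * c i x)"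
proof (induction N arbitrary: b c)
  case 0
  then show ?case by (rule CB_0_mult)
next
  case (Suc N)
  from Suc.prems obtain b' c' where
    d: "\<forall>i\<in>I. \<forall>x. (b i has_vector_derivative b' i x) (at x)" "CB N I b'"
       "\<forall>i\<in>I. \<forall>x. (c i has_vector_derivative c' i x) (at x)" "CB N I c'" by auto
  have "CB N I b" "CB N I c" using Suc.prems CB_Suc_D by blast+
  then have "CB N I (\<lambda>i x. b i x * c' i x + b' i x * c i x)"
    by (intro CB_add Suc.IH d)
  moreover have "((\<lambda>x. b i x * c i x) has_vector_derivative (b i x * c' i x + b' i x * c i x)) (at x)" if "i \<in> I" for i x
    using d that by (intro has_vector_derivative_mult) auto
  moreover have "CB 0 I (\<lambda>i x. b i x * c i x)"
    using Suc.prems CB_0_mult CB_mono[of "Suc N" _ _ 0] by blast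
  ultimately show ?case by (intro CB_SucI)
qed

lemma CB_scale:
  assumes "CB N I b" "\<And>i. i \<in> I \<Longrightarrow> cmod (c i) \<le> C"
  shows "CB N I (\<lambda>i x. c i * b i x)"
  using CB_mult[OF CB_const[of I c C] assms(1)] assms(2) by blast

lemma CB_minus: "CB N I b \<Longrightarrow> CB N I (\<lambda>i x. - b i x)"
  using CB_scale[of N I b "\<lambda>i. -1" 1] by simp

lemma CB_diff: "CB N I b \<Longrightarrow> CB N I c \<Longrightarrow> CB N I (\<lambda>i x. b i x - c i x)"
  using CB_add[OF _ CB_minus, of N I b c] by simp

text \<open>The quotient uses \<open>x / 0 = 0\<close>: where the denominator vanishes, the numerator vanishes nearby.\<close>

lemma quotient_has_vector_derivative:
  fixes b p :: "real \<Rightarrow> complex"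
  assumes "(b has_vector_derivative b') (at x)" "(p has_vector_derivative p') (at x)"
    and "continuous_on UNIV p" "c > 0" "\<And>y. cmod (p y) < c \<Longrightarrow> b y = 0"
  shows "((\<lambda>y. b y / p y) has_vector_derivative (b' / p x - b x * p' / p x / p x)) (at x)"
proof (cases "p x = 0")
  case False
  have "((\<lambda>x. inverse (p x)) has_vector_derivative (- (inverse (p x) * p' * inverse (p x)))) (at x)"
    using Deriv.has_derivative_inverse[OF False assms(2)[unfolded has_vector_derivative_def]]
    unfolding has_vector_derivative_def by (simp add: algebra_simps)
  from has_vector_derivative_mult[OF assms(1) this]
  show ?thesis by (simp add: field_simps)
next
  case True
  have "open {y. cmod (p y) < c}"
    using assms(3) by (intro open_Collect_less continuous_intros) auto
  moreover have "x \<in> {y. cmod (p y) < c}" using True assms by simp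
  ultimately have "((\<lambda>y. b y / p y) has_vector_derivative 0) (at x)"
    by (rule has_vector_derivative_transform_within_open[OF has_vector_derivative_const])
       (simp add: assms(5))
  then show ?thesis using True by simp
qed

text \<open>On the support of the numerator the denominator is at least \<open>c\<close> in modulus,
  which bounds the quotient uniformly over the family. The derivative is again a sum of quotients of
  the same kind, so the order can be lowered inductively.\<close>

lemma CB_quotient:
  assumes "CB N I b" "CB N I p" "c > 0"
    and "\<And>i x. i \<in> I \<Longrightarrow> cmod (p i x) < c \<Longrightarrow> b i x = 0"
  shows "CB N I (\<lambda>i x. b i x / p i x)"
  using assms
proof (induction N arbitrary: b)
  case 0
  obtain B where B: "B \<ge> 0" "\<forall>i\<in>I. \<forall>x. cmod (b i x) \<le> B" using CB_bounded[OF 0(1)] by auto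
  have "cmod (b i x / p i x) \<le> B / c" if "i \<in> I" for i x
  proof (cases "cmod (p i x) < c")
    case False
    then show ?thesis using B that \<open>c > 0\<close> by (auto simp: norm_divide intro!: frac_le)
  qed (use 0 that B in auto)
  moreover have "continuous_on UNIV (\<lambda>x. b i x / p i x)" if i: "i \<in> I" for i
  proof (rule continuous_at_imp_continuous_on, rule ballI)
    fix x
    have cp: "continuous_on UNIV (p i)" "continuous_on UNIV (b i)" using 0 i by auto
    show "isCont (\<lambda>x. b i x / p i x) x"
    proof (cases "p i x = 0")
      case True
      have "open {y. cmod (p i y) < c}"
        using cp by (intro open_Collect_less continuous_intros) auto
      moreover have "x \<in> {y. cmod (p i y) < c}" using True 0 by simp
      ultimately have "eventually (\<lambda>y. y \<in> {y. cmod (p i y) < c}) (nhds x)"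
        by (rule eventually_nhds_in_open)
      then have "eventually (\<lambda>y. b i y / p i y = 0) (nhds x)"
        by eventually_elim (use 0 i in auto)
      then have "isCont (\<lambda>x. b i x / p i x) x \<longleftrightarrow> isCont (\<lambda>x. 0 :: complex) x" by (rule isCont_cong)
      then show ?thesis by simp
    next
      case False
      then show ?thesis using cp by (intro continuous_intros) (auto simp: continuous_on_eq_continuous_at)
    qed
  qed
  ultimately show ?case by auto
next
  case (Suc N)
  from Suc.prems obtain b' p' where
    d: "\<forall>i\<in>I. \<forall>x. (b i has_vector_derivative b' i x) (at x)" "CB N I b'"
       "\<forall>i\<in>I. \<forall>x. (p i has_vector_derivative p' i x) (at x)" "CB N I p'" by auto
  have n: "CB N I b" "CB N I p" using Suc.prems CB_Suc_D by blast+
  have cp: "continuous_on UNIV (p i)" if "i \<in> I" for i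
    by (rule CB_continuous[OF Suc.prems(2) that])
  \<comment> \<open>The set where \<open>p i\<close> is smaller than \<open>c\<close> is open, so
    \<open>b i\<close> vanishes near each of its points and the derivative inherits the vanishing
    condition.\<close>
  have b'0: "b' i x = 0" if "i \<in> I" "cmod (p i x) < c" for i x
  proof -
    have "open {y. cmod (p i y) < c}"
      using cp that by (intro open_Collect_less continuous_intros) auto
    then have "(b i has_vector_derivative 0) (at x)"
      by (rule has_vector_derivative_transform_within_open[OF has_vector_derivative_const])
         (use Suc.prems(4) that in auto)
    then show ?thesis using d(1) that vector_derivative_unique_at by blast
  qed
  have q: "CB N I (\<lambda>i x. b i x / p i x)" using Suc.IH n Suc.prems by blast
  have "CB N I (\<lambda>i x. b' i x / p i x)" using Suc.IH n Suc.prems b'0 d by blast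
  moreover have "CB N I (\<lambda>i x. (b i x / p i x * p' i x) / p i x)"
    by (rule Suc.IH) (use CB_mult[OF q d(4)] n Suc.prems in auto)
  ultimately have "CB N I (\<lambda>i x. b' i x / p i x - (b i x / p i x * p' i x) / p i x)" by (rule CB_diff)
  moreover have "((\<lambda>x. b i x / p i x) has_vector_derivative
      (b' i x / p i x - (b i x / p i x * p' i x) / p i x)) (at x)" if "i \<in> I" for i x
    using quotient_has_vector_derivative[of "b i" "b' i x" x "p i" "p' i x" c] d cp that Suc.prems by auto
  moreover have "CB 0 I (\<lambda>i x. b i x / p i x)" using q CB_mono by blast
  ultimately show ?case by (intro CB_SucI)
qed

lemma periodic_derivative:
  assumes "\<And>x. (f has_vector_derivative f' x) (at x)" "periodic1 f"
  shows "periodic1 f'"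
  unfolding periodic1_def
proof
  fix x
  have "(f has_vector_derivative f' (x+1)) (at (x+1) within UNIV)" using assms(1) by auto
  moreover have "((\<lambda>x. x + 1) has_vector_derivative (1::real)) (at x)"
    using has_vector_derivative_add_const[of "\<lambda>x. x" "1::real"] has_vector_derivative_id by simp
  ultimately have "((f \<circ> (\<lambda>x. x + 1)) has_vector_derivative 1 *\<^sub>R f' (x+1)) (at x)"
    by (intro vector_diff_chain_at) auto
  moreover have "f \<circ> (\<lambda>x. x + 1) = f" using assms(2) by (auto simp: periodic1_def)
  ultimately have "(f has_vector_derivative f' (x+1)) (at x)" by simp
  then show "f' (x+1) = f' x" by (rule vector_derivative_unique_at[OF _ assms(1)])
qed

lemma of_real_has_vector_derivative:
  assumes "(f has_real_derivative d) (at x)"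
  shows "((\<lambda>x. complex_of_real (f x)) has_vector_derivative of_real d) (at x)"
proof -
  have "((\<lambda>x. complex_of_real (f x)) has_derivative (\<lambda>h. of_real (d * h))) (at x)"
    using assms by (intro has_derivative_of_real) (simp add: has_field_derivative_def)
  then show ?thesis by (simp add: has_vector_derivative_def scaleR_conv_of_real mult.commute)
qed

lemma cis_has_vector_derivative:
  assumes "(f has_real_derivative d) (at x)"
  shows "((\<lambda>x. cis (f x)) has_vector_derivative of_real d * (\<i> * cis (f x))) (at x)"
proof -
  have "((\<lambda>z. exp (\<i> * z)) has_field_derivative \<i> * exp (\<i> * of_real (f x))) (at (of_real (f x)))"
    by (auto intro!: derivative_eq_intros)
  from field_vector_diff_chain_at[OF of_real_has_vector_derivative[OF assms] this]
  show ?thesis by (simp add: o_def cis_conv_exp)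
qed

text \<open>The phase \<open>\<psi>\<close> is stationary only where \<open>p\<close> is small, and there the amplitude \<open>b\<close> vanishes.\<close>

lemma nonstationary_phase:
  fixes \<psi> p :: "'i \<Rightarrow> real \<Rightarrow> real" and lam :: "'i \<Rightarrow> real"
  assumes "CB N I b" "CB N I (\<lambda>i x. of_real (p i x))" "c > 0"
    and "\<And>i x. i \<in> I \<Longrightarrow> \<bar>p i x\<bar> < c \<Longrightarrow> b i x = 0"
    and "\<And>i x. i \<in> I \<Longrightarrow> (\<psi> i has_real_derivative lam i * p i x) (at x)"
    and "\<And>i. i \<in> I \<Longrightarrow> lam i > 0"
    and "\<And>i. i \<in> I \<Longrightarrow> periodic1 (b i)" "\<And>i. i \<in> I \<Longrightarrow> periodic1 (p i)"
    and "\<And>i. i \<in> I \<Longrightarrow> periodic1 (\<lambda>x. cis (\<psi> i x))"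
  shows "\<exists>C\<ge>0. \<forall>i\<in>I. cmod (integral {0..1} (\<lambda>x. cis (\<psi> i x) * b i x)) \<le> C / lam i ^ N"
  using assms(1,2,4,7)
proof (induction N arbitrary: b)
  case 0
  obtain B where B: "B \<ge> 0" "\<forall>i\<in>I. \<forall>x. cmod (b i x) \<le> B" using CB_bounded[OF 0(1)] by auto
  have "cmod (integral {0..1} (\<lambda>x. cis (\<psi> i x) * b i x)) \<le> B * (1 - 0)" if i: "i \<in> I" for i
  proof (rule integral_bound)
    have "continuous_on UNIV (\<psi> i)"
      using assms(5)[OF i] by (intro continuous_at_imp_continuous_on ballI DERIV_isCont)
    then show "continuous_on {0..1} (\<lambda>x. cis (\<psi> i x) * b i x)"
      by (intro continuous_intros)
         (rule continuous_on_subset[of UNIV "\<psi> i"] continuous_on_subset[OF CB_continuous[OF 0(1) i]]; simp)+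
  qed (use B i in \<open>auto simp: norm_mult\<close>)
  then show ?case using B by auto
next
  case (Suc N)
  from Suc.prems obtain b' p' where
    d: "\<forall>i\<in>I. \<forall>x. (b i has_vector_derivative b' i x) (at x)" "CB N I b'"
       "\<forall>i\<in>I. \<forall>x. ((\<lambda>x. complex_of_real (p i x)) has_vector_derivative p' i x) (at x)" "CB N I p'" by auto
  have n: "CB N I b" "CB N I (\<lambda>i x. complex_of_real (p i x))" using Suc.prems CB_Suc_D by blast+
  \<comment> \<open>One integration by parts: the derivative of \<open>cis \<psi> * (b / p)\<close>
    is \<open>\<i> * lam * cis \<psi> * b\<close> plus \<open>cis \<psi> * b1\<close>. The integral
    with \<open>b\<close> is thus that with \<open>b1\<close>, divided by \<open>lam\<close> in
    modulus, and \<open>b1\<close> has one order of smoothness less.\<close>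
  have "CB (Suc N) I (\<lambda>i x. b i x / of_real (p i x))"
    by (rule CB_quotient) (use Suc.prems assms(3) in auto)
  then obtain b1 where b1: "\<forall>i\<in>I. \<forall>x. ((\<lambda>x. b i x / of_real (p i x)) has_vector_derivative b1 i x) (at x)"
      "CB N I b1" by auto
  have per: "periodic1 (b1 i)" if "i \<in> I" for i
    by (rule periodic_derivative[of "\<lambda>x. b i x / of_real (p i x)"])
       (use b1 that Suc.prems(4) assms(8) in \<open>auto simp: periodic1_def\<close>)
  \<comment> \<open>The new amplitude vanishes near stationary points as the old one did, so the
    integration by parts can be repeated.\<close>
  have z: "b1 i x = 0" if "i \<in> I" "\<bar>p i x\<bar> < c" for i x
  proof -
    have "continuous_on UNIV (\<lambda>x. norm (complex_of_real (p i x)))"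
      by (rule continuous_on_norm) (rule CB_continuous[OF n(2) that(1)])
    then have "continuous_on UNIV (\<lambda>x. \<bar>p i x\<bar>)" by simp
    then have "open {y. \<bar>p i y\<bar> < c}" by (intro open_Collect_less) auto
    then have "((\<lambda>x. b i x / of_real (p i x)) has_vector_derivative 0) (at x)"
      by (rule has_vector_derivative_transform_within_open[OF has_vector_derivative_const])
         (use Suc.prems(3) that in auto)
    then show ?thesis using b1(1) that vector_derivative_unique_at by blast
  qed
  obtain C where C: "C \<ge> 0" "\<forall>i\<in>I. cmod (integral {0..1} (\<lambda>x. cis (\<psi> i x) * b1 i x)) \<le> C / lam i ^ N"
    using Suc.IH[OF b1(2) n(2) z per] by auto
  have "cmod (integral {0..1} (\<lambda>x. cis (\<psi> i x) * b i x)) \<le> C / lam i ^ Suc N" if i: "i \<in> I" for i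
  proof -
    let ?f = "\<lambda>x. cis (\<psi> i x) * (b i x / of_real (p i x))"
    have cpsi: "continuous_on UNIV (\<psi> i)"
      using assms(5)[OF i] by (intro continuous_at_imp_continuous_on ballI DERIV_isCont)
    have D: "(?f has_vector_derivative (cis (\<psi> i x) * b1 i x + \<i> * of_real (lam i) * (cis (\<psi> i x) * b i x))) (at x)" for x
    proof -
      have "((\<lambda>x. cis (\<psi> i x)) has_vector_derivative (of_real (lam i * p i x) * (\<i> * cis (\<psi> i x)))) (at x)"
        by (rule cis_has_vector_derivative[OF assms(5)[OF i]])
      from has_vector_derivative_mult[OF this, of "\<lambda>x. b i x / of_real (p i x)" "b1 i x"] b1(1) i
      have "(?f has_vector_derivative (cis (\<psi> i x) * b1 i x + of_real (lam i * p i x) * (\<i> * cis (\<psi> i x)) * (b i x / of_real (p i x)))) (at x)"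
        by auto
      moreover have "of_real (p i x) * (b i x / of_real (p i x)) = b i x"
        using Suc.prems(3)[OF i, of x] assms(3) by (cases "p i x = 0") auto
      then have "of_real (lam i * p i x) * (\<i> * cis (\<psi> i x)) * (b i x / of_real (p i x)) = \<i> * of_real (lam i) * (cis (\<psi> i x) * b i x)"
        by (metis (no_types, opaque_lifting) mult.assoc mult.commute of_real_mult)
      ultimately show ?thesis by simp
    qed
    have "((\<lambda>x. cis (\<psi> i x) * b1 i x + \<i> * of_real (lam i) * (cis (\<psi> i x) * b i x)) has_integral (?f 1 - ?f 0)) {0..1}"
      by (rule fundamental_theorem_of_calculus) (use D in \<open>auto intro: has_vector_derivative_at_within\<close>)
    \<comment> \<open>Boundary terms cancel. Periodicity is required of
      \<open>cis (\<psi> i x)\<close> only: the phase itself may increase by multiples of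
      \<open>2 * pi\<close>.\<close>
    moreover have "?f 1 = ?f 0"
      using assms(8,9)[OF i] Suc.prems(4)[OF i] unfolding periodic1_def
      by (metis add.left_neutral)
    ultimately have I0: "integral {0..1} (\<lambda>x. cis (\<psi> i x) * b1 i x + \<i> * of_real (lam i) * (cis (\<psi> i x) * b i x)) = 0"
      by auto
    have i1: "(\<lambda>x. cis (\<psi> i x) * b1 i x) integrable_on {0..1}"
      by (intro integrable_continuous_real continuous_intros)
         (rule continuous_on_subset[OF cpsi] continuous_on_subset[OF CB_continuous[OF b1(2) i]]; simp)+
    have i2: "(\<lambda>x. (cis (\<psi> i x) * b i x)) integrable_on {0..1}"
      by (intro integrable_continuous_real continuous_intros)
         (rule continuous_on_subset[OF cpsi] continuous_on_subset[OF CB_continuous[OF Suc.prems(1) i]]; simp)+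
    have "integral {0..1} (\<lambda>x. cis (\<psi> i x) * b1 i x) + \<i> * of_real (lam i) * integral {0..1} (\<lambda>x. cis (\<psi> i x) * b i x) = 0"
      using I0 i1 i2 by (subst (asm) integral_add) (auto intro: integrable_on_mult_right)
    then have "\<i> * of_real (lam i) * integral {0..1} (\<lambda>x. cis (\<psi> i x) * b i x) = - integral {0..1} (\<lambda>x. cis (\<psi> i x) * b1 i x)"
      by (simp add: eq_neg_iff_add_eq_0 add.commute)
    then have "cmod (\<i> * of_real (lam i) * integral {0..1} (\<lambda>x. cis (\<psi> i x) * b i x)) = cmod (integral {0..1} (\<lambda>x. cis (\<psi> i x) * b1 i x))"
      by simp
    then have "lam i * cmod (integral {0..1} (\<lambda>x. cis (\<psi> i x) * b i x)) \<le> C / lam i ^ N"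
      using C(2) i assms(6)[OF i] by (auto simp: norm_mult)
    then show ?thesis using assms(6)[OF i] by (simp add: field_simps)
  qed
  then show ?case using C(1) by auto
qed

section \<open>Operators on weighted sequence spaces\<close>

text \<open>The norm is encoded through its upper bounds on finite sets of coordinates. Such bounds
  carry no summability condition and survive coordinatewise limits.\<close>

definition wnorm_le :: "(int \<Rightarrow> real) \<Rightarrow> (int \<Rightarrow> complex) \<Rightarrow> real \<Rightarrow> bool" where
  "wnorm_le a c M \<longleftrightarrow> (\<forall>F. finite F \<longrightarrow> L2_set (\<lambda>n. a n * cmod (c n)) F \<le> M)"

definition wseq :: "(int \<Rightarrow> real) \<Rightarrow> (int \<Rightarrow> complex) set" where
  "wseq a = {c. \<exists>M. wnorm_le a c M}"

lemma wnorm_leD: "wnorm_le a c M \<Longrightarrow> finite F \<Longrightarrow> L2_set (\<lambda>n. a n * cmod (c n)) F \<le> M"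
  by (auto simp: wnorm_le_def)

lemma wnorm_le_nonneg: "wnorm_le a c M \<Longrightarrow> 0 \<le> M"
  using wnorm_leD[of a c M "{}"] by simp

lemma wnorm_le_mono: "wnorm_le a c M \<Longrightarrow> M \<le> M' \<Longrightarrow> wnorm_le a c M'"
  by (force simp: wnorm_le_def)

lemma wnorm_le_coord: "wnorm_le a c M \<Longrightarrow> a n > 0 \<Longrightarrow> cmod (c n) \<le> M / a n"
  using wnorm_leD[of a c M "{n}"] by (simp add: pos_le_divide_eq mult.commute)

lemma wnorm_le_dominated:
  assumes "wnorm_le a d M" "\<And>n. 0 \<le> b n" "\<And>n. b n * cmod (c n) \<le> C * (a n * cmod (d n))" "C \<ge> 0"
  shows "wnorm_le b c (C * M)"
  unfolding wnorm_le_def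
proof safe
  fix F :: "int set" assume F: "finite F"
  have "L2_set (\<lambda>n. b n * cmod (c n)) F \<le> L2_set (\<lambda>n. C * (a n * cmod (d n))) F"
    using assms by (intro L2_set_mono) auto
  also have "\<dots> = C * L2_set (\<lambda>n. a n * cmod (d n)) F"
    using assms by (simp add: L2_set_right_distrib)
  also have "\<dots> \<le> C * M"
    using wnorm_leD[OF assms(1) F] assms by (intro mult_left_mono) auto
  finally show "L2_set (\<lambda>n. b n * cmod (c n)) F \<le> C * M" .
qed

lemma wnorm_le_compare:
  assumes "wnorm_le a c M" "\<And>n. 0 \<le> b n" "\<And>n. b n \<le> C * a n" "C \<ge> 0"
  shows "wnorm_le b c (C * M)"
  by (rule wnorm_le_dominated[OF assms(1,2)])
     (use assms in \<open>auto simp flip: mult.assoc intro!: mult_right_mono\<close>)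

lemma wnorm_le_add:
  assumes "\<And>n. 0 \<le> a n" "wnorm_le a c M" "wnorm_le a d M'"
  shows "wnorm_le a (\<lambda>n. c n + d n) (M + M')"
  unfolding wnorm_le_def
proof safe
  fix F :: "int set" assume F: "finite F"
  have "L2_set (\<lambda>n. a n * cmod (c n + d n)) F \<le> L2_set (\<lambda>n. a n * cmod (c n) + a n * cmod (d n)) F"
    using assms(1) by (intro L2_set_mono) (auto simp flip: distrib_left intro!: mult_left_mono norm_triangle_ineq)
  also have "\<dots> \<le> L2_set (\<lambda>n. a n * cmod (c n)) F + L2_set (\<lambda>n. a n * cmod (d n)) F"
    by (rule L2_set_triangle_ineq)
  also have "\<dots> \<le> M + M'" using wnorm_leD[OF assms(2) F] wnorm_leD[OF assms(3) F] by simp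
  finally show "L2_set (\<lambda>n. a n * cmod (c n + d n)) F \<le> M + M'" .
qed

lemma wnorm_le_scale:
  assumes "\<And>n. 0 \<le> a n" "wnorm_le a c M"
  shows "wnorm_le a (\<lambda>n. z * c n) (cmod z * M)"
  by (rule wnorm_le_dominated[OF assms(2,1)]) (auto simp: norm_mult)

lemma wnorm_le_zero: "wnorm_le a (\<lambda>n. 0) 0"
  by (simp add: wnorm_le_def L2_set_def)

lemma wnorm_le_sum:
  assumes "\<And>n. 0 \<le> a n" "\<And>j. j \<in> J \<Longrightarrow> wnorm_le a (c j) (M j)" "finite J"
  shows "wnorm_le a (\<lambda>n. \<Sum>j\<in>J. c j n) (\<Sum>j\<in>J. M j)"
  using assms(3,2)
  by (induction J rule: finite_induct) (auto intro!: wnorm_le_zero wnorm_le_add assms(1))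

text \<open>Fatou's property: each partial norm is a continuous function of finitely many
  coordinates. All infinite sums of sequences and operators below are estimated through their
  truncations in this way.\<close>

lemma wnorm_le_lim:
  assumes "\<And>n. (\<lambda>j. c j n) \<longlonglongrightarrow> c' n" "\<And>j. wnorm_le a (c j) M"
  shows "wnorm_le a c' M"
  unfolding wnorm_le_def
proof safe
  fix F :: "int set" assume F: "finite F"
  have "(\<lambda>j. L2_set (\<lambda>n. a n * cmod (c j n)) F) \<longlonglongrightarrow> L2_set (\<lambda>n. a n * cmod (c' n)) F"
    unfolding L2_set_def by (intro tendsto_intros assms)
  then show "L2_set (\<lambda>n. a n * cmod (c' n)) F \<le> M"
    by (rule LIMSEQ_le_const2) (use wnorm_leD[OF assms(2) F] in auto)
qed

definition wop :: "(int \<Rightarrow> real) \<Rightarrow> (int \<Rightarrow> real) \<Rightarrow> ((int \<Rightarrow> complex) \<Rightarrow> (int \<Rightarrow> complex)) \<Rightarrow> bool" where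
  "wop a b A \<longleftrightarrow>
     (\<forall>c\<in>wseq a. \<forall>d\<in>wseq a. \<forall>x y. A (\<lambda>n. x * c n + y * d n) = (\<lambda>n. x * A c n + y * A d n)) \<and>
     (\<exists>C\<ge>0. \<forall>c M. wnorm_le a c M \<longrightarrow> wnorm_le b (A c) (C * M))"

definition wres :: "(int \<Rightarrow> real) \<Rightarrow> ((int \<Rightarrow> complex) \<Rightarrow> (int \<Rightarrow> complex)) \<Rightarrow> complex set" where
  "wres a A = {z. \<exists>B. wop a a B \<and>
     (\<forall>c\<in>wseq a. B (\<lambda>n. z * c n - A c n) = c \<and> (\<lambda>n. z * B c n - A (B c) n) = c)}"

lemma wseq_lin:
  assumes "\<And>n. 0 \<le> a n" "c \<in> wseq a" "d \<in> wseq a"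
  shows "(\<lambda>n. x * c n + y * d n) \<in> wseq a"
  using assms wnorm_le_add[of a "\<lambda>n. x * c n" _ "\<lambda>n. y * d n"] wnorm_le_scale[of a]
  unfolding wseq_def by blast

lemma wseq_diff: "(\<And>n. 0 \<le> a n) \<Longrightarrow> c \<in> wseq a \<Longrightarrow> d \<in> wseq a \<Longrightarrow> (\<lambda>n. c n - d n) \<in> wseq a"
  using wseq_lin[of a c d 1 "-1"] by simp

lemma wseq_scale: "(\<And>n. 0 \<le> a n) \<Longrightarrow> c \<in> wseq a \<Longrightarrow> (\<lambda>n. x * c n) \<in> wseq a"
  using wseq_lin[of a c c x 0] by simp

lemma wopI:
  assumes "\<And>c d x y. c \<in> wseq a \<Longrightarrow> d \<in> wseq a \<Longrightarrow> A (\<lambda>n. x * c n + y * d n) = (\<lambda>n. x * A c n + y * A d n)"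
    and "C \<ge> 0" "\<And>c M. wnorm_le a c M \<Longrightarrow> wnorm_le b (A c) (C * M)"
  shows "wop a b A"
  using assms unfolding wop_def by blast

lemma wop_in: "wop a b A \<Longrightarrow> c \<in> wseq a \<Longrightarrow> A c \<in> wseq b"
  unfolding wop_def wseq_def by blast

lemma wop_lin: "wop a b A \<Longrightarrow> c \<in> wseq a \<Longrightarrow> d \<in> wseq a \<Longrightarrow>
   A (\<lambda>n. x * c n + y * d n) = (\<lambda>n. x * A c n + y * A d n)"
  unfolding wop_def by blast

lemma wop_plus: "wop a b A \<Longrightarrow> c \<in> wseq a \<Longrightarrow> d \<in> wseq a \<Longrightarrow>
   A (\<lambda>n. c n + d n) = (\<lambda>n. A c n + A d n)"
  using wop_lin[of a b A c d 1 1] by simp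

lemma wop_minus: "wop a b A \<Longrightarrow> c \<in> wseq a \<Longrightarrow> d \<in> wseq a \<Longrightarrow>
   A (\<lambda>n. c n - d n) = (\<lambda>n. A c n - A d n)"
  using wop_lin[of a b A c d 1 "-1"] by simp

lemma wop_smult: "wop a b A \<Longrightarrow> c \<in> wseq a \<Longrightarrow> A (\<lambda>n. x * c n) = (\<lambda>n. x * A c n)"
  using wop_lin[of a b A c c x 0] by simp

lemma wop_cong:
  assumes "wop a b A" "\<And>n. 0 \<le> a n" "\<And>c. c \<in> wseq a \<Longrightarrow> A c = B c"
  shows "wop a b B"
proof -
  obtain C where C: "C \<ge> 0" "\<forall>c M. wnorm_le a c M \<longrightarrow> wnorm_le b (A c) (C * M)"
    using assms(1) by (auto simp: wop_def)
  have "wnorm_le b (B c) (C * M)" if "wnorm_le a c M" for c M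
    using C(2) that assms(3)[of c] unfolding wseq_def by force
  moreover have "B (\<lambda>n. x * c n + y * d n) = (\<lambda>n. x * B c n + y * B d n)"
    if "c \<in> wseq a" "d \<in> wseq a" for c d x y
    using wop_lin[OF assms(1) that] assms(3) that wseq_lin[OF assms(2) that] by metis
  ultimately show ?thesis using C(1) by (intro wopI)
qed

lemma wop_comp:
  assumes "wop a b A" "wop b d B"
  shows "wop a d (\<lambda>c. B (A c))"
proof -
  obtain C where C: "C \<ge> 0" "\<forall>c M. wnorm_le a c M \<longrightarrow> wnorm_le b (A c) (C * M)"
    using assms(1) by (auto simp: wop_def)
  obtain D where D: "D \<ge> 0" "\<forall>c M. wnorm_le b c M \<longrightarrow> wnorm_le d (B c) (D * M)"
    using assms(2) by (auto simp: wop_def)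
  have "wnorm_le d (B (A c)) (D * C * M)" if "wnorm_le a c M" for c M
    unfolding mult.assoc using C(2) D(2) that by blast
  moreover have "B (A (\<lambda>n. x * c n + y * e n)) = (\<lambda>n. x * B (A c) n + y * B (A e) n)"
    if "c \<in> wseq a" "e \<in> wseq a" for c e x y
    by (simp add: wop_lin[OF assms(1) that] wop_lin[OF assms(2)] wop_in[OF assms(1)] that)
  moreover have "D * C \<ge> 0" using C(1) D(1) by simp
  ultimately show ?thesis by (intro wopI)
qed

lemma wop_add:
  assumes "\<And>n. 0 \<le> b n" "wop a b A" "wop a b B"
  shows "wop a b (\<lambda>c n. A c n + B c n)"
proof -
  obtain C where C: "C \<ge> 0" "\<forall>c M. wnorm_le a c M \<longrightarrow> wnorm_le b (A c) (C * M)"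
    using assms(2) by (auto simp: wop_def)
  obtain D where D: "D \<ge> 0" "\<forall>c M. wnorm_le a c M \<longrightarrow> wnorm_le b (B c) (D * M)"
    using assms(3) by (auto simp: wop_def)
  have "wnorm_le b (\<lambda>n. A c n + B c n) ((C + D) * M)" if "wnorm_le a c M" for c M
    using wnorm_le_add[OF assms(1)] C D that by (simp add: distrib_right)
  moreover have "(\<lambda>n. A (\<lambda>n. x * c n + y * e n) n + B (\<lambda>n. x * c n + y * e n) n) =
      (\<lambda>n. x * (A c n + B c n) + y * (A e n + B e n))"
    if "c \<in> wseq a" "e \<in> wseq a" for c e x y
    by (simp add: wop_lin[OF assms(2) that] wop_lin[OF assms(3) that] algebra_simps)
  moreover have "C + D \<ge> 0" using C(1) D(1) by simp
  ultimately show ?thesis by (intro wopI)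
qed

lemma wop_scale:
  assumes "\<And>n. 0 \<le> b n" "wop a b A"
  shows "wop a b (\<lambda>c n. z * A c n)"
proof -
  obtain C where C: "C \<ge> 0" "\<forall>c M. wnorm_le a c M \<longrightarrow> wnorm_le b (A c) (C * M)"
    using assms(2) by (auto simp: wop_def)
  have "wnorm_le b (\<lambda>n. z * A c n) ((cmod z * C) * M)" if "wnorm_le a c M" for c M
    using wnorm_le_scale[OF assms(1)] C that by (simp add: mult.assoc)
  moreover have "(\<lambda>n. z * A (\<lambda>n. x * c n + y * e n) n) = (\<lambda>n. x * (z * A c n) + y * (z * A e n))"
    if "c \<in> wseq a" "e \<in> wseq a" for c e x y
    by (simp add: wop_lin[OF assms(2) that] algebra_simps)
  moreover have "cmod z * C \<ge> 0" using C(1) by simp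
  ultimately show ?thesis by (intro wopI)
qed

lemma wop_id:
  assumes "\<And>n. 0 \<le> b n" "\<And>n. b n \<le> C * a n" "C \<ge> 0"
  shows "wop a b (\<lambda>c. c)"
  by (rule wopI[of _ _ C]) (use assms wnorm_le_compare in auto)

lemma wseq_subset:
  assumes "\<And>n. 0 \<le> b n" "\<And>n. b n \<le> C * a n" "C \<ge> 0"
  shows "wseq a \<subseteq> wseq b"
  using wnorm_le_compare[of a _ _ b C, OF _ assms(1,2,3)] unfolding wseq_def by blast

lemma wop_funpow:
  assumes "\<And>n. 0 \<le> a n" "wop a a A"
  shows "wop a a (A ^^ j)"
proof (induction j)
  case 0
  show ?case using wop_id[of a 1 a, OF assms(1)] by (simp add: id_def)
next
  case (Suc j)
  show ?case using wop_comp[OF Suc assms(2)] by (simp add: o_def)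
qed

lemma wres_equiv:
  assumes "\<And>n. 0 \<le> a n" "\<And>n. 0 \<le> b n" "\<And>n. b n \<le> C * a n" "\<And>n. a n \<le> D * b n" "C \<ge> 0" "D \<ge> 0"
  shows "wres a A = wres b A"
proof -
  have s: "wseq a = wseq b"
    using wseq_subset[of b C a, OF assms(2,3,5)] wseq_subset[of a D b, OF assms(1,4,6)] by blast
  have "wop a a B \<longleftrightarrow> wop b b B" for B
    using wop_comp[OF wop_comp[OF wop_id[of a D b, OF assms(1,4,6)], of a B] wop_id[of b C a, OF assms(2,3,5)]]
      wop_comp[OF wop_comp[OF wop_id[of b C a, OF assms(2,3,5)], of b B] wop_id[of a D b, OF assms(1,4,6)]] by blast
  then show ?thesis unfolding wres_def s by simp
qed

section \<open>Neumann series on weighted sequence spaces\<close>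

definition neumann :: "((int \<Rightarrow> complex) \<Rightarrow> (int \<Rightarrow> complex)) \<Rightarrow> complex \<Rightarrow> (int \<Rightarrow> complex) \<Rightarrow> int \<Rightarrow> complex" where
  "neumann A z c n = (\<Sum>j. (A ^^ j) c n / z ^ Suc j)"

context
  fixes a :: "int \<Rightarrow> real" and A and q :: real and z :: complex
  assumes pos: "\<And>n. 0 < a n" and A: "wop a a A"
    and bound: "\<And>c M. wnorm_le a c M \<Longrightarrow> wnorm_le a (A c) (q * M)"
    and q: "0 \<le> q" "q < cmod z"
begin

lemma nonneg: "0 \<le> a n"
  using pos[of n] by simp

lemma z_nonzero: "z \<noteq> 0"
  using q by auto

lemma power_bound: "wnorm_le a c M \<Longrightarrow> wnorm_le a ((A ^^ j) c) (q ^ j * M)"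
  by (induction j) (auto dest: bound simp: mult.assoc)

lemma term_bound:
  assumes "wnorm_le a c M"
  shows "cmod ((A ^^ j) c n / z ^ j) \<le> (M / a n) * (q / cmod z) ^ j"
  using wnorm_le_coord[OF power_bound[OF assms] pos, of j n] z_nonzero
  by (simp add: norm_divide norm_power power_divide field_simps)

lemma ratio: "norm (q / cmod z) < 1" "q / cmod z \<ge> 0"
  using q z_nonzero by (auto simp: divide_less_eq)

lemma ratio_lim: "(\<lambda>j. K * (q / cmod z) ^ j) \<longlonglongrightarrow> 0"
  using tendsto_mult_right_zero[OF LIMSEQ_power_zero[OF ratio(1)]] .

lemma neumann_summable:
  assumes "c \<in> wseq a"
  shows "summable (\<lambda>j. (A ^^ j) c n / z ^ Suc j)"
proof -
  obtain M where M: "wnorm_le a c M" using assms by (auto simp: wseq_def)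
  have "summable (\<lambda>j. (A ^^ j) c n / z ^ j)"
    by (rule summable_comparison_test'[where N=0 and g="\<lambda>j. (M / a n) * (q / cmod z) ^ j"])
       (use term_bound[OF M] ratio in \<open>auto intro: summable_mult summable_geometric\<close>)
  from summable_divide[OF this, of z] show ?thesis by (simp add: field_simps)
qed

lemma partial_bound:
  assumes "wnorm_le a c M"
  shows "wnorm_le a (\<lambda>n. \<Sum>j<J. (A ^^ j) c n / z ^ Suc j) (1 / (cmod z - q) * M)"
proof (rule wnorm_le_mono)
  have "wnorm_le a (\<lambda>n. (A ^^ j) c n / z ^ Suc j) (1 / cmod z ^ Suc j * (q ^ j * M))" for j
    using wnorm_le_scale[OF nonneg power_bound[OF assms, of j], of "1 / z ^ Suc j"]
    by (simp add: norm_divide norm_power norm_mult)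
  then show "wnorm_le a (\<lambda>n. \<Sum>j<J. (A ^^ j) c n / z ^ Suc j) (\<Sum>j<J. 1 / cmod z ^ Suc j * (q ^ j * M))"
    by (intro wnorm_le_sum nonneg) auto
  have "(\<Sum>j<J. 1 / cmod z ^ Suc j * (q ^ j * M)) = M / cmod z * (\<Sum>j<J. (q / cmod z) ^ j)"
    by (auto simp: sum_distrib_left power_divide field_simps intro!: sum.cong)
  also have "\<dots> \<le> M / cmod z * (1 / (1 - q / cmod z))"
  proof (rule mult_left_mono)
    have "(\<Sum>j<J. (q / cmod z) ^ j) \<le> (\<Sum>j. (q / cmod z) ^ j)"
      using ratio by (intro sum_le_suminf summable_geometric) auto
    then show "(\<Sum>j<J. (q / cmod z) ^ j) \<le> 1 / (1 - q / cmod z)"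
      using suminf_geometric[OF ratio(1)] by simp
  qed (use wnorm_le_nonneg[OF assms] in auto)
  also have "\<dots> = 1 / (cmod z - q) * M"
    using q by (auto simp: field_simps)
  finally show "(\<Sum>j<J. 1 / cmod z ^ Suc j * (q ^ j * M)) \<le> 1 / (cmod z - q) * M" .
qed

lemma neumann_lim:
  assumes "c \<in> wseq a"
  shows "(\<lambda>J. \<Sum>j<J. (A ^^ j) c n / z ^ Suc j) \<longlonglongrightarrow> neumann A z c n"
  unfolding neumann_def using summable_LIMSEQ[OF neumann_summable[OF assms]] .

text \<open>The series is defined coordinate by coordinate. The partial sums satisfy the geometric
  bound uniformly, and \<open>wnorm_le_lim\<close> passes it to the limit.\<close>

lemma neumann_bound:
  assumes "wnorm_le a c M"
  shows "wnorm_le a (neumann A z c) (1 / (cmod z - q) * M)"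
  by (rule wnorm_le_lim[OF neumann_lim partial_bound[OF assms]]) (use assms in \<open>auto simp: wseq_def\<close>)

lemma wop_neumann: "wop a a (neumann A z)"
proof -
  have "neumann A z (\<lambda>n. x * c n + y * d n) n = x * neumann A z c n + y * neumann A z d n"
    if cd: "c \<in> wseq a" "d \<in> wseq a" for c d x y n
  proof -
    have "(\<lambda>j. (A ^^ j) (\<lambda>n. x * c n + y * d n) n / z ^ Suc j) =
        (\<lambda>j. x * ((A ^^ j) c n / z ^ Suc j) + y * ((A ^^ j) d n / z ^ Suc j))"
      using wop_lin[OF wop_funpow[OF nonneg A] cd] by (simp add: add_divide_distrib)
    then show ?thesis unfolding neumann_def
      by (simp only: suminf_add[OF summable_mult summable_mult, OF neumann_summable[OF cd(1)] neumann_summable[OF cd(2)], symmetric]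
          suminf_mult[OF neumann_summable[OF cd(1)]] suminf_mult[OF neumann_summable[OF cd(2)]])
  qed
  moreover have "1 / (cmod z - q) \<ge> 0" using q by simp
  ultimately show ?thesis using neumann_bound by (intro wopI[of _ _ "1 / (cmod z - q)"]) blast+
qed

lemma neumann_left:
  assumes c: "c \<in> wseq a"
  shows "neumann A z (\<lambda>n. z * c n - A c n) = c"
proof
  fix n
  obtain M where M: "wnorm_le a c M" using assms by (auto simp: wseq_def)
  have "(A ^^ j) (\<lambda>n. z * c n - A c n) = (\<lambda>n. z * (A ^^ j) c n - (A ^^ Suc j) c n)" for j
    using wop_lin[OF wop_funpow[OF nonneg A] c wop_in[OF A c], of j z "-1"]
    by (simp add: funpow_swap1)
  then have "(\<lambda>j. (A ^^ j) (\<lambda>n. z * c n - A c n) n / z ^ Suc j) =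
      (\<lambda>j. (A ^^ j) c n / z ^ j - (A ^^ Suc j) c n / z ^ Suc j)"
    using z_nonzero by (auto simp: field_simps)
  moreover have "(\<lambda>j. (A ^^ j) c n / z ^ j) \<longlonglongrightarrow> 0"
    by (rule Lim_null_comparison[OF _ ratio_lim[of "M / a n"]]) (use term_bound[OF M] in auto)
  from telescope_sums'[OF this]
  have "(\<lambda>j. (A ^^ j) c n / z ^ j - (A ^^ Suc j) c n / z ^ Suc j) sums (c n)" by simp
  ultimately show "neumann A z (\<lambda>n. z * c n - A c n) n = c n"
    unfolding neumann_def by (simp add: sums_iff)
qed

text \<open>Linearity of \<open>A\<close> covers finite sums only, so the series is split at
  \<open>J\<close> into a finite sum, which telescopes, and \<open>1 / z ^ J\<close> times the
  series of \<open>(A ^^ J) c\<close>. Every coordinate of the second part is of order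
  \<open>(q / cmod z) ^ J\<close> and disappears as \<open>J\<close> grows.\<close>

lemma neumann_right:
  assumes c: "c \<in> wseq a"
  shows "(\<lambda>n. z * neumann A z c n - A (neumann A z c) n) = c"
proof
  fix n
  obtain M where M: "wnorm_le a c M" using assms by (auto simp: wseq_def)
  define N where "N = neumann A z"
  have Nop: "wop a a N" using wop_neumann N_def by simp
  have fp: "(A ^^ J) c \<in> wseq a" for J using wop_in[OF wop_funpow[OF nonneg A] c] .
  define P where "P J = (\<lambda>n. \<Sum>j<J. (A ^^ j) c n / z ^ Suc j)" for J
  have Pin: "P J \<in> wseq a" for J using partial_bound[OF M] by (auto simp: P_def wseq_def)
  have split: "N c = (\<lambda>n. P J n + 1 / z ^ J * N ((A ^^ J) c) n)" for J
  proof
    fix n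
    have "N c n = (\<Sum>j. (A ^^ (j + J)) c n / z ^ Suc (j + J)) + P J n"
      unfolding N_def neumann_def P_def using suminf_split_initial_segment[OF neumann_summable[OF c]] by simp
    also have "(\<lambda>j. (A ^^ (j + J)) c n / z ^ Suc (j + J)) = (\<lambda>j. 1 / z ^ J * ((A ^^ j) ((A ^^ J) c) n / z ^ Suc j))"
      by (simp add: funpow_add power_add field_simps)
    also have "(\<Sum>j. 1 / z ^ J * ((A ^^ j) ((A ^^ J) c) n / z ^ Suc j)) = 1 / z ^ J * N ((A ^^ J) c) n"
      unfolding N_def neumann_def by (rule suminf_mult[OF neumann_summable[OF fp]])
    finally show "N c n = P J n + 1 / z ^ J * N ((A ^^ J) c) n" by simp
  qed
  have AP: "z * P J n - A (P J) n = c n - (A ^^ J) c n / z ^ J" for J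
  proof (induction J)
    case 0
    have "A (\<lambda>n. 0 * c n) = (\<lambda>n. 0 * A c n)" by (rule wop_smult[OF A c])
    then show ?case by (simp add: P_def)
  next
    case (Suc J)
    have "P (Suc J) = (\<lambda>n. 1 * P J n + (1 / z ^ Suc J) * (A ^^ J) c n)" by (simp add: P_def)
    then have "A (P (Suc J)) = (\<lambda>n. 1 * A (P J) n + (1 / z ^ Suc J) * A ((A ^^ J) c) n)"
      using wop_lin[OF A Pin fp] by presburger
    then have "z * P (Suc J) n - A (P (Suc J)) n = (z * P J n - A (P J) n) + (A ^^ J) c n / z ^ J - (A ^^ Suc J) c n / z ^ Suc J"
      using z_nonzero by (simp add: P_def field_simps)
    then show ?case using Suc by simp
  qed
  define K where "K = M / a n + (cmod z * (1 / (cmod z - q) * M) / a n + q * (1 / (cmod z - q) * M) / a n)"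
  have est: "cmod (z * N c n - A (N c) n - c n) \<le> K * (q / cmod z) ^ J" for J
  proof -
    let ?t = "N ((A ^^ J) c)"
    have tin: "?t \<in> wseq a" using wop_in[OF Nop fp] .
    have A1: "A (N c) = (\<lambda>n. 1 * A (P J) n + 1 / z ^ J * A ?t n)"
      using wop_lin[OF A Pin tin, of 1 J "1 / z ^ J"] split[of J] by simp
    have e: "z * N c n - A (N c) n - c n = - ((A ^^ J) c n / z ^ J) + (z * ?t n / z ^ J - A ?t n / z ^ J)"
      using AP[of J] unfolding A1 split[of J, THEN fun_cong, of n] by (simp add: algebra_simps)
    have b1: "wnorm_le a ?t (1 / (cmod z - q) * (q ^ J * M))"
      unfolding N_def by (rule neumann_bound[OF power_bound[OF M]])
    have c1: "cmod (?t n) \<le> (1 / (cmod z - q) * (q ^ J * M)) / a n" by (rule wnorm_le_coord[OF b1 pos])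
    have c2: "cmod (A ?t n) \<le> (q * (1 / (cmod z - q) * (q ^ J * M))) / a n"
      by (rule wnorm_le_coord[OF bound[OF b1] pos])
    have "cmod (z * ?t n / z ^ J) \<le> (cmod z * (1 / (cmod z - q) * M) / a n) * (q / cmod z) ^ J"
      using mult_left_mono[OF c1, of "cmod z / cmod z ^ J"] z_nonzero
      by (simp add: norm_mult norm_divide norm_power power_divide mult_ac)
    moreover have "cmod (A ?t n / z ^ J) \<le> (q * (1 / (cmod z - q) * M) / a n) * (q / cmod z) ^ J"
      using mult_left_mono[OF c2, of "1 / cmod z ^ J"] z_nonzero
      by (simp add: norm_mult norm_divide norm_power power_divide mult_ac)
    moreover have "cmod (- ((A ^^ J) c n / z ^ J)) \<le> (M / a n) * (q / cmod z) ^ J"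
      using term_bound[OF M, of J n] by simp
    moreover have "cmod (z * N c n - A (N c) n - c n) \<le>
        cmod (- ((A ^^ J) c n / z ^ J)) + (cmod (z * ?t n / z ^ J) + cmod (A ?t n / z ^ J))"
      unfolding e by (intro order_trans[OF norm_triangle_ineq] add_mono norm_triangle_ineq4) simp
    ultimately show ?thesis unfolding K_def distrib_right by linarith
  qed
  have "cmod (z * N c n - A (N c) n - c n) \<le> 0"
    by (rule LIMSEQ_le_const[OF ratio_lim[of K]]) (use est in auto)
  then show "z * neumann A z c n - A (neumann A z c) n = c n" by (simp add: N_def)
qed

lemma neumann_wres: "z \<in> wres a A"
  unfolding wres_def using wop_neumann neumann_left neumann_right by blast

end

text \<open>With \<open>S = sum of z ^ (N - 1 - j) * A ^ j\<close> one has
  \<open>(z - A) S = S (z - A) = z ^ N - A ^ N\<close>. Composing \<open>S\<close> with the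
  resolvent of \<open>A ^^ N\<close> on either side gives a left and a right inverse of
  \<open>z - A\<close>, and these coincide.\<close>

lemma wres_power:
  assumes "\<And>n. 0 \<le> a n" "wop a a A" "z ^ N \<in> wres a (A ^^ N)" "N > 0"
  shows "z \<in> wres a A"
proof -
  obtain B where B: "wop a a B"
      "\<And>c. c \<in> wseq a \<Longrightarrow> B (\<lambda>n. z ^ N * c n - (A ^^ N) c n) = c"
      "\<And>c. c \<in> wseq a \<Longrightarrow> (\<lambda>n. z ^ N * B c n - (A ^^ N) (B c) n) = c"
    using assms(3) by (auto simp: wres_def)
  define S where "S k = (\<lambda>c n. \<Sum>j<k. z ^ (k - Suc j) * (A ^^ j) c n)" for k
  have S_Suc: "S (Suc k) = (\<lambda>c n. z * S k c n + (A ^^ k) c n)" for k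
  proof (intro ext)
    fix c n
    have "(\<Sum>j<k. z ^ (Suc k - Suc j) * (A ^^ j) c n) = (\<Sum>j<k. z * (z ^ (k - Suc j) * (A ^^ j) c n))"
      by (intro sum.cong) (auto simp: Suc_diff_Suc simp flip: mult.assoc power_Suc)
    then show "S (Suc k) c n = z * S k c n + (A ^^ k) c n"
      by (simp add: S_def sum_distrib_left)
  qed
  have Aj: "wop a a (A ^^ j)" for j by (rule wop_funpow[OF assms(1,2)])
  have opS: "wop a a (S k)" for k
  proof (induction k)
    case 0
    have "wop a a (\<lambda>c n. 0 * c n)"
      using wop_scale[OF assms(1) wop_id[of a 1 a, OF assms(1)], of 0] by simp
    then show ?case by (simp add: S_def)
  next
    case (Suc k)
    show ?case unfolding S_Suc by (intro wop_add wop_scale assms(1) Suc Aj)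
  qed
  have tel1: "S k (\<lambda>n. z * c n - A c n) = (\<lambda>n. z ^ k * c n - (A ^^ k) c n)" if c: "c \<in> wseq a" for c k
  proof (induction k)
    case (Suc k)
    have "(A ^^ k) (\<lambda>n. z * c n - A c n) = (\<lambda>n. z * (A ^^ k) c n - (A ^^ Suc k) c n)"
      using wop_lin[OF Aj c wop_in[OF assms(2) c], of k z "-1"] by (simp add: funpow_swap1)
    then show ?case using Suc by (simp add: S_Suc algebra_simps)
  qed (simp add: S_def)
  have comm: "A (S k c) = S k (A c)" if c: "c \<in> wseq a" for c k
  proof (induction k)
    case 0
    have "A (\<lambda>n. 0 * c n) = (\<lambda>n. 0 * A c n)" by (rule wop_smult[OF assms(2) c])
    then show ?case by (simp add: S_def)
  next
    case (Suc k)
    have "A (\<lambda>n. z * S k c n + 1 * (A ^^ k) c n) = (\<lambda>n. z * A (S k c) n + 1 * A ((A ^^ k) c) n)"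
      by (rule wop_lin[OF assms(2) wop_in[OF opS c] wop_in[OF Aj c]])
    then show ?case using Suc by (simp add: S_Suc funpow_swap1)
  qed
  have tel2: "(\<lambda>n. z * S k c n - A (S k c) n) = (\<lambda>n. z ^ k * c n - (A ^^ k) c n)" if c: "c \<in> wseq a" for c k
    using tel1[OF c, of k] wop_lin[OF opS c wop_in[OF assms(2) c], of k z "-1"] comm[OF c, of k] by simp
  have l: "B (S N (\<lambda>n. z * c n - A c n)) = c" if "c \<in> wseq a" for c
    using tel1[OF that] B(2)[OF that] by simp
  have r: "(\<lambda>n. z * S N (B c) n - A (S N (B c)) n) = c" if "c \<in> wseq a" for c
    using tel2[OF wop_in[OF B(1) that]] B(3)[OF that] by simp
  have SB: "S N (B c) = B (S N c)" if c: "c \<in> wseq a" for c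
  proof -
    have Bc: "S N (B c) \<in> wseq a" using wop_in[OF opS wop_in[OF B(1) c]] .
    have "B (S N (\<lambda>n. z * S N (B c) n - A (S N (B c)) n)) = S N (B c)" by (rule l[OF Bc])
    then show ?thesis using r[OF c] by simp
  qed
  have "wop a a (\<lambda>c. B (S N c))" by (rule wop_comp[OF opS B(1)])
  then show ?thesis unfolding wres_def using l r SB by auto
qed

text \<open>A smoothing perturbation \<open>K\<close> of an operator \<open>S\<close> that is small on both scales:
  the resolvent of \<open>S + K\<close> is transported between the scales by the resolvent of \<open>S\<close>.\<close>

lemma wres_transport:
  assumes pos: "\<And>n. 0 < a n" "\<And>n. 0 < b n" and le: "\<And>n. a n \<le> C * b n" "C \<ge> 0"
    and S: "wop a a S" "wop b b S"
    and q: "0 \<le> q" "q < cmod z"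
    and bound: "\<And>c M. wnorm_le a c M \<Longrightarrow> wnorm_le a (S c) (q * M)"
      "\<And>c M. wnorm_le b c M \<Longrightarrow> wnorm_le b (S c) (q * M)"
    and K: "wop a b K" and F: "\<And>c. c \<in> wseq a \<Longrightarrow> F c = (\<lambda>n. S c n + K c n)"
  shows "z \<in> wres a F \<longleftrightarrow> z \<in> wres b F"
proof -
  have nn: "0 \<le> a n" "0 \<le> b n" for n using pos[of n] by auto
  define Q where "Q = neumann S z"
  have Qa: "wop a a Q" "\<And>c. c \<in> wseq a \<Longrightarrow> Q (\<lambda>n. z * c n - S c n) = c"
      "\<And>c. c \<in> wseq a \<Longrightarrow> (\<lambda>n. z * Q c n - S (Q c) n) = c"
    unfolding Q_def by (rule wop_neumann neumann_left neumann_right; (fact | use pos S bound q in blast))+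
  have Qb: "wop b b Q" unfolding Q_def by (rule wop_neumann; (fact | use pos S bound q in blast))
  have sub: "c \<in> wseq a" if "c \<in> wseq b" for c using wseq_subset[of a C b, OF nn(1) le] that by blast
  have Ka: "wop a a K" using wop_comp[OF K wop_id[of a C b, OF nn(1) le]] by simp
  have Fop: "wop a a F" by (rule wop_cong[OF wop_add[OF nn(1) S(1) Ka] nn(1)]) (simp add: F)
  show ?thesis
  proof
    assume "z \<in> wres a F"
    then obtain R where R: "wop a a R" "\<And>c. c \<in> wseq a \<Longrightarrow> R (\<lambda>n. z * c n - F c n) = c"
      "\<And>c. c \<in> wseq a \<Longrightarrow> (\<lambda>n. z * R c n - F (R c) n) = c" by (auto simp: wres_def)
    \<comment> \<open>Resolvent identity \<open>R = Q + Q K R\<close>. The right-hand side takes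
      values in the smaller space since \<open>K\<close> maps into it and \<open>Q\<close> preserves
      it, so the resolvent on \<open>wseq a\<close> restricts to \<open>wseq b\<close>.\<close>
    have eq: "(\<lambda>n. Q c n + Q (K (R c)) n) = R c" if c: "c \<in> wseq b" for c
    proof -
      have y: "R c \<in> wseq a" by (rule wop_in[OF R(1) sub[OF c]])
      have Ky: "K (R c) \<in> wseq a" by (rule wop_in[OF Ka y])
      have "(\<lambda>n. z * R c n - S (R c) n) = (\<lambda>n. c n + K (R c) n)"
        using R(3)[OF sub[OF c]] F[OF y] by (auto simp: fun_eq_iff algebra_simps)
      with Qa(2)[OF y] have "R c = Q (\<lambda>n. c n + K (R c) n)" by simp
      also have "\<dots> = (\<lambda>n. Q c n + Q (K (R c)) n)" by (rule wop_plus[OF Qa(1) sub[OF c] Ky])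
      finally show ?thesis by simp
    qed
    have "wop b b R"
      by (rule wop_cong[OF wop_add[OF nn(2) Qb wop_comp[OF wop_comp[OF wop_comp[OF wop_id[of a C b, OF nn(1) le] R(1)] K] Qb]] nn(2)])
         (rule eq)
    then show "z \<in> wres b F" unfolding wres_def using R sub by blast
  next
    assume "z \<in> wres b F"
    then obtain R where R: "wop b b R" "\<And>c. c \<in> wseq b \<Longrightarrow> R (\<lambda>n. z * c n - F c n) = c"
      "\<And>c. c \<in> wseq b \<Longrightarrow> (\<lambda>n. z * R c n - F (R c) n) = c" by (auto simp: wres_def)
    \<comment> \<open>Conversely \<open>R\<close> is known on \<open>wseq b\<close> only. In
      \<open>Q + R K Q\<close> it is applied to values of \<open>K\<close>, which lie there.\<close>
    define R' where "R' = (\<lambda>c n. Q c n + R (K (Q c)) n)"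
    have op: "wop a a R'" unfolding R'_def
      by (intro wop_add nn Qa wop_comp[OF wop_comp[OF wop_comp[OF Qa(1) K] R(1)] wop_id[of a C b, OF nn(1) le]])
    have "(\<lambda>n. z * R' c n - F (R' c) n) = c" if c: "c \<in> wseq a" for c
    proof -
      have Qc: "Q c \<in> wseq a" by (rule wop_in[OF Qa(1) c])
      have k: "K (Q c) \<in> wseq b" by (rule wop_in[OF K Qc])
      have Rk: "R (K (Q c)) \<in> wseq a" by (rule sub[OF wop_in[OF R(1) k]])
      have "F (R' c) = (\<lambda>n. F (Q c) n + F (R (K (Q c))) n)"
        unfolding R'_def by (rule wop_plus[OF Fop Qc Rk])
      then show ?thesis using Qa(3)[OF c] R(3)[OF k] F[OF Qc]
        by (auto simp: R'_def fun_eq_iff algebra_simps)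
    qed
    moreover have "R' (\<lambda>n. z * c n - F c n) = c" if c: "c \<in> wseq a" for c
    proof -
      define k where "k = K c"
      have kb: "k \<in> wseq b" unfolding k_def by (rule wop_in[OF K c])
      have ka: "k \<in> wseq a" by (rule sub[OF kb])
      have zS: "(\<lambda>n. z * c n - S c n) \<in> wseq a"
        using wseq_lin[OF nn(1) c wop_in[OF S(1) c], of z "-1"] by simp
      have e: "(\<lambda>n. z * c n - F c n) = (\<lambda>n. (z * c n - S c n) - k n)"
        using F[OF c] by (auto simp: k_def algebra_simps)
      have Qe: "Q (\<lambda>n. z * c n - F c n) = (\<lambda>n. c n - Q k n)"
        unfolding e wop_minus[OF Qa(1) zS ka] Qa(2)[OF c] ..
      have Qka: "Q k \<in> wseq a" by (rule wop_in[OF Qa(1) ka])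
      have Qkb: "Q k \<in> wseq b" by (rule wop_in[OF Qb kb])
      have KQe: "K (\<lambda>n. c n - Q k n) = (\<lambda>n. k n - K (Q k) n)"
        using wop_minus[OF K c Qka] by (simp add: k_def)
      have "(\<lambda>n. z * Q k n - F (Q k) n) = (\<lambda>n. k n - K (Q k) n)"
        using Qa(3)[OF ka] F[OF Qka] by (auto simp: fun_eq_iff algebra_simps)
      with R(2)[OF Qkb] have "R (\<lambda>n. k n - K (Q k) n) = Q k" by simp
      then show ?thesis unfolding R'_def Qe KQe by simp
    qed
    ultimately show "z \<in> wres a F" unfolding wres_def using op by blast
  qed
qed

section \<open>Fourier series\<close>

definition ee :: "int \<Rightarrow> real \<Rightarrow> complex" where
  "ee n x = cis (2 * pi * real_of_int n * x)"

lemma ee_add: "ee (m + n) x = ee m x * ee n x"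
  by (simp add: ee_def cis_mult algebra_simps)

lemma ee_add_arg: "ee n (x + y) = ee n x * ee n y"
  by (simp add: ee_def cis_mult algebra_simps)

lemma cmod_ee [simp]: "cmod (ee n x) = 1"
  by (simp add: ee_def)

lemma ee_0 [simp]: "ee 0 x = 1" "ee n 0 = 1"
  by (simp_all add: ee_def)

lemma cnj_ee: "cnj (ee n x) = ee (- n) x"
  by (simp add: ee_def cis_cnj)

lemma ee_int [simp]: "ee n (of_int j) = 1"
  using cis_multiple_2pi[of "of_int (n * j)"] by (simp add: ee_def mult_ac)

lemma ee_periodic: "ee n (x + of_int j) = ee n x"
  by (simp add: ee_add_arg)

lemma periodic1_ee: "periodic1 (ee n)"
  unfolding periodic1_def using ee_periodic[of n _ 1] by simp

lemma continuous_on_ee [continuous_intros]: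
  "continuous_on S f \<Longrightarrow> continuous_on S (\<lambda>x. ee n (f x))"
  unfolding ee_def by (intro continuous_intros)

lemma fourier_coeff_ee: "fourier_coeff \<phi> n = (LINT x:{0..1}|lborel. ee (- n) x * \<phi> x)"
  by (simp add: fourier_coeff_def ee_def)

lemma ee_has_vector_derivative:
  "(ee n has_vector_derivative of_real (2 * pi * of_int n) * \<i> * ee n x) (at x)"
proof -
  have "((\<lambda>x. 2 * pi * real_of_int n * x) has_real_derivative 2 * pi * of_int n) (at x)"
    by (auto intro!: derivative_eq_intros)
  from cis_has_vector_derivative[OF this] show ?thesis
    by (simp add: ee_def [abs_def] mult_ac)
qed

lemma set_integrable_continuous:
  fixes f :: "real \<Rightarrow> 'a::euclidean_space"
  shows "continuous_on UNIV f \<Longrightarrow> set_integrable lborel {0..1} f"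
  by (rule borel_integrable_atLeastAtMost') (rule continuous_on_subset[of UNIV], auto)

lemma LINT_continuous:
  fixes f :: "real \<Rightarrow> 'a::euclidean_space"
  shows "continuous_on UNIV f \<Longrightarrow> (LINT x:{0..1}|lborel. f x) = integral {0..1} f"
  by (intro set_borel_integral_eq_integral(2) set_integrable_continuous)

lemma integral_ee: "(LINT x:{0..1}|lborel. ee n x) = (if n = 0 then 1 else 0)"
proof -
  have "(ee n has_integral (if n = 0 then 1 else 0)) {0..1}"
  proof (cases "n = 0")
    case True
    then have "ee n = (\<lambda>x. 1)" by (auto simp: fun_eq_iff)
    then show ?thesis using True has_integral_const_real[of "1::complex" 0 1] by simp
  next
    case False
    define K where "K = complex_of_real (2 * pi * of_int n) * \<i>"
    have K: "K \<noteq> 0" using False by (simp add: K_def)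
    have "((\<lambda>x. inverse K * ee n x) has_vector_derivative inverse K * (K * ee n x)) (at x within {0..1})" for x
      unfolding K_def
      by (rule has_vector_derivative_mult_right[OF has_vector_derivative_at_within[OF ee_has_vector_derivative]])
    then have "((\<lambda>x. inverse K * ee n x) has_vector_derivative ee n x) (at x within {0..1})" for x
      using K by (simp flip: mult.assoc)
    then have "(ee n has_integral (inverse K * ee n 1 - inverse K * ee n 0)) {0..1}"
      by (intro fundamental_theorem_of_calculus) auto
    then show ?thesis using False ee_int[of n 1] by simp
  qed
  then have "integral {0..1} (ee n) = (if n = 0 then 1 else 0)" by (rule integral_unique)
  moreover have "continuous_on UNIV (ee n)" by (intro continuous_intros)
  ultimately show ?thesis by (simp add: LINT_continuous)
qed

lemma L2_circle_continuous:
  assumes "continuous_on UNIV f" "periodic1 f"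
  shows "f \<in> L2_circle"
  using assms
  by (auto simp: L2_circle_def intro!: borel_measurable_continuous_onI set_integrable_continuous continuous_intros)

lemma ee_L2: "ee n \<in> L2_circle"
  by (intro L2_circle_continuous periodic1_ee continuous_intros)

lemma L2_mult_integrable:
  assumes "u \<in> L2_circle" "v \<in> L2_circle"
  shows "set_integrable lborel {0..1} (\<lambda>x. u x * v x)"
proof (rule set_integrable_bound)
  show "set_integrable lborel {0..1} (\<lambda>x. (cmod (u x))\<^sup>2 + (cmod (v x))\<^sup>2)"
    using assms by (intro set_integral_add) (auto simp: L2_circle_def)
  show "set_borel_measurable lborel {0..1} (\<lambda>x. u x * v x)"
    using assms by (auto simp: L2_circle_def set_borel_measurable_def)
  have "cmod (u x * v x) \<le> (cmod (u x))\<^sup>2 + (cmod (v x))\<^sup>2" for x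
    using sum_squares_bound[of "cmod (u x)" "cmod (v x)"] mult_nonneg_nonneg[OF norm_ge_zero[of "u x"] norm_ge_zero[of "v x"]]
    unfolding norm_mult by linarith
  then show "AE x in lborel. x \<in> {0..1} \<longrightarrow> cmod (u x * v x) \<le> norm ((cmod (u x))\<^sup>2 + (cmod (v x))\<^sup>2)"
    by auto
qed

lemma L2_circle_cnj: "u \<in> L2_circle \<Longrightarrow> (\<lambda>x. cnj (u x)) \<in> L2_circle"
  by (auto simp: L2_circle_def periodic1_def intro: borel_measurable_continuous_on[OF continuous_on_cnj[OF continuous_on_id]])

lemma L2_circle_lincomb:
  assumes "u \<in> L2_circle" "v \<in> L2_circle"
  shows "(\<lambda>x. a * u x + b * v x) \<in> L2_circle"
proof -
  have "set_integrable lborel {0..1} (\<lambda>x. (cmod (a * u x + b * v x))\<^sup>2)"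
  proof (rule set_integrable_bound)
    show "set_integrable lborel {0..1} (\<lambda>x. (2 * (cmod a)\<^sup>2) * (cmod (u x))\<^sup>2 + (2 * (cmod b)\<^sup>2) * (cmod (v x))\<^sup>2)"
      using assms by (intro set_integral_add set_integrable_mult_right) (auto simp: L2_circle_def)
    show "set_borel_measurable lborel {0..1} (\<lambda>x. (cmod (a * u x + b * v x))\<^sup>2)"
      using assms by (auto simp: L2_circle_def set_borel_measurable_def)
    have "(cmod (a * u x + b * v x))\<^sup>2 \<le> (2 * (cmod a)\<^sup>2) * (cmod (u x))\<^sup>2 + (2 * (cmod b)\<^sup>2) * (cmod (v x))\<^sup>2" for x
    proof -
      have "(cmod (a * u x + b * v x))\<^sup>2 \<le> (cmod a * cmod (u x) + cmod b * cmod (v x))\<^sup>2"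
        by (intro power_mono) (auto simp flip: norm_mult intro: norm_triangle_ineq)
      also have "\<dots> \<le> 2 * (cmod a * cmod (u x))\<^sup>2 + 2 * (cmod b * cmod (v x))\<^sup>2"
        using sum_squares_bound[of "cmod a * cmod (u x)" "cmod b * cmod (v x)"] by (simp add: power2_sum)
      finally show ?thesis by (simp add: power_mult_distrib mult_ac)
    qed
    then show "AE x in lborel. x \<in> {0..1} \<longrightarrow> norm ((cmod (a * u x + b * v x))\<^sup>2) \<le>
        norm ((2 * (cmod a)\<^sup>2) * (cmod (u x))\<^sup>2 + (2 * (cmod b)\<^sup>2) * (cmod (v x))\<^sup>2)" by auto
  qed
  then show ?thesis using assms by (auto simp: L2_circle_def periodic1_def)
qed

lemma L2_circle_trig: "finite S \<Longrightarrow> (\<lambda>x. \<Sum>n\<in>S. c n * ee n x) \<in> L2_circle"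
  by (intro L2_circle_continuous continuous_intros)
     (use periodic1_ee in \<open>auto simp: periodic1_def\<close>)

lemma LINT_sum:
  fixes f :: "'i \<Rightarrow> real \<Rightarrow> complex"
  assumes "finite S" "\<And>i. i \<in> S \<Longrightarrow> set_integrable M A (f i)"
  shows "(LINT x:A|M. (\<Sum>i\<in>S. f i x)) = (\<Sum>i\<in>S. (LINT x:A|M. f i x))" "set_integrable M A (\<lambda>x. \<Sum>i\<in>S. f i x)"
  using assms(2) unfolding set_lebesgue_integral_def set_integrable_def scaleR_sum_right
  by (rule Bochner_Integration.integral_sum Bochner_Integration.integrable_sum; blast)+

lemma trig_parseval:
  assumes "finite S"
  shows "(LINT x:{0..1}|lborel. (cmod (\<Sum>n\<in>S. c n * ee n x))\<^sup>2) = (\<Sum>n\<in>S. (cmod (c n))\<^sup>2)"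
proof -
  have ei: "set_integrable lborel {0..1} (\<lambda>x. a * ee n x)" for a n
    by (intro set_integrable_continuous continuous_intros)
  have "complex_of_real (LINT x:{0..1}|lborel. (cmod (\<Sum>n\<in>S. c n * ee n x))\<^sup>2) =
      (LINT x:{0..1}|lborel. complex_of_real ((cmod (\<Sum>n\<in>S. c n * ee n x))\<^sup>2))"
    by (rule set_integral_complex_of_real[symmetric])
  also have "\<dots> = (LINT x:{0..1}|lborel. (\<Sum>n\<in>S. \<Sum>m\<in>S. (c n * cnj (c m)) * ee (n - m) x))"
    unfolding complex_norm_square cnj_sum sum_product complex_cnj_mult cnj_ee
    by (simp add: ee_add[of _ "- _", simplified] mult_ac)
  also have "\<dots> = (\<Sum>n\<in>S. \<Sum>m\<in>S. (c n * cnj (c m)) * (LINT x:{0..1}|lborel. ee (n - m) x))"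
    using assms by (simp add: LINT_sum ei)
  also have "\<dots> = (\<Sum>n\<in>S. c n * cnj (c n))"
    using assms by (simp add: integral_ee if_distrib cong: if_cong)
  also have "\<dots> = complex_of_real (\<Sum>n\<in>S. (cmod (c n))\<^sup>2)"
    by (simp only: complex_norm_square[symmetric] of_real_sum)
  finally show ?thesis by (simp only: of_real_eq_iff)
qed

lemma L2_trig_distance:
  assumes "f \<in> L2_circle" "finite S"
  shows "(LINT x:{0..1}|lborel. (cmod (f x - (\<Sum>n\<in>S. fourier_coeff f n * ee n x)))\<^sup>2) =
    (LINT x:{0..1}|lborel. (cmod (f x))\<^sup>2) - (\<Sum>n\<in>S. (cmod (fourier_coeff f n))\<^sup>2)"
proof -
  define p where "p x = (\<Sum>n\<in>S. fourier_coeff f n * ee n x)" for x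
  have p: "p \<in> L2_circle" unfolding p_def by (rule L2_circle_trig[OF assms(2)])
  have i1: "set_integrable lborel {0..1} (\<lambda>x. (cmod (f x))\<^sup>2)" "set_integrable lborel {0..1} (\<lambda>x. (cmod (p x))\<^sup>2)"
    using assms p by (auto simp: L2_circle_def)
  have i2: "set_integrable lborel {0..1} (\<lambda>x. f x * cnj (p x))"
    by (intro L2_mult_integrable L2_circle_cnj assms p)
  have i3: "set_integrable lborel {0..1} (\<lambda>x. ee n x * f x)" for n
    by (intro L2_mult_integrable ee_L2 assms)
  have "(LINT x:{0..1}|lborel. f x * cnj (p x)) = (LINT x:{0..1}|lborel. (\<Sum>n\<in>S. cnj (fourier_coeff f n) * (ee (- n) x * f x)))"
    by (simp add: p_def cnj_ee sum_distrib_left mult_ac)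
  also have "\<dots> = (\<Sum>n\<in>S. cnj (fourier_coeff f n) * fourier_coeff f n)"
    using assms(2) i3 by (simp add: LINT_sum fourier_coeff_ee)
  also have "\<dots> = complex_of_real (\<Sum>n\<in>S. (cmod (fourier_coeff f n))\<^sup>2)"
    by (simp only: complex_norm_square of_real_sum mult.commute)
  finally have c: "(LINT x:{0..1}|lborel. f x * cnj (p x)) = complex_of_real (\<Sum>n\<in>S. (cmod (fourier_coeff f n))\<^sup>2)" .
  have "(LINT x:{0..1}|lborel. Re (f x * cnj (p x))) = Re (LINT x:{0..1}|lborel. f x * cnj (p x))"
    using i2 by (simp add: set_lebesgue_integral_def set_integrable_def flip: integral_Re)
  with c have R: "(LINT x:{0..1}|lborel. Re (f x * cnj (p x))) = (\<Sum>n\<in>S. (cmod (fourier_coeff f n))\<^sup>2)" by simp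
  have i2R: "set_integrable lborel {0..1} (\<lambda>x. Re (f x * cnj (p x)))"
    using integrable_Re[OF i2[unfolded set_integrable_def]] by (simp add: set_integrable_def)
  have sq: "(cmod (f x - p x))\<^sup>2 = (cmod (f x))\<^sup>2 - 2 * Re (f x * cnj (p x)) + (cmod (p x))\<^sup>2" for x
    unfolding cmod_power2 by (simp add: power2_eq_square algebra_simps)
  have "(LINT x:{0..1}|lborel. (cmod (f x - p x))\<^sup>2) =
     (LINT x:{0..1}|lborel. (cmod (f x))\<^sup>2) - 2 * (LINT x:{0..1}|lborel. Re (f x * cnj (p x))) + (LINT x:{0..1}|lborel. (cmod (p x))\<^sup>2)"
    unfolding sq using i1 i2R
    by (simp only: set_integral_add set_integral_diff set_integrable_mult_right set_integral_mult_right)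
  then show ?thesis using R trig_parseval[OF assms(2), of "fourier_coeff f"] by (simp add: p_def)
qed

lemma bessel_inequality:
  assumes "f \<in> L2_circle" "finite S"
  shows "(\<Sum>n\<in>S. (cmod (fourier_coeff f n))\<^sup>2) \<le> (LINT x:{0..1}|lborel. (cmod (f x))\<^sup>2)"
proof -
  have "0 \<le> (LINT x:{0..1}|lborel. (cmod (f x - (\<Sum>n\<in>S. fourier_coeff f n * ee n x)))\<^sup>2)"
    unfolding set_lebesgue_integral_def by (intro Bochner_Integration.integral_nonneg) auto
  then show ?thesis using L2_trig_distance[OF assms] by simp
qed

lemma int_square_sum_bound:
  "\<exists>Z>0. \<forall>F::int set. finite F \<longrightarrow> (\<Sum>n\<in>F. 1 / (max 1 \<bar>real_of_int n\<bar>)\<^sup>2) \<le> Z"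
proof -
  define w where "w = (\<lambda>n::int. 1 / (max 1 \<bar>real_of_int n\<bar>)\<^sup>2)"
  define z where "z = (\<lambda>k::nat. 1 / (max 1 (real k))\<^sup>2)"
  have "summable (\<lambda>k. inverse (real (Suc k) ^ 2))"
    using inverse_power_summable[of 2, where ?'a=real] by (subst summable_Suc_iff) auto
  moreover have "z (Suc k) = inverse (real (Suc k) ^ 2)" for k
    by (simp add: z_def max_def inverse_eq_divide)
  ultimately have "summable (\<lambda>k. z (Suc k))" by simp
  then have sz: "summable z" using summable_Suc_iff by blast
  have "(\<Sum>n\<in>F. w n) \<le> 2 * suminf z + 1" if F: "finite F" for F
  proof -
    define N where "N = Max (insert 0 ((\<lambda>n. nat \<bar>n\<bar>) ` F))"
    have "F \<subseteq> int ` {..N} \<union> (\<lambda>k. - int k) ` {..N}"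
    proof
      fix n assume n: "n \<in> F"
      then have "nat \<bar>n\<bar> \<le> N" using F by (auto simp: N_def)
      then show "n \<in> int ` {..N} \<union> (\<lambda>k. - int k) ` {..N}"
        by (cases "n \<ge> 0") (auto simp: image_iff intro: bexI[of _ "nat \<bar>n\<bar>"])
    qed
    then have "(\<Sum>n\<in>F. w n) \<le> (\<Sum>n\<in>int ` {..N} \<union> (\<lambda>k. - int k) ` {..N}. w n)"
      by (intro sum_mono2) (auto simp: w_def)
    also have "\<dots> \<le> (\<Sum>n\<in>int ` {..N}. w n) + (\<Sum>n\<in>(\<lambda>k. - int k) ` {..N}. w n)"
      using sum_nonneg[of "int ` {..N} \<inter> (\<lambda>k. - int k) ` {..N}" w] by (simp add: sum_Un w_def)
    also have "\<dots> = (\<Sum>k\<le>N. z k) + (\<Sum>k\<le>N. z k)"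
      by (simp add: sum.reindex inj_on_def w_def z_def)
    also have "(\<Sum>k\<le>N. z k) \<le> suminf z"
      using sz by (intro sum_le_suminf) (auto simp: z_def)
    finally show ?thesis by simp
  qed
  moreover have "suminf z \<ge> 0" using sz by (intro suminf_nonneg) (auto simp: z_def)
  ultimately show ?thesis unfolding w_def by (intro exI[of _ "2 * suminf z + 1"]) auto
qed

lemma summable_on_int_bound:
  fixes f :: "int \<Rightarrow> 'a::banach"
  assumes "\<And>n. norm (f n) \<le> C / (max 1 \<bar>real_of_int n\<bar>)\<^sup>2"
  shows "(\<lambda>n. norm (f n)) summable_on UNIV" "f summable_on UNIV"
proof -
  obtain Z where Z: "\<And>F::int set. finite F \<Longrightarrow> (\<Sum>n\<in>F. 1 / (max 1 \<bar>real_of_int n\<bar>)\<^sup>2) \<le> Z"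
    using int_square_sum_bound by blast
  have C: "C \<ge> 0" using order_trans[OF norm_ge_zero assms[of 0]] by simp
  have "(\<Sum>n\<in>F. norm (f n)) \<le> C * Z" if "finite F" for F
  proof -
    have "(\<Sum>n\<in>F. norm (f n)) \<le> (\<Sum>n\<in>F. C * (1 / (max 1 \<bar>real_of_int n\<bar>)\<^sup>2))"
      using assms by (intro sum_mono) simp
    also have "\<dots> \<le> C * Z" unfolding sum_distrib_left[symmetric] by (intro mult_left_mono Z that C)
    finally show ?thesis .
  qed
  then show s: "(\<lambda>n. norm (f n)) summable_on UNIV"
    by (intro nonneg_bdd_above_summable_on bdd_aboveI2[of _ _ "C * Z"]) auto
  show "f summable_on UNIV" by (rule abs_summable_summable[OF s])
qed

lemma int_interval_filterlim:
  "filterlim (\<lambda>N. {- int N..int N}) (finite_subsets_at_top UNIV) sequentially"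
  unfolding filterlim_finite_subsets_at_top
proof safe
  fix X :: "int set" assume X: "finite X"
  define K where "K = nat (Max (insert 0 (abs ` X)))"
  have "X \<subseteq> {- int N..int N}" if "N \<ge> K" for N
  proof
    fix n assume "n \<in> X"
    then have "\<bar>n\<bar> \<le> Max (insert 0 (abs ` X))" using X by (intro Max_ge) auto
    then show "n \<in> {- int N..int N}" using that by (auto simp: K_def)
  qed
  then show "\<forall>\<^sub>F N in sequentially. finite {- int N..int N} \<and> X \<subseteq> {- int N..int N} \<and> {- int N..int N} \<subseteq> UNIV"
    by (auto simp: eventually_sequentially)
qed

lemma has_sum_int_tendsto:
  assumes "(f has_sum s) UNIV"
  shows "(\<lambda>N. \<Sum>n\<in>{- int N..int N}. f n) \<longlonglongrightarrow> s"
  using filterlim_compose[OF assms[unfolded has_sum_def] int_interval_filterlim] by (simp add: o_def)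

text \<open>For \<open>n\<close> nonzero the normalized slope of the phase is
  \<open>- sgn n\<close>, of modulus 1, so it is nowhere stationary. Coefficient 0 is absorbed into
  the constant.\<close>

lemma fourier_coeff_decay:
  assumes "CB N {()} (\<lambda>_. f)" "periodic1 f"
  shows "\<exists>C\<ge>0. \<forall>n. cmod (fourier_coeff f n) \<le> C / (max 1 \<bar>real_of_int n\<bar>) ^ N"
proof -
  have cont: "continuous_on UNIV f" by (rule CB_continuous[OF assms(1)]) simp
  have "\<exists>C\<ge>0. \<forall>n\<in>{n::int. n \<noteq> 0}. cmod (integral {0..1} (\<lambda>x. cis (- 2 * pi * of_int n * x) * f x)) \<le> C / (2 * pi * \<bar>real_of_int n\<bar>) ^ N"
  proof (rule nonstationary_phase[where p="\<lambda>n x. - sgn (of_int n)" and c=1])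
    show "CB N {n::int. n \<noteq> 0} (\<lambda>n. f)" using CB_reindex[OF assms(1), of _ "\<lambda>_. ()"] by auto
    show "CB N {n::int. n \<noteq> 0} (\<lambda>n x. complex_of_real (- sgn (real_of_int n)))"
      by (rule CB_const[of _ _ 1]) (auto simp: sgn_if)
    show "periodic1 (\<lambda>x. cis (- 2 * pi * real_of_int n * x))" for n :: int
      using periodic1_ee[of "- n"] by (simp add: ee_def [abs_def])
    show "((\<lambda>x. - 2 * pi * real_of_int n * x) has_real_derivative 2 * pi * \<bar>real_of_int n\<bar> * - sgn (real_of_int n)) (at x)" for n :: int and x
      by (auto intro!: derivative_eq_intros simp: sgn_if)
    show "f x = 0" if "n \<in> {n::int. n \<noteq> 0}" "\<bar>- sgn (real_of_int n)\<bar> < 1" for n x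
      using that by (auto simp: sgn_if split: if_splits)
  qed (use assms(2) in \<open>auto simp: sgn_if periodic1_def\<close>)
  then obtain C where C: "C \<ge> 0" "\<And>n::int. n \<noteq> 0 \<Longrightarrow> cmod (integral {0..1} (\<lambda>x. cis (- 2 * pi * of_int n * x) * f x)) \<le> C / (2 * pi * \<bar>real_of_int n\<bar>) ^ N"
    by auto
  have fc: "fourier_coeff f n = integral {0..1} (\<lambda>x. cis (- 2 * pi * of_int n * x) * f x)" for n
    unfolding fourier_coeff_def by (rule LINT_continuous) (intro continuous_intros cont)
  have "cmod (fourier_coeff f n) \<le> max C (cmod (fourier_coeff f 0)) / (max 1 \<bar>real_of_int n\<bar>) ^ N" for n
  proof (cases "n = 0")
    case False
    have "cmod (fourier_coeff f n) \<le> C / (2 * pi * \<bar>real_of_int n\<bar>) ^ N" using C(2)[OF False] fc by simp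
    also have "\<dots> \<le> C / (max 1 \<bar>real_of_int n\<bar>) ^ N"
    proof (intro divide_left_mono power_mono C mult_pos_pos zero_less_power)
      show "max 1 \<bar>real_of_int n\<bar> \<le> 2 * pi * \<bar>real_of_int n\<bar>"
        using False pi_gt3 mult_mono[of 1 "2 * pi" 1 "\<bar>real_of_int n\<bar>"] mult_right_mono[of 1 "2 * pi" "\<bar>real_of_int n\<bar>"] by auto
    qed (use False in auto)
    also have "\<dots> \<le> max C (cmod (fourier_coeff f 0)) / (max 1 \<bar>real_of_int n\<bar>) ^ N"
      by (intro divide_right_mono) auto
    finally show ?thesis .
  qed auto
  then show ?thesis using C(1) by (intro exI[of _ "max C (cmod (fourier_coeff f 0))"]) auto
qed

text \<open>Jordan's inequality in a weak form, from concavity of the sine. With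
  \<open>cmod_ee_minus_1\<close> it bounds the denominator of the difference quotient in
  \<open>fourier_inversion\<close> from below.\<close>

lemma sin_pi_lower: "\<bar>t\<bar> \<le> 1/2 \<Longrightarrow> \<bar>t\<bar> \<le> \<bar>sin (pi * t)\<bar>"
proof -
  have pos: "t \<le> sin (pi * t)" if t: "0 \<le> t" "t \<le> 1/2" for t :: real
  proof -
    have "concave_on {0..pi} sin"
      by (rule f''_le0_imp_concave[where f'=cos and f''="\<lambda>x. - sin x"])
         (auto intro!: derivative_eq_intros sin_ge_zero)
    from concave_onD[OF this, of "2 * t" 0 "pi/2"] t
    have "2 * t \<le> sin (pi * t)" by (simp add: mult_ac)
    then show ?thesis using t by simp
  qed
  assume "\<bar>t\<bar> \<le> 1/2"
  then show ?thesis using pos[of t] pos[of "- t"] by (cases "t \<ge> 0") auto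
qed

lemma cmod_ee_minus_1: "cmod (ee 1 t - 1) = 2 * \<bar>sin (pi * t)\<bar>"
proof -
  have "(cmod (ee 1 t - 1))\<^sup>2 = (cos (2 * (pi * t)) - 1)\<^sup>2 + (sin (2 * (pi * t)))\<^sup>2"
    by (simp add: ee_def cmod_power2 mult.assoc)
  also have "\<dots> = 2 - 2 * cos (2 * (pi * t))"
    using sin_cos_squared_add[of "2 * (pi * t)"] by (simp add: power2_eq_square algebra_simps)
  also have "\<dots> = (2 * \<bar>sin (pi * t)\<bar>)\<^sup>2"
    by (simp add: cos_double_sin power_mult_distrib)
  finally show ?thesis by (metis norm_ge_zero abs_ge_zero mult_nonneg_nonneg power2_eq_imp_eq zero_le_numeral)
qed

lemma periodic1_of_int:
  assumes "periodic1 f" shows "f (x + of_int j) = f x"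
proof -
  have p: "f (x + 1) = f x" for x using assms by (simp add: periodic1_def)
  show ?thesis
  proof (induction j rule: int_induct[of _ 0])
    case (step1 i)
    then show ?case using p[of "x + of_int i"] by (simp add: add.assoc)
  next
    case (step2 i)
    then show ?case using p[of "x + of_int (i - 1)"] by (simp add: add.assoc)
  qed simp
qed

text \<open>Chernoff's argument: \<open>(f x - f x0) / (e\<^sup>2\<^sup>\<pi>\<^sup>i\<^sup>(\<^sup>x\<^sup>-\<^sup>x\<^sup>0\<^sup>) - 1)\<close> is bounded, and by its Fourier
  coefficients the partial sums of the Fourier series of \<open>f - f x0\<close> telescope.\<close>

lemma fourier_inversion:
  assumes "CB 2 {()} (\<lambda>_. f)" "periodic1 f"
  shows "((\<lambda>n. fourier_coeff f n * ee n x0) has_sum f x0) UNIV"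
proof -
  have cont: "continuous_on UNIV f" by (rule CB_continuous[OF assms(1)]) simp
  obtain f' where f': "\<And>x. (f has_vector_derivative f' x) (at x)" "CB 1 {()} (\<lambda>_. f')"
    using assms(1) by (auto simp: numeral_2_eq_2)
  obtain B where B: "B \<ge> 0" "\<And>x. cmod (f' x) \<le> B" using CB_bounded[OF f'(2)] by auto
  have per: "f (x + of_int j) = f x" for x j by (rule periodic1_of_int[OF assms(2)])
  define h where "h x = (f x - f x0) / (ee 1 (x - x0) - 1)" for x
  have Lip: "cmod (f x - f y) \<le> B * \<bar>x - y\<bar>" for x y
  proof -
    have "\<bar>t\<bar> * cmod (f' x) \<le> B * \<bar>t\<bar>" for t x
      using mult_left_mono[OF B(2)[of x] abs_ge_zero[of t]] by (simp add: mult.commute)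
    then have "norm (f x - f y) \<le> B * norm (x - y)"
      by (intro differentiable_bound[of UNIV f "\<lambda>x h. h *\<^sub>R f' x"])
         (use f'(1) in \<open>auto simp: has_vector_derivative_def intro!: onorm_le\<close>)
    then show ?thesis by simp
  qed
  \<comment> \<open>Every quantity involved is 1-periodic in \<open>x\<close>, so \<open>x\<close>
    may be replaced by the representative within 1/2 of \<open>x0\<close>, where Jordan's inequality
    applies.\<close>
  have red: "\<exists>j::int. \<bar>x - of_int j - x0\<bar> \<le> 1/2" for x
    by (rule exI[of _ "round (x - x0)"]) (use of_int_round_abs_le[of "x - x0"] in \<open>auto simp: abs_minus_commute algebra_simps\<close>)
  have e1: "ee 1 (x - of_int j - x0) = ee 1 (x - x0)" for x j
    using ee_periodic[of 1 "x - of_int j - x0" j] by (simp add: algebra_simps)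
  have f1: "f (x - of_int j) = f x" for x j using per[of "x - of_int j" j] by simp
  have hb: "cmod (h x) \<le> B" for x
  proof -
    obtain j where j: "\<bar>x - of_int j - x0\<bar> \<le> 1/2" using red by blast
    let ?t = "x - of_int j - x0"
    have "cmod (f x - f x0) \<le> B * \<bar>?t\<bar>" using Lip[of "x - of_int j" x0] by (simp add: f1)
    also have "\<dots> \<le> B * cmod (ee 1 (x - x0) - 1)"
      using sin_pi_lower[OF j] cmod_ee_minus_1[of ?t] B by (intro mult_left_mono) (auto simp: e1)
    finally show ?thesis using B by (cases "ee 1 (x - x0) = 1") (auto simp: h_def norm_divide divide_simps)
  qed
  have hid: "h x * (ee 1 (x - x0) - 1) = f x - f x0" for x
  proof (cases "ee 1 (x - x0) = 1")
    case True
    obtain j where j: "\<bar>x - of_int j - x0\<bar> \<le> 1/2" using red by blast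
    have "x - of_int j - x0 = 0"
      using sin_pi_lower[OF j] cmod_ee_minus_1[of "x - of_int j - x0"] True by (simp add: e1)
    then show ?thesis using f1[of x j] True by simp
  qed (simp add: h_def)
  have hm: "h \<in> borel_measurable borel"
    unfolding h_def by (intro borel_measurable_divide borel_measurable_diff borel_measurable_continuous_onI continuous_intros cont)
  have hL: "h \<in> L2_circle"
  proof -
    have "periodic1 h"
      using ee_periodic[of 1 _ 1] per[of _ 1] by (simp add: periodic1_def h_def add_diff_eq[symmetric] add.commute[of _ "1::real"])
    moreover have "set_integrable lborel {0..1} (\<lambda>x. (cmod (h x))\<^sup>2)"
      by (rule set_integrable_bound[OF set_integrable_continuous[of "\<lambda>x. B\<^sup>2"]])
         (use hm hb in \<open>auto simp: set_borel_measurable_def intro!: power_mono\<close>)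
    ultimately show ?thesis using hm by (auto simp: L2_circle_def)
  qed
  have hi: "set_integrable lborel {0..1} (\<lambda>x. ee n x * h x)" for n
    by (intro L2_mult_integrable ee_L2 hL)
  have fi: "set_integrable lborel {0..1} (\<lambda>x. ee n x * f x)" for n
    by (intro set_integrable_continuous continuous_intros cont)
  \<comment> \<open>Multiplication by \<open>ee 1 (x - x0) - 1\<close> turns the coefficients of
    \<open>h\<close> into differences of neighbouring ones. The correction at \<open>n = 0\<close>
    is the constant \<open>f x0\<close> subtracted from \<open>f\<close>.\<close>
  have coeff: "fourier_coeff f n - (if n = 0 then f x0 else 0) = ee (- 1) x0 * fourier_coeff h (n - 1) - fourier_coeff h n" for n
  proof -
    have "fourier_coeff f n - (if n = 0 then f x0 else 0) = (LINT x:{0..1}|lborel. ee (- n) x * f x - ee (- n) x * f x0)"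
      by (subst set_integral_diff) (use fi[of "- n"] integral_ee[of "- n"] in
          \<open>auto simp: fourier_coeff_ee intro!: set_integrable_continuous continuous_intros\<close>)
    also have "(\<lambda>x. ee (- n) x * f x - ee (- n) x * f x0) = (\<lambda>x. ee (- 1) x0 * (ee (- (n - 1)) x * h x) - ee (- n) x * h x)"
    proof
      fix x
      have "ee (- n) x * f x - ee (- n) x * f x0 = ee (- n) x * (h x * (ee 1 (x + - x0) - 1))"
        unfolding right_diff_distrib[of "ee (- n) x", symmetric] using hid[of x] by simp
      also have "ee 1 (x + - x0) = ee 1 x * ee (- 1) x0"
        by (simp add: ee_def cis_mult algebra_simps)
      also have "ee (- n) x * (h x * (ee 1 x * ee (- 1) x0 - 1)) = ee (- 1) x0 * (ee (- n + 1) x * h x) - ee (- n) x * h x"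
        unfolding ee_add by (simp add: algebra_simps)
      finally show "ee (- n) x * f x - ee (- n) x * f x0 = ee (- 1) x0 * (ee (- (n - 1)) x * h x) - ee (- n) x * h x"
        by simp
    qed
    also have "(LINT x:{0..1}|lborel. ee (- 1) x0 * (ee (- (n - 1)) x * h x) - ee (- n) x * h x) =
        ee (- 1) x0 * fourier_coeff h (n - 1) - fourier_coeff h n"
      unfolding fourier_coeff_ee using hi by (subst set_integral_diff) auto
    finally show ?thesis .
  qed
  define u where "u n = ee n x0 * fourier_coeff h n" for n
  have step: "fourier_coeff f n * ee n x0 = (if n = 0 then f x0 else 0) + (u (n - 1) - u n)" for n
  proof -
    have "ee n x0 * ee (- 1) x0 = ee (n - 1) x0" using ee_add[of n "- 1" x0] by simp
    then have "u (n - 1) = ee n x0 * (ee (- 1) x0 * fourier_coeff h (n - 1))" by (simp add: u_def mult.assoc)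
    then have "u (n - 1) - u n = ee n x0 * (ee (- 1) x0 * fourier_coeff h (n - 1) - fourier_coeff h n)"
      by (simp add: u_def right_diff_distrib)
    also have "\<dots> = ee n x0 * fourier_coeff f n - (if n = 0 then f x0 else 0)"
      unfolding coeff[symmetric] by (simp add: algebra_simps)
    finally show ?thesis by (simp add: algebra_simps)
  qed
  have part: "(\<Sum>n\<in>{- int N..int N}. fourier_coeff f n * ee n x0) = f x0 + (u (- int N - 1) - u (int N))" for N
  proof (induction N)
    case 0
    then show ?case by (simp add: step[of 0, simplified])
  next
    case (Suc N)
    have "{- int (Suc N)..int (Suc N)} = insert (- int (Suc N)) (insert (int (Suc N)) {- int N..int N})" by auto
    then have "(\<Sum>n\<in>{- int (Suc N)..int (Suc N)}. fourier_coeff f n * ee n x0) =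
        fourier_coeff f (- int (Suc N)) * ee (- int (Suc N)) x0 + (fourier_coeff f (int (Suc N)) * ee (int (Suc N)) x0 +
        (\<Sum>n\<in>{- int N..int N}. fourier_coeff f n * ee n x0))" by simp
    also have "\<dots> = f x0 + (u (- int (Suc N) - 1) - u (int (Suc N)))"
      unfolding Suc.IH step[of "- int (Suc N)"] step[of "int (Suc N)"]
      by (simp add: algebra_simps) (simp add: minus_diff_commute)
    finally show ?case .
  qed
  have "(\<lambda>n. (cmod (fourier_coeff h n))\<^sup>2) summable_on UNIV"
    using bessel_inequality[OF hL] by (intro nonneg_bdd_above_summable_on bdd_aboveI2) auto
  then obtain s where "((\<lambda>n. (cmod (fourier_coeff h n))\<^sup>2) has_sum s) UNIV" by (auto simp: summable_on_def)
  have inj: "((\<lambda>N. (cmod (fourier_coeff h (g N)))\<^sup>2) \<longlonglongrightarrow> 0)" if "inj g" for g :: "nat \<Rightarrow> int"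
  proof (rule summable_LIMSEQ_zero)
    show "summable (\<lambda>N. (cmod (fourier_coeff h (g N)))\<^sup>2)"
    proof (rule summableI_nonneg_bounded[of _ "LINT x:{0..1}|lborel. (cmod (h x))\<^sup>2"])
      fix N
      have "(\<Sum>i<N. (cmod (fourier_coeff h (g i)))\<^sup>2) = (\<Sum>n\<in>g ` {..<N}. (cmod (fourier_coeff h n))\<^sup>2)"
        using that by (subst sum.reindex) (auto simp: inj_on_def)
      also have "\<dots> \<le> (LINT x:{0..1}|lborel. (cmod (h x))\<^sup>2)" by (rule bessel_inequality[OF hL]) simp
      finally show "(\<Sum>i<N. (cmod (fourier_coeff h (g i)))\<^sup>2) \<le> (LINT x:{0..1}|lborel. (cmod (h x))\<^sup>2)" .
    qed auto
  qed
  \<comment> \<open>The two ends of the telescoped sum tend to 0 because Bessel's inequality makes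
    the squared coefficients of \<open>h\<close> summable along any injective sequence.\<close>
  have u0: "(\<lambda>N. u (g N)) \<longlonglongrightarrow> 0" if "inj g" for g :: "nat \<Rightarrow> int"
  proof (rule tendsto_norm_zero_cancel)
    have "(\<lambda>N. sqrt ((cmod (fourier_coeff h (g N)))\<^sup>2)) \<longlonglongrightarrow> sqrt 0"
      by (intro tendsto_real_sqrt inj that)
    then show "(\<lambda>N. norm (u (g N))) \<longlonglongrightarrow> 0" by (simp add: u_def norm_mult)
  qed
  have "(\<lambda>N. f x0 + (u (- int N - 1) - u (int N))) \<longlonglongrightarrow> f x0 + (0 - 0)"
    by (intro tendsto_intros u0) (auto simp: inj_on_def)
  then have lim: "(\<lambda>N. \<Sum>n\<in>{- int N..int N}. fourier_coeff f n * ee n x0) \<longlonglongrightarrow> f x0" by (simp add: part)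
  \<comment> \<open>So far the limit is along symmetric intervals. Quadratic decay of the
    coefficients gives absolute summability and upgrades it to \<open>has_sum\<close>.\<close>
  obtain C where C: "\<And>n. cmod (fourier_coeff f n) \<le> C / (max 1 \<bar>real_of_int n\<bar>)\<^sup>2"
    using fourier_coeff_decay[OF assms] by auto
  have "(\<lambda>n. fourier_coeff f n * ee n x0) summable_on UNIV"
    by (rule summable_on_int_bound(2)[of _ C]) (use C in \<open>simp add: norm_mult\<close>)
  then obtain s where s: "((\<lambda>n. fourier_coeff f n * ee n x0) has_sum s) UNIV" by (auto simp: summable_on_def)
  have "s = f x0" by (rule LIMSEQ_unique[OF has_sum_int_tendsto[OF s] lim])
  then show ?thesis using s by simp
qed

section \<open>Smooth periodic functions\<close>

text \<open>Differentiability without bounds, for a single function with values in any normed space.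
  \<open>smooth\<close> means \<open>CN\<close> of every order, and for periodic functions
  \<open>CB_of_CN\<close> supplies the bounds by compactness.\<close>

primrec CN :: "nat \<Rightarrow> (real \<Rightarrow> 'a::real_normed_vector) \<Rightarrow> bool" where
  "CN 0 f \<longleftrightarrow> continuous_on UNIV f"
| "CN (Suc n) f \<longleftrightarrow> (\<exists>f'. (\<forall>x. (f has_vector_derivative f' x) (at x)) \<and> CN n f')"

lemma CN_continuous: "CN n f \<Longrightarrow> continuous_on UNIV f"
  by (cases n) (auto intro!: continuous_at_imp_continuous_on dest!: spec intro: has_vector_derivative_continuous)

lemma CN_Suc_D: "CN (Suc n) f \<Longrightarrow> CN n f"
proof (induction n arbitrary: f)
  case 0
  then show ?case using CN_continuous[OF 0] by simp
next
  case (Suc n)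
  then obtain f' where "\<forall>x. (f has_vector_derivative f' x) (at x)" "CN (Suc n) f'" by auto
  with Suc.IH[of f'] show ?case by auto
qed

lemma CN_SucI: "(\<And>x. (f has_vector_derivative f' x) (at x)) \<Longrightarrow> CN n f' \<Longrightarrow> CN (Suc n) f"
  by auto

lemma CN_const: "CN n (\<lambda>x. c)"
proof -
  have "CN n (\<lambda>x. 0)" for n
  proof (induction n)
    case (Suc n)
    show ?case by (rule CN_SucI[OF has_vector_derivative_const Suc])
  qed simp
  then show ?thesis by (cases n) (auto intro!: exI[of _ "\<lambda>_. 0"])
qed

lemma CN_bilinear:
  assumes "bounded_bilinear pr"
  shows "CN n f \<Longrightarrow> CN n h \<Longrightarrow> CN n (\<lambda>x. pr (f x) (h x))"
proof (induction n arbitrary: f h)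
  case 0
  then show ?case using bounded_bilinear.continuous_on[OF assms] by auto
next
  case (Suc n)
  from Suc.prems obtain f' h' where d: "\<forall>x. (f has_vector_derivative f' x) (at x)" "CN n f'"
    "\<forall>x. (h has_vector_derivative h' x) (at x)" "CN n h'" by auto
  have add: "CN n (\<lambda>x. u x + v x)" if "CN n u" "CN n v" for u v :: "real \<Rightarrow> 'c" and n
    using that
  proof (induction n arbitrary: u v)
    case 0
    then show ?case by (simp add: continuous_on_add)
  next
    case (Suc n)
    then obtain u' v' where uv: "\<forall>x. (u has_vector_derivative u' x) (at x)" "CN n u'"
      "\<forall>x. (v has_vector_derivative v' x) (at x)" "CN n v'" by auto
    show ?case by (rule CN_SucI[OF has_vector_derivative_add Suc.IH[OF uv(2,4)]]) (use uv in auto)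
  qed
  show ?case
  proof (rule CN_SucI)
    show "((\<lambda>x. pr (f x) (h x)) has_vector_derivative (pr (f x) (h' x) + pr (f' x) (h x))) (at x)" for x
      using d by (intro bounded_bilinear.has_vector_derivative[OF assms]) auto
    show "CN n (\<lambda>x. pr (f x) (h' x) + pr (f' x) (h x))"
      by (intro add Suc.IH d(2,4) CN_Suc_D[OF Suc.prems(1)] CN_Suc_D[OF Suc.prems(2)])
  qed
qed

lemma CN_add: "CN n f \<Longrightarrow> CN n h \<Longrightarrow> CN n (\<lambda>x. f x + h x)"
proof (induction n arbitrary: f h)
  case 0
  then show ?case by (simp add: continuous_on_add)
next
  case (Suc n)
  then obtain u' v' where uv: "\<forall>x. (f has_vector_derivative u' x) (at x)" "CN n u'"
    "\<forall>x. (h has_vector_derivative v' x) (at x)" "CN n v'" by auto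
  show ?case by (rule CN_SucI[OF has_vector_derivative_add Suc.IH[OF uv(2,4)]]) (use uv in auto)
qed

lemmas CN_mult = CN_bilinear[OF bounded_bilinear_mult]
lemmas CN_scaleR = CN_bilinear[OF bounded_bilinear_scaleR]

lemma CN_sum: "finite S \<Longrightarrow> (\<And>i. i \<in> S \<Longrightarrow> CN n (f i)) \<Longrightarrow> CN n (\<lambda>x. \<Sum>i\<in>S. f i x)"
  by (induction S rule: finite_induct) (auto intro!: CN_const CN_add)

lemma CN_of_real: "CN n f \<Longrightarrow> CN n (\<lambda>x. complex_of_real (f x))"
  using CN_scaleR[OF _ CN_const[of n "1::complex"], of f] by (simp add: scaleR_conv_of_real)

lemma CN_ident: "CN n (\<lambda>x. x)"
proof (cases n)
  case (Suc m)
  show ?thesis unfolding Suc by (rule CN_SucI[OF has_vector_derivative_id CN_const])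
qed simp

lemma CN_compose: "CN n f \<Longrightarrow> CN n h \<Longrightarrow> CN n (\<lambda>x. f (h x))"
proof (induction n arbitrary: f)
  case 0
  then show ?case using continuous_on_compose2[of UNIV f UNIV h] by auto
next
  case (Suc n)
  from Suc.prems obtain f' h' where d: "\<forall>x. (f has_vector_derivative f' x) (at x)" "CN n f'"
    "\<forall>x. (h has_vector_derivative h' x) (at x)" "CN n h'" by auto
  show ?case
  proof (rule CN_SucI)
    show "((\<lambda>x. f (h x)) has_vector_derivative h' x *\<^sub>R f' (h x)) (at x)" for x
      using vector_diff_chain_at[of h "h' x" x f "f' (h x)"] d by (simp add: o_def)
    show "CN n (\<lambda>x. h' x *\<^sub>R f' (h x))"
      by (intro CN_scaleR d(4) Suc.IH[OF d(2)] CN_Suc_D[OF Suc.prems(2)])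
  qed
qed

lemma CN_inverse:
  fixes f :: "real \<Rightarrow> real"
  assumes "\<And>x. f x \<noteq> 0"
  shows "CN n f \<Longrightarrow> CN n (\<lambda>x. inverse (f x))"
proof (induction n)
  case 0
  then show ?case using assms by (auto intro!: continuous_on_inverse)
next
  case (Suc n)
  then obtain f' where f': "\<forall>x. (f has_vector_derivative f' x) (at x)" "CN n f'" by auto
  show ?case
  proof (rule CN_SucI)
    show "((\<lambda>x. inverse (f x)) has_vector_derivative (- 1) * (f' x * (inverse (f x) * inverse (f x)))) (at x)" for x
      using f'(1) DERIV_inverse_fun[of f "f' x" x UNIV] assms
      by (simp add: has_real_derivative_iff_has_vector_derivative mult_ac)
    show "CN n (\<lambda>x. (- 1) * (f' x * (inverse (f x) * inverse (f x))))"
      by (intro CN_mult CN_const f'(2) Suc.IH CN_Suc_D[OF Suc.prems])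
  qed
qed

lemma CN_cis: "CN n f \<Longrightarrow> CN n (\<lambda>x. cis (f x))"
proof (induction n)
  case 0
  then show ?case by (auto intro!: continuous_intros)
next
  case (Suc n)
  then obtain f' where f': "\<forall>x. (f has_vector_derivative f' x) (at x)" "CN n f'" by auto
  show ?case
  proof (rule CN_SucI)
    show "((\<lambda>x. cis (f x)) has_vector_derivative of_real (f' x) * (\<i> * cis (f x))) (at x)" for x
      using f'(1) by (intro cis_has_vector_derivative) (simp add: has_real_derivative_iff_has_vector_derivative)
    show "CN n (\<lambda>x. complex_of_real (f' x) * (\<i> * cis (f x)))"
      by (intro CN_mult CN_const CN_of_real f'(2) Suc.IH CN_Suc_D[OF Suc.prems])
  qed
qed

text \<open>The cubed positive part vanishes to third order at 0, hence is twice continuously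
  differentiable. Cutoffs built from it take the place of smooth bump functions: the estimates that
  contain them integrate by parts at most twice.\<close>

lemma CN_cube: "CN 2 f \<Longrightarrow> CN 2 (\<lambda>x. (max 0 (f x :: real)) ^ 3)"
proof -
  have sq: "((\<lambda>t. (max 0 t) ^ 2) has_vector_derivative 2 * max 0 t) (at t)" for t :: real
  proof (cases "t = 0")
    case True
    have "((\<lambda>h. (max 0 h)\<^sup>2 / h) \<longlongrightarrow> (0::real)) (at 0)"
    proof (rule Lim_null_comparison)
      show "\<forall>\<^sub>F h::real in at 0. norm ((max 0 h)\<^sup>2 / h) \<le> \<bar>h\<bar>"
        by (rule always_eventually) (auto simp: max_def power2_eq_square)
      show "((\<lambda>h::real. \<bar>h\<bar>) \<longlongrightarrow> 0) (at 0)" by (auto intro!: tendsto_eq_intros)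
    qed
    then show ?thesis
      using True by (simp add: has_real_derivative_iff_has_vector_derivative[symmetric] DERIV_def)
  next
    case False
    show ?thesis
    proof (cases "t > 0")
      case True
      have "((\<lambda>t. t ^ 2) has_vector_derivative 2 * max 0 t) (at t)"
        unfolding has_real_derivative_iff_has_vector_derivative[symmetric]
        using True by (auto intro!: derivative_eq_intros)
      then show ?thesis
        by (rule has_vector_derivative_transform_within_open[of _ _ _ "{0<..}"]) (use True in auto)
    next
      case False
      then have "t < 0" using \<open>t \<noteq> 0\<close> by simp
      then show ?thesis
        using has_vector_derivative_transform_within_open[OF has_vector_derivative_const, of "{..<0}" t "0" "\<lambda>t. (max 0 t)^2"]
        by auto
    qed
  qed
  have cube: "((\<lambda>t. (max 0 t) ^ 3) has_vector_derivative 3 * (max 0 t)\<^sup>2) (at t)" for t :: real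
  proof -
    have 1: "(max 0 t) ^ 3 = (max 0 t)\<^sup>2 * t" for t :: real
      by (simp add: max_def power2_eq_square power3_eq_cube)
    have 2: "((\<lambda>t. (max 0 t)\<^sup>2 * t) has_vector_derivative (max 0 t)\<^sup>2 * 1 + 2 * max 0 t * t) (at t)"
      by (intro has_vector_derivative_mult sq has_vector_derivative_id)
    have 3: "3 * (max 0 t)\<^sup>2 = (max 0 t)\<^sup>2 * 1 + 2 * max 0 t * t"
      by (simp add: max_def power2_eq_square)
    show ?thesis unfolding 1 3 by (rule 2)
  qed
  have "CN 2 (\<lambda>t::real. (max 0 t) ^ 3)"
    unfolding numeral_2_eq_2
  proof (intro CN_SucI)
    show "((\<lambda>t. (max 0 t) ^ 3) has_vector_derivative 3 * (max 0 t)\<^sup>2) (at t)" for t :: real by (rule cube)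
    show "((\<lambda>t. 3 * (max 0 t)\<^sup>2) has_vector_derivative 3 * (2 * max 0 t)) (at t)" for t :: real
      by (rule has_vector_derivative_mult_right[OF sq])
  qed (auto intro!: continuous_intros)
  then show "CN 2 f \<Longrightarrow> CN 2 (\<lambda>x. (max 0 (f x :: real)) ^ 3)" by (rule CN_compose)
qed

section \<open>Smoothness in the sense of the statement, uniform bounds from periodicity\<close>

lemma nderiv_Suc: "nderiv (Suc n) f x = vector_derivative (nderiv n f) (at x)"
  by (simp add: nderiv_def)

lemma smooth_nderiv: "smooth f \<Longrightarrow> (nderiv n f has_vector_derivative nderiv (Suc n) f x) (at x)"
  by (simp add: smooth_def nderiv_Suc vector_derivative_works)

lemma smooth_iff_CN: "smooth f \<longleftrightarrow> (\<forall>n. CN n f)"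
proof
  assume s: "smooth f"
  have "CN n (nderiv j f)" for n j
  proof (induction n arbitrary: j)
    case 0
    show ?case using CN_continuous[of 1 "nderiv j f"]
      using smooth_nderiv[OF s, of j]
      by (auto intro!: continuous_at_imp_continuous_on intro: has_vector_derivative_continuous)
  next
    case (Suc n)
    show ?case by (rule CN_SucI[OF smooth_nderiv[OF s] Suc])
  qed
  from this[of _ 0] show "\<forall>n. CN n f" by (simp add: nderiv_def)
next
  assume a: "\<forall>n. CN n f"
  have "\<forall>n. CN n (nderiv j f)" for j
  proof (induction j)
    case 0
    then show ?case using a by (simp add: nderiv_def)
  next
    case (Suc j)
    show ?case
    proof
      fix n
      from Suc have "CN (Suc n) (nderiv j f)" by blast
      then obtain f' where f': "\<forall>x. (nderiv j f has_vector_derivative f' x) (at x)" "CN n f'" by auto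
      have "nderiv (Suc j) f = f'"
        by (rule ext) (use f'(1) in \<open>simp add: nderiv_Suc vector_derivative_at\<close>)
      then show "CN n (nderiv (Suc j) f)" using f'(2) by simp
    qed
  qed
  then have "CN (Suc 0) (nderiv j f)" for j by blast
  then show "smooth f"
    unfolding smooth_def by (force simp: has_vector_derivative_def intro: differentiableI)
qed

lemma periodic_bounded:
  fixes f :: "real \<Rightarrow> 'a::real_normed_vector"
  assumes "continuous_on UNIV f" "periodic1 f"
  shows "\<exists>C. \<forall>x. norm (f x) \<le> C"
proof -
  have "compact (f ` {0..1})"
    by (intro compact_continuous_image continuous_on_subset[OF assms(1)]) auto
  then obtain C where C: "\<And>x. x \<in> {0..1} \<Longrightarrow> norm (f x) \<le> C"
    using compact_imp_bounded bounded_iff by (metis image_eqI)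
  have "norm (f x) \<le> C" for x
  proof -
    have "f x = f (frac x)"
      using periodic1_of_int[OF assms(2), of "frac x" "\<lfloor>x\<rfloor>"] by (simp add: frac_def)
    then show ?thesis using C[of "frac x"] frac_ge_0[of x] frac_lt_1[of x] by (simp add: less_imp_le)
  qed
  then show ?thesis by blast
qed

lemma CB_of_CN:
  assumes "CN N f" "periodic1 f"
  shows "CB N {()} (\<lambda>_. f)"
  using assms
proof (induction N arbitrary: f)
  case 0
  then show ?case using periodic_bounded[of f] by auto
next
  case (Suc N)
  then obtain f' where f': "\<forall>x. (f has_vector_derivative f' x) (at x)" "CN N f'" by auto
  have "CB N {()} (\<lambda>_. f')" using Suc.IH[OF f'(2)] periodic_derivative[of f f'] f'(1) Suc.prems by auto
  moreover have "CB 0 {()} (\<lambda>_. f)"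
    using periodic_bounded[of f] CN_continuous[OF Suc.prems(1)] Suc.prems(2) by auto
  ultimately show ?case using f'(1) by (intro CB_SucI[where b'="\<lambda>_. f'"]) auto
qed

lemma CB_of_CN': "CN N f \<Longrightarrow> periodic1 f \<Longrightarrow> CB N I (\<lambda>_. f)"
  using CB_reindex[OF CB_of_CN, of N f I "\<lambda>_. ()"] by auto

lemma CB_finite:
  assumes "finite I" "\<And>i. i \<in> I \<Longrightarrow> CB N {()} (\<lambda>_. b i)"
  shows "CB N I b"
  using assms(2)
proof (induction N arbitrary: b)
  case 0
  then have "\<exists>C. \<forall>x. cmod (b i x) \<le> C" if "i \<in> I" for i using that by auto
  then obtain C where C: "\<And>i x. i \<in> I \<Longrightarrow> cmod (b i x) \<le> C i" by metis
  have "cmod (b i x) \<le> Max (C ` I)" if "i \<in> I" for i x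
    using C[OF that] assms(1) that by (meson Max_ge finite_imageI imageI order_trans)
  then show ?case using 0 by auto
next
  case (Suc N)
  have "\<exists>b'. (\<forall>x. (b i has_vector_derivative b' x) (at x)) \<and> CB N {()} (\<lambda>_. b')" if i: "i \<in> I" for i
  proof -
    from Suc.prems[OF i] obtain b' where "\<forall>x. (b i has_vector_derivative b' () x) (at x)" "CB N {()} b'" by auto
    then show ?thesis by (intro exI[of _ "b' ()"]) (auto elim: CB_cong)
  qed
  then obtain b' where b': "\<And>i x. i \<in> I \<Longrightarrow> (b i has_vector_derivative b' i x) (at x)"
      "\<And>i. i \<in> I \<Longrightarrow> CB N {()} (\<lambda>_. b' i)" by metis
  have "\<exists>C. \<forall>x. cmod (b i x) \<le> C" if "i \<in> I" for i using Suc.prems[OF that] by auto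
  then obtain C where C: "\<And>i x. i \<in> I \<Longrightarrow> cmod (b i x) \<le> C i" by metis
  have "cmod (b i x) \<le> Max (C ` I)" if "i \<in> I" for i x
    using C[OF that] assms(1) that by (meson Max_ge finite_imageI imageI order_trans)
  moreover have "CB N I b'" by (rule Suc.IH) (rule b'(2))
  ultimately show ?case using b'(1) by (auto intro!: exI[of _ b'])
qed

lemma integral_periodic_shift:
  fixes h :: "real \<Rightarrow> 'a::euclidean_space"
  assumes cont: "continuous_on UNIV h" and per: "periodic1 h"
  shows "integral {a..a+1} h = integral {0..1} h"
proof -
  have int: "h integrable_on {x..y}" for x y
    by (intro integrable_continuous_real continuous_on_subset[OF cont]) auto
  have sh: "h \<circ> (+) (of_int j) = h" for j
    using periodic1_of_int[OF per] by (auto simp: add.commute)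
  have shift: "integral {x..y} h = integral {x + of_int j..y + of_int j} h" for x y j
    using integral_shift_Icc_real[of x y h "of_int j"] unfolding sh .
  define b where "b = frac a"
  have b: "0 \<le> b" "b < 1" by (auto simp: b_def frac_lt_1)
  have "integral {a..a+1} h = integral {b..b+1} h"
    using shift[of b "b+1" "\<lfloor>a\<rfloor>"] by (simp add: b_def frac_def)
  also have "\<dots> = integral {b..1} h + integral {1..b+1} h"
    by (rule Henstock_Kurzweil_Integration.integral_combine[symmetric]) (use b int in auto)
  also have "integral {1..b+1} h = integral {0..b} h"
    using shift[of 0 b 1] by simp
  also have "integral {b..1} h + integral {0..b} h = integral {0..1} h"
    using b Henstock_Kurzweil_Integration.integral_combine[of 0 b 1 h] int by (simp add: add.commute)
  finally show ?thesis .
qed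

lemma integral_split_equal:
  fixes q :: "real \<Rightarrow> 'a::euclidean_space"
  assumes cont: "continuous_on UNIV q" and k: "k > 0"
  shows "integral {0..1} q = (\<Sum>\<epsilon><k. integral {0..1} (\<lambda>y. (1 / real k) *\<^sub>R q ((y + real \<epsilon>) / real k)))"
proof -
  have int: "q integrable_on {x..y}" for x y
    by (intro integrable_continuous_real continuous_on_subset[OF cont]) auto
  have piece: "integral {0..1} (\<lambda>y. (1 / real k) *\<^sub>R q ((y + real e) / real k)) = integral {real e / real k..real (Suc e) / real k} q" for e
  proof -
    have "((\<lambda>y. (1 / real k) *\<^sub>R q ((y + real e) / real k)) has_integral
        integral {(0 + real e) / real k..(1 + real e) / real k} q) {0..1}"
    proof (rule has_integral_substitution[where c="real e / real k" and d="real (Suc e) / real k"])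
      show "continuous_on {real e / real k..real (Suc e) / real k} q"
        by (rule continuous_on_subset[OF cont]) simp
      show "((\<lambda>y. (y + real e) / real k) has_field_derivative 1 / real k) (at x within {0..1})" for x
        using k by (auto intro!: derivative_eq_intros)
    qed (use k in \<open>auto simp: divide_simps\<close>)
    moreover have "(0 + real e) / real k = real e / real k" "(1 + real e) / real k = real (Suc e) / real k" by simp_all
    ultimately show ?thesis using integral_unique by metis
  qed
  have "integral {0..real m / real k} q = (\<Sum>e<m. integral {real e / real k..real (Suc e) / real k} q)" for m
  proof (induction m)
    case (Suc m)
    have "integral {0..real m / real k} q + integral {real m / real k..real (Suc m) / real k} q = integral {0..real (Suc m) / real k} q"
      by (intro Henstock_Kurzweil_Integration.integral_combine int) (use k in \<open>auto simp: divide_simps\<close>)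
    then show ?case using Suc by simp
  qed simp
  from this[of k] show ?thesis using k piece by simp
qed

section \<open>Expanding skew products\<close>

lemma CN_deriv:
  fixes f :: "real \<Rightarrow> real"
  assumes "CN (Suc n) f"
  shows "(f has_real_derivative deriv f x) (at x)" "CN n (deriv f)"
proof -
  obtain f' where f': "\<forall>x. (f has_vector_derivative f' x) (at x)" "CN n f'" using assms by auto
  have D: "(f has_real_derivative f' x) (at x)" for x
    using f'(1) by (simp add: has_real_derivative_iff_has_vector_derivative)
  then have "deriv f = f'" by (intro ext DERIV_imp_deriv)
  with D f'(2) show "(f has_real_derivative deriv f x) (at x)" "CN n (deriv f)" by auto
qed

lemma periodic1_deriv:
  fixes f :: "real \<Rightarrow> real"
  assumes "\<And>x. (f has_real_derivative f' x) (at x)" "\<And>x. f (x + 1) = f x + c"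
  shows "periodic1 f'"
  unfolding periodic1_def
proof
  fix x
  have "((\<lambda>x. f (x + 1)) has_real_derivative f' (x + 1) * (1 + 0)) (at x)"
    by (rule DERIV_chain2[of f]) (auto intro!: assms(1) derivative_eq_intros)
  moreover have "((\<lambda>x. f (x + 1)) has_real_derivative f' x + 0) (at x)"
    unfolding assms(2) by (intro DERIV_add assms(1) DERIV_const)
  ultimately show "f' (x + 1) = f' x" using DERIV_unique by fastforce
qed

lemma periodic1_frac: "periodic1 f \<Longrightarrow> f (frac x) = f x"
  using periodic1_of_int[of f "frac x" "\<lfloor>x\<rfloor>"] by (simp add: frac_def)

definition words :: "nat \<Rightarrow> nat \<Rightarrow> nat list set" where
  "words k n = {w. length w = n \<and> set w \<subseteq> {..<k}}"

lemma finite_words: "finite (words k n)" and card_words: "card (words k n) = k ^ n"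
  using finite_lists_length_eq[of "{..<k}" n] card_lists_length_eq[of "{..<k}" n]
  by (simp_all add: words_def conj_commute)

lemma words_0: "words k 0 = {[]}"
  by (auto simp: words_def)

text \<open>A letter is appended at the right end because \<open>foldr\<close> lets the last letter
  act first: the new letter is the first step of the trajectory.\<close>

lemma words_Suc: "words k (Suc n) = (\<lambda>(\<epsilon>, w). w @ [\<epsilon>]) ` ({..<k} \<times> words k n)"
proof -
  have "w \<in> (\<lambda>(\<epsilon>, w). w @ [\<epsilon>]) ` ({..<k} \<times> words k n)" if "w \<in> words k (Suc n)" for w
  proof -
    have "w \<noteq> []" using that by (auto simp: words_def)
    then have "w = butlast w @ [last w]" "last w \<in> set w" "set (butlast w) \<subseteq> set w"
      by (auto dest: in_set_butlastD)
    then show ?thesis using that by (intro image_eqI[of _ _ "(last w, butlast w)"]) (auto simp: words_def)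
  qed
  then show ?thesis by (auto simp: words_def)
qed

text \<open>Partial captivity is left out: the estimates for a fixed number of iterations hold for
  every such map and carry \<open>captive_count\<close> in their constants.\<close>

locale expanding_skew =
  fixes g \<tau> :: "real \<Rightarrow> real" and k :: nat and \<kappa> R :: real
  assumes lift: "circle_diffeo_lift g"
    and k2: "k \<ge> 2"
    and smooth_tau: "smooth \<tau>" and periodic_tau: "periodic1 \<tau>"
    and E_min: "E_min k g > 1"
    and kappa: "1 < \<kappa>" "\<kappa> < E_min k g"
    and R: "R \<ge> 0" and escape: "escape_radius k g \<tau> \<kappa> R"
begin

abbreviation "E \<equiv> expanding_map k g"
abbreviation "dE \<equiv> deriv (expanding_map k g)"

text \<open>The n-th power of the transfer operator composes with \<open>Phi n\<close> and
  multiplies by \<open>cis (\<nu> * theta n x)\<close>. \<open>Phi n\<close> is the iterate of the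
  lift, not reduced modulo 1, and so stays smooth on the line; \<open>theta n\<close> is the
  Birkhoff sum of \<open>\<tau>\<close>.\<close>

definition "Phi n = E ^^ n"
definition "theta n x = (\<Sum>j<n. \<tau> ((E ^^ j) x))"
definition "dPhi n = deriv (Phi n)"
definition "dtheta n = deriv (theta n)"

lemma CN_g: "CN n g" and CN_inv_g: "CN n (inv g)" and CN_tau: "CN n \<tau>"
  using lift smooth_tau by (auto simp: circle_diffeo_lift_def smooth_iff_CN)

lemma g_shift: "g (x + 1) = g x + 1"
  using lift by (simp add: circle_diffeo_lift_def)

lemma g_inv [simp]: "g (inv g x) = x" "inv g (g x) = x"
  using lift by (auto simp: circle_diffeo_lift_def bij_def surj_f_inv_f inv_f_f)

lemma g_inv_shift: "inv g (x + 1) = inv g x + 1"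
proof -
  have "inv g (g (inv g x + 1)) = inv g (x + 1)" unfolding g_shift by simp
  then show ?thesis by simp
qed

lemma g_inv_shift_int: "inv g (x + of_int j) = inv g x + of_int j"
  using periodic1_of_int[of "\<lambda>x. inv g x - x" x j] g_inv_shift by (simp add: periodic1_def)

lemma CN_E: "CN n E"
  unfolding expanding_map_def [abs_def] by (intro CN_mult CN_const CN_g)

lemma E_shift: "E (x + 1) = E x + real k"
  by (simp add: expanding_map_def g_shift distrib_left)

lemma E_shift_int: "E (x + of_int j) = E x + of_int (int k * j)"
  using periodic1_of_int[of "\<lambda>x. E x - real k * x" x j] E_shift
  by (simp add: periodic1_def algebra_simps)

lemma E_has_deriv: "(E has_real_derivative dE x) (at x)" and CN_dE: "CN n dE"
  using CN_deriv[OF CN_E] by auto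

lemma tau_has_deriv: "(\<tau> has_real_derivative deriv \<tau> x) (at x)" and CN_dtau: "CN n (deriv \<tau>)"
  using CN_deriv[OF CN_tau] by auto

lemma periodic_dE: "periodic1 dE"
  by (rule periodic1_deriv[OF E_has_deriv E_shift])

lemma periodic_dtau: "periodic1 (deriv \<tau>)"
  by (rule periodic1_deriv[OF tau_has_deriv, of 0]) (use periodic_tau in \<open>simp add: periodic1_def\<close>)

lemma dE_ge: "dE x \<ge> E_min k g"
proof -
  obtain C where "\<And>x. norm (dE x) \<le> C"
    using periodic_bounded[OF CN_continuous[OF CN_dE[of 0]] periodic_dE] by blast
  then have "bdd_below (range dE)" by (intro bdd_belowI2[of _ "- C"]) (simp add: abs_le_iff minus_le_iff)
  then show ?thesis unfolding E_min_def by (rule cINF_lower) simp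
qed

lemma dE_pos: "dE x > 0"
  using dE_ge[of x] E_min by linarith

lemma dE_eq: "dE x = real k * deriv g x"
  unfolding expanding_map_def [abs_def]
  by (intro DERIV_imp_deriv DERIV_cmult CN_deriv(1)[OF CN_g])

lemma dg_pos: "deriv g x > 0"
  using dE_pos[of x] k2 by (simp add: dE_eq zero_less_mult_iff)

section \<open>Inverse branches and sums over preimages\<close>

lemma inv_g_has_deriv: "(inv g has_real_derivative 1 / deriv g (inv g x)) (at x)"
proof -
  have D: "(inv g has_real_derivative deriv (inv g) x) (at x)" by (rule CN_deriv(1)[OF CN_inv_g])
  have "((\<lambda>x. g (inv g x)) has_real_derivative deriv g (inv g x) * deriv (inv g) x) (at x)"
    by (rule DERIV_chain2[OF CN_deriv(1)[OF CN_g] D])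
  moreover have "((\<lambda>x. g (inv g x)) has_real_derivative 1) (at x)" by simp
  ultimately have "deriv g (inv g x) * deriv (inv g) x = 1" by (rule DERIV_unique)
  then have "deriv (inv g) x = 1 / deriv g (inv g x)" using dg_pos[of "inv g x"] by (simp add: field_simps)
  then show ?thesis using D by simp
qed

lemma inv_g_mono: "x \<le> y \<Longrightarrow> inv g x \<le> inv g y"
  by (rule DERIV_nonneg_imp_nondecreasing) (use inv_g_has_deriv dg_pos in \<open>auto intro!: exI less_imp_le simp: less_imp_le\<close>)

text \<open>In contrast to \<open>inverse_branch\<close> there is no fractional part, which makes
  the branch smooth in \<open>y\<close> on the whole line.\<close>

definition "branch \<epsilon> y = inv g ((y + real \<epsilon>) / real k)"

lemma E_branch: "E (branch \<epsilon> y) = y + real \<epsilon>"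
  using k2 by (simp add: expanding_map_def branch_def)

lemma CN_branch: "CN n (branch \<epsilon>)"
proof -
  have "CN n (\<lambda>y. inv g (y * (1 / real k) + real \<epsilon> / real k))"
    by (intro CN_compose[OF CN_inv_g] CN_add CN_mult CN_ident CN_const)
  then show ?thesis unfolding branch_def [abs_def] by (simp add: add_divide_distrib)
qed

lemma continuous_on_branch [continuous_intros]: "continuous_on S (branch \<epsilon>)"
  by (rule continuous_on_subset[OF CN_continuous[OF CN_branch[of 0]]]) simp

text \<open>The integral over a period is first shifted to the period starting at
  \<open>inv g 0\<close>, so that the substitution by \<open>inv g\<close> produces exactly the
  interval from 0 to 1. Cutting this interval into \<open>k\<close> equal pieces yields the
  branches.\<close>

lemma branch_change_of_variables:
  fixes h :: "real \<Rightarrow> 'a::euclidean_space"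
  assumes "continuous_on UNIV h" "periodic1 h"
  shows "integral {0..1} h = (\<Sum>\<epsilon><k. integral {0..1} (\<lambda>y. (1 / dE (branch \<epsilon> y)) *\<^sub>R h (branch \<epsilon> y)))"
proof -
  have cdg: "continuous_on UNIV (deriv g)" by (rule CN_continuous[OF CN_deriv(2)[OF CN_g[of 1, unfolded One_nat_def]]])
  have cG: "continuous_on UNIV (inv g)" by (rule CN_continuous[OF CN_inv_g[of 0]])
  have q: "continuous_on UNIV (\<lambda>t. (1 / deriv g (inv g t)) *\<^sub>R h (inv g t))"
    using dg_pos by (intro continuous_intros continuous_on_compose2[OF cdg cG] continuous_on_compose2[OF assms(1) cG])
      (auto simp: less_imp_neq[symmetric])
  have "integral {0..1} h = integral {inv g 0..inv g 0 + 1} h"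
    by (rule integral_periodic_shift[OF assms, symmetric])
  also have "\<dots> = integral {inv g 0..inv g 1} h" using g_inv_shift[of 0] by simp
  also have "\<dots> = integral {0..1} (\<lambda>t. (1 / deriv g (inv g t)) *\<^sub>R h (inv g t))"
  proof (rule integral_unique[symmetric], rule has_integral_substitution[where c="inv g 0" and d="inv g 1"])
    show "continuous_on {inv g 0..inv g 1} h" by (rule continuous_on_subset[OF assms(1)]) simp
    show "(inv g has_field_derivative 1 / deriv g (inv g x)) (at x within {0..1})" for x
      by (rule has_field_derivative_at_within[OF inv_g_has_deriv])
  qed (auto intro: inv_g_mono)
  also have "\<dots> = (\<Sum>\<epsilon><k. integral {0..1} (\<lambda>y. (1 / dE (branch \<epsilon> y)) *\<^sub>R h (branch \<epsilon> y)))"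
    by (subst integral_split_equal[OF q]) (use k2 in \<open>auto simp: dE_eq branch_def\<close>)
  finally show ?thesis .
qed

definition "branch_sum f y = (\<Sum>\<epsilon><k. f (branch \<epsilon> y))"

lemma branch_shift: "branch \<epsilon> (y + 1) = branch (Suc \<epsilon>) y"
  by (simp add: branch_def add_ac)

lemma branch_k: "branch k y = branch 0 y + 1"
  using k2 g_inv_shift[of "y / real k"] by (simp add: branch_def add_divide_distrib)

text \<open>Moving \<open>y\<close> by 1 replaces each branch by the next one, and the last by the
  first plus 1, so a periodic summand sees only a cyclic permutation.\<close>

lemma periodic_branch_sum:
  fixes f :: "real \<Rightarrow> 'a::comm_monoid_add"
  assumes "periodic1 f"
  shows "periodic1 (branch_sum f)"
  unfolding periodic1_def
proof
  fix y
  obtain j where j: "k = Suc j" using k2 by (cases k) auto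
  then have l: "{..<k} = {..<Suc j}" by simp
  have "branch_sum f (y + 1) = (\<Sum>\<epsilon><j. f (branch (Suc \<epsilon>) y)) + f (branch k y)"
    unfolding branch_sum_def l sum.lessThan_Suc branch_shift by (simp add: j[symmetric])
  also have "f (branch k y) = f (branch 0 y)" using assms by (simp add: branch_k periodic1_def)
  also have "(\<Sum>\<epsilon><j. f (branch (Suc \<epsilon>) y)) + f (branch 0 y) = branch_sum f y"
    unfolding branch_sum_def l sum.lessThan_Suc_shift by (simp add: add.commute)
  finally show "branch_sum f (y + 1) = branch_sum f y" .
qed

lemma continuous_branch_sum:
  fixes f :: "real \<Rightarrow> 'a::real_normed_vector"
  assumes "continuous_on UNIV f" shows "continuous_on UNIV (branch_sum f)"
  unfolding branch_sum_def [abs_def]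
  by (intro continuous_intros continuous_on_compose2[OF assms]) auto

lemma periodic_E_compose: "periodic1 U \<Longrightarrow> periodic1 (\<lambda>x. U (E x))"
  using periodic1_of_int[of U _ "int k"] by (simp add: periodic1_def E_shift)

lemma continuous_on_E [continuous_intros]: "continuous_on S f \<Longrightarrow> continuous_on S (\<lambda>x. E (f x))"
  by (rule continuous_on_compose2[OF CN_continuous[OF CN_E[of 0]]]) auto

text \<open>The source of the factor \<open>1 / E_min k g\<close> in the theorem. Along each branch
  the Jacobian is at most that factor, while \<open>U (E x)\<close> takes the same value at all
  preimages of a point.\<close>

lemma integral_E_compose_le:
  fixes f U :: "real \<Rightarrow> real"
  assumes f: "continuous_on UNIV f" "periodic1 f" "\<And>x. 0 \<le> f x"
    and U: "continuous_on UNIV U" "periodic1 U" "\<And>x. 0 \<le> U x"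
  shows "integral {0..1} (\<lambda>x. f x * U (E x)) \<le> (1 / E_min k g) * integral {0..1} (\<lambda>y. branch_sum f y * U y)"
proof -
  have i: "(\<lambda>y. f (branch e y) * U y) integrable_on {0..1}" for e
    by (intro integrable_continuous_real continuous_intros continuous_on_compose2[OF f(1)] continuous_on_subset[OF U(1)]) auto
  have cdE: "continuous_on UNIV dE" by (rule CN_continuous[OF CN_dE[of 0]])
  have i2: "(\<lambda>y. (1 / dE (branch e y)) *\<^sub>R (f (branch e y) * U (E (branch e y)))) integrable_on {0..1}" for e
    by (intro integrable_continuous_real continuous_intros continuous_on_compose2[OF f(1)] continuous_on_compose2[OF U(1)]
        continuous_on_compose2[OF cdE]) (use dE_pos in \<open>auto simp: less_imp_neq[symmetric]\<close>)
  have "integral {0..1} (\<lambda>x. f x * U (E x)) =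
      (\<Sum>\<epsilon><k. integral {0..1} (\<lambda>y. (1 / dE (branch \<epsilon> y)) *\<^sub>R (f (branch \<epsilon> y) * U (E (branch \<epsilon> y)))))"
    using periodic_E_compose[OF U(2)] f(2)
    by (intro branch_change_of_variables continuous_intros f(1) continuous_on_compose2[OF U(1)])
       (auto simp: periodic1_def)
  also have "\<dots> \<le> (\<Sum>\<epsilon><k. integral {0..1} (\<lambda>y. (1 / E_min k g) * (f (branch \<epsilon> y) * U y)))"
  proof (intro sum_mono integral_le)
    fix e y :: real and \<epsilon>
    have "U (E (branch \<epsilon> y)) = U y"
      unfolding E_branch using periodic1_of_int[OF U(2), of y "int \<epsilon>"] by simp
    moreover have "1 / dE (branch \<epsilon> y) \<le> 1 / E_min k g"
      using dE_ge[of "branch \<epsilon> y"] E_min by (intro divide_left_mono) auto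
    ultimately show "(1 / dE (branch \<epsilon> y)) *\<^sub>R (f (branch \<epsilon> y) * U (E (branch \<epsilon> y))) \<le> (1 / E_min k g) * (f (branch \<epsilon> y) * U y)"
      using f(3) U(3) mult_right_mono[of "1 / dE (branch \<epsilon> y)" "1 / E_min k g" "f (branch \<epsilon> y) * U y"] by simp
  qed (intro i2 integrable_on_mult_right i)+
  also have "\<dots> = (1 / E_min k g) * integral {0..1} (\<lambda>y. branch_sum f y * U y)"
    using i by (simp add: branch_sum_def sum_distrib_right integral_sum sum_distrib_left)
  finally show ?thesis .
qed

text \<open>An unweighted sum over the \<open>k ^ n\<close> preimages. The Jacobians have been
  estimated by their maximum before, so what remains for a cutoff is to count preimages.\<close>

primrec iter_sum :: "nat \<Rightarrow> (real \<Rightarrow> real) \<Rightarrow> real \<Rightarrow> real" where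
  "iter_sum 0 f = f"
| "iter_sum (Suc n) f = branch_sum (iter_sum n f)"

lemma iter_sum_props:
  assumes "continuous_on UNIV f" "periodic1 f" "\<And>x. 0 \<le> f x"
  shows "continuous_on UNIV (iter_sum n f)" "periodic1 (iter_sum n f)" "0 \<le> iter_sum n f x"
  using assms
proof (induction n arbitrary: x)
  case (Suc n)
  { case 1 show ?case using Suc 1 continuous_branch_sum by simp }
  { case 2 show ?case using Suc 2 periodic_branch_sum by simp }
  { case 3 show ?case using Suc 3 by (auto simp: branch_sum_def intro!: sum_nonneg) }
qed auto

lemma Phi_0 [simp]: "Phi 0 x = x" and Phi_Suc: "Phi (Suc n) x = Phi n (E x)"
  and Phi_Suc': "Phi (Suc n) x = E (Phi n x)"
  by (simp_all add: Phi_def funpow_swap1)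

lemma integral_Phi_compose_le:
  fixes f U :: "real \<Rightarrow> real"
  assumes f: "continuous_on UNIV f" "periodic1 f" "\<And>x. 0 \<le> f x"
    and U: "continuous_on UNIV U" "periodic1 U" "\<And>x. 0 \<le> U x"
  shows "integral {0..1} (\<lambda>x. f x * U (Phi n x)) \<le> (1 / E_min k g) ^ n * integral {0..1} (\<lambda>y. iter_sum n f y * U y)"
  using U
proof (induction n arbitrary: U)
  case 0
  then show ?case by simp
next
  case (Suc n)
  have U': "continuous_on UNIV (\<lambda>x. U (E x))"
    by (intro continuous_on_compose2[OF Suc.prems(1)] continuous_intros) auto
  have "integral {0..1} (\<lambda>x. f x * U (Phi (Suc n) x)) \<le>
      (1 / E_min k g) ^ n * integral {0..1} (\<lambda>y. iter_sum n f y * U (E y))"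
    using Suc.IH[OF U' periodic_E_compose[OF Suc.prems(2)] Suc.prems(3)] by (simp add: Phi_Suc')
  also have "integral {0..1} (\<lambda>y. iter_sum n f y * U (E y)) \<le>
      (1 / E_min k g) * integral {0..1} (\<lambda>y. branch_sum (iter_sum n f) y * U y)"
    by (intro integral_E_compose_le iter_sum_props f Suc.prems)
  finally show ?case using E_min by (simp add: mult_ac divide_right_mono)
qed

section \<open>Iterates and the expansion of phase derivatives\<close>

lemma theta_0 [simp]: "theta 0 x = 0" and theta_Suc: "theta (Suc n) x = \<tau> x + theta n (E x)"
  unfolding theta_def sum.lessThan_Suc_shift by (simp_all add: funpow_swap1)

lemma CN_Phi: "CN m (Phi n)"
proof (induction n)
  case 0
  then show ?case using CN_ident by (simp add: Phi_def id_def)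
next
  case (Suc n)
  have "Phi (Suc n) = (\<lambda>x. Phi n (E x))" by (simp add: fun_eq_iff Phi_Suc)
  then show ?case using CN_compose[OF Suc CN_E] by simp
qed

lemma CN_theta: "CN m (theta n)"
proof (induction n)
  case 0
  then show ?case using CN_const[of m "0::real"] by (simp add: theta_def [abs_def])
next
  case (Suc n)
  have "theta (Suc n) = (\<lambda>x. \<tau> x + theta n (E x))" by (simp add: fun_eq_iff theta_Suc)
  then show ?case using CN_add[OF CN_tau CN_compose[OF Suc CN_E]] by simp
qed

lemma Phi_has_deriv: "(Phi n has_real_derivative dPhi n x) (at x)" and CN_dPhi: "CN m (dPhi n)"
  using CN_deriv[OF CN_Phi] by (auto simp: dPhi_def)

lemma theta_has_deriv: "(theta n has_real_derivative dtheta n x) (at x)" and CN_dtheta: "CN m (dtheta n)"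
  using CN_deriv[OF CN_theta] by (auto simp: dtheta_def)

lemma Phi_shift: "Phi n (x + 1) = Phi n x + of_int (int k ^ n)"
proof (induction n)
  case (Suc n)
  then show ?case unfolding Phi_Suc' by (simp only: E_shift_int power_Suc)
qed simp

lemma periodic_theta: "periodic1 (theta n)"
proof (induction n)
  case 0
  then show ?case by (simp add: periodic1_def)
next
  case (Suc n)
  then show ?case using periodic_E_compose[of "theta n"] periodic_tau by (simp add: periodic1_def theta_Suc)
qed

lemma periodic_dPhi: "periodic1 (dPhi n)"
  by (rule periodic1_deriv[OF Phi_has_deriv Phi_shift])

lemma periodic_dtheta: "periodic1 (dtheta n)"
  by (rule periodic1_deriv[OF theta_has_deriv, of _ 0]) (use periodic_theta in \<open>simp add: periodic1_def\<close>)

lemma dPhi_0: "dPhi 0 x = 1" and dtheta_0: "dtheta 0 x = 0"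
proof -
  have "Phi 0 = (\<lambda>x. x)" "theta 0 = (\<lambda>x. 0)" by auto
  then show "dPhi 0 x = 1" "dtheta 0 x = 0" by (simp_all add: dPhi_def dtheta_def)
qed

lemma dPhi_Suc: "dPhi (Suc n) x = dPhi n (E x) * dE x"
proof -
  have "Phi (Suc n) = (\<lambda>x. Phi n (E x))" by (simp add: fun_eq_iff Phi_Suc)
  then show ?thesis unfolding dPhi_def
    using DERIV_imp_deriv[OF DERIV_chain2[OF Phi_has_deriv E_has_deriv]] by (simp add: dPhi_def)
qed

lemma dtheta_Suc: "dtheta (Suc n) x = deriv \<tau> x + dtheta n (E x) * dE x"
proof -
  have "theta (Suc n) = (\<lambda>x. \<tau> x + theta n (E x))" by (simp add: fun_eq_iff theta_Suc)
  then show ?thesis unfolding dtheta_def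
    using DERIV_imp_deriv[OF DERIV_add[OF tau_has_deriv DERIV_chain2[OF theta_has_deriv E_has_deriv]]] by (simp add: dtheta_def)
qed

lemma dPhi_ge: "dPhi n x \<ge> E_min k g ^ n"
proof (induction n arbitrary: x)
  case (Suc n)
  show ?case unfolding dPhi_Suc using Suc[of "E x"] dE_ge[of x] E_min mult_mono[of "E_min k g ^ n" "dPhi n (E x)" "E_min k g" "dE x"]
    by (simp add: mult.commute order_trans[OF _ Suc])
qed (simp add: dPhi_0)

text \<open>This is the escape condition in homogeneous form, with \<open>t = \<nu> * \<xi>\<close>,
  read at the arrival point \<open>x\<close> instead of the starting point: \<open>x\<close> modulo
  1 is the image of \<open>frac (E x0)\<close> under one of the inverse branches. For
  \<open>\<nu> = 0\<close> it reduces to \<open>\<kappa> < E_min k g\<close>.\<close>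

lemma one_step_expansion:
  assumes "\<bar>t\<bar> > R * \<bar>\<nu>\<bar>"
  shows "\<bar>t * dE x + \<nu> * deriv \<tau> x\<bar> \<ge> \<kappa> * \<bar>t\<bar>"
proof (cases "\<nu> = 0")
  case True
  have "\<kappa> * \<bar>t\<bar> \<le> dE x * \<bar>t\<bar>" using dE_ge[of x] kappa by (intro mult_right_mono) auto
  then show ?thesis using dE_pos[of x] True by (simp add: abs_mult mult.commute)
next
  case False
  define x0 where "x0 = frac x"
  define N where "N = \<lfloor>E x0\<rfloor>"
  \<comment> \<open>The branch through \<open>x0\<close> has as index the integer part of
    \<open>E x0\<close> modulo \<open>k\<close>; the quotient by \<open>k\<close> only shifts the
    point by an integer.\<close>
  define e where "e = nat (N mod int k)"
  have e: "e < k" "real e = of_int (N mod int k)" using k2 by (auto simp: e_def nat_less_iff)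
  have "frac (E x0) + real e = E x0 - of_int (int k * (N div int k))"
  proof -
    have "real_of_int N = of_int (int k * (N div int k)) + of_int (N mod int k)"
      unfolding of_int_add[symmetric] by simp
    then show ?thesis unfolding e(2) frac_def N_def[symmetric] by linarith
  qed
  then have "(frac (E x0) + real e) / real k = g x0 + of_int (- (N div int k))"
    using k2 by (simp add: expanding_map_def field_simps)
  then have b: "inverse_branch k g e (frac (E x0)) = x0"
    unfolding inverse_branch_def by (simp only: g_inv_shift_int g_inv) (simp add: x0_def frac_def)
  have "\<bar>t / \<nu>\<bar> > R" using assms False by (simp add: abs_divide field_simps)
  then have "\<bar>dE x0 * (t / \<nu>) + deriv \<tau> x0\<bar> > \<kappa> * \<bar>t / \<nu>\<bar>"
    using escape[unfolded escape_radius_def, rule_format, of "frac (E x0)" e "t / \<nu>"] e(1) frac_lt_1[of "E x0"]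
    by (simp add: canonical_map_def Let_def b)
  then have "\<kappa> * \<bar>t / \<nu>\<bar> * \<bar>\<nu>\<bar> \<le> \<bar>dE x0 * (t / \<nu>) + deriv \<tau> x0\<bar> * \<bar>\<nu>\<bar>"
    by (intro mult_right_mono) auto
  also have "\<dots> = \<bar>t * dE x0 + \<nu> * deriv \<tau> x0\<bar>"
    using False by (simp add: abs_mult[symmetric] field_simps)
  finally have "\<kappa> * \<bar>t\<bar> \<le> \<bar>t * dE x0 + \<nu> * deriv \<tau> x0\<bar>" using False by simp
  moreover have "dE x0 = dE x" "deriv \<tau> x0 = deriv \<tau> x"
    unfolding x0_def by (simp_all add: periodic1_frac periodic_dE periodic_dtau)
  ultimately show ?thesis by simp
qed

text \<open>The quantity estimated is the derivative of the phase
  \<open>t * Phi n + \<nu> * theta n\<close>. Since \<open>\<kappa> > 1\<close>, a value above the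
  threshold \<open>R * \<bar>\<nu>\<bar>\<close> stays above it, and the one-step estimate can be
  iterated.\<close>

lemma expansion:
  assumes "\<bar>t\<bar> > R * \<bar>\<nu>\<bar>"
  shows "\<bar>t * dPhi n x + \<nu> * dtheta n x\<bar> \<ge> \<kappa> ^ n * \<bar>t\<bar>"
proof (induction n arbitrary: x)
  case 0
  then show ?case by (simp add: dPhi_0 dtheta_0)
next
  case (Suc n)
  let ?t = "t * dPhi n (E x) + \<nu> * dtheta n (E x)"
  have "\<kappa> ^ n \<ge> 1" using kappa by simp
  then have "\<bar>t\<bar> \<le> \<kappa> ^ n * \<bar>t\<bar>" using mult_right_mono[of 1 "\<kappa> ^ n" "\<bar>t\<bar>"] by simp
  then have "\<bar>?t\<bar> > R * \<bar>\<nu>\<bar>" using Suc[of "E x"] assms by linarith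
  from one_step_expansion[OF this, of x] have "\<kappa> * \<bar>?t\<bar> \<le> \<bar>?t * dE x + \<nu> * deriv \<tau> x\<bar>" .
  moreover have "\<kappa> * (\<kappa> ^ n * \<bar>t\<bar>) \<le> \<kappa> * \<bar>?t\<bar>" using Suc[of "E x"] kappa by (intro mult_left_mono) auto
  ultimately show ?case by (simp add: dPhi_Suc dtheta_Suc algebra_simps)
qed

section \<open>Words and trajectories in phase space\<close>

abbreviation "F w p \<equiv> foldr (canonical_map k g \<tau>) w p"

lemma canonical_map_eq: "canonical_map k g \<tau> \<epsilon> (y, \<xi>) = (frac (branch \<epsilon> y), dE (branch \<epsilon> y) * \<xi> + deriv \<tau> (branch \<epsilon> y))"
  by (simp add: canonical_map_def inverse_branch_def branch_def Let_def periodic1_frac periodic_dE periodic_dtau)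

lemma canonical_phase_space: "fst p \<in> {0..<1} \<Longrightarrow> fst (F w p) \<in> {0..<1}"
  by (induction w) (auto simp: canonical_map_def inverse_branch_def Let_def frac_lt_1)

text \<open>The fibre coordinate at the end of a trajectory is a phase derivative evaluated at the
  end point. This is the link between trapped words and points where an oscillatory integral can be
  stationary.\<close>

lemma snd_F:
  assumes "y \<in> {0..<1}"
  shows "snd (F w (y, \<xi>)) = dPhi (length w) (fst (F w (y, \<xi>))) * \<xi> + dtheta (length w) (fst (F w (y, \<xi>)))"
proof (induction w)
  case Nil
  then show ?case by (simp add: dPhi_0 dtheta_0)
next
  case (Cons \<epsilon> w)
  obtain x1 \<xi>1 where p: "F w (y, \<xi>) = (x1, \<xi>1)" by (cases "F w (y, \<xi>)")
  let ?x = "branch \<epsilon> x1"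
  have E: "h (E ?x) = h x1" if "periodic1 h" for h :: "real \<Rightarrow> real"
    unfolding E_branch using periodic1_of_int[OF that, of x1 "int \<epsilon>"] by simp
  have "dPhi (Suc (length w)) ?x = dPhi (length w) x1 * dE ?x"
    "dtheta (Suc (length w)) ?x = deriv \<tau> ?x + dtheta (length w) x1 * dE ?x"
    unfolding dPhi_Suc dtheta_Suc by (simp_all add: E periodic_dPhi periodic_dtheta)
  then show ?case using Cons p
    by (simp add: canonical_map_eq periodic1_frac periodic_dPhi periodic_dtheta algebra_simps)
qed

text \<open>The base point of a trajectory does not see the fibre coordinate, so
  \<open>\<xi>\<close> is free here. It is later set to the frequency whose cutoff is being
  summed.\<close>

lemma iter_sum_words:
  assumes "periodic1 f" "y \<in> {0..<1}"
  shows "iter_sum n f y = (\<Sum>w\<in>words k n. f (fst (F w (y, \<xi>))))"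
  using assms(2)
proof (induction n arbitrary: y \<xi>)
  case 0
  then show ?case by (simp add: words_0)
next
  case (Suc n)
  have per: "periodic1 (iter_sum n f)"
    using assms(1) by (induction n) (auto intro: periodic_branch_sum)
  have "iter_sum (Suc n) f y = (\<Sum>\<epsilon><k. iter_sum n f (frac (branch \<epsilon> y)))"
    by (simp add: branch_sum_def periodic1_frac[OF per])
  also have "\<dots> = (\<Sum>\<epsilon><k. \<Sum>w\<in>words k n. f (fst (F w (canonical_map k g \<tau> \<epsilon> (y, \<xi>)))))"
    by (intro sum.cong refl) (simp add: Suc.IH frac_lt_1 canonical_map_eq)
  also have "\<dots> = (\<Sum>(\<epsilon>, w)\<in>{..<k} \<times> words k n. f (fst (F (w @ [\<epsilon>]) (y, \<xi>))))"
    by (simp add: sum.cartesian_product)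
  also have "\<dots> = (\<Sum>w\<in>words k (Suc n). f (fst (F w (y, \<xi>))))"
    unfolding words_Suc by (subst sum.reindex) (auto simp: inj_on_def intro!: sum.cong)
  finally show ?case .
qed

lemma captive_count_ge:
  assumes "p \<in> phase_space"
  shows "card {w \<in> words k n. F w p \<in> trapping_zone R'} \<le> captive_count k g \<tau> R' n"
proof -
  have fin: "finite ((\<lambda>p. card {w. length w = n \<and> set w \<subseteq> {..<k} \<and> F w p \<in> trapping_zone R'}) ` phase_space)"
  proof (rule finite_subset)
    show "(\<lambda>p. card {w. length w = n \<and> set w \<subseteq> {..<k} \<and> F w p \<in> trapping_zone R'}) ` phase_space \<subseteq> {..k ^ n}"
    proof safe
      fix p show "card {w. length w = n \<and> set w \<subseteq> {..<k} \<and> F w p \<in> trapping_zone R'} \<le> k ^ n"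
        unfolding card_words[symmetric] by (intro card_mono finite_words) (auto simp: words_def)
    qed
  qed simp
  have "card {w \<in> words k n. F w p \<in> trapping_zone R'} =
      card {w. length w = n \<and> set w \<subseteq> {..<k} \<and> F w p \<in> trapping_zone R'}"
    by (rule arg_cong[of _ _ card]) (auto simp: words_def)
  also have "\<dots> \<le> captive_count k g \<tau> R' n"
    unfolding captive_count_def by (rule Max_ge[OF fin]) (use assms in auto)
  finally show ?thesis .
qed

lemma escape_step:
  assumes "x \<in> {0..<1}" "\<epsilon> < k" "\<bar>\<xi>\<bar> > R"
  shows "\<bar>snd (canonical_map k g \<tau> \<epsilon> (x, \<xi>))\<bar> > \<kappa> * \<bar>\<xi>\<bar>"
  using escape assms by (auto simp: escape_radius_def)

lemma escape_word:
  assumes "fst p \<in> {0..<1}" "set w \<subseteq> {..<k}" "\<bar>snd p\<bar> > R"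
  shows "\<bar>snd (F w p)\<bar> \<ge> \<kappa> ^ length w * \<bar>snd p\<bar>"
  using assms(2)
proof (induction w)
  case (Cons \<epsilon> w)
  let ?q = "F w p"
  have IH: "\<bar>snd ?q\<bar> \<ge> \<kappa> ^ length w * \<bar>snd p\<bar>" using Cons by auto
  have "\<bar>snd p\<bar> \<le> \<kappa> ^ length w * \<bar>snd p\<bar>"
    using mult_right_mono[of 1 "\<kappa> ^ length w" "\<bar>snd p\<bar>"] kappa by simp
  then have "\<bar>snd ?q\<bar> > R" using IH assms(3) by linarith
  from escape_step[OF canonical_phase_space[OF assms(1)] _ this, of \<epsilon> w]
  have "\<bar>snd (F (\<epsilon> # w) p)\<bar> > \<kappa> * \<bar>snd ?q\<bar>" using Cons.prems by simp
  moreover have "\<kappa> * (\<kappa> ^ length w * \<bar>snd p\<bar>) \<le> \<kappa> * \<bar>snd ?q\<bar>" using IH kappa by (intro mult_left_mono) auto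
  ultimately show ?case by (simp add: mult.assoc)
qed simp

text \<open>A trajectory outside the zone of radius \<open>R\<close> after \<open>n - l\<close>
  steps would exceed \<open>r\<close> after \<open>l\<close> more, by expansion. So the first
  \<open>n - l\<close> steps of a counted word are captive and only the remaining \<open>l\<close>
  letters are free, which costs the factor \<open>k ^ l\<close>.\<close>

lemma captive_words_larger_zone:
  assumes p: "p \<in> phase_space" and R0: "R > 0" and l: "\<kappa> ^ l * R > r" "l \<le> n"
  shows "card {w \<in> words k n. \<bar>snd (F w p)\<bar> \<le> r} \<le> k ^ l * captive_count k g \<tau> R (n - l)"
proof -
  have fp: "fst p \<in> {0..<1}" using p by (auto simp: phase_space_def)
  let ?A = "{w \<in> words k n. \<bar>snd (F w p)\<bar> \<le> r}"
  let ?B = "words k l \<times> {w \<in> words k (n - l). F w p \<in> trapping_zone R}"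
  have "card ?A \<le> card ?B"
  \<comment> \<open>\<open>take l w\<close> contains the letters that act last,
    \<open>drop l w\<close> those that act first.\<close>
  proof (rule card_inj_on_le[where f="\<lambda>w. (take l w, drop l w)"])
    show "inj_on (\<lambda>w. (take l w, drop l w)) ?A"
      by (rule inj_onI) (metis append_take_drop_id prod.inject)
    show "finite ?B" by (intro finite_cartesian_product finite_words) (simp add: finite_words)
    show "(\<lambda>w. (take l w, drop l w)) ` ?A \<subseteq> ?B"
    proof safe
      fix w assume w: "w \<in> words k n" "\<bar>snd (F w p)\<bar> \<le> r"
      have s: "set (take l w) \<subseteq> {..<k}" "set (drop l w) \<subseteq> {..<k}" "length w = n"
        using w set_take_subset[of l w] set_drop_subset[of l w] by (auto simp: words_def)
      then show "take l w \<in> words k l" "drop l w \<in> words k (n - l)" using l by (auto simp: words_def)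
      let ?q = "F (drop l w) p"
      have fq: "fst ?q \<in> {0..<1}" by (rule canonical_phase_space[OF fp])
      have "\<bar>snd ?q\<bar> \<le> R"
      proof (rule ccontr)
        assume "\<not> \<bar>snd ?q\<bar> \<le> R"
        then have a: "\<bar>snd ?q\<bar> > R" by simp
        have "F (take l w) ?q = F w p" by (metis append_take_drop_id comp_apply foldr_append)
        with escape_word[OF fq s(1) a] have "\<kappa> ^ l * \<bar>snd ?q\<bar> \<le> r" using w(2) l s(3) by simp
        moreover have "\<kappa> ^ l * R \<le> \<kappa> ^ l * \<bar>snd ?q\<bar>" using a kappa by (intro mult_left_mono) auto
        ultimately show False using l by linarith
      qed
      then show "?q \<in> trapping_zone R" using fq unfolding trapping_zone_def by (cases ?q) auto
    qed
  qed
  also have "\<dots> = k ^ l * card {w \<in> words k (n - l). F w p \<in> trapping_zone R}"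
    by (simp add: card_cartesian_product card_words)
  also have "\<dots> \<le> k ^ l * captive_count k g \<tau> R (n - l)"
    by (intro mult_left_mono captive_count_ge p) auto
  finally show ?thesis .
qed

text \<open>If \<open>R = 0\<close>, escape from every nonzero fibre coordinate forces the
  derivative of \<open>\<tau>\<close> to vanish. The zero section is then invariant, all
  \<open>k ^ n\<close> words are captive, and the growth rate is at least
  \<open>ln k > 0\<close>.\<close>

lemma captive_radius_pos:
  assumes "partially_captive k g \<tau> R"
  shows "R > 0"
proof (rule ccontr)
  assume "\<not> R > 0"
  then have R0: "R = 0" using R by simp
  have dt: "deriv \<tau> x = 0" for x
  proof (rule ccontr)
    assume a: "deriv \<tau> x \<noteq> 0"
    \<comment> \<open>The first variable of the rule is \<open>\<nu>\<close>, the second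
      \<open>t\<close>: with \<open>t = 1\<close> and this \<open>\<nu>\<close> the expanded
      quantity is 0, although it should be at least \<open>\<kappa>\<close>.\<close>
    from one_step_expansion[of "- dE x / deriv \<tau> x" 1 x] a kappa show False by (simp add: R0)
  qed
  have z: "F w (0, 0) \<in> trapping_zone R" for w
  proof -
    have "snd (F w (0, 0)) = 0"
    proof (induction w)
      case (Cons \<epsilon> w)
      then show ?case by (cases "F w (0, 0)") (simp add: canonical_map_eq dt)
    qed simp
    moreover have "fst (F w (0, 0)) \<in> {0..<1}" by (rule canonical_phase_space) simp
    ultimately show ?thesis unfolding trapping_zone_def by (cases "F w (0, 0)") (auto simp: R0)
  qed
  have "k ^ n \<le> captive_count k g \<tau> R n" for n
    using captive_count_ge[of "(0,0)" n R] z by (simp add: phase_space_def card_words)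
  then have ge: "ln (real k) \<le> ln (real (captive_count k g \<tau> R n)) / real n" if "n \<ge> 1" for n
  proof -
    have "real k ^ n \<le> real (captive_count k g \<tau> R n)"
      using \<open>\<And>n. k ^ n \<le> captive_count k g \<tau> R n\<close>[of n] by (metis of_nat_le_iff of_nat_power)
    then have "ln (real k ^ n) \<le> ln (real (captive_count k g \<tau> R n))"
      using k2 by (intro ln_mono) auto
    then show ?thesis using that k2 by (simp add: ln_realpow field_simps)
  qed
  have "ln (real k) \<le> 0"
    using assms unfolding partially_captive_def
    by (rule LIMSEQ_le_const) (use ge in auto)
  then show False using k2 by (simp add: not_le)
qed

end

section \<open>High frequencies\<close>

text \<open>Summation by parts: a function of the level is its value at the top level
  \<open>P\<close> plus a combination of indicators of the sets \<open>f i \<le> r\<close>.\<close>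

lemma layer_cake_expand:
  fixes w :: "nat \<Rightarrow> real"
  assumes "finite K" "\<And>i. i \<in> K \<Longrightarrow> f i \<le> P"
  shows "(\<Sum>i\<in>K. w (f i) * X i) = w P * (\<Sum>i\<in>K. X i) + (\<Sum>r<P. (w r - w (Suc r)) * (\<Sum>i\<in>{i\<in>K. f i \<le> r}. X i))"
proof -
  have tel: "w a = w P + (\<Sum>r<P. if a \<le> r then w r - w (Suc r) else 0)" if "a \<le> P" for a
    using that
  proof (induction "P" rule: dec_induct)
    case base
    have "(\<Sum>r<a. if a \<le> r then w r - w (Suc r) else 0) = 0" by (intro sum.neutral) auto
    then show ?case by simp
  next
    case (step m)
    then show ?case by simp
  qed
  have "(\<Sum>i\<in>K. w (f i) * X i) = (\<Sum>i\<in>K. w P * X i + (\<Sum>r<P. (w r - w (Suc r)) * (if f i \<le> r then X i else 0)))"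
  proof (intro sum.cong refl)
    fix i assume "i \<in> K"
    then have "w (f i) * X i = (w P + (\<Sum>r<P. if f i \<le> r then w r - w (Suc r) else 0)) * X i"
      using tel[OF assms(2)] by simp
    also have "\<dots> = w P * X i + (\<Sum>r<P. (w r - w (Suc r)) * (if f i \<le> r then X i else 0))"
      by (auto simp: distrib_right sum_distrib_right intro!: sum.cong)
    finally show "w (f i) * X i = w P * X i + (\<Sum>r<P. (w r - w (Suc r)) * (if f i \<le> r then X i else 0))" .
  qed
  also have "\<dots> = w P * (\<Sum>i\<in>K. X i) + (\<Sum>r<P. \<Sum>i\<in>K. (w r - w (Suc r)) * (if f i \<le> r then X i else 0))"
    by (simp add: sum.distrib sum_distrib_left sum.swap[of _ K])
  also have "(\<Sum>r<P. \<Sum>i\<in>K. (w r - w (Suc r)) * (if f i \<le> r then X i else 0)) =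
      (\<Sum>r<P. (w r - w (Suc r)) * (\<Sum>i\<in>{i\<in>K. f i \<le> r}. X i))"
    using assms(1) by (intro sum.cong refl) (simp add: sum_distrib_left[symmetric] sum.inter_filter)
  finally show ?thesis .
qed

text \<open>For decreasing nonnegative weights the coefficients of the layer cake are nonnegative,
  so inequalities on all truncations combine. It turns unweighted estimates on frequencies up to
  \<open>r\<close> into estimates with the decreasing weight of a negative Sobolev exponent.\<close>

lemma layer_cake_le:
  fixes A :: "'a \<Rightarrow> real" and B :: "'b \<Rightarrow> real" and h :: "'a \<Rightarrow> nat" and h' :: "'b \<Rightarrow> nat"
  assumes fin: "finite J" "finite S"
    and le: "\<And>r. (\<Sum>j\<in>{j\<in>J. h j \<le> r}. A j) \<le> (\<Sum>l\<in>{l\<in>S. h' l \<le> r}. B l)"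
    and w: "\<And>r. 0 \<le> w r" "\<And>r. w (Suc r) \<le> (w r :: real)"
  shows "(\<Sum>j\<in>J. w (h j) * A j) \<le> (\<Sum>l\<in>S. w (h' l) * B l)"
proof -
  define P where "P = Max (insert 0 (h ` J \<union> h' ` S))"
  have P: "h j \<le> P" if "j \<in> J" for j using fin that by (auto simp: P_def intro!: Max_ge)
  have P': "h' l \<le> P" if "l \<in> S" for l using fin that by (auto simp: P_def intro!: Max_ge)
  have "{j\<in>J. h j \<le> P} = J" "{l\<in>S. h' l \<le> P} = S" using P P' by auto
  then have tot: "(\<Sum>j\<in>J. A j) \<le> (\<Sum>l\<in>S. B l)" using le[of P] by simp
  have "(\<Sum>j\<in>J. w (h j) * A j) = w P * (\<Sum>i\<in>J. A i) + (\<Sum>r<P. (w r - w (Suc r)) * (\<Sum>i\<in>{i\<in>J. h i \<le> r}. A i))"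
    by (rule layer_cake_expand[OF fin(1) P])
  also have "\<dots> \<le> w P * (\<Sum>i\<in>S. B i) + (\<Sum>r<P. (w r - w (Suc r)) * (\<Sum>i\<in>{i\<in>S. h' i \<le> r}. B i))"
    by (intro add_mono mult_left_mono sum_mono tot le) (use w in auto)
  also have "\<dots> = (\<Sum>l\<in>S. w (h' l) * B l)"
    by (rule layer_cake_expand[OF fin(2) P', symmetric])
  finally show ?thesis .
qed

lemma L2_set_square: "finite S \<Longrightarrow> (L2_set f S)\<^sup>2 = (\<Sum>i\<in>S. (f i)\<^sup>2)"
  by (simp add: L2_set_def sum_nonneg)

lemma L2_set_le_iff: "0 \<le> M \<Longrightarrow> L2_set f S \<le> M \<longleftrightarrow> (\<Sum>i\<in>S. (f i)\<^sup>2) \<le> M\<^sup>2"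
  unfolding L2_set_def by (metis abs_of_nonneg real_sqrt_abs real_sqrt_le_iff)

lemma L2_set_subset: "finite S \<Longrightarrow> T \<subseteq> S \<Longrightarrow> L2_set f T \<le> L2_set f S"
  unfolding L2_set_def by (intro real_sqrt_le_mono sum_mono2) auto

text \<open>Equivalent to the weight of \<open>H^m\<close> for fixed \<open>\<mu>\<close>, but equal
  to 1 for all frequencies up to \<open>\<mu>\<close> whatever \<open>m\<close> is. On these
  frequencies the weighted norm is the plain L2 norm.\<close>

definition flat_weight :: "real \<Rightarrow> real \<Rightarrow> int \<Rightarrow> real" where
  "flat_weight \<mu> m n = (max 1 (\<bar>of_int n\<bar> / \<mu>)) powr m"

lemma flat_weight_pos: "0 < flat_weight \<mu> m n"
  by (simp add: flat_weight_def)

lemma flat_weight_le_1: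
  assumes "m \<le> 0" shows "flat_weight \<mu> m n \<le> 1"
proof -
  define x where "x = max 1 (\<bar>of_int n\<bar> / \<mu>)"
  have "x \<ge> 1" by (simp add: x_def)
  then show ?thesis using powr_mono[OF assms, of x] by (simp add: flat_weight_def x_def[symmetric])
qed

text \<open>\<open>T\<close> stands for the matrix of a power of the operator. Entries with
  \<open>\<bar>j\<bar> \<le> \<kappa>2 * \<bar>l\<bar>\<close>, called near, are small by
  nonstationary phase; far entries raise the frequency by more than the factor
  \<open>\<kappa>2\<close> and are controlled by the L2 bound \<open>D\<close> together with the
  decreasing weight.\<close>

context
  fixes T :: "int \<Rightarrow> int \<Rightarrow> complex" and D C \<kappa>2 \<mu> Z :: real and N p :: nat
  assumes T_L2: "\<And>S J c. finite S \<Longrightarrow> finite J \<Longrightarrow>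
      L2_set (\<lambda>j. cmod (\<Sum>l\<in>S. T j l * c l)) J \<le> D * L2_set (\<lambda>l. cmod (c l)) S"
    and decay: "\<And>j l. \<mu> < \<bar>real_of_int l\<bar> \<Longrightarrow> \<bar>real_of_int j\<bar> \<le> \<kappa>2 * \<bar>real_of_int l\<bar> \<Longrightarrow>
      cmod (T j l) \<le> C / \<bar>real_of_int l\<bar> ^ (p + 4)"
    and Z: "Z > 0" "\<And>F::int set. finite F \<Longrightarrow> (\<Sum>n\<in>F. 1 / (max 1 \<bar>real_of_int n\<bar>)\<^sup>2) \<le> Z"
    and D: "D \<ge> 0" and C: "C \<ge> 0" and \<kappa>2: "\<kappa>2 > 1" and \<mu>: "\<mu> \<ge> 1"
begin

definition near_const :: real where "near_const = C * Z * \<kappa>2 * sqrt Z / \<mu>"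

lemma near_const_nonneg: "near_const \<ge> 0"
  using C Z(1) \<kappa>2 \<mu> by (auto simp: near_const_def)

lemma near_part_bound:
  assumes S: "finite S" "\<And>l. l \<in> S \<Longrightarrow> \<mu> < \<bar>real_of_int l\<bar>"
    and c: "\<And>l. l \<in> S \<Longrightarrow> cmod (c l) \<le> B * \<bar>real_of_int l\<bar> ^ p" and B: "B \<ge> 0" and J: "finite J"
  shows "L2_set (\<lambda>j. cmod (\<Sum>l\<in>{l\<in>S. \<bar>real_of_int j\<bar> \<le> \<kappa>2 * \<bar>real_of_int l\<bar>}. T j l * c l)) J \<le> near_const * B"
proof -
  have pt: "cmod (\<Sum>l\<in>{l\<in>S. \<bar>real_of_int j\<bar> \<le> \<kappa>2 * \<bar>real_of_int l\<bar>}. T j l * c l) \<le>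
      (C * Z * \<kappa>2 / \<mu> * B) * (1 / max 1 \<bar>real_of_int j\<bar>)" for j
  proof -
    let ?S = "{l\<in>S. \<bar>real_of_int j\<bar> \<le> \<kappa>2 * \<bar>real_of_int l\<bar>}"
    have "cmod (\<Sum>l\<in>?S. T j l * c l) \<le> (\<Sum>l\<in>?S. cmod (T j l * c l))" by (rule norm_sum)
    also have "\<dots> \<le> (\<Sum>l\<in>?S. (C * \<kappa>2 / \<mu> * B / max 1 \<bar>real_of_int j\<bar>) * (1 / (max 1 \<bar>real_of_int l\<bar>)\<^sup>2))"
    proof (rule sum_mono)
      fix l assume l: "l \<in> ?S"
      define x where "x = \<bar>real_of_int l\<bar>"
      have x: "x > \<mu>" "\<bar>real_of_int j\<bar> \<le> \<kappa>2 * x" using l S by (auto simp: x_def)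
      have x1: "1 \<le> x" using x \<mu> by linarith
      have "cmod (T j l * c l) \<le> C / x ^ (p + 4) * (B * x ^ p)"
        unfolding norm_mult x_def using l S C B by (intro mult_mono decay c) auto
      \<comment> \<open>Use of the exponent \<open>p + 4\<close>: \<open>p\<close> powers compensate
        the growth of \<open>c\<close>, two make the sum over \<open>l\<close> converge, one becomes
        decay in \<open>j\<close>, and one becomes the small factor
        \<open>1 / \<mu>\<close>.\<close>
      also have "\<dots> = (C * B) * (1 / x) * (1 / x) * (1 / x\<^sup>2)"
        using x1 by (simp add: power_add field_simps power2_eq_square power4_eq_xxxx)
      also have "\<dots> \<le> (C * B) * (1 / \<mu>) * (\<kappa>2 / max 1 \<bar>real_of_int j\<bar>) * (1 / x\<^sup>2)"
      proof (intro mult_right_mono mult_mono)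
        show "1 / x \<le> 1 / \<mu>" using x \<mu> by (intro divide_left_mono) auto
        have "max 1 \<bar>real_of_int j\<bar> \<le> \<kappa>2 * x" using x1 \<kappa>2 x(2) mult_mono[of 1 \<kappa>2 1 x] by simp
        then show "1 / x \<le> \<kappa>2 / max 1 \<bar>real_of_int j\<bar>" using x1 by (simp add: divide_simps mult.commute)
      qed (use C B x1 \<mu> \<kappa>2 in auto)
      also have "\<dots> = (C * \<kappa>2 / \<mu> * B / max 1 \<bar>real_of_int j\<bar>) * (1 / (max 1 \<bar>real_of_int l\<bar>)\<^sup>2)"
        using x1 by (simp add: x_def max_def)
      finally show "cmod (T j l * c l) \<le> \<dots>" .
    qed
    also have "\<dots> = (C * \<kappa>2 / \<mu> * B / max 1 \<bar>real_of_int j\<bar>) * (\<Sum>l\<in>?S. 1 / (max 1 \<bar>real_of_int l\<bar>)\<^sup>2)"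
      by (rule sum_distrib_left[symmetric])
    also have "\<dots> \<le> (C * \<kappa>2 / \<mu> * B / max 1 \<bar>real_of_int j\<bar>) * Z"
      using C B \<mu> \<kappa>2 S by (intro mult_left_mono Z(2)) auto
    finally show ?thesis by (simp add: mult_ac)
  qed
  have "L2_set (\<lambda>j. cmod (\<Sum>l\<in>{l\<in>S. \<bar>real_of_int j\<bar> \<le> \<kappa>2 * \<bar>real_of_int l\<bar>}. T j l * c l)) J \<le>
      L2_set (\<lambda>j. (C * Z * \<kappa>2 / \<mu> * B) * (1 / max 1 \<bar>real_of_int j\<bar>)) J"
    by (intro L2_set_mono pt) auto
  also have "\<dots> = (C * Z * \<kappa>2 / \<mu> * B) * L2_set (\<lambda>j. 1 / max 1 \<bar>real_of_int j\<bar>) J"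
    using C B Z(1) \<mu> \<kappa>2 by (intro L2_set_right_distrib[symmetric]) auto
  also have "\<dots> \<le> (C * Z * \<kappa>2 / \<mu> * B) * sqrt Z"
    using C B Z \<mu> \<kappa>2 J by (intro mult_left_mono) (auto simp: L2_set_def power_divide)
  finally show ?thesis by (simp add: near_const_def mult_ac)
qed

text \<open>The range of summation depends on \<open>j\<close>, so the L2 bound does not apply
  directly. The sum is completed to a fixed set of columns, and what is added consists of near
  entries. Outputs up to \<open>r\<close> involve only inputs below \<open>r / \<kappa>2\<close>,
  and this is the gain.\<close>

lemma far_part_bound:
  assumes S: "finite S" "\<And>l. l \<in> S \<Longrightarrow> \<mu> < \<bar>real_of_int l\<bar>" and J: "finite J"
    and Jr: "\<And>j. j \<in> J \<Longrightarrow> \<bar>real_of_int j\<bar> \<le> r"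
  shows "L2_set (\<lambda>j. cmod (\<Sum>l\<in>{l\<in>S. \<kappa>2 * \<bar>real_of_int l\<bar> < \<bar>real_of_int j\<bar>}. T j l * c l)) J \<le>
     (D + near_const) * L2_set (\<lambda>l. cmod (c l)) {l\<in>S. \<kappa>2 * \<bar>real_of_int l\<bar> < r}"
proof -
  define S' where "S' = {l\<in>S. \<kappa>2 * \<bar>real_of_int l\<bar> < r}"
  have S': "finite S'" "\<And>l. l \<in> S' \<Longrightarrow> \<mu> < \<bar>real_of_int l\<bar>" using S by (auto simp: S'_def)
  have split: "(\<Sum>l\<in>{l\<in>S. \<kappa>2 * \<bar>real_of_int l\<bar> < \<bar>real_of_int j\<bar>}. T j l * c l) =
      (\<Sum>l\<in>S'. T j l * c l) + - (\<Sum>l\<in>{l\<in>S'. \<bar>real_of_int j\<bar> \<le> \<kappa>2 * \<bar>real_of_int l\<bar>}. T j l * c l)" if "j \<in> J" for j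
  proof -
    have "{l\<in>S. \<kappa>2 * \<bar>real_of_int l\<bar> < \<bar>real_of_int j\<bar>} = S' - {l\<in>S'. \<bar>real_of_int j\<bar> \<le> \<kappa>2 * \<bar>real_of_int l\<bar>}"
      using Jr[OF that] by (auto simp: S'_def)
    then show ?thesis using S'(1) by (simp add: sum_diff)
  qed
  have "L2_set (\<lambda>j. cmod (\<Sum>l\<in>{l\<in>S. \<kappa>2 * \<bar>real_of_int l\<bar> < \<bar>real_of_int j\<bar>}. T j l * c l)) J \<le>
      L2_set (\<lambda>j. cmod (\<Sum>l\<in>S'. T j l * c l) + cmod (\<Sum>l\<in>{l\<in>S'. \<bar>real_of_int j\<bar> \<le> \<kappa>2 * \<bar>real_of_int l\<bar>}. T j l * c l)) J"
  proof (rule L2_set_mono)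
    fix j assume "j \<in> J"
    show "cmod (\<Sum>l\<in>{l\<in>S. \<kappa>2 * \<bar>real_of_int l\<bar> < \<bar>real_of_int j\<bar>}. T j l * c l) \<le>
        cmod (\<Sum>l\<in>S'. T j l * c l) + cmod (\<Sum>l\<in>{l\<in>S'. \<bar>real_of_int j\<bar> \<le> \<kappa>2 * \<bar>real_of_int l\<bar>}. T j l * c l)"
      unfolding split[OF \<open>j \<in> J\<close>] by (rule order_trans[OF norm_triangle_ineq]) simp
  qed simp
  also have "\<dots> \<le> L2_set (\<lambda>j. cmod (\<Sum>l\<in>S'. T j l * c l)) J +
      L2_set (\<lambda>j. cmod (\<Sum>l\<in>{l\<in>S'. \<bar>real_of_int j\<bar> \<le> \<kappa>2 * \<bar>real_of_int l\<bar>}. T j l * c l)) J"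
    by (rule L2_set_triangle_ineq)
  also have "\<dots> \<le> D * L2_set (\<lambda>l. cmod (c l)) S' + near_const * L2_set (\<lambda>l. cmod (c l)) S'"
  proof (intro add_mono T_L2 near_part_bound S' J)
    fix l assume l: "l \<in> S'"
    have "1 \<le> \<bar>real_of_int l\<bar> ^ p" using S'(2)[OF l] \<mu> by (intro one_le_power) auto
    then have "1 * L2_set (\<lambda>l. cmod (c l)) S' \<le> \<bar>real_of_int l\<bar> ^ p * L2_set (\<lambda>l. cmod (c l)) S'"
      by (intro mult_right_mono) auto
    then show "cmod (c l) \<le> L2_set (\<lambda>l. cmod (c l)) S' * \<bar>real_of_int l\<bar> ^ p"
      using member_le_L2_set[OF S'(1) l, of "\<lambda>l. cmod (c l)"] by (simp add: mult.commute)
  qed auto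
  finally show ?thesis by (simp add: S'_def distrib_right)
qed

text \<open>The far part satisfies truncated inequalities in which the input level is
  \<open>\<kappa>2\<close> times smaller than the output level; the layer cake converts this into
  the factor \<open>\<kappa>2 powr m\<close>. The near part is bounded without weights, since
  \<open>flat_weight\<close> is at most 1. If all outputs lie below \<open>\<mu>\<close>, every
  entry is near.\<close>

lemma high_frequency_bound:
  fixes c :: "int \<Rightarrow> complex"
  assumes S: "finite S" "\<And>l. l \<in> S \<Longrightarrow> \<mu> < \<bar>real_of_int l\<bar>" and J: "finite J"
    and m: "m < 0" "- m \<le> real p"
  defines "M \<equiv> L2_set (\<lambda>l. flat_weight \<mu> m l * cmod (c l)) S"
  shows "L2_set (\<lambda>j. flat_weight \<mu> m j * cmod (\<Sum>l\<in>S. T j l * c l)) J \<le> ((D + near_const) * \<kappa>2 powr m + near_const) * M"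
    and "(\<And>j. j \<in> J \<Longrightarrow> \<bar>real_of_int j\<bar> \<le> \<mu>) \<Longrightarrow> L2_set (\<lambda>j. cmod (\<Sum>l\<in>S. T j l * c l)) J \<le> near_const * M"
proof -
  have M0: "M \<ge> 0" by (simp add: M_def)
  have cb: "cmod (c l) \<le> M * \<bar>real_of_int l\<bar> ^ p" if l: "l \<in> S" for l
  proof -
    define x where "x = \<bar>real_of_int l\<bar>"
    have x: "x > \<mu>" using S l by (simp add: x_def)
    have fw: "flat_weight \<mu> m l = (x / \<mu>) powr m" using x \<mu> by (simp add: flat_weight_def x_def max_def)
    have "flat_weight \<mu> m l * cmod (c l) \<le> M"
      unfolding M_def using member_le_L2_set[OF S(1) l, of "\<lambda>l. flat_weight \<mu> m l * cmod (c l)"] .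
    then have "cmod (c l) \<le> M * (x / \<mu>) powr (- m)"
      using x \<mu> unfolding fw by (simp add: powr_minus field_simps)
    also have "(x / \<mu>) powr (- m) \<le> x powr (- m)"
      using x \<mu> m by (intro powr_mono2) (auto simp: divide_simps)
    also have "x powr (- m) \<le> x powr (real p)" using x \<mu> m by (intro powr_mono) auto
    also have "\<dots> = x ^ p" using x \<mu> by (simp add: powr_realpow)
    finally show ?thesis using M0 by (simp add: x_def mult_left_mono)
  qed
  have near: "L2_set (\<lambda>j. cmod (\<Sum>l\<in>{l\<in>S. \<bar>real_of_int j\<bar> \<le> \<kappa>2 * \<bar>real_of_int l\<bar>}. T j l * c l)) J' \<le> near_const * M"
    if "finite J'" for J' by (rule near_part_bound[OF S cb M0 that])
  {
    assume Jl: "\<And>j. j \<in> J \<Longrightarrow> \<bar>real_of_int j\<bar> \<le> \<mu>"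
    have "{l\<in>S. \<bar>real_of_int j\<bar> \<le> \<kappa>2 * \<bar>real_of_int l\<bar>} = S" if "j \<in> J" for j
    proof -
      have "\<bar>real_of_int j\<bar> \<le> \<kappa>2 * \<bar>real_of_int l\<bar>" if "l \<in> S" for l
        using Jl[OF \<open>j \<in> J\<close>] S(2)[OF that] \<kappa>2 mult_right_mono[of 1 \<kappa>2 "\<bar>real_of_int l\<bar>"] by simp
      then show ?thesis by auto
    qed
    then have "L2_set (\<lambda>j. cmod (\<Sum>l\<in>S. T j l * c l)) J =
        L2_set (\<lambda>j. cmod (\<Sum>l\<in>{l\<in>S. \<bar>real_of_int j\<bar> \<le> \<kappa>2 * \<bar>real_of_int l\<bar>}. T j l * c l)) J"
      by (intro L2_set_cong) auto
    also have "\<dots> \<le> near_const * M" by (rule near[OF J])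
    finally show "L2_set (\<lambda>j. cmod (\<Sum>l\<in>S. T j l * c l)) J \<le> near_const * M" .
  }
  define Fc where "Fc j = (\<Sum>l\<in>{l\<in>S. \<kappa>2 * \<bar>real_of_int l\<bar> < \<bar>real_of_int j\<bar>}. T j l * c l)" for j
  define Ec where "Ec j = (\<Sum>l\<in>{l\<in>S. \<bar>real_of_int j\<bar> \<le> \<kappa>2 * \<bar>real_of_int l\<bar>}. T j l * c l)" for j
  have split: "(\<Sum>l\<in>S. T j l * c l) = Fc j + Ec j" for j
  proof -
    have "S = {l\<in>S. \<kappa>2 * \<bar>real_of_int l\<bar> < \<bar>real_of_int j\<bar>} \<union> {l\<in>S. \<bar>real_of_int j\<bar> \<le> \<kappa>2 * \<bar>real_of_int l\<bar>}" by auto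
    then show ?thesis unfolding Fc_def Ec_def using S(1) by (subst sum.union_disjoint[symmetric]) (auto intro: sum.cong)
  qed
  \<comment> \<open>The squared weight as a function of the integer level. An input \<open>l\<close>
    has the level of the smallest output it can reach, \<open>\<kappa>2 * \<bar>l\<bar>\<close>
    rounded up.\<close>
  define w where "w r = (max 1 (real r / \<mu>)) powr (2 * m)" for r :: nat
  have "(\<Sum>j\<in>J. w (nat \<bar>j\<bar>) * (cmod (Fc j))\<^sup>2) \<le> (\<Sum>l\<in>S. w (nat \<lceil>\<kappa>2 * \<bar>real_of_int l\<bar>\<rceil>) * ((D + near_const)\<^sup>2 * (cmod (c l))\<^sup>2))"
  proof (rule layer_cake_le[OF J S(1)])
    fix r :: nat
    let ?J = "{j\<in>J. nat \<bar>j\<bar> \<le> r}"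
    let ?S = "{l\<in>S. \<kappa>2 * \<bar>real_of_int l\<bar> < real r}"
    have "L2_set (\<lambda>j. cmod (Fc j)) ?J \<le> (D + near_const) * L2_set (\<lambda>l. cmod (c l)) ?S"
      unfolding Fc_def by (rule far_part_bound[OF S]) (use J in auto)
    then have "(L2_set (\<lambda>j. cmod (Fc j)) ?J)\<^sup>2 \<le> ((D + near_const) * L2_set (\<lambda>l. cmod (c l)) ?S)\<^sup>2"
      by (intro power_mono) auto
    then have "(\<Sum>j\<in>?J. (cmod (Fc j))\<^sup>2) \<le> (\<Sum>l\<in>?S. (D + near_const)\<^sup>2 * (cmod (c l))\<^sup>2)"
      using J S by (simp add: L2_set_square power_mult_distrib sum_distrib_left)
    also have "\<dots> \<le> (\<Sum>l\<in>{l \<in> S. nat \<lceil>\<kappa>2 * \<bar>real_of_int l\<bar>\<rceil> \<le> r}. (D + near_const)\<^sup>2 * (cmod (c l))\<^sup>2)"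
      using S by (intro sum_mono2) (auto simp: nat_le_iff ceiling_le_iff)
    finally show "(\<Sum>j\<in>?J. (cmod (Fc j))\<^sup>2) \<le> \<dots>" .
  next
    fix r
    show "0 \<le> w r" by (simp add: w_def)
    have "real r / \<mu> \<le> real (Suc r) / \<mu>" using \<mu> by (intro divide_right_mono) auto
    then have "max 1 (real r / \<mu>) \<le> max 1 (real (Suc r) / \<mu>)" by (intro max.mono) auto
    then show "w (Suc r) \<le> w r" unfolding w_def using m by (intro powr_mono2') auto
  qed
  also have "\<dots> \<le> (\<Sum>l\<in>S. ((D + near_const) * \<kappa>2 powr m)\<^sup>2 * (flat_weight \<mu> m l * cmod (c l))\<^sup>2)"
  proof (rule sum_mono)
    fix l assume l: "l \<in> S"
    define x where "x = \<bar>real_of_int l\<bar>"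
    have x: "x > \<mu>" using S l by (simp add: x_def)
    have "w (nat \<lceil>\<kappa>2 * x\<rceil>) \<le> (\<kappa>2 * (x / \<mu>)) powr (2 * m)"
      unfolding w_def
    proof (rule powr_mono2')
      have "\<kappa>2 * x \<le> real (nat \<lceil>\<kappa>2 * x\<rceil>)" by linarith
      then show "\<kappa>2 * (x / \<mu>) \<le> max 1 (real (nat \<lceil>\<kappa>2 * x\<rceil>) / \<mu>)"
        using \<mu> divide_right_mono[of "\<kappa>2 * x" "real (nat \<lceil>\<kappa>2 * x\<rceil>)" \<mu>] by simp
    qed (use m x \<mu> \<kappa>2 in auto)
    also have "\<dots> = (\<kappa>2 powr m)\<^sup>2 * (flat_weight \<mu> m l)\<^sup>2"
    proof -
      have "(\<kappa>2 * (x / \<mu>)) powr (2 * m) = \<kappa>2 powr (2 * m) * (x / \<mu>) powr (2 * m)"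
        by (rule powr_mult)
      moreover have "flat_weight \<mu> m l = (x / \<mu>) powr m"
        using x \<mu> by (simp add: flat_weight_def x_def[symmetric] max_def)
      moreover have "y powr (2 * m) = (y powr m)\<^sup>2" for y :: real
        by (simp add: power2_eq_square powr_add[symmetric])
      ultimately show ?thesis by simp
    qed
    finally show "w (nat \<lceil>\<kappa>2 * \<bar>real_of_int l\<bar>\<rceil>) * ((D + near_const)\<^sup>2 * (cmod (c l))\<^sup>2) \<le>
        ((D + near_const) * \<kappa>2 powr m)\<^sup>2 * (flat_weight \<mu> m l * cmod (c l))\<^sup>2"
      using mult_right_mono[of "w (nat \<lceil>\<kappa>2 * \<bar>real_of_int l\<bar>\<rceil>)" "(\<kappa>2 powr m)\<^sup>2 * (flat_weight \<mu> m l)\<^sup>2" "(D + near_const)\<^sup>2 * (cmod (c l))\<^sup>2"]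
      by (simp add: x_def power_mult_distrib mult_ac)
  qed
  also have "\<dots> = ((D + near_const) * \<kappa>2 powr m * M)\<^sup>2"
    using S by (simp add: M_def L2_set_square power_mult_distrib sum_distrib_left)
  finally have wsum: "(\<Sum>j\<in>J. w (nat \<bar>j\<bar>) * (cmod (Fc j))\<^sup>2) \<le> ((D + near_const) * \<kappa>2 powr m * M)\<^sup>2" .
  have "(\<Sum>j\<in>J. (flat_weight \<mu> m j * cmod (Fc j))\<^sup>2) \<le> ((D + near_const) * \<kappa>2 powr m * M)\<^sup>2"
  proof -
    have "y powr (2 * m) = (y powr m)\<^sup>2" for y :: real
      by (simp add: power2_eq_square powr_add[symmetric])
    then have "w (nat \<bar>j\<bar>) = (flat_weight \<mu> m j)\<^sup>2" for j by (simp add: w_def flat_weight_def)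
    then show ?thesis using wsum by (simp only: power_mult_distrib)
  qed
  then have far: "L2_set (\<lambda>j. flat_weight \<mu> m j * cmod (Fc j)) J \<le> (D + near_const) * \<kappa>2 powr m * M"
    using D near_const_nonneg M0 by (subst L2_set_le_iff) auto
  have "L2_set (\<lambda>j. flat_weight \<mu> m j * cmod (\<Sum>l\<in>S. T j l * c l)) J \<le>
      L2_set (\<lambda>j. flat_weight \<mu> m j * cmod (Fc j) + cmod (Ec j)) J"
  proof (rule L2_set_mono)
    fix j
    have "flat_weight \<mu> m j * cmod (Fc j + Ec j) \<le> flat_weight \<mu> m j * (cmod (Fc j) + cmod (Ec j))"
      using flat_weight_pos[of \<mu> m j] by (intro mult_left_mono norm_triangle_ineq) auto
    moreover have "flat_weight \<mu> m j * cmod (Ec j) \<le> 1 * cmod (Ec j)"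
      using m by (intro mult_right_mono flat_weight_le_1) auto
    ultimately show "flat_weight \<mu> m j * cmod (\<Sum>l\<in>S. T j l * c l) \<le> flat_weight \<mu> m j * cmod (Fc j) + cmod (Ec j)"
      unfolding split by (simp add: distrib_left)
    show "0 \<le> flat_weight \<mu> m j * cmod (\<Sum>l\<in>S. T j l * c l)"
      using flat_weight_pos[of \<mu> m j] by auto
  qed
  also have "\<dots> \<le> L2_set (\<lambda>j. flat_weight \<mu> m j * cmod (Fc j)) J + L2_set (\<lambda>j. cmod (Ec j)) J"
    by (rule L2_set_triangle_ineq)
  also have "\<dots> \<le> (D + near_const) * \<kappa>2 powr m * M + near_const * M"
    using far near[OF J] by (intro add_mono) (auto simp: Ec_def)
  finally show "L2_set (\<lambda>j. flat_weight \<mu> m j * cmod (\<Sum>l\<in>S. T j l * c l)) J \<le> ((D + near_const) * \<kappa>2 powr m + near_const) * M"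
    by (simp add: distrib_right)
qed

end

section \<open>The matrix of the powers of the transfer operator\<close>

context expanding_skew
begin

text \<open>The image of the exponential of frequency \<open>l\<close> under the n-th power of the
  transfer operator. \<open>T n \<nu> j l\<close> is then the matrix entry in row \<open>j\<close>
  and column \<open>l\<close>.\<close>

definition wave :: "nat \<Rightarrow> real \<Rightarrow> int \<Rightarrow> real \<Rightarrow> complex" where
  "wave n \<nu> l x = cis (\<nu> * theta n x) * ee l (Phi n x)"

definition T :: "nat \<Rightarrow> real \<Rightarrow> int \<Rightarrow> int \<Rightarrow> complex" where
  "T n \<nu> j l = fourier_coeff (wave n \<nu> l) j"

text \<open>A bound for the L2 operator norm of the n-th power, uniform in \<open>\<nu>\<close>:
  \<open>k ^ n\<close> preimages with Jacobians at most \<open>E_min ^ (- n)\<close>.\<close>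

definition growth :: "nat \<Rightarrow> real" where
  "growth n = sqrt ((real k / E_min k g) ^ n)"

lemma continuous_Phi: "continuous_on UNIV (Phi n)" and continuous_theta: "continuous_on UNIV (theta n)"
  by (rule CN_continuous[OF CN_Phi[of 0]], rule CN_continuous[OF CN_theta[of 0]])

lemma periodic_Phi_compose: "periodic1 U \<Longrightarrow> periodic1 (\<lambda>x. U (Phi n x))"
  unfolding periodic1_def Phi_shift using periodic1_of_int[of U _ "int k ^ n"] by (simp add: periodic1_def)

lemma wave_continuous: "continuous_on UNIV (wave n \<nu> l)" and wave_periodic: "periodic1 (wave n \<nu> l)"
proof -
  show "continuous_on UNIV (wave n \<nu> l)"
    unfolding wave_def [abs_def] by (intro continuous_intros continuous_theta continuous_Phi)
  show "periodic1 (wave n \<nu> l)"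
    using periodic_Phi_compose[OF periodic1_ee, of l n] periodic_theta[of n]
    by (simp add: wave_def periodic1_def)
qed

lemma fourier_coeff_sum:
  assumes "finite S" "\<And>l. l \<in> S \<Longrightarrow> f l \<in> L2_circle"
  shows "fourier_coeff (\<lambda>x. \<Sum>l\<in>S. c l * f l x) j = (\<Sum>l\<in>S. c l * fourier_coeff (f l) j)"
proof -
  have "(LINT x:{0..1}|lborel. ee (- j) x * (\<Sum>l\<in>S. c l * f l x)) = (LINT x:{0..1}|lborel. (\<Sum>l\<in>S. c l * (ee (- j) x * f l x)))"
    by (simp add: sum_distrib_left mult_ac)
  also have "\<dots> = (\<Sum>l\<in>S. c l * fourier_coeff (f l) j)"
    using assms by (simp add: LINT_sum L2_mult_integrable ee_L2 fourier_coeff_ee)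
  finally show ?thesis by (simp add: fourier_coeff_ee)
qed

text \<open>Used with \<open>f = 1\<close>, where \<open>B\<close> is the number
  \<open>k ^ n\<close> of all preimages, and with \<open>f\<close> a squared cutoff, where
  \<open>B\<close> is a number of trapped words. The difference between the two is the gain from
  captivity.\<close>

lemma integral_Phi_compose_bound:
  assumes "continuous_on UNIV f" "periodic1 f" "\<And>x. 0 \<le> f x"
    and B: "\<And>y. y \<in> {0..<1} \<Longrightarrow> iter_sum n f y \<le> B" "0 \<le> B" and S: "finite S"
  shows "integral {0..1} (\<lambda>x. f x * (cmod (\<Sum>l\<in>S. c l * ee l (Phi n x)))\<^sup>2) \<le> B / E_min k g ^ n * (\<Sum>l\<in>S. (cmod (c l))\<^sup>2)"
proof -
  let ?U = "\<lambda>y. (cmod (\<Sum>l\<in>S. c l * ee l y))\<^sup>2"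
  have U: "continuous_on UNIV ?U" "periodic1 ?U" "\<And>x. 0 \<le> ?U x"
    using periodic1_ee by (auto simp: periodic1_def intro!: continuous_intros)
  have pB: "iter_sum n f y \<le> B" for y
    using B(1)[of "frac y"] periodic1_frac[OF iter_sum_props(2)[OF assms(1-3)], of n y] frac_lt_1[of y] by simp
  have "integral {0..1} (\<lambda>x. f x * ?U (Phi n x)) \<le> (1 / E_min k g) ^ n * integral {0..1} (\<lambda>y. iter_sum n f y * ?U y)"
    by (rule integral_Phi_compose_le[OF assms(1-3) U])
  also have "\<dots> \<le> (1 / E_min k g) ^ n * integral {0..1} (\<lambda>y. B * ?U y)"
  proof (intro mult_left_mono integral_le mult_right_mono pB U(3))
    show "(\<lambda>y. iter_sum n f y * ?U y) integrable_on {0..1}"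
      by (intro integrable_continuous_real continuous_on_mult)
         (auto intro: continuous_on_subset[OF iter_sum_props(1)[OF assms(1-3)]] continuous_on_subset[OF U(1)])
    show "(\<lambda>y. B * ?U y) integrable_on {0..1}"
      by (intro integrable_continuous_real continuous_on_mult continuous_on_const continuous_on_subset[OF U(1)]) auto
  qed (use E_min in auto)
  also have "integral {0..1} (\<lambda>y. B * ?U y) = B * integral {0..1} ?U" by simp
  also have "integral {0..1} ?U = (\<Sum>l\<in>S. (cmod (c l))\<^sup>2)"
    using trig_parseval[OF S, of c] LINT_continuous[OF U(1)] by simp
  finally show ?thesis by (simp add: power_divide mult_ac)
qed

lemma iter_sum_1: "iter_sum n (\<lambda>x. 1) y = real k ^ n"
  by (induction n arbitrary: y) (auto simp: branch_sum_def)

lemma T_L2: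
  assumes "finite S" "finite J"
  shows "L2_set (\<lambda>j. cmod (\<Sum>l\<in>S. T n \<nu> j l * c l)) J \<le> growth n * L2_set (\<lambda>l. cmod (c l)) S"
proof -
  define v where "v x = (\<Sum>l\<in>S. c l * wave n \<nu> l x)" for x
  have v: "v \<in> L2_circle"
    unfolding v_def using wave_periodic
    by (intro L2_circle_continuous continuous_intros continuous_on_subset[OF wave_continuous]) (auto simp: periodic1_def)
  have vc: "continuous_on UNIV v"
    unfolding v_def by (intro continuous_intros continuous_on_subset[OF wave_continuous]) auto
  have "(\<Sum>j\<in>J. (cmod (\<Sum>l\<in>S. T n \<nu> j l * c l))\<^sup>2) = (\<Sum>j\<in>J. (cmod (fourier_coeff v j))\<^sup>2)"
    unfolding v_def T_def
    by (subst fourier_coeff_sum[OF assms(1)]) (auto intro!: L2_circle_continuous wave_continuous wave_periodic simp: mult.commute)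
  also have "\<dots> \<le> (LINT x:{0..1}|lborel. (cmod (v x))\<^sup>2)" by (rule bessel_inequality[OF v assms(2)])
  also have "\<dots> = integral {0..1} (\<lambda>x. 1 * (cmod (\<Sum>l\<in>S. c l * ee l (Phi n x)))\<^sup>2)"
  proof -
    have "v x = cis (\<nu> * theta n x) * (\<Sum>l\<in>S. c l * ee l (Phi n x))" for x
      by (simp add: v_def wave_def sum_distrib_left mult_ac)
    then have "cmod (v x) = cmod (\<Sum>l\<in>S. c l * ee l (Phi n x))" for x by (simp add: norm_mult)
    moreover have "(LINT x:{0..1}|lborel. (cmod (v x))\<^sup>2) = integral {0..1} (\<lambda>x. (cmod (v x))\<^sup>2)"
      by (intro LINT_continuous continuous_intros vc)
    ultimately show ?thesis by simp
  qed
  also have "\<dots> \<le> real k ^ n / E_min k g ^ n * (\<Sum>l\<in>S. (cmod (c l))\<^sup>2)"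
    by (rule integral_Phi_compose_bound) (use assms in \<open>auto simp: iter_sum_1 periodic1_def\<close>)
  also have "\<dots> = (growth n * L2_set (\<lambda>l. cmod (c l)) S)\<^sup>2"
    using assms E_min by (simp add: power_mult_distrib L2_set_square growth_def power_divide)
  finally show ?thesis using E_min by (subst L2_set_le_iff) (auto simp: growth_def)
qed

lemma CB_dPhi: "CB N I (\<lambda>_ x. complex_of_real (dPhi n x))"
  and CB_dtheta: "CB N I (\<lambda>_ x. complex_of_real (dtheta n x))"
  using periodic_dPhi periodic_dtheta
  by (auto intro!: CB_of_CN' CN_of_real CN_dPhi CN_dtheta simp: periodic1_def)

lemma phase_deriv:
  "((\<lambda>x. \<nu> * theta n x + 2 * pi * (t * Phi n x) - 2 * pi * s * x) has_real_derivative
     \<nu> * dtheta n x + 2 * pi * (t * dPhi n x) - 2 * pi * s) (at x)"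
  by (auto intro!: derivative_eq_intros DERIV_cmult theta_has_deriv Phi_has_deriv)

lemma phase_periodic:
  "periodic1 (\<lambda>x. cis (\<nu> * theta n x + 2 * pi * (of_int l * Phi n x) - 2 * pi * of_int j * x))"
proof -
  have "cis (\<nu> * theta n x + 2 * pi * (of_int l * Phi n x) - 2 * pi * of_int j * x) = wave n \<nu> l x * ee (- j) x" for x
    by (simp add: wave_def ee_def cis_mult algebra_simps)
  then show ?thesis using wave_periodic[of n \<nu> l] periodic1_ee[of "-j"] by (simp add: periodic1_def)
qed

lemma T_eq_integral:
  "T n \<nu> j l = integral {0..1} (\<lambda>x. cis (\<nu> * theta n x + 2 * pi * (of_int l * Phi n x) - 2 * pi * of_int j * x) * 1)"
proof -
  have "T n \<nu> j l = integral {0..1} (\<lambda>x. ee (- j) x * wave n \<nu> l x)"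
    unfolding T_def fourier_coeff_ee by (intro LINT_continuous continuous_intros wave_continuous)
  moreover have "ee (- j) x * wave n \<nu> l x = cis (\<nu> * theta n x + 2 * pi * (of_int l * Phi n x) - 2 * pi * of_int j * x) * 1" for x
    by (simp add: wave_def ee_def cis_mult algebra_simps)
  ultimately show ?thesis by simp
qed

text \<open>After division by \<open>2 * pi * \<bar>l\<bar>\<close> the phase derivatives form a
  bounded family, because \<open>\<bar>\<nu>\<bar>\<close> is at most a multiple of
  \<open>\<bar>l\<bar> / R\<close>. By \<open>expansion\<close> their modulus is at least
  \<open>\<kappa> ^ n - \<kappa>2\<close>, so no point is stationary. The whole triple
  \<open>(\<nu>, j, l)\<close> is the index, and hence \<open>C\<close> serves all
  \<open>\<nu>\<close>.\<close>

lemma T_decay: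
  assumes R0: "R > 0" and \<kappa>2: "1 < \<kappa>2" "\<kappa>2 < \<kappa> ^ n"
  shows "\<exists>C\<ge>0. \<forall>\<nu> j l. l \<noteq> 0 \<longrightarrow> R * \<bar>\<nu>\<bar> < 2 * pi * \<bar>real_of_int l\<bar> \<longrightarrow> \<bar>real_of_int j\<bar> \<le> \<kappa>2 * \<bar>real_of_int l\<bar> \<longrightarrow>
     cmod (T n \<nu> j l) \<le> C / \<bar>real_of_int l\<bar> ^ N"
proof -
  define I where "I = {(\<nu>, j, l). l \<noteq> 0 \<and> R * \<bar>\<nu>\<bar> < 2 * pi * \<bar>real_of_int l\<bar> \<and> \<bar>real_of_int j\<bar> \<le> \<kappa>2 * \<bar>real_of_int l\<bar>}"
  define lam where "lam = (\<lambda>(\<nu>::real, j::int, l::int). 2 * pi * \<bar>real_of_int l\<bar>)"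
  define p where "p = (\<lambda>(\<nu>::real, j::int, l::int) x. \<nu> / (2 * pi * \<bar>real_of_int l\<bar>) * dtheta n x + sgn (real_of_int l) * dPhi n x - real_of_int j / \<bar>real_of_int l\<bar>)"
  define \<psi> where "\<psi> = (\<lambda>(\<nu>::real, j::int, l::int) x. \<nu> * theta n x + 2 * pi * (of_int l * Phi n x) - 2 * pi * of_int j * x)"
  have lp: "lam i * p i x = (case i of (\<nu>, j, l) \<Rightarrow> \<nu> * dtheta n x + 2 * pi * (of_int l * dPhi n x) - 2 * pi * of_int j)"
    if "i \<in> I" for i x
  proof -
    obtain \<nu> j l where i: "i = (\<nu>, j, l)" by (cases i) auto
    have l: "real_of_int l \<noteq> 0" using that by (auto simp: I_def i)
    have s: "\<bar>real_of_int l\<bar> * sgn (real_of_int l) = real_of_int l" by (simp add: abs_mult_sgn)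
    have "lam i * p i x = \<nu> * dtheta n x + 2 * pi * ((\<bar>real_of_int l\<bar> * sgn (real_of_int l)) * dPhi n x) - 2 * pi * of_int j"
      using l unfolding i lam_def p_def prod.case by (simp add: right_diff_distrib distrib_left)
    then show ?thesis unfolding s by (simp add: i)
  qed
  have "\<exists>C\<ge>0. \<forall>i\<in>I. cmod (integral {0..1} (\<lambda>x. cis (\<psi> i x) * 1)) \<le> C / lam i ^ N"
  proof (rule nonstationary_phase[where p=p and c="\<kappa> ^ n - \<kappa>2"])
    show "CB N I (\<lambda>i x. 1 :: complex)" by (rule CB_const[of _ _ 1]) simp
    have "CB N I (\<lambda>i x. (case i of (\<nu>, j, l) \<Rightarrow> of_real (\<nu> / (2 * pi * \<bar>real_of_int l\<bar>))) * complex_of_real (dtheta n x)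
        + (case i of (\<nu>, j, l) \<Rightarrow> of_real (sgn (real_of_int l))) * complex_of_real (dPhi n x)
        - (case i of (\<nu>, j, l) \<Rightarrow> of_real (real_of_int j / \<bar>real_of_int l\<bar>)))"
    proof (intro CB_diff CB_add CB_scale[OF CB_dtheta] CB_scale[OF CB_dPhi] CB_const)
      fix i assume i: "i \<in> I"
      show "cmod (case i of (\<nu>, j, l) \<Rightarrow> of_real (\<nu> / (2 * pi * \<bar>real_of_int l\<bar>))) \<le> 1 / R"
      proof -
        obtain \<nu> j l where e: "i = (\<nu>, j, l)" by (cases i) auto
        have "l \<noteq> 0" "R * \<bar>\<nu>\<bar> \<le> 2 * pi * \<bar>real_of_int l\<bar>" using i by (auto simp: I_def e)
        then have "\<bar>\<nu>\<bar> / (2 * pi * \<bar>real_of_int l\<bar>) \<le> 1 / R" using R0 by (simp add: divide_simps mult.commute)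
        then show ?thesis unfolding e prod.case norm_of_real by (simp add: abs_divide abs_mult)
      qed
      show "cmod (case i of (\<nu>, j, l) \<Rightarrow> of_real (sgn (real_of_int l))) \<le> 1"
        by (auto simp: sgn_if split: prod.splits)
      show "cmod (case i of (\<nu>, j, l) \<Rightarrow> of_real (real_of_int j / \<bar>real_of_int l\<bar>)) \<le> \<kappa>2"
        using i by (auto simp: I_def abs_divide divide_simps norm_divide)
    qed
    then show "CB N I (\<lambda>i x. complex_of_real (p i x))"
      by (rule CB_cong) (auto simp: p_def split: prod.splits)
    show "(\<psi> i has_real_derivative lam i * p i x) (at x)" if "i \<in> I" for i x
      unfolding lp[OF that] using phase_deriv by (auto simp: \<psi>_def split: prod.splits)
    show "periodic1 (\<lambda>x. cis (\<psi> i x))" for i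
      using phase_periodic by (auto simp: \<psi>_def split: prod.splits)
    show "periodic1 (p i)" for i
      using periodic_dPhi[of n] periodic_dtheta[of n] by (auto simp: p_def periodic1_def split: prod.splits)
    show "lam i > 0" if "i \<in> I" for i using that by (auto simp: I_def lam_def)
    show "1 = (0::complex)" if "i \<in> I" "\<bar>p i x\<bar> < \<kappa> ^ n - \<kappa>2" for i x
    proof -
      obtain \<nu> j l where i: "i = (\<nu>, j, l)" by (cases i) auto
      have l: "l \<noteq> 0" "R * \<bar>\<nu>\<bar> < 2 * pi * \<bar>real_of_int l\<bar>" "\<bar>real_of_int j\<bar> \<le> \<kappa>2 * \<bar>real_of_int l\<bar>"
        using that by (auto simp: I_def i)
      have "R * \<bar>\<nu>\<bar> < \<bar>2 * pi * real_of_int l\<bar>" using l by (simp add: abs_mult)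
      from expansion[OF this, of n x]
      have "\<kappa> ^ n * (2 * pi * \<bar>real_of_int l\<bar>) \<le> \<bar>2 * pi * real_of_int l * dPhi n x + \<nu> * dtheta n x\<bar>" by (simp add: abs_mult)
      moreover have "\<bar>2 * pi * real_of_int j\<bar> \<le> \<kappa>2 * (2 * pi * \<bar>real_of_int l\<bar>)"
        using mult_left_mono[OF l(3), of "2 * pi"] by (simp add: abs_mult mult_ac)
      ultimately have "(\<kappa> ^ n - \<kappa>2) * lam i \<le> \<bar>lam i * p i x\<bar>"
        unfolding lp[OF that(1)] by (simp add: i lam_def left_diff_distrib mult.assoc)
      also have "\<bar>lam i * p i x\<bar> = \<bar>p i x\<bar> * lam i" using l by (simp add: i lam_def abs_mult mult.commute)
      finally show ?thesis using that(2) l by (simp add: i lam_def)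
    qed
  qed (use \<kappa>2 in \<open>auto simp: periodic1_def\<close>)
  then obtain C where C: "C \<ge> 0" "\<And>i. i \<in> I \<Longrightarrow> cmod (integral {0..1} (\<lambda>x. cis (\<psi> i x) * 1)) \<le> C / lam i ^ N" by auto
  have "cmod (T n \<nu> j l) \<le> C / \<bar>real_of_int l\<bar> ^ N"
    if "l \<noteq> 0" "R * \<bar>\<nu>\<bar> < 2 * pi * \<bar>real_of_int l\<bar>" "\<bar>real_of_int j\<bar> \<le> \<kappa>2 * \<bar>real_of_int l\<bar>" for \<nu> j l
  proof -
    have "cmod (T n \<nu> j l) \<le> C / (2 * pi * \<bar>real_of_int l\<bar>) ^ N"
      using C(2)[of "(\<nu>, j, l)"] that by (simp add: I_def \<psi>_def lam_def T_eq_integral)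
    also have "\<dots> \<le> C / \<bar>real_of_int l\<bar> ^ N"
    proof (intro divide_left_mono power_mono C(1))
      show "\<bar>real_of_int l\<bar> \<le> 2 * pi * \<bar>real_of_int l\<bar>"
        using mult_right_mono[of 1 "2 * pi" "\<bar>real_of_int l\<bar>"] pi_gt3 by simp
    qed (use that in auto)
    finally show ?thesis .
  qed
  then show ?thesis using C(1) by blast
qed

end

section \<open>Low frequencies\<close>

text \<open>Almost orthogonality. Each cell has at most three cells at distance at most 1, itself
  included, and these pairs are charged to the diagonal quantities \<open>q\<close>; all remaining
  pairs count as error. The factor 3 does not depend on the number of cells.\<close>

lemma near_far_sum:
  fixes I :: "int \<Rightarrow> int \<Rightarrow> complex" and q :: "int \<Rightarrow> real"
  assumes B: "finite B" and q: "\<And>b. b \<in> B \<Longrightarrow> 0 \<le> q b" and e: "0 \<le> e"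
    and near: "\<And>b b'. b \<in> B \<Longrightarrow> b' \<in> B \<Longrightarrow> cmod (I b b') \<le> (q b + q b') / 2"
    and far: "\<And>b b'. b \<in> B \<Longrightarrow> b' \<in> B \<Longrightarrow> \<bar>b - b'\<bar> \<ge> 2 \<Longrightarrow> cmod (I b b') \<le> e"
  shows "cmod (\<Sum>b\<in>B. \<Sum>b'\<in>B. I b b') \<le> 3 * (\<Sum>b\<in>B. q b) + real (card B ^ 2) * e"
proof -
  define n where "n b b' = (if \<bar>b - b'\<bar> \<le> 1 then 1 else 0 :: real)" for b b' :: int
  have n3: "(\<Sum>b'\<in>B. n b b') \<le> 3" for b
  proof -
    have "(\<Sum>b'\<in>B. n b b') = real (card {b'\<in>B. \<bar>b - b'\<bar> \<le> 1})"
      using B by (simp add: n_def sum.If_cases Int_def)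
    also have "card {b'\<in>B. \<bar>b - b'\<bar> \<le> 1} \<le> card {b - 1..b + 1}" by (intro card_mono) auto
    finally show ?thesis by simp
  qed
  have sym: "n b b' = n b' b" for b b' by (simp add: n_def abs_minus_commute)
  have "cmod (\<Sum>b\<in>B. \<Sum>b'\<in>B. I b b') \<le> (\<Sum>b\<in>B. \<Sum>b'\<in>B. cmod (I b b'))"
    by (intro order_trans[OF norm_sum] sum_mono norm_sum)
  also have "\<dots> \<le> (\<Sum>b\<in>B. \<Sum>b'\<in>B. (n b b' * q b / 2 + n b' b * q b' / 2) + e)"
  proof (intro sum_mono)
    fix b b' assume b: "b \<in> B" "b' \<in> B"
    show "cmod (I b b') \<le> (n b b' * q b / 2 + n b' b * q b' / 2) + e"
    proof (cases "\<bar>b - b'\<bar> \<le> 1")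
      case True
      then show ?thesis using near[OF b] e sym[of b b'] by (simp add: n_def add_divide_distrib)
    next
      case False
      then have "n b b' = 0" "n b' b = 0" by (auto simp: n_def abs_minus_commute)
      then show ?thesis using far[OF b] False by simp
    qed
  qed
  also have "\<dots> = (\<Sum>b\<in>B. (\<Sum>b'\<in>B. n b b') * q b / 2) + (\<Sum>b\<in>B. \<Sum>b'\<in>B. n b' b * q b' / 2) + real (card B ^ 2) * e"
    by (simp add: sum.distrib sum_distrib_right sum_divide_distrib power2_eq_square)
  also have "(\<Sum>b\<in>B. \<Sum>b'\<in>B. n b' b * q b' / 2) = (\<Sum>b\<in>B. (\<Sum>b'\<in>B. n b b') * q b / 2)"
    by (subst sum.swap) (simp add: sum_distrib_right sum_divide_distrib)
  also have "(\<Sum>b\<in>B. (\<Sum>b'\<in>B. n b b') * q b / 2) \<le> (\<Sum>b\<in>B. 3 * q b / 2)"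
    using n3 q by (intro sum_mono divide_right_mono mult_right_mono) auto
  finally show ?thesis by (simp add: sum_distrib_left sum_divide_distrib[symmetric])
qed

lemma card_frequency_le:
  assumes "finite S" "\<And>i. i \<in> S \<Longrightarrow> 2 * pi * \<bar>real_of_int i\<bar> \<le> 2 * R * \<nu>" "1 \<le> \<nu>" "0 \<le> R"
  shows "real (card S) \<le> (2 * R + 1) * \<nu>"
proof -
  have "S \<subseteq> {- \<lfloor>R * \<nu>\<rfloor>..\<lfloor>R * \<nu>\<rfloor>}"
  proof
    fix i assume "i \<in> S"
    then have "pi * \<bar>real_of_int i\<bar> \<le> R * \<nu>" using assms(2)[of i] by simp
    moreover have "\<bar>real_of_int i\<bar> \<le> pi * \<bar>real_of_int i\<bar>" using pi_gt3 mult_right_mono[of 1 pi "\<bar>real_of_int i\<bar>"] by simp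
    ultimately have "real_of_int \<bar>i\<bar> \<le> R * \<nu>" by simp
    then have "\<bar>i\<bar> \<le> \<lfloor>R * \<nu>\<rfloor>" by (simp add: le_floor_iff)
    then show "i \<in> {- \<lfloor>R * \<nu>\<rfloor>..\<lfloor>R * \<nu>\<rfloor>}" by auto
  qed
  then have "card S \<le> card {- \<lfloor>R * \<nu>\<rfloor>..\<lfloor>R * \<nu>\<rfloor>}" by (intro card_mono) auto
  also have "\<dots> = nat (2 * \<lfloor>R * \<nu>\<rfloor> + 1)" by simp
  finally have "real (card S) \<le> real (nat (2 * \<lfloor>R * \<nu>\<rfloor> + 1))" by simp
  also have "\<dots> = 2 * real_of_int \<lfloor>R * \<nu>\<rfloor> + 1" using assms by (simp add: of_nat_nat)
  also have "\<dots> \<le> 2 * (R * \<nu>) + 1" by simp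
  also have "\<dots> \<le> (2 * R + 1) * \<nu>" using assms by (simp add: algebra_simps)
  finally show ?thesis .
qed

lemma sum_le_card_L2:
  assumes "finite S"
  shows "(\<Sum>i\<in>S. cmod (c i)) \<le> sqrt (real (card S)) * L2_set (\<lambda>i. cmod (c i)) S"
  using L2_set_mult_ineq[where A=S and f="\<lambda>_. 1" and g="\<lambda>i. cmod (c i)"] assms by (simp add: L2_set_constant)

section \<open>Cutoffs in phase space and their oscillatory integrals\<close>

context expanding_skew
begin

text \<open>By \<open>snd_F\<close>, the fibre coordinate after \<open>n\<close> steps of the
  trajectory that starts with fibre coordinate \<open>\<xi>\<close> and ends over
  \<open>x\<close>.\<close>

definition fibre_freq :: "nat \<Rightarrow> real \<Rightarrow> real \<Rightarrow> real" where
  "fibre_freq n \<xi> x = \<xi> * dPhi n x + dtheta n x"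

text \<open>A twice differentiable function of the fibre frequency, 1 up to \<open>3 * R\<close> and
  0 from \<open>4 * R\<close> on; note \<open>16 = 9 + 7\<close>. The value \<open>3 * R\<close> is
  the sum of \<open>2 * R\<close>, the range of the output frequency, and two margins
  \<open>R / 2\<close>: one for the cell width and one as distance from stationarity.\<close>

definition cutoff :: "nat \<Rightarrow> real \<Rightarrow> real \<Rightarrow> real" where
  "cutoff n \<xi> x = (max 0 (1 - (max 0 (((fibre_freq n \<xi> x)\<^sup>2 - 9 * R\<^sup>2) / (7 * R\<^sup>2))) ^ 3)) ^ 3"

lemma cutoff_bounds: "0 \<le> cutoff n \<xi> x" "cutoff n \<xi> x \<le> 1"
proof -
  show "0 \<le> cutoff n \<xi> x" by (simp add: cutoff_def)
  have "max 0 (1 - (max 0 y) ^ 3) \<le> 1" for y :: real by simp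
  then show "cutoff n \<xi> x \<le> 1" unfolding cutoff_def by (intro power_le_one) auto
qed

lemma cutoff_eq_1: "\<bar>fibre_freq n \<xi> x\<bar> \<le> 3 * R \<Longrightarrow> cutoff n \<xi> x = 1"
proof -
  assume "\<bar>fibre_freq n \<xi> x\<bar> \<le> 3 * R"
  then have "\<bar>fibre_freq n \<xi> x\<bar>\<^sup>2 \<le> (3 * R)\<^sup>2" by (intro power_mono) auto
  then have "(fibre_freq n \<xi> x)\<^sup>2 \<le> (3 * R)\<^sup>2" by simp
  then have "((fibre_freq n \<xi> x)\<^sup>2 - 9 * R\<^sup>2) / (7 * R\<^sup>2) \<le> 0"
    by (intro divide_nonpos_nonneg) (auto simp: power_mult_distrib)
  then show ?thesis by (simp add: cutoff_def)
qed

lemma cutoff_nonzero: "R > 0 \<Longrightarrow> cutoff n \<xi> x \<noteq> 0 \<Longrightarrow> \<bar>fibre_freq n \<xi> x\<bar> \<le> 4 * R"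
proof (rule ccontr)
  assume a: "R > 0" "cutoff n \<xi> x \<noteq> 0" "\<not> \<bar>fibre_freq n \<xi> x\<bar> \<le> 4 * R"
  then have "(4 * R)\<^sup>2 \<le> \<bar>fibre_freq n \<xi> x\<bar>\<^sup>2" by (intro power_mono) auto
  then have "(4 * R)\<^sup>2 \<le> (fibre_freq n \<xi> x)\<^sup>2" by simp
  then have "1 \<le> ((fibre_freq n \<xi> x)\<^sup>2 - 9 * R\<^sup>2) / (7 * R\<^sup>2)" using a(1) by (simp add: power_mult_distrib field_simps)
  then have "1 \<le> (max 0 (((fibre_freq n \<xi> x)\<^sup>2 - 9 * R\<^sup>2) / (7 * R\<^sup>2))) ^ 3" by (intro one_le_power) auto
  then have "cutoff n \<xi> x = 0" by (simp add: cutoff_def)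
  then show False using a by simp
qed

lemma CN_fibre_freq: "CN m (fibre_freq n \<xi>)"
  unfolding fibre_freq_def [abs_def] by (intro CN_add CN_mult CN_const CN_dPhi CN_dtheta)

lemma CN_cutoff: "CN 2 (cutoff n \<xi>)"
proof -
  have "CN 2 (\<lambda>x. (max 0 (1 + (- 1) * (max 0 (1 / (7 * R\<^sup>2) * (fibre_freq n \<xi> x * fibre_freq n \<xi> x + - (9 * R\<^sup>2)))) ^ 3)) ^ 3)"
    by (intro CN_cube CN_add CN_mult CN_const CN_fibre_freq)
  then show ?thesis by (simp add: cutoff_def [abs_def] power2_eq_square)
qed

lemma periodic_fibre_freq: "periodic1 (fibre_freq n \<xi>)"
  using periodic_dPhi[of n] periodic_dtheta[of n] by (simp add: periodic1_def fibre_freq_def)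

lemma periodic_cutoff: "periodic1 (cutoff n \<xi>)"
  using periodic_fibre_freq[of n \<xi>] by (simp add: periodic1_def cutoff_def)

lemma continuous_cutoff: "continuous_on UNIV (cutoff n \<xi>)"
  by (rule CN_continuous[OF CN_cutoff])

lemma CB_cutoff: "CB 2 {()} (\<lambda>_ x. complex_of_real (cutoff n \<xi> x))"
  using periodic_cutoff by (intro CB_of_CN CN_of_real CN_cutoff) (simp add: periodic1_def)

text \<open>The cutoff at a preimage is nonzero only if the word leading there ends with fibre
  coordinate at most \<open>4 * R\<close>. Those words are counted by
  \<open>captive_words_larger_zone\<close>.\<close>

lemma iter_sum_cutoff:
  assumes R0: "R > 0" and l: "\<kappa> ^ l * R > 4 * R" "l \<le> n" and y: "y \<in> {0..<1}"
  shows "iter_sum n (\<lambda>x. (cutoff n \<xi> x)\<^sup>2) y \<le> real (k ^ l * captive_count k g \<tau> R (n - l))"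
proof -
  have "iter_sum n (\<lambda>x. (cutoff n \<xi> x)\<^sup>2) y = (\<Sum>w\<in>words k n. (cutoff n \<xi> (fst (F w (y, \<xi>))))\<^sup>2)"
    by (rule iter_sum_words) (use periodic_cutoff y in \<open>auto simp: periodic1_def\<close>)
  also have "\<dots> \<le> (\<Sum>w\<in>words k n. if \<bar>snd (F w (y, \<xi>))\<bar> \<le> 4 * R then 1 else 0)"
  proof (rule sum_mono)
    fix w assume "w \<in> words k n"
    then have len: "length w = n" by (simp add: words_def)
    have s: "snd (F w (y, \<xi>)) = fibre_freq n \<xi> (fst (F w (y, \<xi>)))"
      using snd_F[OF y, of w \<xi>] by (simp add: len fibre_freq_def mult.commute)
    show "(cutoff n \<xi> (fst (F w (y, \<xi>))))\<^sup>2 \<le> (if \<bar>snd (F w (y, \<xi>))\<bar> \<le> 4 * R then 1 else 0)"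
      unfolding s using cutoff_nonzero[OF R0, of n \<xi>] cutoff_bounds[of n \<xi>] by (auto intro: power_le_one)
  qed
  also have "\<dots> = real (card {w \<in> words k n. \<bar>snd (F w (y, \<xi>))\<bar> \<le> 4 * R})"
    using finite_words by (simp add: sum.If_cases Int_def)
  also have "card {w \<in> words k n. \<bar>snd (F w (y, \<xi>))\<bar> \<le> 4 * R} \<le> k ^ l * captive_count k g \<tau> R (n - l)"
    by (rule captive_words_larger_zone[OF _ R0 l]) (use y in \<open>auto simp: phase_space_def\<close>)
  finally show ?thesis by simp
qed

text \<open>Where the cutoff differs from 1 the fibre frequency exceeds \<open>3 * R\<close>. The
  output frequency accounts for at most \<open>2 * R\<close>, and replacing
  \<open>2 * pi * i / \<nu>\<close> by its cell value for at most \<open>R / 2\<close>. So the phase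
  derivative divided by \<open>\<nu>\<close> is at least \<open>R / 2\<close>, and two integrations
  by parts give the square of \<open>1 / \<nu>\<close>.\<close>

lemma cutoff_complement_decay:
  assumes R0: "R > 0" and \<rho>: "\<And>x. \<rho> * dPhi n x \<le> R / 2" "\<rho> > 0" and B: "finite B"
  shows "\<exists>C\<ge>0. \<forall>\<nu>>0. \<forall>i j. \<forall>b\<in>B. \<bar>2 * pi * of_int i\<bar> \<le> 2 * R * \<nu> \<longrightarrow> \<bar>2 * pi * of_int j\<bar> \<le> 2 * R * \<nu> \<longrightarrow>
     \<bar>2 * pi * of_int i / \<nu> - \<rho> * of_int b\<bar> \<le> \<rho> \<longrightarrow>
     cmod (integral {0..1} (\<lambda>x. cis (\<nu> * theta n x + 2 * pi * (of_int i * Phi n x) - 2 * pi * of_int j * x) *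
       (1 - of_real (cutoff n (\<rho> * of_int (b::int)) x)))) \<le> C / \<nu>\<^sup>2"
proof -
  define I where "I = {(\<nu>::real, i::int, j::int, b). \<nu> > 0 \<and> b \<in> B \<and> \<bar>2 * pi * of_int i\<bar> \<le> 2 * R * \<nu> \<and>
     \<bar>2 * pi * of_int j\<bar> \<le> 2 * R * \<nu> \<and> \<bar>2 * pi * of_int i / \<nu> - \<rho> * of_int b\<bar> \<le> \<rho>}"
  define p where "p = (\<lambda>(\<nu>::real, i::int, j::int, b::int) x. dtheta n x + 2 * pi * of_int i / \<nu> * dPhi n x - 2 * pi * of_int j / \<nu>)"
  define \<psi> where "\<psi> = (\<lambda>(\<nu>::real, i::int, j::int, b::int) x. \<nu> * theta n x + 2 * pi * (of_int i * Phi n x) - 2 * pi * of_int j * x)"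
  define a where "a = (\<lambda>(\<nu>::real, i::int, j::int, b::int) x. 1 - complex_of_real (cutoff n (\<rho> * of_int b) x))"
  have div: "\<bar>t / \<nu>\<bar> \<le> 2 * R" if "\<bar>t\<bar> \<le> 2 * R * \<nu>" "\<nu> > 0" for t \<nu>
    using that by (simp add: abs_divide divide_le_eq)
  have "\<exists>C\<ge>0. \<forall>i\<in>I. cmod (integral {0..1} (\<lambda>x. cis (\<psi> i x) * a i x)) \<le> C / fst i ^ 2"
  proof (rule nonstationary_phase[where p=p and c="R / 2"])
    have "CB 2 B (\<lambda>b x. complex_of_real (cutoff n (\<rho> * of_int b) x))" by (rule CB_finite[OF B CB_cutoff])
    then have "CB 2 I (\<lambda>i x. complex_of_real (cutoff n (\<rho> * of_int (snd (snd (snd i)))) x))"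
      by (rule CB_reindex) (auto simp: I_def)
    then have "CB 2 I (\<lambda>i x. 1 - complex_of_real (cutoff n (\<rho> * of_int (snd (snd (snd i)))) x))"
      by (intro CB_diff CB_const[of _ _ 1]) auto
    then show "CB 2 I a" by (rule CB_cong) (auto simp: a_def)
    have "CB 2 I (\<lambda>i x. complex_of_real (dtheta n x) + (case i of (\<nu>, i, j, b) \<Rightarrow> of_real (2 * pi * of_int i / \<nu>)) * complex_of_real (dPhi n x)
        - (case i of (\<nu>, i, j, b) \<Rightarrow> of_real (2 * pi * of_int j / \<nu>)))"
    proof (intro CB_diff CB_add CB_dtheta CB_scale[OF CB_dPhi] CB_const)
      fix i assume i: "i \<in> I"
      obtain \<nu> u j b where e: "i = (\<nu>, u, j, b)" by (cases i) auto
      have u: "\<bar>2 * pi * of_int u\<bar> \<le> 2 * R * \<nu>" "\<bar>2 * pi * of_int j\<bar> \<le> 2 * R * \<nu>" "\<nu> > 0"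
        using i by (auto simp: I_def e)
      show "cmod (case i of (\<nu>, i, j, b) \<Rightarrow> of_real (2 * pi * of_int i / \<nu>)) \<le> 2 * R"
        "cmod (case i of (\<nu>, i, j, b) \<Rightarrow> of_real (2 * pi * of_int j / \<nu>)) \<le> 2 * R"
        unfolding e prod.case norm_of_real by (rule div; fact)+
    qed
    then show "CB 2 I (\<lambda>i x. complex_of_real (p i x))"
      by (rule CB_cong) (auto simp: p_def split: prod.splits)
    show "(\<psi> i has_real_derivative fst i * p i x) (at x)" if "i \<in> I" for i x
    proof -
      obtain \<nu> u j b where e: "i = (\<nu>, u, j, b)" by (cases i) auto
      have "fst i * p i x = \<nu> * dtheta n x + 2 * pi * (of_int u * dPhi n x) - 2 * pi * of_int j"
        using that by (simp add: e p_def I_def algebra_simps)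
      then show ?thesis using phase_deriv[of \<nu> n "of_int u" "of_int j" x] by (simp add: \<psi>_def e)
    qed
    show "periodic1 (\<lambda>x. cis (\<psi> i x))" for i
      using phase_periodic by (auto simp: \<psi>_def split: prod.splits)
    show "periodic1 (p i)" for i
      using periodic_dPhi[of n] periodic_dtheta[of n] by (auto simp: p_def periodic1_def split: prod.splits)
    show "periodic1 (a i)" for i
      using periodic_cutoff[of n] by (auto simp: a_def periodic1_def split: prod.splits)
    show "fst i > 0" if "i \<in> I" for i using that by (auto simp: I_def)
    show "a i x = 0" if i: "i \<in> I" "\<bar>p i x\<bar> < R / 2" for i x
    proof -
      obtain \<nu> u j b where e: "i = (\<nu>, u, j, b)" by (cases i) auto
      have j: "\<bar>2 * pi * of_int j / \<nu>\<bar> \<le> 2 * R" by (rule div) (use i(1) in \<open>auto simp: I_def e\<close>)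
      have "\<bar>(2 * pi * of_int u / \<nu> - \<rho> * of_int b) * dPhi n x\<bar> \<le> \<rho> * dPhi n x"
        using i(1) dPhi_ge[of n x] E_min by (auto simp: I_def e abs_mult intro!: mult_mono)
           (smt (verit) zero_less_power)
      then have "\<bar>(2 * pi * of_int u / \<nu> - \<rho> * of_int b) * dPhi n x\<bar> \<le> R / 2" using \<rho>(1)[of x] by linarith
      moreover have "fibre_freq n (\<rho> * of_int b) x = p i x + 2 * pi * of_int j / \<nu> - (2 * pi * of_int u / \<nu> - \<rho> * of_int b) * dPhi n x"
        by (simp add: fibre_freq_def e p_def algebra_simps)
      moreover have "\<bar>s + t - r\<bar> \<le> 3 * R" if "\<bar>r\<bar> \<le> R / 2" "\<bar>s\<bar> < R / 2" "\<bar>t\<bar> \<le> 2 * R" for r s t :: real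
        using that by linarith
      ultimately have "\<bar>fibre_freq n (\<rho> * of_int b) x\<bar> \<le> 3 * R" using i(2) j by metis
      from cutoff_eq_1[OF this] show ?thesis by (simp add: a_def e)
    qed
  qed (use R0 in auto)
  then obtain C where C: "C \<ge> 0" "\<And>i. i \<in> I \<Longrightarrow> cmod (integral {0..1} (\<lambda>x. cis (\<psi> i x) * a i x)) \<le> C / fst i ^ 2" by auto
  show ?thesis
  proof (intro exI[of _ C] conjI allI ballI impI C(1))
    fix \<nu> :: real and i j b
    assume "0 < \<nu>" "b \<in> B" "\<bar>2 * pi * of_int i\<bar> \<le> 2 * R * \<nu>" "\<bar>2 * pi * of_int j\<bar> \<le> 2 * R * \<nu>"
      "\<bar>2 * pi * of_int i / \<nu> - \<rho> * of_int b\<bar> \<le> \<rho>"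
    then show "cmod (integral {0..1} (\<lambda>x. cis (\<nu> * theta n x + 2 * pi * (of_int i * Phi n x) - 2 * pi * of_int j * x) *
       (1 - of_real (cutoff n (\<rho> * of_int b) x)))) \<le> C / \<nu>\<^sup>2"
      using C(2)[of "(\<nu>, i, j, b)"] by (simp add: I_def \<psi>_def a_def)
  qed
qed

text \<open>In the product of one wave with the conjugate of another the factor containing
  \<open>\<nu>\<close> cancels. The remaining phase is a multiple of \<open>Phi n\<close>, whose
  derivative is at least 1, so the bound does not involve \<open>\<nu>\<close>.\<close>

lemma cutoff_gram_decay:
  assumes B: "finite B"
  shows "\<exists>C\<ge>0. \<forall>b\<in>B. \<forall>b'\<in>B. \<forall>i i'::int. i \<noteq> i' \<longrightarrow>
     cmod (integral {0..1} (\<lambda>x. ee (i - i') (Phi n x) * of_real (cutoff n (\<rho> * of_int (b::int)) x * cutoff n (\<rho> * of_int b') x)))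
       \<le> C / (2 * pi * \<bar>of_int (i - i')\<bar>)\<^sup>2"
proof -
  define I where "I = {(b, b', d::int). b \<in> B \<and> b' \<in> B \<and> d \<noteq> 0}"
  define lam where "lam = (\<lambda>(b::int, b'::int, d::int). 2 * pi * \<bar>real_of_int d\<bar>)"
  define p where "p = (\<lambda>(b::int, b'::int, d::int) x. sgn (real_of_int d) * dPhi n x)"
  define \<psi> where "\<psi> = (\<lambda>(b::int, b'::int, d::int) x. 2 * pi * real_of_int d * Phi n x)"
  define a where "a = (\<lambda>(b::int, b'::int, d::int) x. complex_of_real (cutoff n (\<rho> * of_int b) x) * of_real (cutoff n (\<rho> * of_int b') x))"
  have "\<exists>C\<ge>0. \<forall>i\<in>I. cmod (integral {0..1} (\<lambda>x. cis (\<psi> i x) * a i x)) \<le> C / lam i ^ 2"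
  proof (rule nonstationary_phase[where p=p and c=1])
    have c: "CB 2 B (\<lambda>b x. complex_of_real (cutoff n (\<rho> * of_int b) x))" by (rule CB_finite[OF B CB_cutoff])
    have "CB 2 I (\<lambda>i x. complex_of_real (cutoff n (\<rho> * of_int (fst i)) x) * complex_of_real (cutoff n (\<rho> * of_int (fst (snd i))) x))"
      by (intro CB_mult CB_reindex[OF c]) (auto simp: I_def)
    then show "CB 2 I a" by (rule CB_cong) (auto simp: a_def)
    have "CB 2 I (\<lambda>i x. of_real (sgn (real_of_int (snd (snd i)))) * complex_of_real (dPhi n x))"
      by (rule CB_scale[OF CB_dPhi, of _ _ 1]) (auto simp: sgn_if)
    then show "CB 2 I (\<lambda>i x. complex_of_real (p i x))"
      by (rule CB_cong) (auto simp: p_def)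
    show "(\<psi> i has_real_derivative lam i * p i x) (at x)" if "i \<in> I" for i x
    proof -
      obtain b b' d where e: "i = (b, b', d)" by (cases i) auto
      have "lam i * p i x = 2 * pi * real_of_int d * dPhi n x"
        by (simp add: lam_def p_def e abs_mult_sgn[symmetric] mult.assoc) (metis abs_mult_sgn mult.assoc)
      then show ?thesis by (auto simp: \<psi>_def e intro!: DERIV_cmult Phi_has_deriv)
    qed
    show "periodic1 (\<lambda>x. cis (\<psi> i x))" for i
      using periodic_Phi_compose[OF periodic1_ee, of "snd (snd i)" n]
      by (auto simp: \<psi>_def periodic1_def ee_def split: prod.splits)
    show "periodic1 (p i)" for i
      using periodic_dPhi[of n] by (auto simp: p_def periodic1_def split: prod.splits)
    show "periodic1 (a i)" for i
      using periodic_cutoff[of n] by (auto simp: a_def periodic1_def split: prod.splits)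
    show "lam i > 0" if "i \<in> I" for i using that by (auto simp: I_def lam_def)
    show "a i x = 0" if i: "i \<in> I" "\<bar>p i x\<bar> < 1" for i x
    proof -
      have "E_min k g ^ n \<ge> 1" using E_min by simp
      then have "\<bar>p i x\<bar> \<ge> 1" using i(1) dPhi_ge[of n x] by (auto simp: p_def I_def abs_mult sgn_if split: prod.splits)
      then show ?thesis using i(2) by simp
    qed
  qed auto
  then obtain C where C: "C \<ge> 0" "\<And>i. i \<in> I \<Longrightarrow> cmod (integral {0..1} (\<lambda>x. cis (\<psi> i x) * a i x)) \<le> C / lam i ^ 2" by auto
  show ?thesis
  proof (intro exI[of _ C] conjI allI ballI impI C(1))
    fix b b' and i i' :: int
    assume "b \<in> B" "b' \<in> B" "i \<noteq> i'"
    then show "cmod (integral {0..1} (\<lambda>x. ee (i - i') (Phi n x) * of_real (cutoff n (\<rho> * of_int b) x * cutoff n (\<rho> * of_int b') x)))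
       \<le> C / (2 * pi * \<bar>of_int (i - i')\<bar>)\<^sup>2"
      using C(2)[of "(b, b', i - i')"] by (simp add: I_def \<psi>_def a_def lam_def ee_def)
  qed
qed

end

section \<open>The block of low frequencies\<close>

context expanding_skew
begin

text \<open>The rescaled input frequencies are sorted into cells of width \<open>\<rho>\<close>,
  each with one cutoff. Within a cell the trapped words are counted; neighbouring cells are handled
  by the inequality between means, distant ones by decay of the Gram matrix. The 6 is 3 for the
  neighbours times 2 for splitting off the part outside the cutoffs.\<close>

lemma low_frequency_bound:
  assumes R0: "R > 0" and l: "\<kappa> ^ l * R > 4 * R" "l \<le> n"
  shows "\<exists>C\<ge>0. \<forall>\<nu>\<ge>1. \<forall>S J c. finite S \<longrightarrow> finite J \<longrightarrow>
     (\<forall>i\<in>S. 2 * pi * \<bar>real_of_int i\<bar> \<le> 2 * R * \<nu>) \<longrightarrow> (\<forall>j\<in>J. 2 * pi * \<bar>real_of_int j\<bar> \<le> 2 * R * \<nu>) \<longrightarrow>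
     (L2_set (\<lambda>j. cmod (\<Sum>i\<in>S. T n \<nu> j i * c i)) J)\<^sup>2 \<le>
       (6 * real (k ^ l * captive_count k g \<tau> R (n - l)) / E_min k g ^ n + C / \<nu>) * (L2_set (\<lambda>i. cmod (c i)) S)\<^sup>2"
proof -
  define Ncap where "Ncap = real (k ^ l * captive_count k g \<tau> R (n - l))"
  have "continuous_on UNIV (dPhi n)" by (rule CN_continuous[OF CN_dPhi[of 0]])
  then obtain Mx where Mx: "\<And>x. norm (dPhi n x) \<le> Mx" using periodic_bounded periodic_dPhi by blast
  have dPhi1: "1 \<le> dPhi n x" for x
    using dPhi_ge[of n x] one_le_power[of "E_min k g" n] E_min by linarith
  have Mx1: "Mx \<ge> 1" and dPhiM: "\<And>x. dPhi n x \<le> Mx"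
    using Mx dPhi1 by (auto simp: abs_le_iff intro: order_trans)
  \<comment> \<open>The width is chosen so that a change of \<open>\<xi>\<close> by
    \<open>\<rho>\<close> moves the fibre frequency by at most \<open>R / 2\<close>.\<close>
  define \<rho> where "\<rho> = R / (2 * Mx)"
  have \<rho>0: "\<rho> > 0" using R0 Mx1 by (simp add: \<rho>_def)
  have \<rho>: "\<rho> * dPhi n x \<le> R / 2" for x
    using mult_left_mono[OF dPhiM[of x], of \<rho>] \<rho>0 Mx1 by (simp add: \<rho>_def)
  \<comment> \<open>Rescaled frequencies are at most \<open>2 * R\<close> in modulus, hence at most
    \<open>4 * Mx\<close> in units of \<open>\<rho>\<close>; the extra 2 covers rounding. The set
    does not depend on \<open>\<nu>\<close>.\<close>
  define B where "B = {- \<lceil>4 * Mx + 2\<rceil>..\<lceil>4 * Mx + 2\<rceil>}"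
  have finB: "finite B" by (simp add: B_def)
  obtain C1 where C1: "C1 \<ge> 0" and C1b: "\<forall>\<nu>>0. \<forall>i j. \<forall>b\<in>B. \<bar>2 * pi * of_int i\<bar> \<le> 2 * R * \<nu> \<longrightarrow> \<bar>2 * pi * of_int j\<bar> \<le> 2 * R * \<nu> \<longrightarrow>
     \<bar>2 * pi * of_int i / \<nu> - \<rho> * of_int b\<bar> \<le> \<rho> \<longrightarrow>
     cmod (integral {0..1} (\<lambda>x. cis (\<nu> * theta n x + 2 * pi * (of_int i * Phi n x) - 2 * pi * of_int j * x) *
       (1 - of_real (cutoff n (\<rho> * of_int (b::int)) x)))) \<le> C1 / \<nu>\<^sup>2"
    using cutoff_complement_decay[OF R0 \<rho> \<rho>0 finB] by (elim exE conjE) (rule that)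
  obtain C2 where C2: "C2 \<ge> 0" and C2b: "\<forall>b\<in>B. \<forall>b'\<in>B. \<forall>i i'::int. i \<noteq> i' \<longrightarrow>
     cmod (integral {0..1} (\<lambda>x. ee (i - i') (Phi n x) * of_real (cutoff n (\<rho> * of_int (b::int)) x * cutoff n (\<rho> * of_int b') x)))
       \<le> C2 / (2 * pi * \<bar>of_int (i - i')\<bar>)\<^sup>2"
    using cutoff_gram_decay[OF finB, of n \<rho>] by (elim exE conjE) (rule that)
  define K where "K = 2 * R + 1"
  have K0: "K > 0" using R0 by (simp add: K_def)
  define C where "C = 2 * (real (card B ^ 2) * (C2 * K / \<rho>\<^sup>2)) + 2 * (C1 * K)\<^sup>2"
  have C0: "C \<ge> 0" using C2 K0 by (simp add: C_def)
  have main: "(L2_set (\<lambda>j. cmod (\<Sum>i\<in>S. T n \<nu> j i * c i)) J)\<^sup>2 \<le>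
       (6 * Ncap / E_min k g ^ n + C / \<nu>) * (L2_set (\<lambda>i. cmod (c i)) S)\<^sup>2"
    if \<nu>: "\<nu> \<ge> 1" and S: "finite S" "\<And>i. i \<in> S \<Longrightarrow> 2 * pi * \<bar>real_of_int i\<bar> \<le> 2 * R * \<nu>"
      and J: "finite J" "\<And>j. j \<in> J \<Longrightarrow> 2 * pi * \<bar>real_of_int j\<bar> \<le> 2 * R * \<nu>" for \<nu> S J c
  proof -
    define X where "X = L2_set (\<lambda>i. cmod (c i)) S"
    have X0: "X \<ge> 0" by (simp add: X_def)
    define bin where "bin i = \<lfloor>2 * pi * real_of_int i / \<nu> / \<rho>\<rfloor>" for i
    have bin_lo: "\<rho> * of_int (bin i) \<le> 2 * pi * real_of_int i / \<nu>" for i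
    proof -
      have "of_int (bin i) \<le> 2 * pi * real_of_int i / \<nu> / \<rho>" unfolding bin_def by (rule of_int_floor_le)
      from mult_right_mono[OF this, of \<rho>] show ?thesis using \<rho>0 by (simp add: mult.commute[of \<rho>])
    qed
    have bin_hi: "2 * pi * real_of_int i / \<nu> < \<rho> * (of_int (bin i) + 1)" for i
    proof -
      have "2 * pi * real_of_int i / \<nu> / \<rho> < of_int (bin i) + 1" unfolding bin_def by linarith
      from mult_strict_right_mono[OF this \<rho>0] show ?thesis using \<rho>0 by (simp add: mult.commute[of \<rho>])
    qed
    have binB: "bin i \<in> B" if "i \<in> S" for i
    proof -
      define t where "t = 2 * pi * real_of_int i / \<nu> / \<rho>"
      have "\<bar>t\<bar> = 2 * pi * \<bar>real_of_int i\<bar> / \<nu> / \<rho>" using \<nu> \<rho>0 by (simp add: t_def abs_mult)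
      also have "\<dots> \<le> 2 * R / \<rho>"
        using S(2)[OF that] \<nu> \<rho>0 by (intro divide_right_mono) (auto simp: divide_le_eq)
      also have "\<dots> = 4 * Mx" using R0 Mx1 by (simp add: \<rho>_def)
      finally have "\<bar>t\<bar> \<le> 4 * Mx" .
      then have "real_of_int (bin i) \<le> real_of_int \<lceil>4 * Mx + 2\<rceil>" "real_of_int (- \<lceil>4 * Mx + 2\<rceil>) \<le> real_of_int (bin i)"
        unfolding bin_def t_def[symmetric] by linarith+
      then show ?thesis unfolding B_def by simp
    qed
    have bin_near: "\<bar>2 * pi * of_int i / \<nu> - \<rho> * of_int (bin i)\<bar> \<le> \<rho>" for i
      using bin_lo[of i] bin_hi[of i] by (simp add: distrib_left)
    define \<beta> where "\<beta> b = cutoff n (\<rho> * of_int b)" for b :: int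
    have c\<beta>: "continuous_on A (\<beta> b)" for A b
      unfolding \<beta>_def by (rule continuous_on_subset[OF continuous_cutoff]) simp
    have cw: "continuous_on A (wave n \<nu> i)" for A i
      by (rule continuous_on_subset[OF wave_continuous]) simp
    define u where "u i x = complex_of_real (\<beta> (bin i) x) * wave n \<nu> i x" for i x
    have cu: "continuous_on A (u i)" for A i unfolding u_def [abs_def] by (intro continuous_intros c\<beta> cw)
    have pu: "periodic1 (u i)" for i
      using wave_periodic[of n \<nu> i] periodic_cutoff[of n "\<rho> * of_int (bin i)"] by (simp add: periodic1_def u_def \<beta>_def)
    define Sb where "Sb b = {i\<in>S. bin i = b}" for b
    have finSb: "finite (Sb b)" for b using S by (simp add: Sb_def)
    define V where "V b x = (\<Sum>i\<in>Sb b. c i * u i x)" for b x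
    have cV: "continuous_on A (V b)" for A b unfolding V_def [abs_def] by (intro continuous_intros cu)
    define v where "v x = (\<Sum>i\<in>S. c i * u i x)" for x
    have cv: "continuous_on A v" for A unfolding v_def [abs_def] by (intro continuous_intros cu)
    have group: "(\<Sum>b\<in>B. \<Sum>i\<in>Sb b. f i) = (\<Sum>i\<in>S. f i)" for f :: "int \<Rightarrow> 'z::comm_monoid_add"
      unfolding Sb_def using binB by (intro sum.group S finB) auto
    have vV: "v x = (\<Sum>b\<in>B. V b x)" for x unfolding v_def V_def by (rule group[symmetric])
    have v_in: "v \<in> L2_circle"
      by (rule L2_circle_continuous[OF cv]) (use pu in \<open>auto simp: v_def periodic1_def\<close>)
    have sumc: "(\<Sum>i\<in>S. cmod (c i)) \<le> sqrt (K * \<nu>) * X"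
      using sum_le_card_L2[OF S(1), of c] card_frequency_le[OF S \<nu>] R
      by (auto simp: X_def K_def intro: order_trans intro!: mult_right_mono)
    define r where "r j = (\<Sum>i\<in>S. c i * (T n \<nu> j i - fourier_coeff (u i) j))" for j
    have rb: "cmod (r j) \<le> C1 / \<nu>\<^sup>2 * (sqrt (K * \<nu>) * X)" if j: "j \<in> J" for j
    proof -
      have d: "cmod (T n \<nu> j i - fourier_coeff (u i) j) \<le> C1 / \<nu>\<^sup>2" if i: "i \<in> S" for i
      proof -
        have "T n \<nu> j i - fourier_coeff (u i) j = integral {0..1} (\<lambda>x. ee (- j) x * wave n \<nu> i x) - integral {0..1} (\<lambda>x. ee (- j) x * u i x)"
          unfolding T_def fourier_coeff_ee by (simp add: LINT_continuous continuous_intros cw cu)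
        also have "\<dots> = integral {0..1} (\<lambda>x. ee (- j) x * wave n \<nu> i x - ee (- j) x * u i x)"
          by (intro integral_diff[symmetric] integrable_continuous_real continuous_intros cw cu)
        also have "(\<lambda>x. ee (- j) x * wave n \<nu> i x - ee (- j) x * u i x) =
          (\<lambda>x. cis (\<nu> * theta n x + 2 * pi * (of_int i * Phi n x) - 2 * pi * of_int j * x) * (1 - of_real (cutoff n (\<rho> * of_int (bin i)) x)))"
        proof
          fix x
          have "cis (\<nu> * theta n x + 2 * pi * (of_int i * Phi n x) - 2 * pi * of_int j * x) = ee (- j) x * wave n \<nu> i x"
            by (simp add: wave_def ee_def cis_mult algebra_simps)
          then show "ee (- j) x * wave n \<nu> i x - ee (- j) x * u i x =
             cis (\<nu> * theta n x + 2 * pi * (of_int i * Phi n x) - 2 * pi * of_int j * x) * (1 - of_real (cutoff n (\<rho> * of_int (bin i)) x))"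
            by (simp add: u_def \<beta>_def algebra_simps)
        qed
        also have "cmod (integral {0..1} \<dots>) \<le> C1 / \<nu>\<^sup>2"
          by (rule C1b[rule_format]) (use \<nu> binB[OF i] bin_near S(2)[OF i] J(2)[OF j] in \<open>auto simp: abs_mult\<close>)
        finally show ?thesis .
      qed
      have "cmod (r j) \<le> (\<Sum>i\<in>S. cmod (c i) * (C1 / \<nu>\<^sup>2))"
        unfolding r_def
        by (rule order_trans[OF norm_sum], rule sum_mono, unfold norm_mult, rule mult_left_mono[OF d]) auto
      also have "\<dots> = C1 / \<nu>\<^sup>2 * (\<Sum>i\<in>S. cmod (c i))" unfolding sum_distrib_right[symmetric] by (rule mult.commute)
      also have "\<dots> \<le> C1 / \<nu>\<^sup>2 * (sqrt (K * \<nu>) * X)" using C1 by (intro mult_left_mono sumc) auto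
      finally show ?thesis .
    qed
    \<comment> \<open>The entries of the remainder are of order \<open>1 / \<nu>\<close> squared.
      The sum over inputs and the norm over outputs each cost \<open>sqrt (K * \<nu>)\<close> by
      Cauchy-Schwarz, which leaves \<open>1 / \<nu>\<close>.\<close>
    have rL: "L2_set (\<lambda>j. cmod (r j)) J \<le> C1 * K / \<nu> * X"
    proof -
      have "L2_set (\<lambda>j. cmod (r j)) J \<le> L2_set (\<lambda>j. C1 / \<nu>\<^sup>2 * (sqrt (K * \<nu>) * X)) J"
        by (intro L2_set_mono rb) auto
      also have "\<dots> = sqrt (real (card J)) * (C1 / \<nu>\<^sup>2 * (sqrt (K * \<nu>) * X))"
        using C1 X0 K0 \<nu> by (simp add: L2_set_constant abs_mult)
      also have "\<dots> \<le> sqrt (K * \<nu>) * (C1 / \<nu>\<^sup>2 * (sqrt (K * \<nu>) * X))"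
        using card_frequency_le[OF J \<nu>] R C1 X0 K0 \<nu> by (intro mult_right_mono) (auto simp: K_def)
      also have "\<dots> = (sqrt (K * \<nu>) * sqrt (K * \<nu>)) * (C1 / \<nu>\<^sup>2 * X)" by simp
      also have "\<dots> = C1 * K / \<nu> * X" using K0 \<nu> by (simp add: power2_eq_square)
      finally show ?thesis .
    qed
    have Tsplit: "(\<Sum>i\<in>S. T n \<nu> j i * c i) = fourier_coeff v j + r j" for j
    proof -
      have "fourier_coeff v j = (\<Sum>i\<in>S. c i * fourier_coeff (u i) j)"
        unfolding v_def by (rule fourier_coeff_sum[OF S(1) L2_circle_continuous[OF cu pu]])
      then show ?thesis by (simp add: r_def sum.distrib[symmetric] algebra_simps)
    qed
    define q where "q b = integral {0..1} (\<lambda>x. (cmod (V b x))\<^sup>2)" for b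
    have qb: "q b \<le> Ncap / E_min k g ^ n * (\<Sum>i\<in>Sb b. (cmod (c i))\<^sup>2)" for b
    proof -
      have "(cmod (V b x))\<^sup>2 = (\<beta> b x)\<^sup>2 * (cmod (\<Sum>i\<in>Sb b. c i * ee i (Phi n x)))\<^sup>2" for x
      proof -
        have "V b x = complex_of_real (\<beta> b x) * cis (\<nu> * theta n x) * (\<Sum>i\<in>Sb b. c i * ee i (Phi n x))"
          unfolding V_def sum_distrib_left by (rule sum.cong) (auto simp: Sb_def u_def wave_def)
        then show ?thesis by (simp add: norm_mult power_mult_distrib)
      qed
      then have "q b = integral {0..1} (\<lambda>x. (\<beta> b x)\<^sup>2 * (cmod (\<Sum>i\<in>Sb b. c i * ee i (Phi n x)))\<^sup>2)" by (simp add: q_def)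
      also have "\<dots> \<le> Ncap / E_min k g ^ n * (\<Sum>i\<in>Sb b. (cmod (c i))\<^sup>2)"
      proof (rule integral_Phi_compose_bound)
        show "continuous_on UNIV (\<lambda>x. (\<beta> b x)\<^sup>2)" by (intro continuous_intros c\<beta>)
        show "periodic1 (\<lambda>x. (\<beta> b x)\<^sup>2)" using periodic_cutoff by (simp add: periodic1_def \<beta>_def)
        show "iter_sum n (\<lambda>x. (\<beta> b x)\<^sup>2) y \<le> Ncap" if "y \<in> {0..<1}" for y
          unfolding \<beta>_def Ncap_def by (rule iter_sum_cutoff[OF R0 l that])
      qed (auto simp: Ncap_def finSb)
      finally show ?thesis .
    qed
    define I where "I b b' = integral {0..1} (\<lambda>x. V b x * cnj (V b' x))" for b b'
    have iV: "(\<lambda>x. V b x * cnj (V b' x)) integrable_on {0..1}" for b b'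
      by (intro integrable_continuous_real continuous_intros cV)
    have iV2: "(\<lambda>x. (cmod (V b x))\<^sup>2) integrable_on {0..1}" for b
      by (intro integrable_continuous_real continuous_intros cV)
    have q0: "q b \<ge> 0" for b unfolding q_def by (intro integral_nonneg iV2) auto
    have near: "cmod (I b b') \<le> (q b + q b') / 2" for b b'
    proof -
      have "cmod (I b b') \<le> integral {0..1} (\<lambda>x. (1/2) * ((cmod (V b x))\<^sup>2 + (cmod (V b' x))\<^sup>2))"
        unfolding I_def
      proof (rule integral_norm_bound_integral[OF iV])
        show "(\<lambda>x. (1/2) * ((cmod (V b x))\<^sup>2 + (cmod (V b' x))\<^sup>2)) integrable_on {0..1}"
          by (intro integrable_on_mult_right integrable_add iV2)
        show "cmod (V b x * cnj (V b' x)) \<le> (1/2) * ((cmod (V b x))\<^sup>2 + (cmod (V b' x))\<^sup>2)" for x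
          using sum_squares_bound[of "cmod (V b x)" "cmod (V b' x)"] by (simp add: norm_mult)
      qed
      also have "\<dots> = (q b + q b') / 2"
        using iV2 by (simp add: integral_add q_def)
      finally show ?thesis .
    qed
    define e where "e = C2 * K / \<rho>\<^sup>2 / \<nu> * X\<^sup>2"
    \<comment> \<open>Frequencies from cells at distance at least 2 differ by at least
      \<open>\<rho> * \<nu> / (2 * pi)\<close>, so each Gram entry is of order
      \<open>1 / \<nu>\<close> squared. The double sum costs \<open>K * \<nu>\<close>, and again
      \<open>1 / \<nu>\<close> remains.\<close>
    have far: "cmod (I b b') \<le> e" if b: "b \<in> B" "b' \<in> B" "\<bar>b - b'\<bar> \<ge> 2" for b b'
    proof -
      have G: "cmod (integral {0..1} (\<lambda>x. ee (i - i') (Phi n x) * of_real (\<beta> b x * \<beta> b' x))) \<le> C2 / (\<rho> * \<nu>)\<^sup>2"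
        if i: "i \<in> Sb b" "i' \<in> Sb b'" for i i'
      proof -
        have bi: "bin i = b" "bin i' = b'" using i by (auto simp: Sb_def)
        have "\<rho> \<le> \<bar>2 * pi * real_of_int i / \<nu> - 2 * pi * real_of_int i' / \<nu>\<bar>"
        proof (cases "b \<ge> b' + 2")
          case True
          then have "\<rho> * (real_of_int b' + 2) \<le> \<rho> * of_int b" using \<rho>0 by (intro mult_left_mono) auto
          then show ?thesis using bin_lo[of i] bin_hi[of i'] unfolding bi by (simp add: distrib_left)
        next
          case False
          then have "b' \<ge> b + 2" using b by auto
          then have "\<rho> * (real_of_int b + 2) \<le> \<rho> * of_int b'" using \<rho>0 by (intro mult_left_mono) auto
          then show ?thesis using bin_lo[of i'] bin_hi[of i] unfolding bi by (simp add: distrib_left)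
        qed
        also have "\<dots> = 2 * pi * \<bar>of_int (i - i')\<bar> / \<nu>"
          using \<nu> by (simp add: diff_divide_distrib[symmetric] right_diff_distrib[symmetric] abs_mult)
        finally have ge: "\<rho> * \<nu> \<le> 2 * pi * \<bar>of_int (i - i')\<bar>" using \<nu> by (simp add: pos_le_divide_eq)
        have pos: "\<rho> * \<nu> > 0" using \<rho>0 \<nu> by simp
        have "cmod (integral {0..1} (\<lambda>x. ee (i - i') (Phi n x) * of_real (\<beta> b x * \<beta> b' x))) \<le> C2 / (2 * pi * \<bar>of_int (i - i')\<bar>)\<^sup>2"
          unfolding \<beta>_def using ge pos by (intro C2b[rule_format] b) auto
        also have "\<dots> \<le> C2 / (\<rho> * \<nu>)\<^sup>2"
          by (rule divide_left_mono[OF power_mono[OF ge less_imp_le[OF pos]] C2 mult_pos_pos[OF zero_less_power zero_less_power[OF pos]]])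
             (use ge pos in linarith)
        finally show ?thesis .
      qed
      have "I b b' = integral {0..1} (\<lambda>x. \<Sum>i\<in>Sb b. \<Sum>i'\<in>Sb b'. (c i * cnj (c i')) * (ee (i - i') (Phi n x) * of_real (\<beta> b x * \<beta> b' x)))"
        unfolding I_def
      proof (rule integral_cong)
        fix x
        have "V b x * cnj (V b' x) = (\<Sum>i\<in>Sb b. \<Sum>i'\<in>Sb b'. (c i * u i x) * cnj (c i' * u i' x))"
          by (simp add: V_def sum_product)
        also have "\<dots> = (\<Sum>i\<in>Sb b. \<Sum>i'\<in>Sb b'. (c i * cnj (c i')) * (ee (i - i') (Phi n x) * of_real (\<beta> b x * \<beta> b' x)))"
        proof (intro sum.cong refl)
          fix i i' assume i: "i \<in> Sb b" "i' \<in> Sb b'"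
          have "wave n \<nu> i x * cnj (wave n \<nu> i' x) = ee (i - i') (Phi n x)"
            using ee_add[of i "- i'" "Phi n x"] cis_mult[of "\<nu> * theta n x" "- (\<nu> * theta n x)"]
            by (simp add: wave_def cnj_ee cis_cnj mult_ac)
          then show "(c i * u i x) * cnj (c i' * u i' x) = (c i * cnj (c i')) * (ee (i - i') (Phi n x) * of_real (\<beta> b x * \<beta> b' x))"
            using i by (simp add: u_def Sb_def mult_ac)
        qed
        finally show "V b x * cnj (V b' x) = \<dots>" .
      qed
      also have "\<dots> = (\<Sum>i\<in>Sb b. \<Sum>i'\<in>Sb b'. (c i * cnj (c i')) * integral {0..1} (\<lambda>x. ee (i - i') (Phi n x) * of_real (\<beta> b x * \<beta> b' x)))"
      proof -
        have "(\<lambda>x. ee (i - i') (Phi n x) * of_real (\<beta> b x * \<beta> b' x)) integrable_on {0..1}" for i i'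
          by (intro integrable_continuous_real continuous_intros c\<beta> continuous_on_subset[OF continuous_Phi]) auto
        then have "(\<lambda>x. (c i * cnj (c i')) * (ee (i - i') (Phi n x) * of_real (\<beta> b x * \<beta> b' x))) integrable_on {0..1}" for i i'
          by (rule integrable_on_mult_right)
        then show ?thesis using finSb
          by (simp only: integral_sum integrable_sum integral_mult_right)
      qed
      also have "cmod \<dots> \<le> (\<Sum>i\<in>Sb b. \<Sum>i'\<in>Sb b'. (cmod (c i) * cmod (c i')) * (C2 / (\<rho> * \<nu>)\<^sup>2))"
        by (intro order_trans[OF norm_sum] sum_mono, unfold norm_mult complex_mod_cnj, intro mult_left_mono G)
           auto
      also have "\<dots> = (\<Sum>i\<in>Sb b. cmod (c i)) * (\<Sum>i'\<in>Sb b'. cmod (c i')) * (C2 / (\<rho> * \<nu>)\<^sup>2)"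
        by (subst sum_product) (simp only: sum_distrib_right)
      also have "\<dots> \<le> (sqrt (K * \<nu>) * X) * (sqrt (K * \<nu>) * X) * (C2 / (\<rho> * \<nu>)\<^sup>2)"
      proof -
        have "(\<Sum>i\<in>Sb b. cmod (c i)) \<le> sqrt (K * \<nu>) * X" for b
          by (rule order_trans[OF sum_mono2 sumc]) (use S in \<open>auto simp: Sb_def\<close>)
        then show ?thesis using X0 K0 \<nu> C2 by (intro mult_right_mono mult_mono) (auto intro: sum_nonneg)
      qed
      also have "\<dots> = (sqrt (K * \<nu>) * sqrt (K * \<nu>)) * X\<^sup>2 * (C2 / (\<rho> * \<nu>)\<^sup>2)" by (simp add: power2_eq_square)
      also have "\<dots> = e" using K0 \<nu> \<rho>0 by (simp add: e_def power2_eq_square field_simps)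
      finally show ?thesis .
    qed
    have e0: "e \<ge> 0" using C2 K0 \<nu> by (simp add: e_def)
    have "complex_of_real (integral {0..1} (\<lambda>x. (cmod (v x))\<^sup>2)) = integral {0..1} (\<lambda>x. complex_of_real ((cmod (v x))\<^sup>2))"
    proof -
      have "(\<lambda>x. (cmod (v x))\<^sup>2) integrable_on {0..1}"
        by (intro integrable_continuous_real continuous_intros cv)
      from integral_linear[OF this bounded_linear_of_real[where 'a=complex]] show ?thesis by (simp add: o_def)
    qed
    also have "\<dots> = integral {0..1} (\<lambda>x. \<Sum>b\<in>B. \<Sum>b'\<in>B. V b x * cnj (V b' x))"
      unfolding complex_norm_square vV cnj_sum sum_product ..
    also have "\<dots> = (\<Sum>b\<in>B. \<Sum>b'\<in>B. I b b')"
      using iV finB unfolding I_def by (simp only: integral_sum integrable_sum)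
    finally have vI: "integral {0..1} (\<lambda>x. (cmod (v x))\<^sup>2) \<le> cmod (\<Sum>b\<in>B. \<Sum>b'\<in>B. I b b')"
      by (metis abs_ge_self norm_of_real)
    also have "\<dots> \<le> 3 * (\<Sum>b\<in>B. q b) + real (card B ^ 2) * e"
      by (rule near_far_sum[OF finB q0 e0 near far])
    also have "(\<Sum>b\<in>B. q b) \<le> (\<Sum>b\<in>B. Ncap / E_min k g ^ n * (\<Sum>i\<in>Sb b. (cmod (c i))\<^sup>2))" by (intro sum_mono qb)
    also have "\<dots> = Ncap / E_min k g ^ n * X\<^sup>2"
      unfolding sum_distrib_left[symmetric] group using S by (simp add: X_def L2_set_square)
    finally have vb: "integral {0..1} (\<lambda>x. (cmod (v x))\<^sup>2) \<le> 3 * (Ncap / E_min k g ^ n * X\<^sup>2) + real (card B ^ 2) * e" by simp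
    have "(L2_set (\<lambda>j. cmod (fourier_coeff v j)) J)\<^sup>2 \<le> integral {0..1} (\<lambda>x. (cmod (v x))\<^sup>2)"
      using bessel_inequality[OF v_in J(1)] J by (simp add: L2_set_square LINT_continuous continuous_intros cv)
    with vb have fv: "(L2_set (\<lambda>j. cmod (fourier_coeff v j)) J)\<^sup>2 \<le> 3 * (Ncap / E_min k g ^ n * X\<^sup>2) + real (card B ^ 2) * e" by simp
    have "L2_set (\<lambda>j. cmod (\<Sum>i\<in>S. T n \<nu> j i * c i)) J \<le> L2_set (\<lambda>j. cmod (fourier_coeff v j) + cmod (r j)) J"
      unfolding Tsplit by (intro L2_set_mono norm_triangle_ineq) auto
    also have "\<dots> \<le> L2_set (\<lambda>j. cmod (fourier_coeff v j)) J + L2_set (\<lambda>j. cmod (r j)) J" by (rule L2_set_triangle_ineq)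
    finally have "(L2_set (\<lambda>j. cmod (\<Sum>i\<in>S. T n \<nu> j i * c i)) J)\<^sup>2 \<le>
        (L2_set (\<lambda>j. cmod (fourier_coeff v j)) J + L2_set (\<lambda>j. cmod (r j)) J)\<^sup>2"
      by (intro power_mono) auto
    also have "\<dots> \<le> 2 * (L2_set (\<lambda>j. cmod (fourier_coeff v j)) J)\<^sup>2 + 2 * (L2_set (\<lambda>j. cmod (r j)) J)\<^sup>2"
      using sum_squares_bound[of "L2_set (\<lambda>j. cmod (fourier_coeff v j)) J" "L2_set (\<lambda>j. cmod (r j)) J"] by (simp add: power2_sum)
    also have "\<dots> \<le> 2 * (3 * (Ncap / E_min k g ^ n * X\<^sup>2) + real (card B ^ 2) * e) + 2 * (C1 * K / \<nu> * X)\<^sup>2"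
      by (intro add_mono mult_left_mono fv power_mono rL) auto
    also have "\<dots> \<le> 6 * Ncap / E_min k g ^ n * X\<^sup>2 + C / \<nu> * X\<^sup>2"
    proof -
      have "(C1 * K / \<nu> * X)\<^sup>2 = (C1 * K)\<^sup>2 * X\<^sup>2 / (\<nu> * \<nu>)" by (simp add: power_mult_distrib power_divide power2_eq_square)
      also have "\<dots> \<le> (C1 * K)\<^sup>2 * X\<^sup>2 / \<nu>" using \<nu> by (intro divide_left_mono) auto
      finally have "2 * (C1 * K / \<nu> * X)\<^sup>2 \<le> 2 * (C1 * K)\<^sup>2 / \<nu> * X\<^sup>2" by simp
      moreover have "C / \<nu> * X\<^sup>2 = 2 * (real (card B ^ 2) * e) + 2 * (C1 * K)\<^sup>2 / \<nu> * X\<^sup>2"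
        by (simp add: C_def e_def add_divide_distrib distrib_right)
      ultimately show ?thesis by simp
    qed
    finally show ?thesis by (simp add: X_def distrib_right)
  qed
  show ?thesis
  proof (intro exI[of _ C] conjI allI impI C0)
    fix \<nu> :: real and S J :: "int set" and c :: "int \<Rightarrow> complex"
    assume "1 \<le> \<nu>" "finite S" "finite J" "\<forall>i\<in>S. 2 * pi * \<bar>real_of_int i\<bar> \<le> 2 * R * \<nu>"
      "\<forall>j\<in>J. 2 * pi * \<bar>real_of_int j\<bar> \<le> 2 * R * \<nu>"
    then show "(L2_set (\<lambda>j. cmod (\<Sum>i\<in>S. T n \<nu> j i * c i)) J)\<^sup>2 \<le>
       (6 * real (k ^ l * captive_count k g \<tau> R (n - l)) / E_min k g ^ n + C / \<nu>) * (L2_set (\<lambda>i. cmod (c i)) S)\<^sup>2"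
      unfolding Ncap_def[symmetric] by (intro main) auto
  qed
qed

end

section \<open>The operator in the Fourier basis\<close>

lemma int_double_sum_swap:
  fixes A :: "int \<Rightarrow> int \<Rightarrow> complex"
  assumes A: "\<And>p l. cmod (A p l) \<le> C / (max 1 \<bar>real_of_int p\<bar>)\<^sup>2 / (max 1 \<bar>real_of_int l\<bar>)\<^sup>2"
  shows "(\<Sum>\<^sub>\<infinity>p. \<Sum>\<^sub>\<infinity>l. A p l) = (\<Sum>\<^sub>\<infinity>l. \<Sum>\<^sub>\<infinity>p. A p l)"
proof (rule infsum_swap_banach)
  obtain Z where Z: "\<And>F::int set. finite F \<Longrightarrow> (\<Sum>n\<in>F. 1 / (max 1 \<bar>real_of_int n\<bar>)\<^sup>2) \<le> Z"
    using int_square_sum_bound by blast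
  have Z0: "Z \<ge> 0" using Z[of "{}"] by simp
  have C: "C \<ge> 0" using order_trans[OF norm_ge_zero A[of 0 0]] by simp
  define w where "w n = 1 / (max 1 \<bar>real_of_int n\<bar>)\<^sup>2" for n :: int
  have s: "(\<Sum>n\<in>A. w n) \<le> Z" if "finite A" for A unfolding w_def by (rule Z[OF that])
  have s0: "0 \<le> (\<Sum>n\<in>A. w n)" for A by (intro sum_nonneg) (simp add: w_def)
  have "(\<Sum>x\<in>F. cmod (case x of (p, l) \<Rightarrow> A p l)) \<le> C * (Z * Z)" if F: "finite F" for F
  proof -
    have "(\<Sum>x\<in>F. cmod (case x of (p, l) \<Rightarrow> A p l)) \<le> (\<Sum>(p, l)\<in>fst ` F \<times> snd ` F. C * (w p * w l))"
    proof (rule order_trans[OF sum_mono])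
      show "cmod (case x of (p, l) \<Rightarrow> A p l) \<le> (case x of (p, l) \<Rightarrow> C * (w p * w l))" for x
        using A by (cases x) (simp add: w_def)
      show "(\<Sum>x\<in>F. case x of (p, l) \<Rightarrow> C * (w p * w l)) \<le> (\<Sum>(p, l)\<in>fst ` F \<times> snd ` F. C * (w p * w l))"
        using F C by (intro sum_mono2 subset_fst_snd) (auto simp: w_def)
    qed
    also have "\<dots> = C * ((\<Sum>p\<in>fst ` F. w p) * (\<Sum>l\<in>snd ` F. w l))"
      unfolding sum_product sum.cartesian_product[symmetric] by (simp add: sum_distrib_left)
    also have "\<dots> \<le> C * (Z * Z)"
      by (intro mult_left_mono mult_mono s s0 Z0 C finite_imageI F)
    finally show ?thesis .
  qed
  then have "(\<lambda>x. cmod (case x of (p, l) \<Rightarrow> A p l)) summable_on UNIV"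
    by (intro nonneg_bdd_above_summable_on bdd_aboveI2[of _ _ "C * (Z * Z)"]) auto
  then show "(\<lambda>(p, l). A p l) summable_on UNIV \<times> UNIV"
    using abs_summable_summable by fastforce
qed

lemma trig_series_tail:
  assumes abs: "(\<lambda>p. cmod (a p)) summable_on UNIV"
  obtains t :: "nat \<Rightarrow> real" where "t \<longlonglongrightarrow> 0"
    "\<And>y N. cmod ((\<Sum>\<^sub>\<infinity>p. a p * ee p y) - (\<Sum>p\<in>{- int N..int N}. a p * ee p y)) \<le> t N"
proof -
  define tail where "tail N = (\<Sum>\<^sub>\<infinity>p. cmod (a p)) - (\<Sum>p\<in>{- int N..int N}. cmod (a p))" for N
  have "(\<lambda>N. \<Sum>p\<in>{- int N..int N}. cmod (a p)) \<longlonglongrightarrow> (\<Sum>\<^sub>\<infinity>p. cmod (a p))"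
    by (rule has_sum_int_tendsto[OF has_sum_infsum[OF abs]])
  from tendsto_diff[OF tendsto_const this, of "\<Sum>\<^sub>\<infinity>p. cmod (a p)"] have tail: "tail \<longlonglongrightarrow> 0" by (simp add: tail_def [abs_def])
  have unif: "cmod ((\<Sum>\<^sub>\<infinity>p. a p * ee p y) - (\<Sum>p\<in>{- int N..int N}. a p * ee p y)) \<le> tail N" for y N
  proof -
    let ?K = "{- int N..int N}"
    have sm: "(\<lambda>p. a p * ee p y) summable_on UNIV"
      by (rule abs_summable_summable) (simp add: norm_mult abs)
    have "(\<Sum>\<^sub>\<infinity>p. a p * ee p y) - (\<Sum>p\<in>?K. a p * ee p y) = (\<Sum>\<^sub>\<infinity>p\<in>UNIV - ?K. a p * ee p y)"
      using infsum_Diff[OF sm summable_on_finite[of ?K]] by simp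
    also have "cmod \<dots> \<le> (\<Sum>\<^sub>\<infinity>p\<in>UNIV - ?K. cmod (a p * ee p y))"
      by (rule norm_infsum_bound) (simp add: norm_mult summable_on_subset_banach[OF abs])
    also have "\<dots> = tail N"
      unfolding tail_def using infsum_Diff[OF abs, of ?K] by (simp add: norm_mult)
    finally show ?thesis .
  qed
  show thesis by (rule that[OF tail unif])
qed

lemma fourier_partial_sum_tail:
  assumes f: "CB 2 {()} (\<lambda>_. f)" "periodic1 f"
  obtains t :: "nat \<Rightarrow> real" where "t \<longlonglongrightarrow> 0"
    "\<And>y N. cmod (f y - (\<Sum>p\<in>{- int N..int N}. fourier_coeff f p * ee p y)) \<le> t N"
proof -
  obtain C where C: "\<And>p. cmod (fourier_coeff f p) \<le> C / (max 1 \<bar>real_of_int p\<bar>)\<^sup>2"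
    using fourier_coeff_decay[OF f] by auto
  obtain t where t: "t \<longlonglongrightarrow> 0" "\<And>y N. cmod ((\<Sum>\<^sub>\<infinity>p. fourier_coeff f p * ee p y) - (\<Sum>p\<in>{- int N..int N}. fourier_coeff f p * ee p y)) \<le> t N"
    using trig_series_tail[OF summable_on_int_bound(1)[OF C]] by blast
  show thesis by (rule that[OF t(1)]) (use t(2) in \<open>simp add: infsumI[OF fourier_inversion[OF f]]\<close>)
qed

text \<open>The Fourier series of \<open>f\<close> converges uniformly, so it may be evaluated at
  \<open>h x\<close> and integrated term by term. With \<open>h\<close> the map \<open>E\<close>
  this composes matrices; with \<open>h\<close> the identity it expresses a pairing by
  coefficients.\<close>

lemma fourier_integral_expansion:
  fixes G :: "real \<Rightarrow> complex" and h :: "real \<Rightarrow> real"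
  assumes f: "CB 2 {()} (\<lambda>_. f)" "periodic1 f" and G: "continuous_on UNIV G" and h: "continuous_on UNIV h"
  shows "((\<lambda>p. fourier_coeff f p * integral {0..1} (\<lambda>x. G x * ee p (h x))) has_sum
           integral {0..1} (\<lambda>x. G x * f (h x))) UNIV"
proof -
  obtain C where C: "\<And>p. cmod (fourier_coeff f p) \<le> C / (max 1 \<bar>real_of_int p\<bar>)\<^sup>2"
    using fourier_coeff_decay[OF f] by auto
  have C0: "C \<ge> 0" using order_trans[OF norm_ge_zero C[of 0]] by simp
  have cf: "continuous_on UNIV f" using CB_continuous[OF f(1)] by simp
  have "compact (G ` {0..1})"
    by (intro compact_continuous_image compact_Icc continuous_on_subset[OF G]) auto
  then obtain B where B: "\<And>x. x \<in> {0..1} \<Longrightarrow> cmod (G x) \<le> B"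
    using compact_imp_bounded bounded_iff by (metis image_eqI)
  have B0: "B \<ge> 0" using order_trans[OF norm_ge_zero B[of 0]] by simp
  have cG: "continuous_on A G" "continuous_on A h" for A using G h by (auto intro: continuous_on_subset)
  have ch: "continuous_on A (\<lambda>x. f (h x))" for A
    by (rule continuous_on_compose2[OF cf cG(2)]) auto
  have int: "(\<lambda>x. G x * ee p (h x)) integrable_on {0..1}" for p
    by (intro integrable_continuous_real continuous_intros cG)
  define s where "s p = fourier_coeff f p * integral {0..1} (\<lambda>x. G x * ee p (h x))" for p
  have "cmod (integral {0..1} (\<lambda>x. G x * ee p (h x))) \<le> B * (1 - 0)" for p
    by (rule integral_bound) (auto intro!: continuous_intros cG simp: norm_mult B)
  then have "cmod (s p) \<le> C / (max 1 \<bar>real_of_int p\<bar>)\<^sup>2 * B" for p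
    unfolding s_def norm_mult using C C0 by (intro mult_mono) auto
  then have "s summable_on UNIV" by (intro summable_on_int_bound(2)[of _ "C * B"]) simp
  then obtain t where t: "(s has_sum t) UNIV" by (auto simp: summable_on_def)
  obtain tail where tail: "tail \<longlonglongrightarrow> 0"
    and unif: "\<And>y N. cmod (f y - (\<Sum>p\<in>{- int N..int N}. fourier_coeff f p * ee p y)) \<le> tail N"
    using fourier_partial_sum_tail[OF f] by blast
  have "(\<lambda>N. (\<Sum>p\<in>{- int N..int N}. s p)) \<longlonglongrightarrow> integral {0..1} (\<lambda>x. G x * f (h x))"
  proof (rule LIM_zero_cancel, rule Lim_null_comparison)
    show "(\<lambda>N. B * tail N) \<longlonglongrightarrow> 0" using tendsto_mult_right_zero[OF tail, of B] by simp
    show "\<forall>\<^sub>F N in sequentially. norm ((\<Sum>p\<in>{- int N..int N}. s p) - integral {0..1} (\<lambda>x. G x * f (h x))) \<le> B * tail N"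
    proof (intro always_eventually allI)
      fix N
      let ?S = "\<lambda>y. \<Sum>p\<in>{- int N..int N}. fourier_coeff f p * ee p y"
      have "(\<Sum>p\<in>{- int N..int N}. s p) = integral {0..1} (\<lambda>x. \<Sum>p\<in>{- int N..int N}. fourier_coeff f p * (G x * ee p (h x)))"
        unfolding s_def using int by (simp add: integral_sum integrable_on_mult_right)
      also have "(\<lambda>x. \<Sum>p\<in>{- int N..int N}. fourier_coeff f p * (G x * ee p (h x))) = (\<lambda>x. G x * ?S (h x))"
        by (simp add: sum_distrib_left mult_ac)
      finally have "(\<Sum>p\<in>{- int N..int N}. s p) - integral {0..1} (\<lambda>x. G x * f (h x)) =
          integral {0..1} (\<lambda>x. G x * ?S (h x) - G x * f (h x))"
        by (simp add: integral_diff integrable_continuous_real continuous_intros cG ch)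
      also have "cmod \<dots> \<le> (B * tail N) * (1 - 0)"
      proof (rule integral_bound)
        show "continuous_on {0..1} (\<lambda>x. G x * ?S (h x) - G x * f (h x))" by (intro continuous_intros cG ch)
        fix x :: real assume x: "x \<in> {0..1}"
        have "cmod (G x * ?S (h x) - G x * f (h x)) = cmod (G x) * cmod (f (h x) - ?S (h x))"
          unfolding right_diff_distrib[symmetric] norm_mult by (simp add: norm_minus_commute)
        also have "\<dots> \<le> B * tail N" using B[OF x] B0 unif by (intro mult_mono) auto
        finally show "cmod (G x * ?S (h x) - G x * f (h x)) \<le> B * tail N" .
      qed simp
      finally show "norm ((\<Sum>p\<in>{- int N..int N}. s p) - integral {0..1} (\<lambda>x. G x * f (h x))) \<le> B * tail N" by simp
    qed
  qed
  then have "t = integral {0..1} (\<lambda>x. G x * f (h x))" using has_sum_int_tendsto[OF t] LIMSEQ_unique by blast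
  then show ?thesis using t by (simp add: s_def [abs_def])
qed

section \<open>Sobolev weights and polynomially bounded coefficients\<close>

definition sob_weight :: "real \<Rightarrow> int \<Rightarrow> real" where
  "sob_weight m n = japanese (2 * pi * real_of_int n) powr m"

lemma japanese_bounds:
  "max 1 \<bar>real_of_int n\<bar> \<le> japanese (2 * pi * real_of_int n)"
  "japanese (2 * pi * real_of_int n) \<le> 8 * max 1 \<bar>real_of_int n\<bar>"
proof -
  define x where "x = \<bar>real_of_int n\<bar>"
  have xx: "(2 * pi * real_of_int n)\<^sup>2 = (2 * pi)\<^sup>2 * x\<^sup>2" by (simp add: x_def power_mult_distrib)
  have p: "(1::real)\<^sup>2 \<le> (2 * pi)\<^sup>2" using pi_gt3 by (intro power_mono) auto
  have "(2 * pi)\<^sup>2 \<le> (7::real)\<^sup>2" using pi_less_4 pi_approx by (intro power_mono) auto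
  then have p2: "(2 * pi)\<^sup>2 * x\<^sup>2 \<le> 49 * x\<^sup>2" by (intro mult_right_mono) auto
  have x0: "x \<ge> 0" by (simp add: x_def)
  have "max 1 x \<le> sqrt (1 + (2 * pi)\<^sup>2 * x\<^sup>2)"
  proof (rule real_le_rsqrt)
    have "x\<^sup>2 \<le> (2 * pi)\<^sup>2 * x\<^sup>2" using mult_right_mono[OF p, of "x\<^sup>2"] by simp
    then show "(max 1 x)\<^sup>2 \<le> 1 + (2 * pi)\<^sup>2 * x\<^sup>2" by (auto simp: max_def)
  qed
  then show "max 1 \<bar>real_of_int n\<bar> \<le> japanese (2 * pi * real_of_int n)"
    unfolding japanese_def xx x_def[symmetric] .
  have "sqrt (1 + (2 * pi)\<^sup>2 * x\<^sup>2) \<le> 8 * max 1 x"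
  proof (rule real_le_lsqrt)
    have "1 + 49 * x\<^sup>2 \<le> 64 * (max 1 x)\<^sup>2"
    proof -
      have "x\<^sup>2 \<le> (max 1 x)\<^sup>2" "1 \<le> (max 1 x)\<^sup>2" using x0 by (auto intro: power_mono)
      then show ?thesis by linarith
    qed
    then show "1 + (2 * pi)\<^sup>2 * x\<^sup>2 \<le> (8 * max 1 x)\<^sup>2" using p2 by (simp add: power_mult_distrib)
  qed (use x0 in auto)
  then show "japanese (2 * pi * real_of_int n) \<le> 8 * max 1 \<bar>real_of_int n\<bar>"
    unfolding japanese_def xx x_def[symmetric] .
qed

lemma japanese_pos: "0 < japanese (2 * pi * real_of_int n)"
  using japanese_bounds(1)[of n] by linarith

lemma sob_weight_pos: "0 < sob_weight m n"
  using japanese_pos[of n] by (simp add: sob_weight_def)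

text \<open>Up to factors 8 and \<open>\<mu>\<close> both weights are powers of
  \<open>max 1 \<bar>n\<bar>\<close>. The constants depend on \<open>\<mu>\<close>, but resolvent
  sets are the same for equivalent norms.\<close>

lemma flat_weight_equiv:
  assumes m: "m \<le> 0" and \<mu>: "\<mu> \<ge> 1"
  shows "sob_weight m n \<le> 1 * flat_weight \<mu> m n" "flat_weight \<mu> m n \<le> (8 * \<mu>) powr (- m) * sob_weight m n"
proof -
  define t where "t = max 1 (\<bar>real_of_int n\<bar> / \<mu>)"
  define J where "J = japanese (2 * pi * real_of_int n)"
  have t1: "t \<ge> 1" by (simp add: t_def)
  have "\<bar>real_of_int n\<bar> / \<mu> \<le> \<bar>real_of_int n\<bar>" using \<mu> by (simp add: divide_le_eq mult_le_cancel_left1)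
  then have tJ: "t \<le> J" using japanese_bounds(1)[of n] by (auto simp: t_def J_def)
  have "max 1 \<bar>real_of_int n\<bar> \<le> \<mu> * t" using \<mu> by (auto simp: t_def max_def field_simps)
  moreover have "J \<le> 8 * max 1 \<bar>real_of_int n\<bar>" using japanese_bounds(2)[of n] by (simp add: J_def)
  ultimately have Jt: "J \<le> 8 * \<mu> * t" unfolding mult.assoc by linarith
  show "sob_weight m n \<le> 1 * flat_weight \<mu> m n"
    unfolding sob_weight_def flat_weight_def J_def[symmetric] t_def[symmetric] using powr_mono2'[of m t J] m t1 tJ by simp
  have "t powr m = (8 * \<mu>) powr (- m) * (8 * \<mu> * t) powr m"
  proof -
    have "(8 * \<mu> * t) powr m = (8 * \<mu>) powr m * t powr m" by (rule powr_mult)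
    then show ?thesis using \<mu> by (simp add: powr_minus)
  qed
  also have "\<dots> \<le> (8 * \<mu>) powr (- m) * J powr m"
    using m Jt t1 tJ by (intro mult_left_mono powr_mono2') auto
  finally show "flat_weight \<mu> m n \<le> (8 * \<mu>) powr (- m) * sob_weight m n"
    unfolding sob_weight_def flat_weight_def J_def[symmetric] t_def[symmetric] .
qed

text \<open>A class of coefficients that contains the coefficients of every \<open>H^m\<close> with
  \<open>m \<le> 0\<close>. On it the matrix acts by absolutely convergent rows, so one operator
  \<open>Top\<close> serves all exponents.\<close>

definition poly_bounded :: "(int \<Rightarrow> complex) \<Rightarrow> bool" where
  "poly_bounded c \<longleftrightarrow> (\<exists>K p. \<forall>l. cmod (c l) \<le> K * (max 1 \<bar>real_of_int l\<bar>) ^ p)"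

lemma poly_boundedI: "(\<And>l. cmod (c l) \<le> K * (max 1 \<bar>real_of_int l\<bar>) ^ p) \<Longrightarrow> poly_bounded c"
  by (auto simp: poly_bounded_def)

lemma wseq_poly_bounded:
  assumes "c \<in> wseq (sob_weight m)" "m \<le> 0"
  shows "poly_bounded c"
proof -
  obtain M where M: "wnorm_le (sob_weight m) c M" using assms by (auto simp: wseq_def)
  obtain p where p: "- m \<le> real p" using real_arch_simple by blast
  have "cmod (c l) \<le> (M * 8 ^ p) * (max 1 \<bar>real_of_int l\<bar>) ^ p" for l
  proof -
    let ?J = "japanese (2 * pi * real_of_int l)"
    have J1: "?J \<ge> 1" using japanese_bounds(1)[of l] by simp
    have "cmod (c l) \<le> M / ?J powr m" using wnorm_le_coord[OF M sob_weight_pos] by (simp add: sob_weight_def)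
    also have "\<dots> = M * ?J powr (- m)" by (simp add: powr_minus divide_inverse)
    also have "\<dots> \<le> M * (8 * max 1 \<bar>real_of_int l\<bar>) ^ p"
    proof (rule mult_left_mono[OF _ wnorm_le_nonneg[OF M]])
      have "?J powr (- m) \<le> ?J powr (real p)" using J1 p by (intro powr_mono) auto
      also have "\<dots> = ?J ^ p" using J1 by (simp add: powr_realpow)
      also have "\<dots> \<le> (8 * max 1 \<bar>real_of_int l\<bar>) ^ p" using J1 japanese_bounds(2) by (intro power_mono) auto
      finally show "?J powr (- m) \<le> (8 * max 1 \<bar>real_of_int l\<bar>) ^ p" .
    qed
    finally show ?thesis by (simp add: power_mult_distrib mult_ac)
  qed
  then show ?thesis by (rule poly_boundedI)
qed

lemma poly_bounded_dominated: "poly_bounded c \<Longrightarrow> (\<And>l. cmod (d l) \<le> cmod (c l)) \<Longrightarrow> poly_bounded d"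
  unfolding poly_bounded_def by (meson order_trans)

lemma wres_cong:
  assumes "\<And>c. c \<in> wseq a \<Longrightarrow> A c = A' c"
  shows "wres a A = wres a A'"
proof -
  have "wop a a B \<Longrightarrow> c \<in> wseq a \<Longrightarrow> A (B c) = A' (B c)" for B c using assms wop_in by blast
  then show ?thesis unfolding wres_def using assms by (intro Collect_cong ex_cong1) auto
qed

section \<open>The matrix as an operator on infinite sequences\<close>

context expanding_skew
begin

lemma T_bounded: "cmod (T n \<nu> j l) \<le> growth n"
  using T_L2[of "{l}" "{j}" n \<nu> "\<lambda>_. 1"] by simp

text \<open>Either \<open>T_decay\<close> applies, or \<open>\<bar>l\<bar>\<close> is at most a
  constant times \<open>max 1 \<bar>j\<bar>\<close>, and then the trivial bound
  \<open>growth n\<close> already has the stated form. All entries are covered, at the price of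
  growth in \<open>j\<close> and of a constant that depends on \<open>\<nu>\<close>.\<close>

lemma T_row_decay:
  assumes R0: "R > 0" and n: "n \<ge> 1"
  shows "\<exists>C\<ge>0. \<forall>j l. cmod (T n \<nu> j l) \<le> C * (max 1 \<bar>real_of_int j\<bar>) ^ N / (max 1 \<bar>real_of_int l\<bar>) ^ N"
proof -
  have kn: "\<kappa> ^ n > 1" using kappa n by (intro one_less_power) auto
  define \<kappa>2 where "\<kappa>2 = (1 + \<kappa> ^ n) / 2"
  have k: "1 < \<kappa>2" "\<kappa>2 < \<kappa> ^ n" using kn by (auto simp: \<kappa>2_def)
  obtain C0 where C0: "C0 \<ge> 0" "\<And>j l. l \<noteq> 0 \<Longrightarrow> R * \<bar>\<nu>\<bar> < 2 * pi * \<bar>real_of_int l\<bar> \<Longrightarrow> \<bar>real_of_int j\<bar> \<le> \<kappa>2 * \<bar>real_of_int l\<bar> \<Longrightarrow>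
     cmod (T n \<nu> j l) \<le> C0 / \<bar>real_of_int l\<bar> ^ N" using T_decay[OF R0 k, of N] by blast
  define L where "L = max 1 (R * \<bar>\<nu>\<bar>)"
  have g0: "growth n \<ge> 0" using E_min by (simp add: growth_def)
  have "cmod (T n \<nu> j l) \<le> (C0 + growth n * L ^ N) * (max 1 \<bar>real_of_int j\<bar>) ^ N / (max 1 \<bar>real_of_int l\<bar>) ^ N" for j l
  proof -
    let ?j = "max 1 \<bar>real_of_int j\<bar>" and ?l = "max 1 \<bar>real_of_int l\<bar>"
    have j1: "1 \<le> ?j ^ N" by (intro one_le_power) auto
    show ?thesis
    proof (cases "l \<noteq> 0 \<and> R * \<bar>\<nu>\<bar> < 2 * pi * \<bar>real_of_int l\<bar> \<and> \<bar>real_of_int j\<bar> \<le> \<kappa>2 * \<bar>real_of_int l\<bar>")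
      case True
      have "?l = \<bar>real_of_int l\<bar>" using True by (auto simp: max_def)
      then have "cmod (T n \<nu> j l) \<le> C0 / ?l ^ N" using C0(2)[of l j] True by simp
      also have "\<dots> \<le> C0 * ?j ^ N / ?l ^ N" using C0(1) j1 mult_left_mono[OF j1 C0(1)] by (intro divide_right_mono) auto
      also have "\<dots> \<le> (C0 + growth n * L ^ N) * ?j ^ N / ?l ^ N"
        using g0 by (intro divide_right_mono mult_right_mono) (auto simp: L_def)
      finally show ?thesis .
    next
      case False
      have "\<bar>real_of_int l\<bar> \<le> L * ?j"
      proof -
        consider "l = 0" | "2 * pi * \<bar>real_of_int l\<bar> \<le> R * \<bar>\<nu>\<bar>" | "\<kappa>2 * \<bar>real_of_int l\<bar> < \<bar>real_of_int j\<bar>" using False by linarith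
        then show ?thesis
        proof cases
          case 1
          then show ?thesis by (simp add: L_def)
        next
          case 2
          have "\<bar>real_of_int l\<bar> \<le> 2 * pi * \<bar>real_of_int l\<bar>" using pi_gt3 mult_right_mono[of 1 "2 * pi" "\<bar>real_of_int l\<bar>"] by simp
          then have "\<bar>real_of_int l\<bar> \<le> L" using 2 by (simp add: L_def)
          moreover have "L * 1 \<le> L * ?j" by (intro mult_left_mono) (auto simp: L_def)
          ultimately show ?thesis by linarith
        next
          case 3
          have "\<bar>real_of_int l\<bar> \<le> \<kappa>2 * \<bar>real_of_int l\<bar>" using k mult_right_mono[of 1 \<kappa>2 "\<bar>real_of_int l\<bar>"] by simp
          then have "\<bar>real_of_int l\<bar> \<le> 1 * ?j" using 3 by simp
          also have "\<dots> \<le> L * ?j" by (intro mult_right_mono) (auto simp: L_def)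
          finally show ?thesis .
        qed
      qed
      moreover have "1 \<le> L * ?j" using mult_mono[of 1 L 1 ?j] by (simp add: L_def)
      ultimately have "?l ^ N \<le> (L * ?j) ^ N" by (intro power_mono) auto
      then have "growth n * ?l ^ N \<le> growth n * (L * ?j) ^ N" using g0 by (intro mult_left_mono)
      then have "growth n \<le> growth n * L ^ N * ?j ^ N / ?l ^ N"
        by (simp add: pos_le_divide_eq power_mult_distrib mult.assoc)
      also have "\<dots> \<le> (C0 + growth n * L ^ N) * ?j ^ N / ?l ^ N"
        using C0(1) by (intro divide_right_mono mult_right_mono) auto
      finally show ?thesis using T_bounded[of n \<nu> j l] by linarith
    qed
  qed
  moreover have "C0 + growth n * L ^ N \<ge> 0" using C0(1) g0 by (simp add: L_def)
  ultimately show ?thesis by blast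
qed

definition Top :: "nat \<Rightarrow> real \<Rightarrow> (int \<Rightarrow> complex) \<Rightarrow> int \<Rightarrow> complex" where
  "Top n \<nu> c j = (\<Sum>\<^sub>\<infinity>l. T n \<nu> j l * c l)"

lemma Top_term_bound:
  assumes R0: "R > 0" and n: "n \<ge> 1" and c: "poly_bounded c"
  shows "\<exists>K q. K \<ge> 0 \<and> (\<forall>j l. cmod (T n \<nu> j l * c l) \<le> K * (max 1 \<bar>real_of_int j\<bar>) ^ q / (max 1 \<bar>real_of_int l\<bar>)\<^sup>2)"
proof -
  obtain K p where K: "\<And>l. cmod (c l) \<le> K * (max 1 \<bar>real_of_int l\<bar>) ^ p" using c by (auto simp: poly_bounded_def)
  have K0: "K \<ge> 0" using order_trans[OF norm_ge_zero K[of 0]] by simp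
  obtain C where C: "C \<ge> 0" "\<And>j l. cmod (T n \<nu> j l) \<le> C * (max 1 \<bar>real_of_int j\<bar>) ^ (p + 2) / (max 1 \<bar>real_of_int l\<bar>) ^ (p + 2)"
    using T_row_decay[OF R0 n, of \<nu> "p + 2"] by auto
  have "cmod (T n \<nu> j l * c l) \<le> (C * K) * (max 1 \<bar>real_of_int j\<bar>) ^ (p + 2) / (max 1 \<bar>real_of_int l\<bar>)\<^sup>2" for j l
  proof -
    let ?l = "max 1 \<bar>real_of_int l\<bar>"
    have "cmod (T n \<nu> j l * c l) \<le> (C * (max 1 \<bar>real_of_int j\<bar>) ^ (p + 2) / ?l ^ (p + 2)) * (K * ?l ^ p)"
      unfolding norm_mult using C(1) K0 by (intro mult_mono C K) auto
    also have "\<dots> = (C * K) * (max 1 \<bar>real_of_int j\<bar>) ^ (p + 2) / ?l\<^sup>2"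
    proof -
      have "?l \<noteq> 0" by linarith
      then show ?thesis by (simp add: power_add power2_eq_square mult_ac)
    qed
    finally show ?thesis .
  qed
  then show ?thesis using C(1) K0 by (intro exI[of _ "C * K"] exI[of _ "p + 2"]) auto
qed

lemma Top_summable:
  assumes "R > 0" "n \<ge> 1" "poly_bounded c"
  shows "(\<lambda>l. T n \<nu> j l * c l) summable_on UNIV"
proof -
  obtain K q where "\<And>j l. cmod (T n \<nu> j l * c l) \<le> K * (max 1 \<bar>real_of_int j\<bar>) ^ q / (max 1 \<bar>real_of_int l\<bar>)\<^sup>2"
    using Top_term_bound[OF assms] by blast
  then show ?thesis by (rule summable_on_int_bound(2))
qed

lemma Top_lin:
  assumes "R > 0" "n \<ge> 1" "poly_bounded c" "poly_bounded d"
  shows "Top n \<nu> (\<lambda>l. x * c l + y * d l) = (\<lambda>j. x * Top n \<nu> c j + y * Top n \<nu> d j)"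
proof
  fix j
  have "Top n \<nu> (\<lambda>l. x * c l + y * d l) j = (\<Sum>\<^sub>\<infinity>l. x * (T n \<nu> j l * c l) + y * (T n \<nu> j l * d l))"
    unfolding Top_def by (simp add: algebra_simps)
  also have "\<dots> = (\<Sum>\<^sub>\<infinity>l. x * (T n \<nu> j l * c l)) + (\<Sum>\<^sub>\<infinity>l. y * (T n \<nu> j l * d l))"
    by (intro infsum_add summable_on_cmult_right Top_summable assms)
  also have "\<dots> = x * Top n \<nu> c j + y * Top n \<nu> d j"
    unfolding Top_def using assms by (simp add: infsum_cmult_right Top_summable)
  finally show "Top n \<nu> (\<lambda>l. x * c l + y * d l) j = x * Top n \<nu> c j + y * Top n \<nu> d j" .
qed

text \<open>Symmetric truncations converge in each coordinate, so \<open>wnorm_le_lim\<close>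
  carries a bound on finite blocks to the infinite matrix. The mask \<open>Q\<close> selects
  columns: the low frequencies, the high ones, or all.\<close>

lemma Top_masked_bound:
  assumes R0: "R > 0" and n: "n \<ge> 1"
    and fin: "\<And>S J c. finite S \<Longrightarrow> finite J \<Longrightarrow> (\<And>l. l \<in> S \<Longrightarrow> Q l) \<Longrightarrow>
      L2_set (\<lambda>j. b j * cmod (\<Sum>l\<in>S. T n \<nu> j l * c l)) J \<le> K * L2_set (\<lambda>l. a l * cmod (c l)) S"
    and K: "K \<ge> 0" and c: "poly_bounded c" "wnorm_le a c M"
  shows "wnorm_le b (Top n \<nu> (\<lambda>l. if Q l then c l else 0)) (K * M)"
proof (rule wnorm_le_lim)
  let ?c = "\<lambda>l. if Q l then c l else 0"
  have pb: "poly_bounded ?c" by (rule poly_bounded_dominated[OF c(1)]) auto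
  show "(\<lambda>N. \<Sum>l\<in>{- int N..int N}. T n \<nu> j l * ?c l) \<longlonglongrightarrow> Top n \<nu> ?c j" for j
    unfolding Top_def by (rule has_sum_int_tendsto[OF has_sum_infsum[OF Top_summable[OF R0 n pb]]])
  show "wnorm_le b (\<lambda>j. \<Sum>l\<in>{- int N..int N}. T n \<nu> j l * ?c l) (K * M)" for N
    unfolding wnorm_le_def
  proof safe
    fix J :: "int set" assume J: "finite J"
    let ?S = "{l\<in>{- int N..int N}. Q l}"
    have finS: "finite ?S" by (rule finite_subset[of _ "{- int N..int N}"]) auto
    have "(\<Sum>l\<in>{- int N..int N}. T n \<nu> j l * ?c l) = (\<Sum>l\<in>?S. T n \<nu> j l * c l)" for j
      by (simp add: sum.inter_filter[symmetric] if_distrib cong: if_cong)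
    then have "L2_set (\<lambda>j. b j * cmod (\<Sum>l\<in>{- int N..int N}. T n \<nu> j l * ?c l)) J =
        L2_set (\<lambda>j. b j * cmod (\<Sum>l\<in>?S. T n \<nu> j l * c l)) J" by simp
    also have "\<dots> \<le> K * L2_set (\<lambda>l. a l * cmod (c l)) ?S" by (rule fin[OF finS J]) simp
    also have "\<dots> \<le> K * M" using wnorm_leD[OF c(2) finS] K by (intro mult_left_mono) auto
    finally show "L2_set (\<lambda>j. b j * cmod (\<Sum>l\<in>{- int N..int N}. T n \<nu> j l * ?c l)) J \<le> K * M" .
  qed
qed

text \<open>One application of the operator to the Fourier series of \<open>wave n \<nu> l\<close>,
  since \<open>wave (Suc n)\<close> is \<open>wave n\<close> composed with \<open>E\<close> and
  multiplied by the phase of one step.\<close>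

lemma T_Suc:
  "((\<lambda>p. T 1 \<nu> j p * T n \<nu> p l) has_sum T (Suc n) \<nu> j l) UNIV"
proof -
  have ct: "continuous_on UNIV \<tau>" by (rule CN_continuous[OF CN_tau[of 0]])
  have "CN 2 (\<lambda>x. cis (\<nu> * theta n x) * cis (2 * pi * of_int l * Phi n x))"
    by (intro CN_mult CN_cis CN_const CN_theta CN_Phi)
  then have CBw: "CB 2 {()} (\<lambda>_. wave n \<nu> l)"
    by (intro CB_of_CN wave_periodic) (simp add: wave_def [abs_def] ee_def)
  have "((\<lambda>p. fourier_coeff (wave n \<nu> l) p * integral {0..1} (\<lambda>x. ee (- j) x * cis (\<nu> * \<tau> x) * ee p (E x))) has_sum
      integral {0..1} (\<lambda>x. ee (- j) x * cis (\<nu> * \<tau> x) * wave n \<nu> l (E x))) UNIV"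
    by (rule fourier_integral_expansion[OF CBw wave_periodic]) (intro continuous_intros ct)+
  moreover have 1: "ee (- j) x * cis (\<nu> * \<tau> x) * wave n \<nu> l (E x) = ee (- j) x * wave (Suc n) \<nu> l x" for x
    by (simp add: wave_def theta_Suc Phi_Suc cis_mult[symmetric] distrib_left mult_ac)
  moreover have 2: "ee (- j) x * cis (\<nu> * \<tau> x) * ee p (E x) = ee (- j) x * wave 1 \<nu> p x" for x p
    by (simp add: wave_def theta_Suc Phi_Suc)
  moreover have 3: "integral {0..1} (\<lambda>x. ee (- j) x * wave n \<nu> l x) = T n \<nu> j l" for n j l
    unfolding T_def fourier_coeff_ee by (intro LINT_continuous[symmetric] continuous_intros wave_continuous)
  ultimately show ?thesis unfolding 1 2 3 T_def[symmetric] by (simp only: mult.commute)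
qed

lemma Top_Suc:
  assumes R0: "R > 0" and n: "n \<ge> 1" and c: "poly_bounded c"
  shows "Top 1 \<nu> (Top n \<nu> c) = Top (Suc n) \<nu> c"
proof
  fix j
  obtain K q where K: "K \<ge> 0" "\<And>j l. cmod (T n \<nu> j l * c l) \<le> K * (max 1 \<bar>real_of_int j\<bar>) ^ q / (max 1 \<bar>real_of_int l\<bar>)\<^sup>2"
    using Top_term_bound[OF R0 n c] by blast
  obtain C where C: "C \<ge> 0" "\<And>j l. cmod (T 1 \<nu> j l) \<le> C * (max 1 \<bar>real_of_int j\<bar>) ^ (q + 2) / (max 1 \<bar>real_of_int l\<bar>) ^ (q + 2)"
    using T_row_decay[OF R0, of 1 \<nu> "q + 2"] by auto
  let ?C = "C * (max 1 \<bar>real_of_int j\<bar>) ^ (q + 2)"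
  have "cmod (T 1 \<nu> j p * (T n \<nu> p l * c l)) \<le> (?C * K) / (max 1 \<bar>real_of_int p\<bar>)\<^sup>2 / (max 1 \<bar>real_of_int l\<bar>)\<^sup>2" for p l
  proof -
    let ?p = "max 1 \<bar>real_of_int p\<bar>"
    have "cmod (T 1 \<nu> j p * (T n \<nu> p l * c l)) \<le> (?C / ?p ^ (q + 2)) * (K * ?p ^ q / (max 1 \<bar>real_of_int l\<bar>)\<^sup>2)"
      unfolding norm_mult[of "T 1 \<nu> j p"] using C(1) K(1) by (intro mult_mono C K) auto
    also have "\<dots> = (?C * K) / ?p\<^sup>2 / (max 1 \<bar>real_of_int l\<bar>)\<^sup>2"
    proof -
      have "?p \<noteq> 0" by linarith
      then show ?thesis by (simp add: power_add power2_eq_square mult_ac)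
    qed
    finally show ?thesis .
  qed
  then have "(\<Sum>\<^sub>\<infinity>p. \<Sum>\<^sub>\<infinity>l. T 1 \<nu> j p * (T n \<nu> p l * c l)) = (\<Sum>\<^sub>\<infinity>l. \<Sum>\<^sub>\<infinity>p. T 1 \<nu> j p * (T n \<nu> p l * c l))"
    by (rule int_double_sum_swap)
  moreover have "(\<Sum>\<^sub>\<infinity>l. T 1 \<nu> j p * (T n \<nu> p l * c l)) = T 1 \<nu> j p * Top n \<nu> c p" for p
    unfolding Top_def by (intro infsum_cmult_right Top_summable R0 n c)
  moreover have "(\<Sum>\<^sub>\<infinity>p. T 1 \<nu> j p * (T n \<nu> p l * c l)) = T (Suc n) \<nu> j l * c l" for l
  proof -
    have "((\<lambda>p. (T 1 \<nu> j p * T n \<nu> p l) * c l) has_sum T (Suc n) \<nu> j l * c l) UNIV"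
      by (rule has_sum_cmult_left[OF T_Suc])
    then show ?thesis by (simp add: infsumI mult.assoc)
  qed
  ultimately show "Top 1 \<nu> (Top n \<nu> c) j = Top (Suc n) \<nu> c j" by (simp add: Top_def)
qed

end

definition hi_freq :: "real \<Rightarrow> (int \<Rightarrow> complex) \<Rightarrow> int \<Rightarrow> complex" where
  "hi_freq \<mu> c l = (if \<mu> < \<bar>real_of_int l\<bar> then c l else 0)"

definition lo_freq :: "real \<Rightarrow> (int \<Rightarrow> complex) \<Rightarrow> int \<Rightarrow> complex" where
  "lo_freq \<mu> c l = (if \<bar>real_of_int l\<bar> \<le> \<mu> then c l else 0)"

lemma poly_bounded_hi_lo:
  assumes "poly_bounded c"
  shows "poly_bounded (hi_freq \<mu> c)" "poly_bounded (lo_freq \<mu> c)"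
  by (rule poly_bounded_dominated[OF assms], simp add: hi_freq_def lo_freq_def)+

lemma flat_weight_nonneg: "0 \<le> flat_weight \<mu> m n" and sob_weight_nonneg: "0 \<le> sob_weight m n"
  using flat_weight_pos[of \<mu> m n] sob_weight_pos[of m n] by auto

lemma flat_weight_low: "\<mu> \<ge> 1 \<Longrightarrow> \<bar>real_of_int n\<bar> \<le> \<mu> \<Longrightarrow> flat_weight \<mu> m n = 1"
  by (simp add: flat_weight_def max_def)

lemma flat_weight_mono: "m \<le> m' \<Longrightarrow> flat_weight \<mu> m n \<le> 1 * flat_weight \<mu> m' n"
  unfolding flat_weight_def by (simp add: powr_mono)

lemma wseq_flat_eq:
  assumes "m \<le> 0" "\<mu> \<ge> 1"
  shows "wseq (flat_weight \<mu> m) = wseq (sob_weight m)"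
  using wseq_subset[of "sob_weight m" 1 "flat_weight \<mu> m", OF sob_weight_nonneg flat_weight_equiv(1)[OF assms]]
    wseq_subset[of "flat_weight \<mu> m" "(8 * \<mu>) powr (- m)" "sob_weight m", OF flat_weight_nonneg flat_weight_equiv(2)[OF assms]] by auto

lemma wres_flat_eq:
  assumes "m \<le> 0" "\<mu> \<ge> 1"
  shows "wres (flat_weight \<mu> m) A = wres (sob_weight m) A"
  by (rule wres_equiv[of "flat_weight \<mu> m" "sob_weight m" 1 "(8 * \<mu>) powr (- m)", OF flat_weight_nonneg sob_weight_nonneg flat_weight_equiv[OF assms]]) auto

lemma powr_small:
  assumes "b > 1" "\<epsilon> > 0"
  shows "\<exists>m0<0. \<forall>m\<le>m0. b powr m \<le> (\<epsilon>::real)"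
proof -
  define m0 where "m0 = min (- 1) (log b \<epsilon>)"
  have "b powr m \<le> \<epsilon>" if "m \<le> m0" for m
  proof -
    have "b powr m \<le> b powr (log b \<epsilon>)" using that assms by (intro powr_mono) (auto simp: m0_def)
    also have "\<dots> = \<epsilon>" using assms by simp
    finally show ?thesis .
  qed
  then show ?thesis by (intro exI[of _ m0]) (auto simp: m0_def)
qed

section \<open>Splitting into high and low frequencies, dependence on the exponent\<close>

context expanding_skew
begin

lemma growth_nonneg: "0 \<le> growth n"
  using E_min by (simp add: growth_def)

text \<open>Above \<open>\<mu>\<close> all columns are nonstationary because
  \<open>2 * pi * \<mu>\<close> is at least \<open>R * \<bar>\<nu>\<bar>\<close>. The constant
  \<open>e0\<close> is chosen before \<open>\<nu>\<close>, \<open>\<mu>\<close> and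
  \<open>m\<close>, for fixed \<open>n\<close> and \<open>p\<close>, so raising \<open>\<mu>\<close>
  makes the error terms as small as desired.\<close>

lemma high_frequency_T:
  assumes R0: "R > 0" and \<kappa>2: "1 < \<kappa>2" "\<kappa>2 < \<kappa> ^ n"
  shows "\<exists>e0\<ge>0. \<forall>\<nu> \<mu> m S J c. \<mu> \<ge> 1 \<longrightarrow> R * \<bar>\<nu>\<bar> \<le> 2 * pi * \<mu> \<longrightarrow> m < 0 \<longrightarrow> - m \<le> real p \<longrightarrow> finite S \<longrightarrow> finite J \<longrightarrow>
     (\<forall>l\<in>S. \<mu> < \<bar>real_of_int l\<bar>) \<longrightarrow>
     L2_set (\<lambda>j. flat_weight \<mu> m j * cmod (\<Sum>l\<in>S. T n \<nu> j l * c l)) J \<le>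
       ((growth n + e0 / \<mu>) * \<kappa>2 powr m + e0 / \<mu>) * L2_set (\<lambda>l. flat_weight \<mu> m l * cmod (c l)) S \<and>
     ((\<forall>j\<in>J. \<bar>real_of_int j\<bar> \<le> \<mu>) \<longrightarrow> L2_set (\<lambda>j. cmod (\<Sum>l\<in>S. T n \<nu> j l * c l)) J \<le>
       e0 / \<mu> * L2_set (\<lambda>l. flat_weight \<mu> m l * cmod (c l)) S)"
proof -
  obtain C where C: "C \<ge> 0" "\<forall>\<nu> j l. l \<noteq> 0 \<longrightarrow> R * \<bar>\<nu>\<bar> < 2 * pi * \<bar>real_of_int l\<bar> \<longrightarrow> \<bar>real_of_int j\<bar> \<le> \<kappa>2 * \<bar>real_of_int l\<bar> \<longrightarrow>
     cmod (T n \<nu> j l) \<le> C / \<bar>real_of_int l\<bar> ^ (p + 4)" using T_decay[OF R0 \<kappa>2, of "p + 4"] by (elim exE conjE) (rule that)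
  obtain Z where Z: "Z > 0" "\<And>F::int set. finite F \<Longrightarrow> (\<Sum>n\<in>F. 1 / (max 1 \<bar>real_of_int n\<bar>)\<^sup>2) \<le> Z"
    using int_square_sum_bound by blast
  define e0 where "e0 = C * Z * \<kappa>2 * sqrt Z"
  have e0: "e0 \<ge> 0" using C Z \<kappa>2 by (simp add: e0_def)
  show ?thesis
  proof (rule exI[of _ e0], rule conjI[OF e0], intro allI impI)
    fix \<nu> \<mu> m :: real and S J :: "int set" and c :: "int \<Rightarrow> complex"
    assume a: "\<mu> \<ge> 1" "R * \<bar>\<nu>\<bar> \<le> 2 * pi * \<mu>" "m < 0" "- m \<le> real p" "finite S" "finite J" "\<forall>l\<in>S. \<mu> < \<bar>real_of_int l\<bar>"
    have S: "\<And>l. l \<in> S \<Longrightarrow> \<mu> < \<bar>real_of_int l\<bar>" using a(7) by blast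
    have dec: "cmod (T n \<nu> j l) \<le> C / \<bar>real_of_int l\<bar> ^ (p + 4)"
      if "\<mu> < \<bar>real_of_int l\<bar>" "\<bar>real_of_int j\<bar> \<le> \<kappa>2 * \<bar>real_of_int l\<bar>" for j l
    proof (rule C(2)[rule_format])
      show "l \<noteq> 0" using that a(1) by auto
      have "2 * pi * \<mu> < 2 * pi * \<bar>real_of_int l\<bar>" using that by simp
      then show "R * \<bar>\<nu>\<bar> < 2 * pi * \<bar>real_of_int l\<bar>" using a(2) by linarith
    qed (rule that)
    have nc: "near_const C \<kappa>2 \<mu> Z = e0 / \<mu>"
      unfolding e0_def
      by (rule near_const_def[where T="T n \<nu>" and D="growth n" and p=p])
         (assumption | rule T_L2 dec Z growth_nonneg C(1) \<kappa>2(1) a(1))+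
    have hf1: "L2_set (\<lambda>j. flat_weight \<mu> m j * cmod (\<Sum>l\<in>S. T n \<nu> j l * c l)) J \<le>
       ((growth n + near_const C \<kappa>2 \<mu> Z) * \<kappa>2 powr m + near_const C \<kappa>2 \<mu> Z) * L2_set (\<lambda>l. flat_weight \<mu> m l * cmod (c l)) S"
      by (rule high_frequency_bound(1)[where T="T n \<nu>" and D="growth n" and p=p])
         (assumption | rule T_L2 dec Z growth_nonneg C(1) \<kappa>2(1) a(1,3-6) S)+
    have hf2: "L2_set (\<lambda>j. cmod (\<Sum>l\<in>S. T n \<nu> j l * c l)) J \<le>
       near_const C \<kappa>2 \<mu> Z * L2_set (\<lambda>l. flat_weight \<mu> m l * cmod (c l)) S" if j: "\<And>j. j \<in> J \<Longrightarrow> \<bar>real_of_int j\<bar> \<le> \<mu>"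
      by (rule high_frequency_bound(2)[where T="T n \<nu>" and D="growth n" and p=p])
         (assumption | rule T_L2 dec Z growth_nonneg C(1) \<kappa>2(1) a(1,3-6) S j)+
    show "L2_set (\<lambda>j. flat_weight \<mu> m j * cmod (\<Sum>l\<in>S. T n \<nu> j l * c l)) J \<le>
       ((growth n + e0 / \<mu>) * \<kappa>2 powr m + e0 / \<mu>) * L2_set (\<lambda>l. flat_weight \<mu> m l * cmod (c l)) S \<and>
     ((\<forall>j\<in>J. \<bar>real_of_int j\<bar> \<le> \<mu>) \<longrightarrow> L2_set (\<lambda>j. cmod (\<Sum>l\<in>S. T n \<nu> j l * c l)) J \<le>
       e0 / \<mu> * L2_set (\<lambda>l. flat_weight \<mu> m l * cmod (c l)) S)"
      using hf1 hf2 unfolding nc by blast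
  qed
qed

text \<open>Inputs up to \<open>\<mu>\<close> have weight 1 for every \<open>m\<close>, and outputs
  have weight at most 1 for every \<open>m' \<le> 0\<close>. Hence the low part maps between any two
  of the scales; it is the smoothing perturbation required by \<open>wres_transport\<close>.\<close>

lemma low_part_flat:
  assumes "m' \<le> 0" "\<mu> \<ge> 1" "finite S" "finite J" "\<And>l. l \<in> S \<Longrightarrow> \<bar>real_of_int l\<bar> \<le> \<mu>"
  shows "L2_set (\<lambda>j. flat_weight \<mu> m' j * cmod (\<Sum>l\<in>S. T n \<nu> j l * c l)) J \<le> growth n * L2_set (\<lambda>l. flat_weight \<mu> m l * cmod (c l)) S"
proof -
  have "L2_set (\<lambda>j. flat_weight \<mu> m' j * cmod (\<Sum>l\<in>S. T n \<nu> j l * c l)) J \<le> L2_set (\<lambda>j. cmod (\<Sum>l\<in>S. T n \<nu> j l * c l)) J"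
    using flat_weight_le_1[OF assms(1)] flat_weight_nonneg by (intro L2_set_mono) (auto intro: mult_left_le_one_le)
  also have "\<dots> \<le> growth n * L2_set (\<lambda>l. cmod (c l)) S" by (rule T_L2[OF assms(3,4)])
  also have "L2_set (\<lambda>l. cmod (c l)) S = L2_set (\<lambda>l. flat_weight \<mu> m l * cmod (c l)) S"
    using flat_weight_low[OF assms(2)] assms(5) by (intro L2_set_cong) auto
  finally show ?thesis .
qed

lemma wop_Top_lo:
  assumes R0: "R > 0" and n: "n \<ge> 1" and m: "m \<le> 0" "m' \<le> 0" and \<mu>: "\<mu> \<ge> 1"
  shows "wop (flat_weight \<mu> m) (flat_weight \<mu> m') (\<lambda>c. Top n \<nu> (lo_freq \<mu> c))"
proof (rule wopI)
  fix c d x y assume cd: "c \<in> wseq (flat_weight \<mu> m)" "d \<in> wseq (flat_weight \<mu> m)"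
  then have p: "poly_bounded c" "poly_bounded d" unfolding wseq_flat_eq[OF m(1) \<mu>] using wseq_poly_bounded m by auto
  have "lo_freq \<mu> (\<lambda>n. x * c n + y * d n) = (\<lambda>l. x * lo_freq \<mu> c l + y * lo_freq \<mu> d l)" by (auto simp: lo_freq_def)
  then show "Top n \<nu> (lo_freq \<mu> (\<lambda>n. x * c n + y * d n)) = (\<lambda>j. x * Top n \<nu> (lo_freq \<mu> c) j + y * Top n \<nu> (lo_freq \<mu> d) j)"
    using Top_lin[OF R0 n] poly_bounded_hi_lo p by simp
next
  fix c M assume c: "wnorm_le (flat_weight \<mu> m) c M"
  then have "c \<in> wseq (flat_weight \<mu> m)" by (auto simp: wseq_def)
  then have "poly_bounded c" unfolding wseq_flat_eq[OF m(1) \<mu>] using wseq_poly_bounded m by auto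
  then show "wnorm_le (flat_weight \<mu> m') (Top n \<nu> (lo_freq \<mu> c)) (growth n * M)"
    unfolding lo_freq_def [abs_def] using c
    by (intro Top_masked_bound[OF R0 n, where a="flat_weight \<mu> m"]) (assumption | rule low_part_flat m \<mu> growth_nonneg)+
qed (rule growth_nonneg)

lemma wop_Top_hi:
  assumes R0: "R > 0" and n: "n \<ge> 1" and m: "m \<le> 0" and \<mu>: "\<mu> \<ge> 1" and q: "q \<ge> 0"
    and fin: "\<And>S J c. finite S \<Longrightarrow> finite J \<Longrightarrow> (\<And>l. l \<in> S \<Longrightarrow> \<mu> < \<bar>real_of_int l\<bar>) \<Longrightarrow>
      L2_set (\<lambda>j. flat_weight \<mu> m j * cmod (\<Sum>l\<in>S. T n \<nu> j l * c l)) J \<le> q * L2_set (\<lambda>l. flat_weight \<mu> m l * cmod (c l)) S"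
  shows "wop (flat_weight \<mu> m) (flat_weight \<mu> m) (\<lambda>c. Top n \<nu> (hi_freq \<mu> c))"
    and "wnorm_le (flat_weight \<mu> m) c M \<Longrightarrow> wnorm_le (flat_weight \<mu> m) (Top n \<nu> (hi_freq \<mu> c)) (q * M)"
proof -
  have bd: "wnorm_le (flat_weight \<mu> m) (Top n \<nu> (hi_freq \<mu> c)) (q * M)" if c: "wnorm_le (flat_weight \<mu> m) c M" for c M
  proof -
    have "c \<in> wseq (flat_weight \<mu> m)" using c by (auto simp: wseq_def)
    then have "poly_bounded c" unfolding wseq_flat_eq[OF m \<mu>] using wseq_poly_bounded m by auto
    then show ?thesis
      unfolding hi_freq_def [abs_def] using c
      by (intro Top_masked_bound[OF R0 n, where a="flat_weight \<mu> m"]) (assumption | rule fin q)+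
  qed
  then show "wnorm_le (flat_weight \<mu> m) c M \<Longrightarrow> wnorm_le (flat_weight \<mu> m) (Top n \<nu> (hi_freq \<mu> c)) (q * M)" .
  show "wop (flat_weight \<mu> m) (flat_weight \<mu> m) (\<lambda>c. Top n \<nu> (hi_freq \<mu> c))"
  proof (rule wopI[OF _ q bd])
    fix c d x y assume cd: "c \<in> wseq (flat_weight \<mu> m)" "d \<in> wseq (flat_weight \<mu> m)"
    then have p: "poly_bounded c" "poly_bounded d" unfolding wseq_flat_eq[OF m \<mu>] using wseq_poly_bounded m by auto
    have "hi_freq \<mu> (\<lambda>n. x * c n + y * d n) = (\<lambda>l. x * hi_freq \<mu> c l + y * hi_freq \<mu> d l)" by (auto simp: hi_freq_def)
    then show "Top n \<nu> (hi_freq \<mu> (\<lambda>n. x * c n + y * d n)) = (\<lambda>j. x * Top n \<nu> (hi_freq \<mu> c) j + y * Top n \<nu> (hi_freq \<mu> d) j)"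
      using Top_lin[OF R0 n] poly_bounded_hi_lo p by simp
  qed
qed

lemma Top_hi_lo:
  assumes "R > 0" "n \<ge> 1" "poly_bounded c"
  shows "Top n \<nu> c = (\<lambda>j. Top n \<nu> (hi_freq \<mu> c) j + Top n \<nu> (lo_freq \<mu> c) j)"
proof -
  have "c = (\<lambda>l. 1 * hi_freq \<mu> c l + 1 * lo_freq \<mu> c l)" by (auto simp: hi_freq_def lo_freq_def)
  then have "Top n \<nu> c = Top n \<nu> (\<lambda>l. 1 * hi_freq \<mu> c l + 1 * lo_freq \<mu> c l)" by (rule arg_cong)
  also have "\<dots> = (\<lambda>j. 1 * Top n \<nu> (hi_freq \<mu> c) j + 1 * Top n \<nu> (lo_freq \<mu> c) j)"
    by (intro Top_lin assms poly_bounded_hi_lo)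
  finally show ?thesis by simp
qed

lemma wop_Top:
  assumes R0: "R > 0" and n: "n \<ge> 1" and m: "m < 0"
  shows "wop (sob_weight m) (sob_weight m) (Top n \<nu>)"
proof -
  have kn: "\<kappa> ^ n > 1" using kappa n by (intro one_less_power) auto
  define \<kappa>2 where "\<kappa>2 = (1 + \<kappa> ^ n) / 2"
  have k: "1 < \<kappa>2" "\<kappa>2 < \<kappa> ^ n" using kn by (auto simp: \<kappa>2_def)
  obtain p where p: "- m \<le> real p" using real_arch_simple by blast
  define \<mu> where "\<mu> = max 1 (R * \<bar>\<nu>\<bar>)"
  have \<mu>: "\<mu> \<ge> 1" "R * \<bar>\<nu>\<bar> \<le> 2 * pi * \<mu>"
    using mult_right_mono[of 1 "2 * pi" \<mu>] pi_gt3 by (auto simp: \<mu>_def max_def)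
  obtain e0 where e0: "e0 \<ge> 0" "\<forall>\<nu> \<mu> m S J c. \<mu> \<ge> 1 \<longrightarrow> R * \<bar>\<nu>\<bar> \<le> 2 * pi * \<mu> \<longrightarrow> m < 0 \<longrightarrow> - m \<le> real p \<longrightarrow> finite S \<longrightarrow> finite J \<longrightarrow>
     (\<forall>l\<in>S. \<mu> < \<bar>real_of_int l\<bar>) \<longrightarrow>
     L2_set (\<lambda>j. flat_weight \<mu> m j * cmod (\<Sum>l\<in>S. T n \<nu> j l * c l)) J \<le>
       ((growth n + e0 / \<mu>) * \<kappa>2 powr m + e0 / \<mu>) * L2_set (\<lambda>l. flat_weight \<mu> m l * cmod (c l)) S \<and>
     ((\<forall>j\<in>J. \<bar>real_of_int j\<bar> \<le> \<mu>) \<longrightarrow> L2_set (\<lambda>j. cmod (\<Sum>l\<in>S. T n \<nu> j l * c l)) J \<le>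
       e0 / \<mu> * L2_set (\<lambda>l. flat_weight \<mu> m l * cmod (c l)) S)"
    using high_frequency_T[OF R0 k, of p] by (elim exE conjE) (rule that)
  have q: "(growth n + e0 / \<mu>) * \<kappa>2 powr m + e0 / \<mu> \<ge> 0" using e0(1) \<mu> growth_nonneg[of n] by simp
  have m0: "m \<le> 0" using m by simp
  have hi: "wop (flat_weight \<mu> m) (flat_weight \<mu> m) (\<lambda>c. Top n \<nu> (hi_freq \<mu> c))"
    by (rule wop_Top_hi[OF R0 n m0 \<mu>(1) q]) (use e0(2) \<mu> m p in blast)
  have "wop (flat_weight \<mu> m) (flat_weight \<mu> m) (\<lambda>c j. Top n \<nu> (hi_freq \<mu> c) j + Top n \<nu> (lo_freq \<mu> c) j)"
    by (intro wop_add flat_weight_nonneg hi wop_Top_lo R0 n m0 \<mu>)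
  then have F: "wop (flat_weight \<mu> m) (flat_weight \<mu> m) (Top n \<nu>)"
  proof (rule wop_cong[OF _ flat_weight_nonneg])
    fix c assume "c \<in> wseq (flat_weight \<mu> m)"
    then have "poly_bounded c" unfolding wseq_flat_eq[OF m0 \<mu>(1)] using wseq_poly_bounded m0 by auto
    then show "(\<lambda>j. Top n \<nu> (hi_freq \<mu> c) j + Top n \<nu> (lo_freq \<mu> c) j) = Top n \<nu> c"
      using Top_hi_lo[OF R0 n] by simp
  qed
  have i1: "wop (sob_weight m) (flat_weight \<mu> m) (\<lambda>c. c)"
    by (rule wop_id[of "flat_weight \<mu> m", OF flat_weight_nonneg flat_weight_equiv(2)[OF m0 \<mu>(1)]]) simp
  have i2: "wop (flat_weight \<mu> m) (sob_weight m) (\<lambda>c. c)"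
    by (rule wop_id[of "sob_weight m", OF sob_weight_nonneg flat_weight_equiv(1)[OF m0 \<mu>(1)]]) simp
  show ?thesis using wop_comp[OF wop_comp[OF i1 F] i2] by simp
qed

text \<open>For very negative exponents the high part has norm at most
  \<open>3 * \<delta> / 4\<close> on both scales, \<open>\<delta> / 2\<close> from far and
  \<open>\<delta> / 4\<close> from near entries, while the low part is smoothing. \<open>m0\<close>
  comes from the far entries alone, whose bound \<open>growth 1\<close> is uniform in
  \<open>\<nu>\<close>; it therefore depends on \<open>\<delta>\<close> but not on
  \<open>\<nu>\<close>.\<close>

lemma resolvent_independent:
  assumes R0: "R > 0" and \<delta>: "\<delta> > 0"
  shows "\<exists>m0<0. \<forall>\<nu> m m' z. m \<le> m0 \<longrightarrow> m' \<le> m0 \<longrightarrow> cmod z > \<delta> \<longrightarrow>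
    (z \<in> wres (sob_weight m) (Top 1 \<nu>) \<longleftrightarrow> z \<in> wres (sob_weight m') (Top 1 \<nu>))"
proof -
  define \<kappa>2 where "\<kappa>2 = (1 + \<kappa>) / 2"
  have k: "1 < \<kappa>2" "\<kappa>2 < \<kappa> ^ 1" using kappa by (auto simp: \<kappa>2_def)
  let ?D = "growth 1"
  have D1: "?D + 1 > 0" using growth_nonneg[of 1] by simp
  obtain m0 where m0: "m0 < 0" "\<And>m. m \<le> m0 \<Longrightarrow> \<kappa>2 powr m \<le> \<delta> / (2 * (?D + 1))"
    using powr_small[OF k(1), of "\<delta> / (2 * (?D + 1))"] \<delta> D1 by auto
  have small: "(?D + 1) * \<kappa>2 powr m \<le> \<delta> / 2" if "m \<le> m0" for m
  proof -
    have "x * (\<delta> / (2 * x)) = \<delta> / 2" if "x > 0" for x :: real using that by simp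
    from this[OF D1] show ?thesis using mult_left_mono[OF m0(2)[OF that], of "?D + 1"] D1 by linarith
  qed
  have core: "z \<in> wres (sob_weight m) (Top 1 \<nu>) \<longleftrightarrow> z \<in> wres (sob_weight m') (Top 1 \<nu>)"
    if m: "m \<le> m'" "m' \<le> m0" and z: "cmod z > \<delta>" for \<nu> m m' z
  proof -
    obtain p where p: "- m \<le> real p" using real_arch_simple by blast
    obtain e0 where e0: "e0 \<ge> 0" "\<forall>\<nu> \<mu> m S J c. \<mu> \<ge> 1 \<longrightarrow> R * \<bar>\<nu>\<bar> \<le> 2 * pi * \<mu> \<longrightarrow> m < 0 \<longrightarrow> - m \<le> real p \<longrightarrow> finite S \<longrightarrow> finite J \<longrightarrow>
       (\<forall>l\<in>S. \<mu> < \<bar>real_of_int l\<bar>) \<longrightarrow>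
       L2_set (\<lambda>j. flat_weight \<mu> m j * cmod (\<Sum>l\<in>S. T 1 \<nu> j l * c l)) J \<le>
         ((growth 1 + e0 / \<mu>) * \<kappa>2 powr m + e0 / \<mu>) * L2_set (\<lambda>l. flat_weight \<mu> m l * cmod (c l)) S \<and>
       ((\<forall>j\<in>J. \<bar>real_of_int j\<bar> \<le> \<mu>) \<longrightarrow> L2_set (\<lambda>j. cmod (\<Sum>l\<in>S. T 1 \<nu> j l * c l)) J \<le>
         e0 / \<mu> * L2_set (\<lambda>l. flat_weight \<mu> m l * cmod (c l)) S)"
      using high_frequency_T[OF R0 k, of p] by (elim exE conjE) (rule that)
    \<comment> \<open>The threshold may depend on \<open>\<nu>\<close> and on both exponents, since
      the resolvent sets for the flat weights do not vary with it. The last two entries give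
      \<open>e0 / \<mu> \<le> 1\<close> and \<open>e0 / \<mu> \<le> \<delta> / 4\<close>.\<close>
    define \<mu> where "\<mu> = max (max 1 (R * \<bar>\<nu>\<bar>)) (max e0 (4 * e0 / \<delta>))"
    have \<mu>: "\<mu> \<ge> 1" "R * \<bar>\<nu>\<bar> \<le> \<mu>" "e0 \<le> \<mu>" "4 * e0 / \<delta> \<le> \<mu>" unfolding \<mu>_def by linarith+
    have "\<mu> \<le> 2 * pi * \<mu>" using mult_right_mono[of 1 "2 * pi" \<mu>] pi_gt3 \<mu>(1) by simp
    then have \<mu>2: "R * \<bar>\<nu>\<bar> \<le> 2 * pi * \<mu>" using \<mu>(2) by linarith
    have e: "e0 / \<mu> \<le> 1" "e0 / \<mu> \<le> \<delta> / 4" "e0 / \<mu> \<ge> 0" using \<mu> \<delta> e0(1) by (auto simp: divide_simps mult_ac)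
    have fin: "L2_set (\<lambda>j. flat_weight \<mu> a j * cmod (\<Sum>l\<in>S. T 1 \<nu> j l * c l)) J \<le> (3 * \<delta> / 4) * L2_set (\<lambda>l. flat_weight \<mu> a l * cmod (c l)) S"
      if a: "m \<le> a" "a \<le> m0" and S: "finite S" "finite J" "\<And>l. l \<in> S \<Longrightarrow> \<mu> < \<bar>real_of_int l\<bar>" for a S J c
    proof -
      have "L2_set (\<lambda>j. flat_weight \<mu> a j * cmod (\<Sum>l\<in>S. T 1 \<nu> j l * c l)) J \<le>
         ((growth 1 + e0 / \<mu>) * \<kappa>2 powr a + e0 / \<mu>) * L2_set (\<lambda>l. flat_weight \<mu> a l * cmod (c l)) S"
        by (rule e0(2)[rule_format, THEN conjunct1]) (use \<mu> \<mu>2 a m0(1) p S in auto)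
      also have "\<dots> \<le> (3 * \<delta> / 4) * L2_set (\<lambda>l. flat_weight \<mu> a l * cmod (c l)) S"
      proof (rule mult_right_mono)
        have "(growth 1 + e0 / \<mu>) * \<kappa>2 powr a \<le> (growth 1 + 1) * \<kappa>2 powr a" using e by (intro mult_right_mono) auto
        then show "(growth 1 + e0 / \<mu>) * \<kappa>2 powr a + e0 / \<mu> \<le> 3 * \<delta> / 4" using small[OF a(2)] e(2) by linarith
      qed simp
      finally show ?thesis .
    qed
    have neg: "m \<le> 0" "m' \<le> 0" using m m0(1) by auto
    have q: "0 \<le> 3 * \<delta> / 4" "3 * \<delta> / 4 < cmod z" using \<delta> z by auto
    have mm: "m \<le> m0" "m \<le> m" using m by auto
    have ha1: "wop (flat_weight \<mu> m) (flat_weight \<mu> m) (\<lambda>c. Top 1 \<nu> (hi_freq \<mu> c))"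
      by (rule wop_Top_hi(1)[OF R0 order_refl neg(1) \<mu>(1) q(1)]) (rule fin[OF mm(2,1)]; assumption)
    have ha2: "wnorm_le (flat_weight \<mu> m) (Top 1 \<nu> (hi_freq \<mu> c)) (3 * \<delta> / 4 * M)" if "wnorm_le (flat_weight \<mu> m) c M" for c M
      by (rule wop_Top_hi(2)[OF R0 order_refl neg(1) \<mu>(1) q(1) _ that]) (rule fin[OF mm(2,1)]; assumption)
    have hb1: "wop (flat_weight \<mu> m') (flat_weight \<mu> m') (\<lambda>c. Top 1 \<nu> (hi_freq \<mu> c))"
      by (rule wop_Top_hi(1)[OF R0 order_refl neg(2) \<mu>(1) q(1)]) (rule fin[OF m]; assumption)
    have hb2: "wnorm_le (flat_weight \<mu> m') (Top 1 \<nu> (hi_freq \<mu> c)) (3 * \<delta> / 4 * M)" if "wnorm_le (flat_weight \<mu> m') c M" for c M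
      by (rule wop_Top_hi(2)[OF R0 order_refl neg(2) \<mu>(1) q(1) _ that]) (rule fin[OF m]; assumption)
    have "z \<in> wres (flat_weight \<mu> m) (Top 1 \<nu>) \<longleftrightarrow> z \<in> wres (flat_weight \<mu> m') (Top 1 \<nu>)"
    proof (rule wres_transport[of "flat_weight \<mu> m" "flat_weight \<mu> m'", OF flat_weight_pos flat_weight_pos flat_weight_mono[OF m(1)] _ ha1 hb1 q ha2 hb2 wop_Top_lo[OF R0 order_refl neg \<mu>(1)]])
      fix c assume "c \<in> wseq (flat_weight \<mu> m)"
      then have "poly_bounded c" unfolding wseq_flat_eq[OF neg(1) \<mu>(1)] using wseq_poly_bounded neg by auto
      then show "Top 1 \<nu> c = (\<lambda>n. Top 1 \<nu> (hi_freq \<mu> c) n + Top 1 \<nu> (lo_freq \<mu> c) n)"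
        by (intro Top_hi_lo R0) auto
    qed auto
    then show ?thesis by (simp add: wres_flat_eq neg \<mu>(1))
  qed
  show ?thesis
  proof (intro exI[of _ m0] conjI m0(1) allI impI)
    fix \<nu> m m' and z :: complex assume a: "m \<le> m0" "m' \<le> m0" "\<delta> < cmod z"
    show "z \<in> wres (sob_weight m) (Top 1 \<nu>) \<longleftrightarrow> z \<in> wres (sob_weight m') (Top 1 \<nu>)"
    proof (cases "m \<le> m'")
      case True
      show ?thesis by (rule core[OF True a(2,3)])
    next
      case False
      then have "m' \<le> m" by simp
      from core[OF this a(1,3), of \<nu>] show ?thesis by (rule sym)
    qed
  qed
qed

lemma Top_funpow:
  assumes "R > 0" "m < 0" "c \<in> wseq (sob_weight m)"
  shows "(Top 1 \<nu> ^^ Suc n) c = Top (Suc n) \<nu> c"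
proof (induction n)
  case (Suc n)
  have "poly_bounded c" using wseq_poly_bounded assms by auto
  then have "Top 1 \<nu> (Top (Suc n) \<nu> c) = Top (Suc (Suc n)) \<nu> c" by (intro Top_Suc assms) auto
  then show ?case using Suc by simp
qed simp

text \<open>The weight \<open>b\<close> makes the block from low to high frequencies as small as the diagonal blocks;
  the price \<open>e / \<omega>\<close> in the opposite block is affordable because \<open>e\<close> tends to 0 with \<open>1 / \<nu>\<close>.\<close>

lemma resolvent_of_power_bound:
  assumes R0: "R > 0" and n: "n \<ge> 1" and m: "m < 0" and \<mu>: "\<mu> \<ge> 1"
    and q: "q > 0" "0 \<le> e" "e * max 1 (growth n) \<le> q * q" "\<delta> \<le> 2 * q"
    and hi_hi: "\<And>S J c. finite S \<Longrightarrow> finite J \<Longrightarrow> (\<And>l. l \<in> S \<Longrightarrow> \<mu> < \<bar>real_of_int l\<bar>) \<Longrightarrow>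
      L2_set (\<lambda>j. flat_weight \<mu> m j * cmod (\<Sum>l\<in>S. T n \<nu> j l * c l)) J \<le> \<delta> * L2_set (\<lambda>l. flat_weight \<mu> m l * cmod (c l)) S"
    and hi_lo: "\<And>S J c. finite S \<Longrightarrow> finite J \<Longrightarrow> (\<And>l. l \<in> S \<Longrightarrow> \<mu> < \<bar>real_of_int l\<bar>) \<Longrightarrow> (\<And>j. j \<in> J \<Longrightarrow> \<bar>real_of_int j\<bar> \<le> \<mu>) \<Longrightarrow>
      L2_set (\<lambda>j. cmod (\<Sum>l\<in>S. T n \<nu> j l * c l)) J \<le> e * L2_set (\<lambda>l. flat_weight \<mu> m l * cmod (c l)) S"
    and lo_lo: "\<And>S J c. finite S \<Longrightarrow> finite J \<Longrightarrow> (\<And>l. l \<in> S \<Longrightarrow> \<bar>real_of_int l\<bar> \<le> \<mu>) \<Longrightarrow> (\<And>j. j \<in> J \<Longrightarrow> \<bar>real_of_int j\<bar> \<le> \<mu>) \<Longrightarrow>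
      L2_set (\<lambda>j. cmod (\<Sum>l\<in>S. T n \<nu> j l * c l)) J \<le> q * L2_set (\<lambda>l. cmod (c l)) S"
    and z: "5 * q < cmod z ^ n"
  shows "z \<in> wres (sob_weight m) (Top 1 \<nu>)"
proof -
  define D where "D = max 1 (growth n)"
  have D: "D \<ge> 1" "growth n \<le> D" by (auto simp: D_def)
  \<comment> \<open>This value makes \<open>\<omega> * growth n \<le> q\<close> for the block from
    low to high, and the hypothesis on \<open>e\<close> is exactly what gives
    \<open>e / \<omega> \<le> q\<close> for the opposite block.\<close>
  define \<omega> where "\<omega> = q / D"
  have \<omega>: "\<omega> > 0" "\<omega> * D = q" using D q by (auto simp: \<omega>_def)
  have e\<omega>: "e \<le> q * \<omega>" using q(3) D by (simp add: \<omega>_def D_def[symmetric] pos_le_divide_eq)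
  define b where "b n = (if \<bar>real_of_int n\<bar> \<le> \<mu> then 1 else \<omega> * flat_weight \<mu> m n)" for n
  have bpos: "0 < b n" for n using \<omega> flat_weight_pos by (simp add: b_def)
  have bnn: "0 \<le> b n" for n using bpos[of n] by simp
  have main: "L2_set (\<lambda>j. b j * cmod (\<Sum>l\<in>S. T n \<nu> j l * c l)) J \<le> (5 * q) * L2_set (\<lambda>l. b l * cmod (c l)) S"
    if S: "finite S" "finite J" for S J c
  proof -
    define S1 where "S1 = {l\<in>S. \<bar>real_of_int l\<bar> \<le> \<mu>}"
    define S2 where "S2 = {l\<in>S. \<mu> < \<bar>real_of_int l\<bar>}"
    define J1 where "J1 = {l\<in>J. \<bar>real_of_int l\<bar> \<le> \<mu>}"
    define J2 where "J2 = {l\<in>J. \<mu> < \<bar>real_of_int l\<bar>}"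
    have fin: "finite S1" "finite S2" "finite J1" "finite J2" using S by (auto simp: S1_def S2_def J1_def J2_def)
    have Su: "S = S1 \<union> S2" "S1 \<inter> S2 = {}" "J = J1 \<union> J2" "J1 \<inter> J2 = {}" by (auto simp: S1_def S2_def J1_def J2_def)
    define A where "A j = (\<Sum>l\<in>S1. T n \<nu> j l * c l)" for j
    define B where "B j = (\<Sum>l\<in>S2. T n \<nu> j l * c l)" for j
    have AB: "(\<Sum>l\<in>S. T n \<nu> j l * c l) = A j + B j" for j
      unfolding Su(1) A_def B_def by (rule sum.union_disjoint[OF fin(1,2) Su(2)])
    define M where "M = L2_set (\<lambda>l. b l * cmod (c l)) S"
    define x where "x = L2_set (\<lambda>l. cmod (c l)) S1"
    define y where "y = L2_set (\<lambda>l. flat_weight \<mu> m l * cmod (c l)) S2"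
    have "x = L2_set (\<lambda>l. b l * cmod (c l)) S1" unfolding x_def by (rule L2_set_cong) (auto simp: S1_def b_def)
    then have xM: "x \<le> M" unfolding M_def using S Su by (auto intro!: L2_set_subset)
    have "\<omega> * y = L2_set (\<lambda>l. \<omega> * (flat_weight \<mu> m l * cmod (c l))) S2"
      unfolding y_def using \<omega> by (intro L2_set_right_distrib) auto
    also have "\<dots> = L2_set (\<lambda>l. b l * cmod (c l)) S2" by (rule L2_set_cong) (auto simp: S2_def b_def mult.assoc)
    finally have yM: "\<omega> * y \<le> M" unfolding M_def using S Su by (auto intro!: L2_set_subset)
    have x0: "x \<ge> 0" and y0: "y \<ge> 0" and M0: "M \<ge> 0" by (auto simp: x_def y_def M_def)
    have union: "L2_set f J \<le> L2_set f J1 + L2_set f J2" for f :: "int \<Rightarrow> real"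
    proof -
      have "(\<Sum>i\<in>J. (f i)\<^sup>2) = (\<Sum>i\<in>J1. (f i)\<^sup>2) + (\<Sum>i\<in>J2. (f i)\<^sup>2)"
        unfolding Su(3) by (rule sum.union_disjoint[OF fin(3,4) Su(4)])
      then show ?thesis unfolding L2_set_def
        using sqrt_add_le_add_sqrt[of "\<Sum>i\<in>J1. (f i)\<^sup>2" "\<Sum>i\<in>J2. (f i)\<^sup>2"] by (simp add: sum_nonneg)
    qed
    have "L2_set (\<lambda>j. b j * cmod (A j + B j)) J1 \<le> L2_set (\<lambda>j. cmod (A j) + cmod (B j)) J1"
      by (rule L2_set_mono) (auto simp: J1_def b_def norm_triangle_ineq)
    also have "\<dots> \<le> L2_set (\<lambda>j. cmod (A j)) J1 + L2_set (\<lambda>j. cmod (B j)) J1" by (rule L2_set_triangle_ineq)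
    also have "\<dots> \<le> q * x + e * y"
      unfolding A_def B_def x_def y_def by (intro add_mono lo_lo hi_lo fin) (auto simp: S1_def S2_def J1_def)
    finally have p1: "L2_set (\<lambda>j. b j * cmod (A j + B j)) J1 \<le> q * x + e * y" .
    have "L2_set (\<lambda>j. b j * cmod (A j + B j)) J2 = L2_set (\<lambda>j. \<omega> * (flat_weight \<mu> m j * cmod (A j + B j))) J2"
      by (rule L2_set_cong) (auto simp: J2_def b_def mult.assoc)
    also have "\<dots> = \<omega> * L2_set (\<lambda>j. flat_weight \<mu> m j * cmod (A j + B j)) J2"
      using \<omega> by (intro L2_set_right_distrib[symmetric]) auto
    also have "L2_set (\<lambda>j. flat_weight \<mu> m j * cmod (A j + B j)) J2 \<le>
        L2_set (\<lambda>j. flat_weight \<mu> m j * cmod (A j) + flat_weight \<mu> m j * cmod (B j)) J2"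
      using flat_weight_nonneg by (intro L2_set_mono) (auto simp flip: distrib_left intro!: mult_left_mono norm_triangle_ineq)
    also have "\<dots> \<le> L2_set (\<lambda>j. flat_weight \<mu> m j * cmod (A j)) J2 + L2_set (\<lambda>j. flat_weight \<mu> m j * cmod (B j)) J2"
      by (rule L2_set_triangle_ineq)
    also have "L2_set (\<lambda>j. flat_weight \<mu> m j * cmod (A j)) J2 \<le> growth n * L2_set (\<lambda>l. flat_weight \<mu> 0 l * cmod (c l)) S1"
      unfolding A_def by (rule low_part_flat) (use m \<mu> fin in \<open>auto simp: S1_def\<close>)
    also have "L2_set (\<lambda>l. flat_weight \<mu> 0 l * cmod (c l)) S1 = x"
      unfolding x_def by (rule L2_set_cong) (auto simp: flat_weight_def)
    also have "L2_set (\<lambda>j. flat_weight \<mu> m j * cmod (B j)) J2 \<le> \<delta> * y"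
      unfolding B_def y_def by (intro hi_hi fin) (auto simp: S2_def)
    finally have p2: "L2_set (\<lambda>j. b j * cmod (A j + B j)) J2 \<le> \<omega> * (growth n * x + \<delta> * y)"
      using \<omega> by simp
    have "e * y \<le> q * (\<omega> * y)" using mult_right_mono[OF e\<omega> y0] by (simp add: mult.assoc)
    also have "\<dots> \<le> q * M" using yM q by (intro mult_left_mono) auto
    finally have t1: "e * y \<le> q * M" .
    have t2: "q * x \<le> q * M" using xM q by (intro mult_left_mono) auto
    have "\<omega> * (growth n * x) \<le> \<omega> * (D * x)" using \<omega> D x0 by (intro mult_left_mono mult_right_mono) auto
    also have "\<dots> = q * x" using \<omega> by (simp add: mult.assoc[symmetric])
    finally have t3: "\<omega> * (growth n * x) \<le> q * M" using t2 by linarith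
    have "\<delta> * (\<omega> * y) \<le> (2 * q) * (\<omega> * y)" using q(4) \<omega> y0 by (intro mult_right_mono) auto
    also have "\<dots> \<le> (2 * q) * M" using yM q by (intro mult_left_mono) auto
    finally have t4: "\<delta> * (\<omega> * y) \<le> 2 * (q * M)" by simp
    have "L2_set (\<lambda>j. b j * cmod (A j + B j)) J \<le> q * x + e * y + (\<omega> * (growth n * x) + \<delta> * (\<omega> * y))"
      using union[of "\<lambda>j. b j * cmod (A j + B j)"] p1 p2 by (simp add: distrib_left mult_ac)
    \<comment> \<open>Each block except high to high contributes at most \<open>q * M\<close>, and
      that one at most \<open>2 * q * M\<close>: this is the 5 in the bound on
      \<open>z\<close>.\<close>
    also have "\<dots> \<le> 5 * (q * M)" using t1 t2 t3 t4 by linarith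
    finally show ?thesis by (simp add: AB M_def)
  qed
  have m0: "m \<le> 0" using m by simp
  define K where "K = max 1 \<omega>"
  define K' where "K' = max 1 (1 / \<omega>)"
  have bf: "b n \<le> K * flat_weight \<mu> m n" for n
    using flat_weight_low[OF \<mu>, of n m] flat_weight_nonneg[of \<mu> m n] by (auto simp: b_def K_def intro!: mult_right_mono)
  have fb: "flat_weight \<mu> m n \<le> K' * b n" for n
  proof (cases "\<bar>real_of_int n\<bar> \<le> \<mu>")
    case True
    then show ?thesis using flat_weight_low[OF \<mu>] by (simp add: b_def K'_def)
  next
    case False
    have "flat_weight \<mu> m n = (1 / \<omega>) * (\<omega> * flat_weight \<mu> m n)" using \<omega> by simp
    also have "\<dots> \<le> K' * (\<omega> * flat_weight \<mu> m n)"
      using \<omega> flat_weight_nonneg[of \<mu> m n] by (intro mult_right_mono) (auto simp: K'_def)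
    finally show ?thesis using False by (simp add: b_def)
  qed
  have KK: "K \<ge> 0" "K' \<ge> 0" by (auto simp: K_def K'_def)
  have ws: "wseq b = wseq (sob_weight m)"
    using wseq_subset[of b K "flat_weight \<mu> m", OF bnn bf KK(1)] wseq_subset[of "flat_weight \<mu> m" K' b, OF flat_weight_nonneg fb KK(2)]
      wseq_flat_eq[OF m0 \<mu>] by auto
  have wr: "wres b F = wres (sob_weight m) F" for F
    using wres_equiv[of b "flat_weight \<mu> m" K' K F, OF bnn flat_weight_nonneg fb bf KK(2,1)] wres_flat_eq[OF m0 \<mu>] by simp
  have pb: "poly_bounded c" if "c \<in> wseq b" for c using that wseq_poly_bounded m0 unfolding ws by blast
  have bound: "wnorm_le b (Top n \<nu> c) (5 * q * M)" if "wnorm_le b c M" for c M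
  proof -
    have "wnorm_le b (Top n \<nu> (\<lambda>l. if True then c l else 0)) (5 * q * M)"
    proof (rule Top_masked_bound[OF R0 n])
      show "poly_bounded c" using pb that by (auto simp: wseq_def)
    qed (use main that q in auto)
    then show ?thesis by simp
  qed
  have op: "wop b b (Top n \<nu>)"
    by (rule wopI[OF _ _ bound]) (use q pb Top_lin[OF R0 n] in auto)
  have "z ^ n \<in> wres b (Top n \<nu>)"
    by (rule neumann_wres[OF bpos op, of "5 * q"]) (use q z bound in \<open>auto simp: norm_power\<close>)
  then have "z ^ n \<in> wres (sob_weight m) (Top n \<nu>)" by (simp add: wr)
  also have "wres (sob_weight m) (Top n \<nu>) = wres (sob_weight m) (Top 1 \<nu> ^^ n)"
  proof (rule wres_cong)
    fix c assume "c \<in> wseq (sob_weight m)"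
    from Top_funpow[OF R0 m this, of "n - 1" \<nu>] n show "Top n \<nu> c = (Top 1 \<nu> ^^ n) c" by simp
  qed
  finally show ?thesis
    using wres_power[OF sob_weight_nonneg wop_Top[OF R0 order_refl m], of z n \<nu>] n by simp
qed

end

section \<open>Choice of constants from partial captivity\<close>

context expanding_skew
begin

lemma captive_count_subexponential:
  assumes pc: "partially_captive k g \<tau> R" and B: "B > 1"
  shows "\<exists>j0. \<forall>j\<ge>j0. real (max 1 (captive_count k g \<tau> R j)) \<le> B ^ j"
proof -
  have "\<forall>\<^sub>F j in sequentially. ln (real (captive_count k g \<tau> R j)) / real j < ln B"
    using pc B unfolding partially_captive_def by (intro order_tendstoD) auto
  then obtain j0 where j0: "\<And>j. j \<ge> j0 \<Longrightarrow> ln (real (captive_count k g \<tau> R j)) / real j < ln B"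
    by (auto simp: eventually_sequentially)
  have "real (max 1 (captive_count k g \<tau> R j)) \<le> B ^ j" if j: "j \<ge> max 1 j0" for j
  proof -
    have B1: "1 \<le> B ^ j" using B by (intro one_le_power) auto
    have "real (captive_count k g \<tau> R j) \<le> B ^ j"
    proof (cases "captive_count k g \<tau> R j = 0")
      case False
      have "ln (real (captive_count k g \<tau> R j)) \<le> real j * ln B"
        using j0[of j] j by (simp add: divide_less_eq mult.commute less_imp_le)
      also have "\<dots> = ln (B ^ j)" using B by (simp add: ln_realpow)
      finally show ?thesis using False B by (subst (asm) ln_le_cancel_iff) auto
    qed (use B1 in auto)
    then show ?thesis using B1 by simp
  qed
  then show ?thesis by blast
qed

text \<open>The choices are nested: \<open>n\<close> depends on \<open>\<eta>\<close> through
  captivity, \<open>m1\<close> on \<open>n\<close>, and \<open>\<nu>0\<close> on \<open>m\<close>.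
  In particular \<open>m1\<close> depends on \<open>\<eta>\<close>;
  \<open>transfer_spectral_radius_bound\<close> removes this dependence.\<close>

lemma spectral_gap_seq:
  assumes pc: "partially_captive k g \<tau> R" and \<eta>: "\<eta> > 0"
  shows "\<exists>m1<0. \<forall>m\<le>m1. \<exists>\<nu>0. \<forall>\<nu>\<ge>\<nu>0. \<forall>z. cmod z > 1 / sqrt (E_min k g) + \<eta> \<longrightarrow> z \<in> wres (sob_weight m) (Top 1 \<nu>)"
proof -
  have R0: "R > 0" by (rule captive_radius_pos[OF pc])
  define Em where "Em = E_min k g"
  have Em: "Em > 1" using E_min by (simp add: Em_def)
  define b where "b = 1 / sqrt Em + \<eta>"
  have b0: "b > 0" using Em \<eta> by (simp add: b_def add_pos_pos)
  have "1 / sqrt Em < b" using \<eta> by (simp add: b_def)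
  then have "(1 / sqrt Em)\<^sup>2 < b\<^sup>2" using Em by (intro power_strict_mono) auto
  then have B: "b\<^sup>2 * Em > 1" using Em by (simp add: power_divide divide_less_eq)
  \<comment> \<open>As \<open>b\<close> exceeds \<open>1 / sqrt Em\<close>, the ratio
    \<open>b ^ 2 * Em\<close> exceeds 1. It is split into two equal factors: one power of
    \<open>s\<close> absorbs the captive count, the other the fixed constant
    \<open>175 * k ^ l\<close>.\<close>
  define s where "s = sqrt (b\<^sup>2 * Em)"
  have s: "s > 1" "s * s = b\<^sup>2 * Em" using B by (auto simp: s_def)
  obtain l where "4 < \<kappa> ^ l" using real_arch_pow[OF kappa(1)] by blast
  then have l: "\<kappa> ^ l * R > 4 * R" using R0 by simp
  obtain j0 where j0: "\<And>j. j \<ge> j0 \<Longrightarrow> real (max 1 (captive_count k g \<tau> R j)) \<le> s ^ j"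
    using captive_count_subexponential[OF pc s(1)] by blast
  obtain n0 where n0: "175 * real k ^ l < s ^ n0" using real_arch_pow[OF s(1)] by blast
  define n where "n = Suc (n0 + l + j0)"
  have n: "n \<ge> 1" "l \<le> n" "n - l \<ge> j0" "n0 \<le> n" by (auto simp: n_def)
  define a where "a = real (max 1 (captive_count k g \<tau> R (n - l)))"
  have a1: "a \<ge> 1" by (simp add: a_def)
  define Q where "Q = real k ^ l * a / Em ^ n"
  have Q0: "Q > 0" using k2 a1 Em by (simp add: Q_def)
  \<comment> \<open>The squared norm of the low block is at most \<open>6 * Q\<close> plus
    \<open>C / \<nu>\<close>, and the latter is at most \<open>Q\<close> for large
    \<open>\<nu>\<close>. Then \<open>(5 * q) ^ 2 = 25 * 7 * Q = 175 * Q\<close>.\<close>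
  define q where "q = sqrt (7 * Q)"
  have q0: "q > 0" and qq: "q * q = 7 * Q" using Q0 by (auto simp: q_def)
  have "a \<le> s ^ (n - l)" unfolding a_def by (rule j0[OF n(3)])
  also have "\<dots> \<le> s ^ n" using s by (intro power_increasing) auto
  finally have an: "a \<le> s ^ n" .
  have "175 * real k ^ l \<le> s ^ n0" using n0 by simp
  also have "\<dots> \<le> s ^ n" using s n by (intro power_increasing) auto
  finally have "175 * real k ^ l * a \<le> s ^ n * s ^ n" using an a1 s by (intro mult_mono) auto
  also have "\<dots> = (b ^ n)\<^sup>2 * Em ^ n"
    unfolding power_mult_distrib[of s s n, symmetric] s(2)
    by (simp add: power_mult_distrib power_mult[symmetric] mult.commute)
  finally have "175 * real k ^ l * a / Em ^ n \<le> (b ^ n)\<^sup>2" using Em by (subst pos_divide_le_eq) auto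
  then have "175 * Q \<le> (b ^ n)\<^sup>2" by (simp add: Q_def)
  moreover have "(5 * q)\<^sup>2 = 175 * Q" using qq by (simp add: power_mult_distrib power2_eq_square)
  ultimately have "(5 * q)\<^sup>2 \<le> (b ^ n)\<^sup>2" by simp
  then have qb: "5 * q \<le> b ^ n" by (rule power2_le_imp_le) (use b0 in simp)
  have kn: "\<kappa> ^ n > 1" using kappa n by (intro one_less_power) auto
  define \<kappa>2 where "\<kappa>2 = (1 + \<kappa> ^ n) / 2"
  have k: "1 < \<kappa>2" "\<kappa>2 < \<kappa> ^ n" using kn by (auto simp: \<kappa>2_def)
  have G0: "growth n + 1 > 0" using growth_nonneg[of n] by simp
  obtain m1 where m1: "m1 < 0" "\<And>m. m \<le> m1 \<Longrightarrow> \<kappa>2 powr m \<le> q / (growth n + 1)"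
    using powr_small[OF k(1), of "q / (growth n + 1)"] q0 G0 by auto
  obtain C where C: "C \<ge> 0" and Cb: "\<forall>\<nu>\<ge>1. \<forall>S J c. finite S \<longrightarrow> finite J \<longrightarrow>
     (\<forall>i\<in>S. 2 * pi * \<bar>real_of_int i\<bar> \<le> 2 * R * \<nu>) \<longrightarrow> (\<forall>j\<in>J. 2 * pi * \<bar>real_of_int j\<bar> \<le> 2 * R * \<nu>) \<longrightarrow>
     (L2_set (\<lambda>j. cmod (\<Sum>i\<in>S. T n \<nu> j i * c i)) J)\<^sup>2 \<le>
       (6 * real (k ^ l * captive_count k g \<tau> R (n - l)) / E_min k g ^ n + C / \<nu>) * (L2_set (\<lambda>i. cmod (c i)) S)\<^sup>2"
    using low_frequency_bound[OF R0 l n(2)] by (elim exE conjE) (rule that)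
  define D where "D = max 1 (growth n)"
  have D1: "D \<ge> 1" by (simp add: D_def)
  \<comment> \<open>Smallness wanted for \<open>e0 / \<mu>\<close>: at most 1 and at most
    \<open>q\<close> to keep the high block below \<open>2 * q\<close>, and at most
    \<open>q * q / D\<close> for the block from high to low.\<close>
  define t where "t = min 1 (min q (q * q / D))"
  have t0: "t > 0" using q0 D1 by (simp add: t_def)
  have main: "\<exists>\<nu>0. \<forall>\<nu>\<ge>\<nu>0. \<forall>z. cmod z > b \<longrightarrow> z \<in> wres (sob_weight m) (Top 1 \<nu>)" if m: "m \<le> m1" for m
  proof -
    have mneg: "m < 0" using m m1(1) by simp
    obtain p where p: "- m \<le> real p" using real_arch_simple by blast
    obtain e0 where e0: "e0 \<ge> 0" "\<forall>\<nu> \<mu> m S J c. \<mu> \<ge> 1 \<longrightarrow> R * \<bar>\<nu>\<bar> \<le> 2 * pi * \<mu> \<longrightarrow> m < 0 \<longrightarrow> - m \<le> real p \<longrightarrow> finite S \<longrightarrow> finite J \<longrightarrow>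
       (\<forall>l\<in>S. \<mu> < \<bar>real_of_int l\<bar>) \<longrightarrow>
       L2_set (\<lambda>j. flat_weight \<mu> m j * cmod (\<Sum>l\<in>S. T n \<nu> j l * c l)) J \<le>
         ((growth n + e0 / \<mu>) * \<kappa>2 powr m + e0 / \<mu>) * L2_set (\<lambda>l. flat_weight \<mu> m l * cmod (c l)) S \<and>
       ((\<forall>j\<in>J. \<bar>real_of_int j\<bar> \<le> \<mu>) \<longrightarrow> L2_set (\<lambda>j. cmod (\<Sum>l\<in>S. T n \<nu> j l * c l)) J \<le>
         e0 / \<mu> * L2_set (\<lambda>l. flat_weight \<mu> m l * cmod (c l)) S)"
      using high_frequency_T[OF R0 k, of p] by (elim exE conjE) (rule that)
    \<comment> \<open>The four entries secure, in this order, \<open>1 \<le> \<nu>\<close>,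
      \<open>1 \<le> \<mu>\<close>, \<open>e0 / \<mu> \<le> t\<close> and
      \<open>C / \<nu> \<le> Q\<close>.\<close>
    define \<nu>0 where "\<nu>0 = max (max 1 (pi / R)) (max (e0 / t * pi / R) (C / Q))"
    show ?thesis
    proof (intro exI[of _ \<nu>0] allI impI)
      fix \<nu> and z :: complex assume \<nu>: "\<nu>0 \<le> \<nu>" and z: "b < cmod z"
      have nu: "1 \<le> \<nu>" "pi / R \<le> \<nu>" "e0 / t * pi / R \<le> \<nu>" "C / Q \<le> \<nu>" using \<nu> unfolding \<nu>0_def by auto
      \<comment> \<open>With this threshold the condition \<open>\<bar>i\<bar> \<le> \<mu>\<close>
        is the frequency range of \<open>low_frequency_bound\<close>.\<close>
      define \<mu> where "\<mu> = \<nu> * R / pi"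
      have \<mu>: "\<mu> \<ge> 1" "e0 / t \<le> \<mu>"
        using nu(2,3) R0 unfolding \<mu>_def by (simp_all only: pos_divide_le_eq pos_le_divide_eq pi_gt_zero mult_1)
      have \<mu>2: "R * \<bar>\<nu>\<bar> \<le> 2 * pi * \<mu>" using nu(1) R0 by (simp add: \<mu>_def)
      have freq: "2 * pi * \<bar>real_of_int i\<bar> \<le> 2 * R * \<nu>" if "\<bar>real_of_int i\<bar> \<le> \<mu>" for i
        using that by (simp add: \<mu>_def pos_le_divide_eq mult_ac)
      have e: "e0 / \<mu> \<le> t" using \<mu> t0 by (simp add: field_simps)
      then have e': "e0 / \<mu> \<le> 1" "e0 / \<mu> \<le> q" "e0 / \<mu> \<le> q * q / D" unfolding t_def by auto
      have en: "0 \<le> e0 / \<mu>" using e0 \<mu> by simp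
      show "z \<in> wres (sob_weight m) (Top 1 \<nu>)"
      proof (rule resolvent_of_power_bound[OF R0 n(1) mneg \<mu>(1) q0 en, where \<delta>="(growth n + e0 / \<mu>) * \<kappa>2 powr m + e0 / \<mu>"])
        show "e0 / \<mu> * max 1 (growth n) \<le> q * q"
          using e'(3) D1 by (simp add: D_def[symmetric] pos_le_divide_eq)
        have "(growth n + e0 / \<mu>) * \<kappa>2 powr m \<le> (growth n + 1) * \<kappa>2 powr m" using e' by (intro mult_right_mono) auto
        also have "\<dots> \<le> (growth n + 1) * (q / (growth n + 1))" using m1(2)[OF m] G0 by (intro mult_left_mono) auto
        also have "\<dots> = q" using G0 by simp
        finally show "(growth n + e0 / \<mu>) * \<kappa>2 powr m + e0 / \<mu> \<le> 2 * q" using e'(2) by linarith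
        have "5 * q < cmod z ^ n"
          using qb power_strict_mono[OF z, of n] b0 n(1) by linarith
        then show "5 * q < cmod z ^ n" .
      next
        fix S J :: "int set" and c :: "int \<Rightarrow> complex"
        assume SJ: "finite S" "finite J" "\<And>l. l \<in> S \<Longrightarrow> \<mu> < \<bar>real_of_int l\<bar>"
        show "L2_set (\<lambda>j. flat_weight \<mu> m j * cmod (\<Sum>l\<in>S. T n \<nu> j l * c l)) J \<le>
            ((growth n + e0 / \<mu>) * \<kappa>2 powr m + e0 / \<mu>) * L2_set (\<lambda>l. flat_weight \<mu> m l * cmod (c l)) S"
          by (rule e0(2)[rule_format, THEN conjunct1]) (use \<mu> \<mu>2 mneg p SJ in auto)
        assume "\<And>j. j \<in> J \<Longrightarrow> \<bar>real_of_int j\<bar> \<le> \<mu>"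
        then show "L2_set (\<lambda>j. cmod (\<Sum>l\<in>S. T n \<nu> j l * c l)) J \<le> e0 / \<mu> * L2_set (\<lambda>l. flat_weight \<mu> m l * cmod (c l)) S"
          by (intro e0(2)[rule_format, THEN conjunct2, rule_format]) (use \<mu> \<mu>2 mneg p SJ in auto)
      next
        fix S J :: "int set" and c :: "int \<Rightarrow> complex"
        assume SJ: "finite S" "finite J" "\<And>l. l \<in> S \<Longrightarrow> \<bar>real_of_int l\<bar> \<le> \<mu>" "\<And>j. j \<in> J \<Longrightarrow> \<bar>real_of_int j\<bar> \<le> \<mu>"
        have "(L2_set (\<lambda>j. cmod (\<Sum>i\<in>S. T n \<nu> j i * c i)) J)\<^sup>2 \<le>
           (6 * real (k ^ l * captive_count k g \<tau> R (n - l)) / E_min k g ^ n + C / \<nu>) * (L2_set (\<lambda>i. cmod (c i)) S)\<^sup>2"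
          by (rule Cb[rule_format]) (use nu SJ freq in auto)
        also have "\<dots> \<le> (q * q) * (L2_set (\<lambda>i. cmod (c i)) S)\<^sup>2"
        proof (rule mult_right_mono)
          have "real (k ^ l * captive_count k g \<tau> R (n - l)) \<le> real k ^ l * a"
            unfolding a_def by (simp add: mult_left_mono)
          then have "real (k ^ l * captive_count k g \<tau> R (n - l)) / Em ^ n \<le> Q"
            unfolding Q_def using Em by (intro divide_right_mono) auto
          moreover have "C / \<nu> \<le> Q" using nu(1,4) Q0 by (simp add: field_simps)
          moreover have "6 * real (k ^ l * captive_count k g \<tau> R (n - l)) / E_min k g ^ n =
              6 * (real (k ^ l * captive_count k g \<tau> R (n - l)) / Em ^ n)" by (simp add: Em_def)
          ultimately show "6 * real (k ^ l * captive_count k g \<tau> R (n - l)) / E_min k g ^ n + C / \<nu> \<le> q * q"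
            unfolding qq by linarith
        qed simp
        also have "\<dots> = (q * L2_set (\<lambda>i. cmod (c i)) S)\<^sup>2" by (simp add: power_mult_distrib power2_eq_square)
        finally show "L2_set (\<lambda>j. cmod (\<Sum>i\<in>S. T n \<nu> j i * c i)) J \<le> q * L2_set (\<lambda>i. cmod (c i)) S"
          using q0 by (intro power2_le_imp_le[OF _ mult_nonneg_nonneg]) auto
      qed
    qed
  qed
  show ?thesis using m1(1) main unfolding b_def Em_def by blast
qed

end

section \<open>The Riesz-Fischer theorem\<close>

lemma L2_integrable: "v \<in> L2_circle \<Longrightarrow> set_integrable lborel {0..1} v"
  using L2_mult_integrable[OF ee_L2[of 0]] by simp

lemma L2_pairing_expansion:
  assumes v: "v \<in> L2_circle" and f: "CB 2 {()} (\<lambda>_. f)" "periodic1 f"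
  shows "((\<lambda>p. fourier_coeff f p * fourier_coeff v (- p)) has_sum (LINT x:{0..1}|lborel. v x * f x)) UNIV"
proof -
  obtain C where C: "\<And>p. cmod (fourier_coeff f p) \<le> C / (max 1 \<bar>real_of_int p\<bar>)\<^sup>2"
    using fourier_coeff_decay[OF f] by auto
  have C0: "C \<ge> 0" using order_trans[OF norm_ge_zero C[of 0]] by simp
  obtain t where t: "t \<longlonglongrightarrow> 0"
    "\<And>y N. cmod (f y - (\<Sum>p\<in>{- int N..int N}. fourier_coeff f p * ee p y)) \<le> t N"
    using fourier_partial_sum_tail[OF f] by blast
  have cf: "continuous_on UNIV f" using CB_continuous[OF f(1)] by simp
  have fL: "f \<in> L2_circle" by (rule L2_circle_continuous[OF cf f(2)])
  have vi: "set_integrable lborel {0..1} v" by (rule L2_integrable[OF v])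
  define B where "B = (LINT x:{0..1}|lborel. cmod (v x))"
  have vb: "cmod (fourier_coeff v p) \<le> B" for p
  proof -
    have "cmod (fourier_coeff v p) \<le> (LINT x:{0..1}|lborel. cmod (ee (- p) x * v x))"
      unfolding fourier_coeff_ee by (intro set_integral_norm_bound L2_mult_integrable ee_L2 v)
    then show ?thesis by (simp add: norm_mult B_def)
  qed
  have B0: "B \<ge> 0" using order_trans[OF norm_ge_zero vb[of 0]] .
  define s where "s p = fourier_coeff f p * fourier_coeff v (- p)" for p
  have "cmod (s p) \<le> C / (max 1 \<bar>real_of_int p\<bar>)\<^sup>2 * B" for p
    unfolding s_def norm_mult using C C0 vb by (intro mult_mono) auto
  then have "s summable_on UNIV" by (intro summable_on_int_bound(2)[of _ "C * B"]) simp
  then obtain r where r: "(s has_sum r) UNIV" by (auto simp: summable_on_def)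
  have "(\<lambda>N. (\<Sum>p\<in>{- int N..int N}. s p)) \<longlonglongrightarrow> (LINT x:{0..1}|lborel. v x * f x)"
  proof (rule LIM_zero_cancel, rule Lim_null_comparison)
    show "(\<lambda>N. B * t N) \<longlonglongrightarrow> 0" using tendsto_mult_right_zero[OF t(1), of B] by simp
    show "\<forall>\<^sub>F N in sequentially. norm ((\<Sum>p\<in>{- int N..int N}. s p) - (LINT x:{0..1}|lborel. v x * f x)) \<le> B * t N"
    proof (intro always_eventually allI)
      fix N
      let ?S = "\<lambda>y. \<Sum>p\<in>{- int N..int N}. fourier_coeff f p * ee p y"
      have SL: "?S \<in> L2_circle" by (rule L2_circle_trig) simp
      have iv: "set_integrable lborel {0..1} (\<lambda>x. v x * ?S x)" "set_integrable lborel {0..1} (\<lambda>x. v x * f x)"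
        by (intro L2_mult_integrable v fL SL)+
      have "(\<Sum>p\<in>{- int N..int N}. s p) = (\<Sum>p\<in>{- int N..int N}. (LINT x:{0..1}|lborel. fourier_coeff f p * (ee p x * v x)))"
        by (simp add: s_def fourier_coeff_ee)
      also have "\<dots> = (LINT x:{0..1}|lborel. (\<Sum>p\<in>{- int N..int N}. fourier_coeff f p * (ee p x * v x)))"
        by (rule LINT_sum(1)[symmetric]) (auto intro!: set_integrable_mult_right L2_mult_integrable ee_L2 v simp del: set_integrable_mult_right_iff)
      also have "(\<lambda>x. \<Sum>p\<in>{- int N..int N}. fourier_coeff f p * (ee p x * v x)) = (\<lambda>x. v x * ?S x)"
        by (simp add: sum_distrib_left mult_ac)
      finally have "(\<Sum>p\<in>{- int N..int N}. s p) - (LINT x:{0..1}|lborel. v x * f x) = (LINT x:{0..1}|lborel. v x * ?S x - v x * f x)"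
        using iv by simp
      also have "cmod \<dots> \<le> (LINT x:{0..1}|lborel. cmod (v x * ?S x - v x * f x))"
        by (intro set_integral_norm_bound set_integral_diff(1) iv)
      also have "\<dots> \<le> (LINT x:{0..1}|lborel. t N * cmod (v x))"
      proof (rule set_integral_mono)
        show "set_integrable lborel {0..1} (\<lambda>x. cmod (v x * ?S x - v x * f x))"
          by (intro set_integrable_norm set_integral_diff(1) iv)
        show "set_integrable lborel {0..1} (\<lambda>x. t N * cmod (v x))"
          by (intro set_integrable_mult_right set_integrable_norm vi)
        fix x
        have "cmod (v x * ?S x - v x * f x) = cmod (v x) * cmod (f x - ?S x)"
          unfolding right_diff_distrib[symmetric] norm_mult by (simp add: norm_minus_commute)
        also have "\<dots> \<le> cmod (v x) * t N" by (intro mult_left_mono t(2)) auto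
        finally show "cmod (v x * ?S x - v x * f x) \<le> t N * cmod (v x)" by (simp add: mult.commute)
      qed
      also have "\<dots> = B * t N" by (simp add: B_def)
      finally show "norm ((\<Sum>p\<in>{- int N..int N}. s p) - (LINT x:{0..1}|lborel. v x * f x)) \<le> B * t N" by simp
    qed
  qed
  then have "r = (LINT x:{0..1}|lborel. v x * f x)" using has_sum_int_tendsto[OF r] LIMSEQ_unique by blast
  then show ?thesis using r by (simp add: s_def [abs_def])
qed

lemma CN_power: "CN n f \<Longrightarrow> CN n (\<lambda>x. (f x :: real) ^ M)"
  by (induction M) (auto intro: CN_const CN_mult)

text \<open>\<open>1 - (1 - \<psi>)\<^sup>M\<close> increases to the indicator function of an interval, where \<open>\<psi>\<close> is a periodic bump
  that is positive exactly on this interval.\<close>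

lemma zero_coeffs_interval:
  assumes v: "v \<in> L2_circle" and z: "\<And>n. fourier_coeff v n = 0" and ab: "0 \<le> a" "a < 1"
  shows "(LINT x:{a<..<1}|lborel. v x) = 0"
proof -
  define mid where "mid = (a + 1) / 2"
  define h where "h = (1 - a) / 2"
  have h: "0 < h" "h \<le> 1/2" "mid - h = a" "mid + h = 1" using ab by (auto simp: h_def mid_def field_simps)
  define \<psi> where "\<psi> x = (max 0 (cos (2 * pi * (x - mid)) - cos (2 * pi * h))) ^ 3 / 8" for x
  have \<psi>01: "0 \<le> \<psi> x" "\<psi> x \<le> 1" for x
  proof -
    have "(max 0 (cos (2 * pi * (x - mid)) - cos (2 * pi * h))) ^ 3 \<le> 2 ^ 3"
      by (rule power_mono, insert cos_le_one[of "2 * pi * (x - mid)"] cos_ge_minus_one[of "2 * pi * h"]) linarith+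
    then show "0 \<le> \<psi> x" "\<psi> x \<le> 1" by (auto simp: \<psi>_def)
  qed
  have pos: "\<psi> x > 0" if "x \<in> {a<..<1}" for x
  proof -
    have "\<bar>x - mid\<bar> < h" using that h by (auto simp: abs_less_iff)
    then have "2 * pi * \<bar>x - mid\<bar> < 2 * pi * h" by simp
    moreover have "2 * pi * h \<le> pi" using h by simp
    ultimately have "cos (2 * pi * h) < cos (2 * pi * \<bar>x - mid\<bar>)" by (intro cos_monotone_0_pi) auto
    also have "cos (2 * pi * \<bar>x - mid\<bar>) = cos (2 * pi * (x - mid))" by (simp add: abs_if) (metis cos_minus minus_diff_eq mult_minus_right)
    finally show ?thesis by (simp add: \<psi>_def)
  qed
  have zero: "\<psi> x = 0" if x: "x \<in> {0..1}" "x \<notin> {a<..<1}" for x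
  proof -
    define t where "t = 2 * pi * \<bar>x - mid\<bar>"
    have "h \<le> \<bar>x - mid\<bar>" "\<bar>x - mid\<bar> \<le> 1 - h" using x h by (auto simp: abs_if)
    then have t: "2 * pi * h \<le> t" "t \<le> 2 * pi * (1 - h)" by (auto simp: t_def)
    have "cos t \<le> cos (2 * pi * h)"
    proof (cases "t \<le> pi")
      case True
      then show ?thesis using t h by (intro cos_monotone_0_pi_le) auto
    \<comment> \<open>Beyond \<open>pi\<close> the cosine increases again, so the comparison is made
      at the reflected argument \<open>2 * pi - t\<close>.\<close>
    next
      case False
      have "cos (2 * pi - t) \<le> cos (2 * pi * h)" using t h False by (intro cos_monotone_0_pi_le) (auto simp: algebra_simps)
      then show ?thesis by (simp add: cos_diff)
    qed
    moreover have "cos t = cos (2 * pi * (x - mid))" unfolding t_def by (simp add: abs_if) (metis cos_minus minus_diff_eq mult_minus_right)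
    ultimately show ?thesis by (simp add: \<psi>_def)
  qed
  have CN\<psi>: "CN 2 \<psi>"
  proof -
    have cosCN: "CN 2 (\<lambda>x. cos (2 * pi * (x - mid)))"
      unfolding numeral_2_eq_2
    proof (intro CN_SucI)
      show "((\<lambda>x. cos (2 * pi * (x - mid))) has_vector_derivative - (2 * pi) * sin (2 * pi * (x - mid))) (at x)" for x
        unfolding has_real_derivative_iff_has_vector_derivative[symmetric] by (auto intro!: derivative_eq_intros)
      show "((\<lambda>x. - (2 * pi) * sin (2 * pi * (x - mid))) has_vector_derivative - (2 * pi) * (2 * pi * cos (2 * pi * (x - mid)))) (at x)" for x
        unfolding has_real_derivative_iff_has_vector_derivative[symmetric] by (auto intro!: derivative_eq_intros)
      show "CN 0 (\<lambda>x. - (2 * pi) * (2 * pi * cos (2 * pi * (x - mid))))" by (auto intro!: continuous_intros)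
    qed
    have "CN 2 (\<lambda>x. (1/8) * (max 0 (cos (2 * pi * (x - mid)) + - cos (2 * pi * h))) ^ 3)"
      by (intro CN_mult CN_cube CN_add CN_const cosCN)
    then show ?thesis by (simp add: \<psi>_def [abs_def])
  qed
  have per\<psi>: "periodic1 \<psi>"
  proof -
    have "cos (2 * pi * (x + 1 - mid)) = cos (2 * pi * (x - mid))" for x
      using cos_periodic[of "2 * pi * (x - mid)"] by (simp add: algebra_simps)
    then show ?thesis by (simp add: periodic1_def \<psi>_def)
  qed
  have zeroM: "(LINT x:{0..1}|lborel. v x * of_real (1 - (1 - \<psi> x) ^ M)) = 0" for M
  proof -
    have "CN 2 (\<lambda>x. 1 + - 1 * (1 + - 1 * \<psi> x) ^ M)"
      by (intro CN_add CN_mult CN_power CN_const CN\<psi>)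
    then have "CN 2 (\<lambda>x. complex_of_real (1 - (1 - \<psi> x) ^ M))" by (intro CN_of_real) simp
    moreover have "periodic1 (\<lambda>x. complex_of_real (1 - (1 - \<psi> x) ^ M))" using per\<psi> by (simp add: periodic1_def)
    ultimately have "((\<lambda>p. fourier_coeff (\<lambda>x. complex_of_real (1 - (1 - \<psi> x) ^ M)) p * fourier_coeff v (- p)) has_sum
        (LINT x:{0..1}|lborel. v x * of_real (1 - (1 - \<psi> x) ^ M))) UNIV"
      by (intro L2_pairing_expansion v CB_of_CN)
    then have "((\<lambda>p::int. 0::complex) has_sum (LINT x:{0..1}|lborel. v x * of_real (1 - (1 - \<psi> x) ^ M))) UNIV" unfolding z mult_zero_right .
    from has_sum_unique[OF this has_sum_0] show ?thesis by simp
  qed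
  have vi: "set_integrable lborel {0..1} v" by (rule L2_integrable[OF v])
  have vm: "v \<in> borel_measurable borel" using v by (simp add: L2_circle_def)
  have \<psi>m: "\<psi> \<in> borel_measurable borel" by (intro borel_measurable_continuous_onI CN_continuous[OF CN\<psi>])
  have "(\<lambda>M. LINT x|lborel. indicator {0..1} x *\<^sub>R (v x * of_real (1 - (1 - \<psi> x) ^ M))) \<longlonglongrightarrow> (LINT x|lborel. indicator {a<..<1} x *\<^sub>R v x)"
  proof (rule integral_dominated_convergence[where w="\<lambda>x. norm (indicator {0..1} x *\<^sub>R v x)"])
    show "integrable lborel (\<lambda>x. norm (indicator {0..1} x *\<^sub>R v x))"
      using vi by (intro integrable_norm) (simp add: set_integrable_def)
    show "(\<lambda>x. indicator {a<..<1} x *\<^sub>R v x) \<in> borel_measurable lborel" using vm by simp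
    show "(\<lambda>x. indicator {0..1} x *\<^sub>R (v x * of_real (1 - (1 - \<psi> x) ^ M))) \<in> borel_measurable lborel" for M
      using vm \<psi>m by simp
    show "AE x in lborel. (\<lambda>M. indicator {0..1} x *\<^sub>R (v x * of_real (1 - (1 - \<psi> x) ^ M))) \<longlonglongrightarrow> indicator {a<..<1} x *\<^sub>R v x"
    proof (rule AE_I2)
      fix x
      show "(\<lambda>M. indicator {0..1} x *\<^sub>R (v x * of_real (1 - (1 - \<psi> x) ^ M))) \<longlonglongrightarrow> indicator {a<..<1} x *\<^sub>R v x"
      proof (cases "x \<in> {a<..<1}")
        case True
        have "(\<lambda>M. (1 - \<psi> x) ^ M) \<longlonglongrightarrow> 0"
        proof (rule LIMSEQ_power_zero)
          have "\<bar>1 - \<psi> x\<bar> < 1" using pos[OF True] \<psi>01[of x] by linarith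
          then show "norm (1 - \<psi> x) < 1" by simp
        qed
        then have "(\<lambda>M. indicator {0..1} x *\<^sub>R (v x * of_real (1 - (1 - \<psi> x) ^ M))) \<longlonglongrightarrow> indicator {0..1} x *\<^sub>R (v x * of_real (1 - 0))"
          by (intro tendsto_scaleR tendsto_mult tendsto_of_real tendsto_diff tendsto_const)
        then show ?thesis using True ab by (simp add: indicator_def)
      next
        case False
        then show ?thesis using zero[of x] by (cases "x \<in> {0..1}") (auto simp: indicator_def)
      qed
    qed
    show "AE x in lborel. norm (indicator {0..1} x *\<^sub>R (v x * of_real (1 - (1 - \<psi> x) ^ M))) \<le> norm (indicator {0..1} x *\<^sub>R v x)" for M
    proof (rule AE_I2)
      fix x
      have p: "0 \<le> (1 - \<psi> x) ^ M" "(1 - \<psi> x) ^ M \<le> 1" using \<psi>01[of x] by (auto intro: power_le_one)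
      have "cmod (v x * of_real (1 - (1 - \<psi> x) ^ M)) = cmod (v x) * \<bar>1 - (1 - \<psi> x) ^ M\<bar>" by (simp only: norm_mult norm_of_real)
      also have "\<dots> \<le> cmod (v x) * 1" using p by (intro mult_left_mono) auto
      finally show "norm (indicator {0..1} x *\<^sub>R (v x * of_real (1 - (1 - \<psi> x) ^ M))) \<le> norm (indicator {0..1} x *\<^sub>R v x)"
        by (auto simp: indicator_def)
    qed
  qed
  then show ?thesis using zeroM unfolding set_lebesgue_integral_def by (simp add: LIMSEQ_const_iff)
qed

text \<open>Vanishing integrals over the intervals from \<open>a\<close> to 1 give vanishing
  integrals over all half-lines. These form an intersection-stable generator of the Borel sets, so
  all Borel integrals vanish, and testing on the sets where the real or imaginary part has a sign
  finishes the proof.\<close>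

lemma L2_uniqueness:
  assumes v: "v \<in> L2_circle" and z: "\<And>n. fourier_coeff v n = 0"
  shows "AE x in lborel. indicator {0..1} x *\<^sub>R v x = 0"
proof -
  define f where "f x = indicator {0..1} x *\<^sub>R v x" for x :: real
  have fi: "integrable lborel f" using L2_integrable[OF v] by (simp add: set_integrable_def f_def [abs_def])
  have fA: "set_integrable lborel A f" if "A \<in> sets borel" for A
    unfolding set_integrable_def using that by (intro integrable_mult_indicator fi) simp
  have tot: "(LINT x|lborel. f x) = 0"
    using z[of 0] by (simp add: fourier_coeff_ee set_lebesgue_integral_def f_def [abs_def])
  have half: "(LINT x:{c<..}|lborel. f x) = 0" for c
  proof -
    consider "c < 0" | "0 \<le> c" "c < 1" | "1 \<le> c" by linarith
    then show ?thesis
    proof cases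
      case 1
      then have "indicator {c<..} x *\<^sub>R f x = f x" for x by (auto simp: f_def indicator_def)
      then show ?thesis using tot by (simp add: set_lebesgue_integral_def)
    next
      case 2
      have "(LINT x:{c<..}|lborel. f x) = (LINT x:{c<..<1}|lborel. v x)"
        unfolding set_lebesgue_integral_def
      proof (rule integral_cong_AE)
        show "AE x in lborel. indicator {c<..} x *\<^sub>R f x = indicator {c<..<1} x *\<^sub>R v x"
          using AE_lborel_singleton[of 1] by eventually_elim (use 2 in \<open>auto simp: f_def indicator_def\<close>)
      qed (use v in \<open>auto simp: f_def [abs_def] L2_circle_def\<close>)
      also have "\<dots> = 0" by (rule zero_coeffs_interval[OF v z 2])
      finally show ?thesis .
    next
      case 3
      have "AE x in lborel. indicator {c<..} x *\<^sub>R f x = 0"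
        by (rule AE_I2) (use 3 in \<open>auto simp: f_def indicator_def\<close>)
      then show ?thesis unfolding set_lebesgue_integral_def by (rule integral_eq_zero_AE)
    qed
  qed
  have all: "(LINT x:A|lborel. f x) = 0" if "A \<in> sets borel" for A
  proof -
    have A: "A \<in> sigma_sets UNIV (range (\<lambda>c::real. {c<..}))"
      using that by (simp add: borel_Ioi)
    have I: "Int_stable (range (\<lambda>c::real. {c<..}))"
    proof (rule Int_stableI)
      fix a b assume "a \<in> range (\<lambda>c::real. {c<..})" "b \<in> range (\<lambda>c::real. {c<..})"
      then obtain c d where "a = {c<..}" "b = {d<..}" by auto
      then have "a \<inter> b = {max c d<..}" by auto
      then show "a \<inter> b \<in> range (\<lambda>c::real. {c<..})" by blast
    qed
    have "range (\<lambda>c::real. {c<..}) \<subseteq> Pow UNIV" by simp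
    from I this A show ?thesis
    proof (induction rule: sigma_sets_induct_disjoint)
      case (basic A)
      then show ?case using half by auto
    next
      case empty
      then show ?case by (simp add: set_lebesgue_integral_def)
    next
      case (compl A)
      then have A: "A \<in> sets borel" by (simp add: borel_Ioi)
      have "(LINT x:(A \<union> (UNIV - A))|lborel. f x) = (LINT x:A|lborel. f x) + (LINT x:UNIV - A|lborel. f x)"
        by (rule set_integral_Un) (use A fA in auto)
      then show ?case using compl tot by (simp add: set_lebesgue_integral_def)
    next
      case (union A)
      then have A: "\<And>i. A i \<in> sets borel" by (auto simp: borel_Ioi)
      have "(LINT x:(\<Union>i. A i)|lborel. f x) = (\<Sum>i. (LINT x:A i|lborel. f x))"
        by (rule lebesgue_integral_countable_add) (use A fA union in \<open>auto simp: disjoint_family_on_def\<close>)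
      then show ?case using union by simp
    qed
  qed
  have real: "AE x in lborel. h x = 0" if h: "integrable lborel h" "\<And>A. A \<in> sets borel \<Longrightarrow> (LINT x:A|lborel. h x) = 0" for h :: "real \<Rightarrow> real"
  proof -
    have hm[measurable]: "h \<in> borel_measurable borel" using borel_measurable_integrable[OF h(1)] by simp
    have P: "{x. 0 \<le> h x} \<in> sets borel" "{x. h x \<le> 0} \<in> sets borel" by simp_all
    have "AE x in lborel. indicator {x. 0 \<le> h x} x *\<^sub>R h x = 0"
      using h(2)[OF P(1)] integrable_mult_indicator[OF _ h(1), of "{x. 0 \<le> h x}"] P(1)
      by (subst integral_nonneg_eq_0_iff_AE[symmetric]) (auto simp: set_lebesgue_integral_def indicator_def)
    moreover have "AE x in lborel. - (indicator {x. h x \<le> 0} x *\<^sub>R h x) = 0"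
      using h(2)[OF P(2)] integrable_mult_indicator[OF _ h(1), of "{x. h x \<le> 0}"] P(2)
      by (subst integral_nonneg_eq_0_iff_AE[symmetric]) (auto simp: set_lebesgue_integral_def indicator_def)
    ultimately show ?thesis by eventually_elim (auto simp: indicator_def split: if_splits)
  qed
  have "AE x in lborel. Re (f x) = 0" "AE x in lborel. Im (f x) = 0"
  proof (rule_tac [!] real)
    fix A :: "real set" assume A: "A \<in> sets borel"
    have i: "integrable lborel (\<lambda>x. indicator A x *\<^sub>R f x)" using fA[OF A] by (simp add: set_integrable_def)
    show "(LINT x:A|lborel. Re (f x)) = 0"
      using integral_Re[OF i] all[OF A] by (simp add: set_lebesgue_integral_def)
    show "(LINT x:A|lborel. Im (f x)) = 0"
      using integral_Im[OF i] all[OF A] by (simp add: set_lebesgue_integral_def)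
  qed (use fi in auto)
  then show ?thesis unfolding f_def[symmetric] by eventually_elim (simp add: complex_eq_iff)
qed

lemma fourier_coeff_lincomb:
  assumes "u \<in> L2_circle" "v \<in> L2_circle"
  shows "fourier_coeff (\<lambda>x. a * u x + b * v x) n = a * fourier_coeff u n + b * fourier_coeff v n"
proof -
  have i: "set_integrable lborel {0..1} (\<lambda>x. a * (ee (- n) x * u x))" "set_integrable lborel {0..1} (\<lambda>x. b * (ee (- n) x * v x))"
    by (intro set_integrable_mult_right L2_mult_integrable ee_L2 assms)+
  show ?thesis using set_integral_add(2)[OF i] by (simp add: fourier_coeff_ee distrib_left mult.left_commute)
qed

lemma fourier_coeff_trig:
  assumes "finite S"
  shows "fourier_coeff (\<lambda>x. \<Sum>n\<in>S. c n * ee n x) p = (if p \<in> S then c p else 0)"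
proof -
  have i: "set_integrable lborel {0..1} (\<lambda>x. c n * (ee (- p) x * ee n x))" for n
    by (intro set_integrable_mult_right L2_mult_integrable ee_L2)
  have "fourier_coeff (\<lambda>x. \<Sum>n\<in>S. c n * ee n x) p = (\<Sum>n\<in>S. LINT x:{0..1}|lborel. c n * (ee (- p) x * ee n x))"
    unfolding fourier_coeff_ee using LINT_sum(1)[OF assms i] by (simp add: sum_distrib_left mult.left_commute)
  also have "\<dots> = (\<Sum>n\<in>S. c n * (if n = p then 1 else 0))"
    by (intro sum.cong refl) (auto simp: integral_ee ee_add[symmetric] simp del: mult_eq_if)
  also have "\<dots> = (if p \<in> S then c p else 0)" using assms by (simp add: if_distrib cong: if_cong)
  finally show ?thesis .
qed

lemma nonpos_of_le_geometric:
  fixes x :: real assumes "\<And>j::nat. x \<le> C * (1/4) ^ j" shows "x \<le> 0"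
proof (rule LIMSEQ_le_const)
  show "(\<lambda>j. C * (1/4) ^ j) \<longlonglongrightarrow> 0" by (intro tendsto_mult_right_zero LIMSEQ_power_zero) simp
qed (use assms in auto)

text \<open>Completeness of L2 is carried out on the partial sums. Along a fast subsequence
  \<open>\<sigma>\<close> the increments are summable in L1, so the sums converge almost everywhere.
  Fatou's lemma then bounds the L2 distance of the limit from the partial sums, which yields the
  coefficients and the norm.\<close>

lemma riesz_fischer:
  assumes "(\<lambda>n. (cmod (c n))\<^sup>2) summable_on UNIV"
  shows "\<exists>v\<in>L2_circle. (\<forall>n. fourier_coeff v n = c n) \<and> (LINT x:{0..1}|lborel. (cmod (v x))\<^sup>2) = (\<Sum>\<^sub>\<infinity>n. (cmod (c n))\<^sup>2)"
proof -
  define a where "a n = (cmod (c n))\<^sup>2" for n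
  define I where "I N = {- int N..int N}" for N
  define S where "S N x = (\<Sum>n\<in>I N. c n * ee n x)" for N x
  define s where "s = (\<Sum>\<^sub>\<infinity>n. a n)"
  define r where "r N = s - (\<Sum>n\<in>I N. a n)" for N
  have sa: "a summable_on UNIV" using assms by (simp add: a_def [abs_def])
  have r0: "r N \<ge> 0" for N unfolding r_def s_def
    using finite_sum_le_infsum[OF sa, of "I N"] by (simp add: a_def I_def)
  have "(\<lambda>N. \<Sum>n\<in>I N. a n) \<longlonglongrightarrow> s"
    using has_sum_int_tendsto[OF has_sum_infsum[OF sa]] by (simp add: s_def I_def)
  then have "r \<longlonglongrightarrow> s - s" unfolding r_def [abs_def] by (intro tendsto_intros)
  then have "\<forall>\<^sub>F N in sequentially. r N < (1/4) ^ j" for j by (intro order_tendstoD(2)[of r 0]) simp_all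
  then have "\<forall>j. \<exists>N. \<forall>M\<ge>N. r M < (1/4) ^ j" by (simp add: eventually_sequentially)
  then obtain N where N: "\<And>j M. M \<ge> N j \<Longrightarrow> r M < (1/4) ^ j" by metis
  \<comment> \<open>A monotone majorant of the thresholds \<open>N\<close>. The summand
    \<open>j\<close> ensures that every frequency is eventually included.\<close>
  define \<sigma> where "\<sigma> j = j + (\<Sum>i\<le>j. N i)" for j
  have \<sigma>N: "N j \<le> \<sigma> j" for j unfolding \<sigma>_def by (rule trans_le_add2, rule member_le_sum) auto
  have \<sigma>r: "r (\<sigma> j) \<le> (1/4) ^ j" for j using N[OF \<sigma>N[of j]] by simp
  have \<sigma>mono: "\<sigma> i \<le> \<sigma> j" if "i \<le> j" for i j
    unfolding \<sigma>_def using that by (intro add_mono sum_mono2) auto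
  have SL: "S M \<in> L2_circle" for M unfolding S_def [abs_def] I_def by (rule L2_circle_trig) simp
  have Sc: "continuous_on UNIV (S M)" for M
    unfolding S_def [abs_def] by (intro continuous_on_sum continuous_on_mult continuous_on_const continuous_on_ee continuous_on_id)
  have Sm[measurable]: "S M \<in> borel_measurable borel" for M by (intro borel_measurable_continuous_onI Sc)
  have Sd: "(LINT x:{0..1}|lborel. (cmod (S M x - S K x))\<^sup>2) \<le> r K" if "K \<le> M" for K M
  proof -
    have sub: "I K \<subseteq> I M" using that by (auto simp: I_def)
    have fin: "finite (I M)" for M by (simp add: I_def)
    have "S M x - S K x = (\<Sum>n\<in>I M - I K. c n * ee n x)" for x
      unfolding S_def by (simp add: sum_diff fin sub)
    then have "(LINT x:{0..1}|lborel. (cmod (S M x - S K x))\<^sup>2) = (\<Sum>n\<in>I M - I K. a n)"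
      by (simp add: trig_parseval fin a_def)
    also have "\<dots> = (\<Sum>n\<in>I M. a n) - (\<Sum>n\<in>I K. a n)" by (simp add: sum_diff fin sub)
    also have "\<dots> = r K - r M" by (simp add: r_def)
    finally show ?thesis using r0[of M] by simp
  qed
  define d where "d j x = S (\<sigma> (Suc j)) x - S (\<sigma> j) x" for j x
  define F where "F j x = indicator {0..1} x * cmod (d j x)" for j and x :: real
  have ci: "set_integrable lborel {0..1} h" if "continuous_on UNIV h" for h :: "real \<Rightarrow> real"
    using that by (intro borel_integrable_atLeastAtMost'[THEN iffD1[OF refl]]) (auto intro: continuous_on_subset)
  have dc: "continuous_on UNIV (d j)" for j unfolding d_def [abs_def] by (intro continuous_intros Sc)
  have dm[measurable]: "d j \<in> borel_measurable borel" for j by (intro borel_measurable_continuous_onI dc)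
  have Fi: "integrable lborel (F j)" for j
    using ci[of "\<lambda>x. cmod (d j x)"] dc by (simp add: F_def [abs_def] set_integrable_def continuous_on_norm)
  have F0: "F j x \<ge> 0" for j x by (simp add: F_def)
  \<comment> \<open>Passage from L2 to L1 by the inequality between means at scale
    \<open>2 ^ j\<close>: the term \<open>2 ^ j / 2 * 4 ^ (- j)\<close> and the constant
    \<open>2 ^ (- j) / 2\<close> have equal size and add up to \<open>2 ^ (- j)\<close>.\<close>
  have Fb: "(LINT x|lborel. F j x) \<le> (1/2) ^ j" for j
  proof -
    have i2: "set_integrable lborel {0..1} (\<lambda>x. (2 ^ j / 2) * (cmod (d j x))\<^sup>2)" "set_integrable lborel {0..1} (\<lambda>x::real. (1/2) ^ j / 2 :: real)"
      by (rule ci[OF continuous_on_mult[OF continuous_on_const continuous_on_power[OF continuous_on_norm[OF dc]]]] ci[OF continuous_on_const])+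
    have "(LINT x|lborel. F j x) = (LINT x:{0..1}|lborel. cmod (d j x))"
      by (simp add: F_def set_lebesgue_integral_def)
    also have "\<dots> \<le> (LINT x:{0..1}|lborel. (2 ^ j / 2) * (cmod (d j x))\<^sup>2 + (1/2) ^ j / 2)"
    proof (rule set_integral_mono)
      show "set_integrable lborel {0..1} (\<lambda>x. cmod (d j x))" by (intro ci continuous_intros dc)
      show "set_integrable lborel {0..1} (\<lambda>x. (2 ^ j / 2) * (cmod (d j x))\<^sup>2 + (1/2) ^ j / 2)" by (intro set_integral_add i2)
      fix x
      have "2 ^ j * (cmod (d j x))\<^sup>2 + (1/2) ^ j - 2 * cmod (d j x) = (1/2) ^ j * (2 ^ j * cmod (d j x) - 1)\<^sup>2"
        by (simp add: power2_diff power_mult_distrib power_one_over field_simps power2_eq_square)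
      also have "\<dots> \<ge> 0" by simp
      finally show "cmod (d j x) \<le> (2 ^ j / 2) * (cmod (d j x))\<^sup>2 + (1/2) ^ j / 2" by simp
    qed
    also have "\<dots> = (2 ^ j / 2) * (LINT x:{0..1}|lborel. (cmod (d j x))\<^sup>2) + (1/2) ^ j / 2"
      using i2 by (subst set_integral_add(2)) (auto simp: set_lebesgue_integral_def)
    also have "\<dots> \<le> (2 ^ j / 2) * (1/4) ^ j + (1/2) ^ j / 2"
      using Sd[OF \<sigma>mono, of j "Suc j"] \<sigma>r[of j] by (intro add_mono mult_left_mono order.refl) (auto simp: d_def)
    also have "\<dots> = (1/2) ^ j" by (simp add: power_mult_distrib[symmetric])
    finally show ?thesis .
  qed
  have "summable (\<lambda>j. LINT x|lborel. F j x)"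
    by (rule summable_comparison_test'[of "\<lambda>j. (1/2) ^ j :: real" 0])
      (use Fb F0 in \<open>auto simp: Bochner_Integration.integral_nonneg\<close>)
  then have "(\<Sum>j. ennreal (LINT x|lborel. F j x)) \<noteq> top"
    by (subst suminf_ennreal2) (auto simp: F0 Bochner_Integration.integral_nonneg)
  also have "(\<Sum>j. ennreal (LINT x|lborel. F j x)) = (\<Sum>j. \<integral>\<^sup>+ x. ennreal (F j x) \<partial>lborel)"
    using Fi F0 by (simp add: nn_integral_eq_integral)
  also have "\<dots> = (\<integral>\<^sup>+ x. (\<Sum>j. ennreal (F j x)) \<partial>lborel)"
    by (rule nn_integral_suminf[symmetric]) (simp add: F_def)
  finally have "AE x in lborel. (\<Sum>j. ennreal (F j x)) \<noteq> \<infinity>"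
    by (intro nn_integral_PInf_AE) (auto simp: F_def)
  then have conv: "AE x in lborel. x \<in> {0..1} \<longrightarrow> convergent (\<lambda>j. S (\<sigma> j) x)"
  proof eventually_elim
    case (elim x)
    show ?case
    proof
      assume x: "x \<in> {0..1}"
      have "summable (\<lambda>j. F j x)" using elim F0 by (intro summable_suminf_not_top) auto
      then have "summable (\<lambda>j. d j x)" using x by (simp add: F_def summable_norm_cancel)
      then have "convergent (\<lambda>j. S (\<sigma> 0) x + (\<Sum>i<j. d i x))"
        by (intro convergent_add convergent_const) (simp add: summable_iff_convergent)
      moreover have "S (\<sigma> 0) x + (\<Sum>i<j. d i x) = S (\<sigma> j) x" for j
        unfolding d_def by (subst sum_lessThan_telescope) simp
      ultimately show "convergent (\<lambda>j. S (\<sigma> j) x)" by simp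
    qed
  qed
  \<comment> \<open>Where the sequence diverges \<open>lim\<close> has an unspecified value;
    measurability holds all the same, and within one period this concerns a null set only.\<close>
  define v where "v x = lim (\<lambda>j. S (\<sigma> j) x)" for x
  have vm[measurable]: "v \<in> borel_measurable borel" unfolding v_def [abs_def] by measurable
  have vp: "periodic1 v" using SL by (auto simp: periodic1_def v_def L2_circle_def)
  define w where "w j x = v x - S (\<sigma> j) x" for j x
  have wm[measurable]: "w j \<in> borel_measurable borel" for j unfolding w_def [abs_def] by measurable
  have Fatou: "(\<integral>\<^sup>+ x. ennreal (indicator {0..1} x * (cmod (w j x))\<^sup>2) \<partial>lborel) \<le> ennreal ((1/4) ^ j)" for j
  proof -
    define u where "u i x = ennreal (indicator {0..1} x * (cmod (S (\<sigma> i) x - S (\<sigma> j) x))\<^sup>2)" for i and x :: real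
    have "AE x in lborel. ennreal (indicator {0..1} x * (cmod (w j x))\<^sup>2) = liminf (\<lambda>i. u i x)"
      using conv
    proof eventually_elim
      case (elim x)
      show ?case
      proof (cases "x \<in> {0..1}")
        case True
        then have "(\<lambda>i. S (\<sigma> i) x) \<longlonglongrightarrow> v x" using elim by (simp add: v_def convergent_LIMSEQ_iff)
        then have "(\<lambda>i. u i x) \<longlonglongrightarrow> ennreal (indicator {0..1} x * (cmod (v x - S (\<sigma> j) x))\<^sup>2)"
          unfolding u_def by (intro tendsto_ennrealI tendsto_intros)
        from lim_imp_Liminf[OF _ this] show ?thesis by (simp add: w_def)
      next
        case False
        then show ?thesis by (simp add: u_def Liminf_const)
      qed
    qed
    then have "(\<integral>\<^sup>+ x. ennreal (indicator {0..1} x * (cmod (w j x))\<^sup>2) \<partial>lborel) = (\<integral>\<^sup>+ x. liminf (\<lambda>i. u i x) \<partial>lborel)"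
      by (rule nn_integral_cong_AE)
    also have "\<dots> \<le> liminf (\<lambda>i. \<integral>\<^sup>+ x. u i x \<partial>lborel)"
      by (rule nn_integral_liminf) (simp add: u_def)
    also have "\<dots> \<le> liminf (\<lambda>i::nat. ennreal ((1/4) ^ j))"
    proof (rule Liminf_mono)
      show "\<forall>\<^sub>F i in sequentially. (\<integral>\<^sup>+ x. u i x \<partial>lborel) \<le> ennreal ((1/4) ^ j)"
        unfolding eventually_sequentially
      proof (intro exI[of _ j] allI impI)
        fix i assume "j \<le> i"
        have "set_integrable lborel {0..1} (\<lambda>x. (cmod (S (\<sigma> i) x - S (\<sigma> j) x))\<^sup>2)" by (intro ci continuous_intros Sc)
        then have "(\<integral>\<^sup>+ x. u i x \<partial>lborel) = ennreal (LINT x:{0..1}|lborel. (cmod (S (\<sigma> i) x - S (\<sigma> j) x))\<^sup>2)"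
          unfolding u_def set_integrable_def set_lebesgue_integral_def
          by (subst nn_integral_eq_integral[symmetric]) auto
        also have "\<dots> \<le> ennreal ((1/4) ^ j)"
          using order_trans[OF Sd[OF \<sigma>mono[OF \<open>j \<le> i\<close>]] \<sigma>r[of j]] by (rule ennreal_leI)
        finally show "(\<integral>\<^sup>+ x. u i x \<partial>lborel) \<le> ennreal ((1/4) ^ j)" .
      qed
    qed
    finally show ?thesis by (simp add: Liminf_const)
  qed
  have wi: "integrable lborel (\<lambda>x. indicator {0..1} x * (cmod (w j x))\<^sup>2)" for j
  proof (rule integrableI_bounded)
    show "(\<integral>\<^sup>+ x. ennreal (norm (indicator {0..1} x * (cmod (w j x))\<^sup>2)) \<partial>lborel) < \<infinity>"
      using Fatou[of j] by (simp add: abs_mult le_less_trans)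
  qed simp
  have wL: "w j \<in> L2_circle" for j
  proof -
    have "periodic1 (w j)" using vp SL[of "\<sigma> j"] by (auto simp: periodic1_def w_def L2_circle_def)
    then show ?thesis using wi[of j] by (simp add: L2_circle_def set_integrable_def)
  qed
  have wn: "(LINT x:{0..1}|lborel. (cmod (w j x))\<^sup>2) \<le> (1/4) ^ j" for j
    using Fatou[of j] nn_integral_eq_integral[OF wi[of j]] by (simp add: set_lebesgue_integral_def)
  have wn0: "0 \<le> (LINT x:{0..1}|lborel. (cmod (w j x))\<^sup>2)" for j
    unfolding set_lebesgue_integral_def by (intro Bochner_Integration.integral_nonneg) auto
  have vL: "v \<in> L2_circle"
  proof -
    have "(\<lambda>x. 1 * w 0 x + 1 * S (\<sigma> 0) x) \<in> L2_circle" by (intro L2_circle_lincomb wL SL)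
    then show ?thesis by (simp add: w_def)
  qed
  have coeff: "fourier_coeff v n = c n" for n
  proof -
    \<comment> \<open>The coefficient \<open>n\<close> is captured only for \<open>j\<close> at
      least \<open>\<bar>n\<bar>\<close>. The large constant makes the inequality trivial for
      smaller \<open>j\<close>, so that it holds for all \<open>j\<close>.\<close>
    have "(cmod (fourier_coeff v n - c n))\<^sup>2 \<le> 4 ^ nat \<bar>n\<bar> * (1 + (cmod (fourier_coeff v n - c n))\<^sup>2) * (1/4) ^ j" for j
    proof (cases "nat \<bar>n\<bar> \<le> j")
      case True
      then have "nat \<bar>n\<bar> \<le> \<sigma> j" by (simp add: \<sigma>_def)
      then have "n \<in> I (\<sigma> j)" by (auto simp: I_def)
      moreover have "w j = (\<lambda>x. 1 * v x + (- 1) * S (\<sigma> j) x)" by (auto simp: w_def)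
      ultimately have "fourier_coeff (w j) n = fourier_coeff v n - c n"
        using fourier_coeff_lincomb[OF vL SL, of 1 "-1" "\<sigma> j" n] fourier_coeff_trig[of "I (\<sigma> j)" c n]
        by (simp add: S_def [abs_def] I_def)
      then have "(cmod (fourier_coeff v n - c n))\<^sup>2 \<le> (1/4) ^ j"
        using order_trans[OF bessel_inequality[OF wL, of "{n}"] wn[of j]] by simp
      also have "\<dots> \<le> 4 ^ nat \<bar>n\<bar> * (1 + (cmod (fourier_coeff v n - c n))\<^sup>2) * (1/4) ^ j"
      proof -
        have "1 * 1 \<le> 4 ^ nat \<bar>n\<bar> * (1 + (cmod (fourier_coeff v n - c n))\<^sup>2)" by (intro mult_mono) auto
        then show ?thesis using mult_right_mono[of 1 _ "(1/4) ^ j :: real"] by simp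
      qed
      finally show ?thesis .
    next
      case False
      have "1 * (cmod (fourier_coeff v n - c n))\<^sup>2 \<le> (4 ^ nat \<bar>n\<bar> * (1/4) ^ j) * (1 + (cmod (fourier_coeff v n - c n))\<^sup>2)"
      proof (rule mult_mono)
        have "(4::real) ^ j \<le> 4 ^ nat \<bar>n\<bar>" using False by (intro power_increasing) auto
        then show "1 \<le> (4::real) ^ nat \<bar>n\<bar> * (1/4) ^ j" by (simp add: power_one_over field_simps)
      qed auto
      then show ?thesis by (simp add: mult_ac)
    qed
    from nonpos_of_le_geometric[OF this] show ?thesis by (simp add: power2_eq_square mult_le_0_iff)
  qed
  have "\<bar>(LINT x:{0..1}|lborel. (cmod (v x))\<^sup>2) - s\<bar> \<le> 2 * (1/4) ^ j" for j
  proof -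
    have "(LINT x:{0..1}|lborel. (cmod (w j x))\<^sup>2) = (LINT x:{0..1}|lborel. (cmod (v x))\<^sup>2) - (\<Sum>n\<in>I (\<sigma> j). a n)"
      using L2_trig_distance[OF vL, of "I (\<sigma> j)"] by (simp add: coeff w_def S_def a_def I_def)
    then have "(LINT x:{0..1}|lborel. (cmod (v x))\<^sup>2) - s = (LINT x:{0..1}|lborel. (cmod (w j x))\<^sup>2) - r (\<sigma> j)"
      by (simp add: r_def)
    then show ?thesis using wn[of j] wn0[of j] r0[of "\<sigma> j"] \<sigma>r[of j] by linarith
  qed
  from nonpos_of_le_geometric[OF this] have "(LINT x:{0..1}|lborel. (cmod (v x))\<^sup>2) = s" by simp
  then show ?thesis using vL coeff by (auto simp: s_def a_def)
qed

lemma L2_summable: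
  assumes "v \<in> L2_circle" shows "(\<lambda>n. (cmod (fourier_coeff v n))\<^sup>2) summable_on UNIV"
  using bessel_inequality[OF assms] by (intro nonneg_bdd_above_summable_on bdd_aboveI2) auto

text \<open>The function that Riesz-Fischer builds from the coefficients of \<open>v\<close>
  satisfies the identity, and by uniqueness it agrees with \<open>v\<close> almost everywhere on a
  period.\<close>

lemma parseval:
  assumes v: "v \<in> L2_circle"
  shows "(LINT x:{0..1}|lborel. (cmod (v x))\<^sup>2) = (\<Sum>\<^sub>\<infinity>n. (cmod (fourier_coeff v n))\<^sup>2)"
proof -
  obtain v' where v': "v' \<in> L2_circle" "\<And>n. fourier_coeff v' n = fourier_coeff v n"
    "(LINT x:{0..1}|lborel. (cmod (v' x))\<^sup>2) = (\<Sum>\<^sub>\<infinity>n. (cmod (fourier_coeff v n))\<^sup>2)"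
    using riesz_fischer[OF L2_summable[OF v]] by auto
  have "(\<lambda>x. 1 * v x + (-1) * v' x) \<in> L2_circle" by (intro L2_circle_lincomb v v'(1))
  from L2_uniqueness[OF this] have "AE x in lborel. indicator {0..1} x *\<^sub>R (v x - v' x) = 0"
    using fourier_coeff_lincomb[OF v v'(1), of 1 "-1"] v'(2) by simp
  then have "AE x in lborel. indicator {0..1} x *\<^sub>R (cmod (v x))\<^sup>2 = indicator {0..1} x *\<^sub>R (cmod (v' x))\<^sup>2"
    by eventually_elim (auto simp: indicator_def)
  then have "(LINT x:{0..1}|lborel. (cmod (v x))\<^sup>2) = (LINT x:{0..1}|lborel. (cmod (v' x))\<^sup>2)"
    unfolding set_lebesgue_integral_def
    by (intro integral_cong_AE) (use v v'(1) in \<open>auto simp: L2_circle_def\<close>)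
  then show ?thesis using v'(3) by simp
qed

section \<open>Distributions and their Fourier coefficients\<close>

definition rapid :: "(int \<Rightarrow> complex) \<Rightarrow> bool" where
  "rapid a \<longleftrightarrow> (\<forall>N. \<exists>C\<ge>0. \<forall>n. cmod (a n) \<le> C / (max 1 \<bar>real_of_int n\<bar>) ^ N)"

lemma rapid_mult:
  assumes a: "rapid a" and c: "poly_bounded c"
  shows "rapid (\<lambda>n. c n * a n)"
  unfolding rapid_def
proof
  fix N
  obtain K p where K: "\<And>l. cmod (c l) \<le> K * (max 1 \<bar>real_of_int l\<bar>) ^ p" using c by (auto simp: poly_bounded_def)
  have K0: "K \<ge> 0" using order_trans[OF norm_ge_zero K[of 0]] by simp
  obtain C where C: "C \<ge> 0" "\<And>n. cmod (a n) \<le> C / (max 1 \<bar>real_of_int n\<bar>) ^ (p + N)" using a by (auto simp: rapid_def)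
  have "cmod (c n * a n) \<le> (K * C) / (max 1 \<bar>real_of_int n\<bar>) ^ N" for n
  proof -
    have nz: "max 1 \<bar>real_of_int n\<bar> \<noteq> 0" by linarith
    have "cmod (c n * a n) \<le> (K * (max 1 \<bar>real_of_int n\<bar>) ^ p) * (C / (max 1 \<bar>real_of_int n\<bar>) ^ (p + N))"
      unfolding norm_mult using K C K0 by (intro mult_mono) auto
    also have "\<dots> = (K * C) / (max 1 \<bar>real_of_int n\<bar>) ^ N" using nz by (simp add: power_add field_simps)
    finally show ?thesis .
  qed
  then show "\<exists>C\<ge>0. \<forall>n. cmod (c n * a n) \<le> C / (max 1 \<bar>real_of_int n\<bar>) ^ N"
    using K0 C(1) by (intro exI[of _ "K * C"]) auto
qed

lemma rapid_summable:
  assumes "rapid a" shows "(\<lambda>n. cmod (a n)) summable_on UNIV" "a summable_on UNIV"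
proof -
  obtain C where "\<And>n. cmod (a n) \<le> C / (max 1 \<bar>real_of_int n\<bar>)\<^sup>2" using assms by (auto simp: rapid_def)
  from summable_on_int_bound[OF this] show "(\<lambda>n. cmod (a n)) summable_on UNIV" "a summable_on UNIV" by auto
qed

definition fourier_series :: "(int \<Rightarrow> complex) \<Rightarrow> real \<Rightarrow> complex" where
  "fourier_series a x = (\<Sum>\<^sub>\<infinity>n. a n * ee n x)"

lemma poly_bounded_frequency: "poly_bounded (\<lambda>n. of_real (2 * pi * of_int n) * \<i>)"
proof (rule poly_boundedI)
  show "cmod (of_real (2 * pi * of_int n) * \<i>) \<le> 2 * pi * (max 1 \<bar>real_of_int n\<bar>) ^ 1" for n
    by (simp add: norm_mult)
qed

lemma fourier_series_has_vector_derivative: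
  assumes a: "rapid a"
  shows "(fourier_series a has_vector_derivative fourier_series (\<lambda>n. of_real (2 * pi * of_int n) * \<i> * a n) x) (at x)"
proof -
  define b where "b n = of_real (2 * pi * of_int n) * \<i> * a n" for n
  have b: "rapid b" unfolding b_def [abs_def] by (rule rapid_mult[OF a poly_bounded_frequency])
  define S where "S N y = (\<Sum>n\<in>{- int N..int N}. a n * ee n y)" for N y
  define D where "D N y = (\<Sum>n\<in>{- int N..int N}. b n * ee n y)" for N y
  obtain t where t: "t \<longlonglongrightarrow> 0" "\<And>y N. cmod (fourier_series b y - D N y) \<le> t N"
    using trig_series_tail[OF rapid_summable(1)[OF b]] unfolding fourier_series_def D_def by blast
  have SD: "(S N has_derivative (\<lambda>h. h *\<^sub>R D N y)) (at y within UNIV)" for N y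
  proof -
    have "((\<lambda>y. a n * ee n y) has_vector_derivative a n * (of_real (2 * pi * of_int n) * \<i> * ee n y)) (at y)" for n
      by (rule has_vector_derivative_mult_right[OF ee_has_vector_derivative])
    then have "(S N has_vector_derivative (\<Sum>n\<in>{- int N..int N}. a n * (of_real (2 * pi * of_int n) * \<i> * ee n y))) (at y)"
      unfolding S_def [abs_def] by (intro has_vector_derivative_sum)
    then show ?thesis by (simp add: has_vector_derivative_def D_def b_def mult_ac)
  qed
  have lim: "(\<lambda>N. S N y) \<longlonglongrightarrow> fourier_series a y" for y
  proof -
    have "(\<lambda>p. a p * ee p y) summable_on UNIV"
      by (rule abs_summable_summable) (simp add: norm_mult rapid_summable(1)[OF a])
    from has_sum_int_tendsto[OF has_sum_infsum[OF this]] show ?thesis by (simp add: S_def fourier_series_def)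
  qed
  have "\<exists>h. \<forall>y\<in>UNIV. (\<lambda>N. S N y) \<longlonglongrightarrow> h y \<and> (h has_derivative (\<lambda>z. z *\<^sub>R fourier_series b y)) (at y within UNIV)"
  proof (rule has_derivative_sequence)
    show "\<forall>\<^sub>F n in sequentially. \<forall>y\<in>UNIV. \<forall>h. norm (h *\<^sub>R D n y - h *\<^sub>R fourier_series b y) \<le> e * norm h" if "e > 0" for e
      using order_tendstoD(2)[OF t(1) that]
    proof eventually_elim
      case (elim n)
      have le: "cmod (D n y - fourier_series b y) \<le> e" for y
        using t(2)[of y n] elim by (simp add: norm_minus_commute)
      have "\<bar>h\<bar> * cmod (D n y - fourier_series b y) \<le> e * \<bar>h\<bar>" for y h
        by (subst mult.commute) (rule mult_right_mono[OF le], simp)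
      then show ?case by (simp add: scaleR_right_diff_distrib[symmetric])
    qed
  qed (use SD lim in auto)
  then obtain h where h: "\<And>y. (\<lambda>N. S N y) \<longlonglongrightarrow> h y" "\<And>y. (h has_derivative (\<lambda>z. z *\<^sub>R fourier_series b y)) (at y)" by auto
  have "h = fourier_series a" using LIMSEQ_unique[OF h(1) lim] by auto
  then show ?thesis using h(2)[of x] by (simp add: has_vector_derivative_def b_def [abs_def])
qed

lemma CN_fourier_series: "rapid a \<Longrightarrow> CN N (fourier_series a)"
proof (induction N arbitrary: a)
  case 0
  show ?case unfolding CN.simps
    by (intro continuous_at_imp_continuous_on ballI has_vector_derivative_continuous[OF fourier_series_has_vector_derivative[OF 0]])
next
  case (Suc N)
  show ?case
    by (rule CN_SucI[OF fourier_series_has_vector_derivative[OF Suc.prems]])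
      (rule Suc.IH[OF rapid_mult[OF Suc.prems poly_bounded_frequency]])
qed

lemma test_function_iff: "f \<in> test_functions \<longleftrightarrow> (\<forall>N. CN N f) \<and> periodic1 f"
  by (simp add: test_functions_def smooth_iff_CN)

lemma fourier_series_test: "rapid a \<Longrightarrow> fourier_series a \<in> test_functions"
  using periodic1_ee unfolding test_function_iff by (simp add: CN_fourier_series periodic1_def fourier_series_def)

lemma fourier_coeff_fourier_series:
  assumes a: "rapid a"
  shows "fourier_coeff (fourier_series a) n = a n"
proof -
  obtain t where t: "t \<longlonglongrightarrow> 0" "\<And>y N. cmod (fourier_series a y - (\<Sum>p\<in>{- int N..int N}. a p * ee p y)) \<le> t N"
    using trig_series_tail[OF rapid_summable(1)[OF a]] unfolding fourier_series_def by blast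
  have t0: "t N \<ge> 0" for N using order_trans[OF norm_ge_zero t(2)] .
  let ?S = "\<lambda>N y. \<Sum>p\<in>{- int N..int N}. a p * ee p y"
  have FL: "fourier_series a \<in> L2_circle"
    using fourier_series_test[OF a] by (intro L2_circle_continuous CN_continuous[of 0]) (auto simp: test_function_iff)
  have SL: "?S N \<in> L2_circle" for N by (rule L2_circle_trig) simp
  have b: "cmod (fourier_coeff (fourier_series a) n - a n) \<le> t N" if N: "nat \<bar>n\<bar> \<le> N" for N
  proof -
    let ?w = "\<lambda>x. 1 * fourier_series a x + (- 1) * ?S N x"
    have "cmod (fourier_coeff ?w n) \<le> (LINT x:{0..1}|lborel. cmod (ee (- n) x * ?w x))"
      unfolding fourier_coeff_ee by (intro set_integral_norm_bound L2_mult_integrable ee_L2 L2_circle_lincomb FL SL)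
    also have "\<dots> \<le> (LINT x::real:{0..1}|lborel. t N)"
    proof (rule set_integral_mono)
      show "set_integrable lborel {0..1} (\<lambda>x. cmod (ee (- n) x * ?w x))"
        by (intro set_integrable_norm L2_mult_integrable ee_L2 L2_circle_lincomb FL SL)
      show "set_integrable lborel {0..1} (\<lambda>x::real. t N)" by (simp add: set_integrable_def)
      show "cmod (ee (- n) x * ?w x) \<le> t N" for x using t(2)[of x N] by (simp add: norm_mult)
    qed
    also have "\<dots> = t N" by (simp add: set_lebesgue_integral_def)
    also have "fourier_coeff ?w n = fourier_coeff (fourier_series a) n - a n"
      unfolding fourier_coeff_lincomb[OF FL SL] using N by (subst fourier_coeff_trig) auto
    finally show ?thesis .
  qed
  have "cmod (fourier_coeff (fourier_series a) n - a n) \<le> 0"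
    by (rule LIMSEQ_le_const[OF t(1)]) (use b in blast)
  then show ?thesis by simp
qed

lemma test_function_CB: "\<phi> \<in> test_functions \<Longrightarrow> CB N {()} (\<lambda>_. \<phi>)"
  and test_function_periodic: "\<phi> \<in> test_functions \<Longrightarrow> periodic1 \<phi>"
  by (auto simp: test_function_iff CB_of_CN)

lemma test_function_rapid: "\<phi> \<in> test_functions \<Longrightarrow> rapid (fourier_coeff \<phi>)"
  unfolding rapid_def using fourier_coeff_decay[OF test_function_CB test_function_periodic] by blast

lemma test_function_eq_fourier_series: "\<phi> \<in> test_functions \<Longrightarrow> fourier_series (fourier_coeff \<phi>) = \<phi>"
  unfolding fourier_series_def
  using infsumI[OF fourier_inversion[OF test_function_CB test_function_periodic]] by auto

lemma ee_test: "ee n \<in> test_functions"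
proof -
  have "CN N (\<lambda>x. cis (2 * pi * real_of_int n * x))" for N by (intro CN_cis CN_mult CN_const CN_ident)
  then show ?thesis using periodic1_ee by (simp add: test_function_iff ee_def [abs_def])
qed

lemma fourier_coeff_ee_delta: "fourier_coeff (ee n) p = (if p = n then 1 else 0)"
  using fourier_coeff_trig[of "{n}" "\<lambda>_. 1" p] by simp

lemma poly_bounded_sob_weight: "poly_bounded (\<lambda>n. of_real (sob_weight s n))"
proof -
  obtain p :: nat where p: "s \<le> real p" using real_arch_simple by blast
  have "cmod (of_real (sob_weight s n)) \<le> 8 ^ p * (max 1 \<bar>real_of_int n\<bar>) ^ p" for n
  proof -
    let ?J = "japanese (2 * pi * real_of_int n)"
    have "?J \<ge> 1" using japanese_bounds(1)[of n] by linarith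
    then have "sob_weight s n \<le> ?J powr (real p)" unfolding sob_weight_def using p by (intro powr_mono) auto
    also have "\<dots> = ?J ^ p" using japanese_pos[of n] by (simp add: powr_realpow)
    also have "\<dots> \<le> (8 * max 1 \<bar>real_of_int n\<bar>) ^ p" using japanese_pos[of n] japanese_bounds(2)[of n] by (intro power_mono) auto
    finally show ?thesis using sob_weight_pos[of s n] by (simp add: power_mult_distrib)
  qed
  then show ?thesis by (rule poly_boundedI)
qed

lemma sob_weight_even: "sob_weight m (- n) = sob_weight m n"
  by (simp add: sob_weight_def japanese_def)

lemma sob_weight_uminus: "sob_weight (- m) n = 1 / sob_weight m n"
  by (simp add: sob_weight_def powr_minus divide_inverse)

lemma bessel_test_eq: "bessel_test s \<phi> = fourier_series (\<lambda>n. of_real (sob_weight s n) * fourier_coeff \<phi> n)"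
  by (simp add: fun_eq_iff bessel_test_def fourier_series_def sob_weight_def ee_def mult.assoc)

lemma bessel_test_rapid:
  "\<phi> \<in> test_functions \<Longrightarrow> rapid (\<lambda>n. of_real (sob_weight s n) * fourier_coeff \<phi> n)"
  by (intro rapid_mult test_function_rapid poly_bounded_sob_weight)

text \<open>The pairing is bilinear, so the coefficient \<open>c n\<close> is the value at the
  exponential of frequency \<open>- n\<close>; hence the reversed index.\<close>

definition dist_of_coeffs :: "(int \<Rightarrow> complex) \<Rightarrow> distribution" where
  "dist_of_coeffs c \<phi> = (if \<phi> \<in> test_functions then \<Sum>\<^sub>\<infinity>p. fourier_coeff \<phi> p * c (- p) else 0)"

lemma dist_of_coeffs_ee: "dist_of_coeffs c (ee (- n)) = c n"
proof -
  have "(\<Sum>\<^sub>\<infinity>p. fourier_coeff (ee (- n)) p * c (- p)) = (\<Sum>\<^sub>\<infinity>p\<in>{- n}. fourier_coeff (ee (- n)) p * c (- p))"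
    by (rule infsum_cong_neutral) (auto simp: fourier_coeff_ee_delta)
  then show ?thesis by (simp add: dist_of_coeffs_def ee_test fourier_coeff_ee_delta)
qed

lemma dist_of_coeffs_inject: "dist_of_coeffs c = dist_of_coeffs d \<longleftrightarrow> c = d"
  using dist_of_coeffs_ee by (metis ext)

lemma poly_bounded_uminus: "poly_bounded c \<Longrightarrow> poly_bounded (\<lambda>n. c (- n))"
  unfolding poly_bounded_def by (metis abs_minus_cancel of_int_minus)

lemma dist_of_coeffs_summable:
  assumes "\<phi> \<in> test_functions" "poly_bounded c"
  shows "(\<lambda>p. fourier_coeff \<phi> p * c (- p)) summable_on UNIV"
  using rapid_summable(2)[OF rapid_mult[OF test_function_rapid[OF assms(1)] poly_bounded_uminus[OF assms(2)]]]
  by (simp add: mult.commute)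

lemma dist_of_coeffs_lin:
  assumes "poly_bounded c" "poly_bounded d"
  shows "(\<lambda>\<phi>. x * dist_of_coeffs c \<phi> + y * dist_of_coeffs d \<phi>) = dist_of_coeffs (\<lambda>n. x * c n + y * d n)"
proof
  fix \<phi>
  show "x * dist_of_coeffs c \<phi> + y * dist_of_coeffs d \<phi> = dist_of_coeffs (\<lambda>n. x * c n + y * d n) \<phi>"
  proof (cases "\<phi> \<in> test_functions")
    case True
    note s = dist_of_coeffs_summable[OF True assms(1)] dist_of_coeffs_summable[OF True assms(2)]
    have "(\<Sum>\<^sub>\<infinity>p. fourier_coeff \<phi> p * (x * c (- p) + y * d (- p))) = (\<Sum>\<^sub>\<infinity>p. x * (fourier_coeff \<phi> p * c (- p)) + y * (fourier_coeff \<phi> p * d (- p)))"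
      by (simp add: algebra_simps)
    also have "\<dots> = x * (\<Sum>\<^sub>\<infinity>p. fourier_coeff \<phi> p * c (- p)) + y * (\<Sum>\<^sub>\<infinity>p. fourier_coeff \<phi> p * d (- p))"
      using s by (subst infsum_add) (auto intro!: summable_on_cmult_right infsum_cmult_right simp: infsum_cmult_right)
    finally show ?thesis using True by (simp add: dist_of_coeffs_def)
  qed (simp add: dist_of_coeffs_def)
qed

lemma bessel_distribution_of:
  assumes v: "v \<in> L2_circle"
  shows "bessel (- m) (distribution_of v) = dist_of_coeffs (\<lambda>n. fourier_coeff v n / of_real (sob_weight m n))"
proof
  fix \<phi>
  show "bessel (- m) (distribution_of v) \<phi> = dist_of_coeffs (\<lambda>n. fourier_coeff v n / of_real (sob_weight m n)) \<phi>"
  proof (cases "\<phi> \<in> test_functions")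
    case True
    have r: "rapid (\<lambda>n. of_real (sob_weight (- m) n) * fourier_coeff \<phi> n)" by (rule bessel_test_rapid[OF True])
    have t: "bessel_test (- m) \<phi> \<in> test_functions" unfolding bessel_test_eq by (rule fourier_series_test[OF r])
    have "(LINT x:{0..1}|lborel. v x * bessel_test (- m) \<phi> x) = (\<Sum>\<^sub>\<infinity>p. fourier_coeff (bessel_test (- m) \<phi>) p * fourier_coeff v (- p))"
      by (rule infsumI[symmetric, OF L2_pairing_expansion[OF v test_function_CB[OF t] test_function_periodic[OF t]]])
    also have "\<dots> = (\<Sum>\<^sub>\<infinity>p. fourier_coeff \<phi> p * (fourier_coeff v (- p) / of_real (sob_weight m (- p))))"
      unfolding bessel_test_eq fourier_coeff_fourier_series[OF r] by (simp add: sob_weight_uminus sob_weight_even mult_ac)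
    finally show ?thesis using True t by (simp add: bessel_def distribution_of_def dist_of_coeffs_def)
  qed (simp add: bessel_def dist_of_coeffs_def)
qed

section \<open>Sobolev spaces as weighted sequence spaces\<close>

definition wnorm :: "(int \<Rightarrow> real) \<Rightarrow> (int \<Rightarrow> complex) \<Rightarrow> real" where
  "wnorm a c = sqrt (\<Sum>\<^sub>\<infinity>n. (a n * cmod (c n))\<^sup>2)"

lemma wseq_summable:
  assumes "c \<in> wseq a" shows "(\<lambda>n. (a n * cmod (c n))\<^sup>2) summable_on UNIV"
proof -
  obtain M where M: "wnorm_le a c M" using assms by (auto simp: wseq_def)
  have "(\<Sum>n\<in>F. (a n * cmod (c n))\<^sup>2) \<le> M\<^sup>2" if "finite F" for F
    using wnorm_leD[OF M that] wnorm_le_nonneg[OF M] by (simp add: L2_set_def real_sqrt_le_iff' real_le_lsqrt sqrt_le_D)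
  then show ?thesis by (intro nonneg_bdd_above_summable_on bdd_aboveI2) auto
qed

lemma summable_wseq:
  assumes s: "(\<lambda>n. (a n * cmod (c n))\<^sup>2) summable_on UNIV"
  shows "wnorm_le a c (wnorm a c)" "c \<in> wseq a"
proof -
  show "wnorm_le a c (wnorm a c)"
    unfolding wnorm_le_def L2_set_def wnorm_def
    using finite_sum_le_infsum[OF s] by auto
  then show "c \<in> wseq a" by (auto simp: wseq_def)
qed

lemma wnorm_le_iff: "c \<in> wseq a \<Longrightarrow> wnorm_le a c M \<longleftrightarrow> wnorm a c \<le> M"
proof
  assume c: "c \<in> wseq a" and M: "wnorm_le a c M"
  have "(\<Sum>\<^sub>\<infinity>n. (a n * cmod (c n))\<^sup>2) \<le> M\<^sup>2"
  proof (rule infsum_le_finite_sums[OF wseq_summable[OF c]])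
    fix F :: "int set" assume "finite F"
    then show "(\<Sum>n\<in>F. (a n * cmod (c n))\<^sup>2) \<le> M\<^sup>2"
      using wnorm_leD[OF M] wnorm_le_nonneg[OF M] by (simp add: L2_set_def sqrt_le_D)
  qed
  then show "wnorm a c \<le> M" unfolding wnorm_def using wnorm_le_nonneg[OF M] by (rule real_le_lsqrt[rotated 1])
next
  assume "c \<in> wseq a" "wnorm a c \<le> M"
  then show "wnorm_le a c M" using summable_wseq(1)[OF wseq_summable] wnorm_le_mono by blast
qed

lemma sobolev_eq: "sobolev m = dist_of_coeffs ` wseq (sob_weight m)"
proof (intro equalityI subsetI)
  fix u assume "u \<in> sobolev m"
  then obtain v where v: "v \<in> L2_circle" and u: "u = dist_of_coeffs (\<lambda>n. fourier_coeff v n / of_real (sob_weight m n))"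
    by (auto simp: sobolev_def bessel_distribution_of)
  have "sob_weight m n * cmod (fourier_coeff v n / of_real (sob_weight m n)) = cmod (fourier_coeff v n)" for n
    using sob_weight_pos[of m n] by (simp add: norm_divide)
  then have "(\<lambda>n. fourier_coeff v n / of_real (sob_weight m n)) \<in> wseq (sob_weight m)"
    using L2_summable[OF v] by (intro summable_wseq(2)) simp
  then show "u \<in> dist_of_coeffs ` wseq (sob_weight m)" using u by blast
next
  fix u assume "u \<in> dist_of_coeffs ` wseq (sob_weight m)"
  then obtain c where c: "c \<in> wseq (sob_weight m)" and u: "u = dist_of_coeffs c" by blast
  have "(\<lambda>n. (cmod (of_real (sob_weight m n) * c n))\<^sup>2) summable_on UNIV"
    using wseq_summable[OF c] by (simp add: norm_mult power_mult_distrib)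
  from riesz_fischer[OF this] obtain v where v: "v \<in> L2_circle" "\<And>n. fourier_coeff v n = of_real (sob_weight m n) * c n" by blast
  have "u = bessel (- m) (distribution_of v)"
    unfolding u bessel_distribution_of[OF v(1)] using sob_weight_pos[of m] by (simp add: v(2) less_imp_neq[symmetric])
  then show "u \<in> sobolev m" using v(1) by (auto simp: sobolev_def)
qed

text \<open>By Parseval all functions \<open>v\<close> that represent the same distribution have the
  same norm, so the definite description in \<open>sobolev_norm\<close> denotes.\<close>

lemma sobolev_norm_eq:
  assumes c: "c \<in> wseq (sob_weight m)"
  shows "sobolev_norm m (dist_of_coeffs c) = wnorm (sob_weight m) c"
proof -
  have eq: "L2_norm_circle v = wnorm (sob_weight m) c"
    if v: "v \<in> L2_circle" and u: "dist_of_coeffs c = bessel (- m) (distribution_of v)" for v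
  proof -
    have "c = (\<lambda>n. fourier_coeff v n / of_real (sob_weight m n))"
      using u unfolding bessel_distribution_of[OF v] dist_of_coeffs_inject .
    then have "sob_weight m n * cmod (c n) = cmod (fourier_coeff v n)" for n
      using sob_weight_pos[of m n] by (simp add: norm_divide)
    then show ?thesis by (simp add: L2_norm_circle_def parseval[OF v] wnorm_def)
  qed
  have "dist_of_coeffs c \<in> sobolev m" using c by (simp add: sobolev_eq)
  then obtain v where "v \<in> L2_circle" "dist_of_coeffs c = bessel (- m) (distribution_of v)"
    by (auto simp: sobolev_def)
  note v = this
  show ?thesis unfolding sobolev_norm_def
  proof (rule the_equality)
    show "\<exists>v\<in>L2_circle. dist_of_coeffs c = bessel (- m) (distribution_of v) \<and> wnorm (sob_weight m) c = L2_norm_circle v"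
      using v eq[OF v] by (intro bexI[of _ v]) auto
  qed (use eq in blast)
qed

section \<open>Spectrum of the transfer operator\<close>

text \<open>Coefficients are recovered by evaluating at exponentials, which translates operators in
  both directions. Polynomial bounds make \<open>dist_of_coeffs\<close> linear on the sequences
  concerned.\<close>

lemma resolvent_set_eq_wres:
  fixes a :: "int \<Rightarrow> real"
  assumes X: "X = dist_of_coeffs ` wseq a"
    and N: "\<And>c. c \<in> wseq a \<Longrightarrow> N (dist_of_coeffs c) = wnorm a c"
    and pos: "\<And>n. 0 \<le> a n" and pb: "\<And>c. c \<in> wseq a \<Longrightarrow> poly_bounded c"
    and A: "\<And>c. c \<in> wseq a \<Longrightarrow> A (dist_of_coeffs c) = dist_of_coeffs (S c)"
    and S: "wop a a S"
  shows "resolvent_set X N A = wres a S"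
proof (intro equalityI subsetI)
  note lin = dist_of_coeffs_lin[OF pb pb]
  have diff: "(\<lambda>\<phi>. z * dist_of_coeffs c \<phi> - dist_of_coeffs d \<phi>) = dist_of_coeffs (\<lambda>n. z * c n - d n)"
    if "c \<in> wseq a" "d \<in> wseq a" for c d z
    using lin[OF that, of z "-1"] by simp
  have zS: "(\<lambda>n. z * c n - S c n) \<in> wseq a" if "c \<in> wseq a" for c z
    by (intro wseq_diff wseq_scale pos that wop_in[OF S])
  {
    fix z assume "z \<in> resolvent_set X N A"
    then obtain B where B: "bounded_operator_on X N B"
      "\<And>u. u \<in> X \<Longrightarrow> B (\<lambda>\<phi>. z * u \<phi> - A u \<phi>) = u" "\<And>u. u \<in> X \<Longrightarrow> (\<lambda>\<phi>. z * B u \<phi> - A (B u) \<phi>) = u"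
      by (auto simp: resolvent_set_def)
    define b where "b c = (\<lambda>n. B (dist_of_coeffs c) (ee (- n)))" for c
    have b: "B (dist_of_coeffs c) = dist_of_coeffs (b c)" "b c \<in> wseq a" if "c \<in> wseq a" for c
    proof -
      have "B (dist_of_coeffs c) \<in> X" using B(1) that by (auto simp: bounded_operator_on_def X)
      then obtain d where d: "d \<in> wseq a" "B (dist_of_coeffs c) = dist_of_coeffs d" by (auto simp: X)
      then have "b c = d" by (simp add: b_def dist_of_coeffs_ee)
      then show "B (dist_of_coeffs c) = dist_of_coeffs (b c)" "b c \<in> wseq a" using d by auto
    qed
    obtain C where C: "\<And>u. u \<in> X \<Longrightarrow> N (B u) \<le> C * N u" using B(1) unfolding bounded_operator_on_def by blast
    have "wop a a b"
    proof (rule wopI[of _ _ "max 0 C"])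
      fix c d x y assume cd: "c \<in> wseq a" "d \<in> wseq a"
      have "dist_of_coeffs (b (\<lambda>n. x * c n + y * d n)) = B (\<lambda>\<phi>. x * dist_of_coeffs c \<phi> + y * dist_of_coeffs d \<phi>)"
        unfolding lin[OF cd] by (rule b(1)[symmetric], rule wseq_lin[OF pos cd])
      also have "\<dots> = (\<lambda>\<phi>. x * B (dist_of_coeffs c) \<phi> + y * B (dist_of_coeffs d) \<phi>)"
        using B(1) cd by (auto simp: bounded_operator_on_def X)
      also have "\<dots> = dist_of_coeffs (\<lambda>n. x * b c n + y * b d n)"
        by (simp add: b(1) cd lin b(2))
      finally show "b (\<lambda>n. x * c n + y * d n) = (\<lambda>n. x * b c n + y * b d n)" by (simp only: dist_of_coeffs_inject)
    next
      fix c M assume M: "wnorm_le a c M"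
      then have c: "c \<in> wseq a" by (auto simp: wseq_def)
      have "wnorm a (b c) = N (B (dist_of_coeffs c))" by (simp add: b[OF c] N)
      also have "\<dots> \<le> C * wnorm a c" using C[of "dist_of_coeffs c"] c by (simp add: X N)
      also have "\<dots> \<le> max 0 C * M"
        using wnorm_le_iff[OF c, of M] M wnorm_le_nonneg[OF summable_wseq(1)[OF wseq_summable[OF c]]]
        by (intro mult_mono) auto
      finally show "wnorm_le a (b c) (max 0 C * M)" by (simp add: wnorm_le_iff b(2)[OF c])
    qed simp
    moreover have "b (\<lambda>n. z * c n - S c n) = c \<and> (\<lambda>n. z * b c n - S (b c) n) = c" if c: "c \<in> wseq a" for c
    proof
      have "dist_of_coeffs (b (\<lambda>n. z * c n - S c n)) = B (\<lambda>\<phi>. z * dist_of_coeffs c \<phi> - A (dist_of_coeffs c) \<phi>)"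
        unfolding A[OF c] diff[OF c wop_in[OF S c]] by (rule b(1)[symmetric], rule zS[OF c])
      then show "b (\<lambda>n. z * c n - S c n) = c" using B(2)[of "dist_of_coeffs c"] c by (simp add: X dist_of_coeffs_inject)
      have "dist_of_coeffs (\<lambda>n. z * b c n - S (b c) n) = (\<lambda>\<phi>. z * B (dist_of_coeffs c) \<phi> - A (B (dist_of_coeffs c)) \<phi>)"
        unfolding b(1)[OF c] A[OF b(2)[OF c]] by (rule diff[symmetric, OF b(2)[OF c] wop_in[OF S b(2)[OF c]]])
      then show "(\<lambda>n. z * b c n - S (b c) n) = c" using B(3)[of "dist_of_coeffs c"] c by (simp add: X dist_of_coeffs_inject)
    qed
    ultimately show "z \<in> wres a S" by (auto simp: wres_def)
  next
    fix z assume "z \<in> wres a S"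
    then obtain b where b: "wop a a b" "\<And>c. c \<in> wseq a \<Longrightarrow> b (\<lambda>n. z * c n - S c n) = c"
      "\<And>c. c \<in> wseq a \<Longrightarrow> (\<lambda>n. z * b c n - S (b c) n) = c" by (auto simp: wres_def)
    define B where "B u = dist_of_coeffs (b (\<lambda>n. u (ee (- n))))" for u
    have B: "B (dist_of_coeffs c) = dist_of_coeffs (b c)" for c by (simp add: B_def dist_of_coeffs_ee)
    note bi = wop_in[OF b(1)]
    obtain C where C: "C \<ge> 0" "\<And>c M. wnorm_le a c M \<Longrightarrow> wnorm_le a (b c) (C * M)" using b(1) by (auto simp: wop_def)
    have "bounded_operator_on X N B"
      unfolding bounded_operator_on_def
    proof (intro conjI ballI allI exI[of _ C])
      show "B ` X \<subseteq> X" using bi by (auto simp: X B)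
    next
      fix u v x y assume "u \<in> X" "v \<in> X"
      then obtain c d where cd: "c \<in> wseq a" "d \<in> wseq a" and uv: "u = dist_of_coeffs c" "v = dist_of_coeffs d" by (auto simp: X)
      show "B (\<lambda>\<phi>. x * u \<phi> + y * v \<phi>) = (\<lambda>\<phi>. x * B u \<phi> + y * B v \<phi>)"
        unfolding uv lin[OF cd] B lin[OF bi[OF cd(1)] bi[OF cd(2)]] wop_lin[OF b(1) cd] ..
    next
      fix u assume "u \<in> X"
      then obtain c where c: "c \<in> wseq a" and u: "u = dist_of_coeffs c" by (auto simp: X)
      show "N (B u) \<le> C * N u"
        using C(2)[OF summable_wseq(1)[OF wseq_summable[OF c]]] by (simp add: u B N bi c wnorm_le_iff)
    qed
    moreover have "B (\<lambda>\<phi>. z * u \<phi> - A u \<phi>) = u \<and> (\<lambda>\<phi>. z * B u \<phi> - A (B u) \<phi>) = u" if "u \<in> X" for u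
    proof -
      from that obtain c where c: "c \<in> wseq a" and u: "u = dist_of_coeffs c" by (auto simp: X)
      show ?thesis
        unfolding u A[OF c] B A[OF bi[OF c]] diff[OF c wop_in[OF S c]] diff[OF bi[OF c] wop_in[OF S bi[OF c]]] b(2)[OF c] b(3)[OF c]
        by simp
    qed
    ultimately show "z \<in> resolvent_set X N A" by (auto simp: resolvent_set_def)
  }
qed

section \<open>The dual operator on test functions\<close>

context expanding_skew
begin

text \<open>The transpose for the bilinear pairing: the two conjugations in
  \<open>transfer_op\<close> reverse the sign of the phase in the adjoint. Summing over branches
  instead of preimages in a fundamental domain makes smoothness visible.\<close>

definition "dual \<nu> \<phi> = branch_sum (\<lambda>x. cis (\<nu> * \<tau> x) * of_real (1 / dE x) * \<phi> x)"

lemma CN_dual: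
  assumes "CN n \<phi>" shows "CN n (dual \<nu> \<phi>)"
proof -
  have "dE x \<noteq> 0" for x using dE_pos[of x] by simp
  then have "CN n (\<lambda>x. cis (\<nu> * \<tau> x) * of_real (inverse (dE x)) * \<phi> x)"
    by (intro CN_mult CN_cis CN_const CN_tau CN_of_real CN_inverse CN_dE assms)
  then have "CN n (\<lambda>x. cis (\<nu> * \<tau> x) * of_real (1 / dE x) * \<phi> x)" by (simp add: divide_inverse)
  from CN_compose[OF this CN_branch] show ?thesis
    unfolding dual_def branch_sum_def [abs_def] by (intro CN_sum) auto
qed

lemma dual_test: "\<phi> \<in> test_functions \<Longrightarrow> dual \<nu> \<phi> \<in> test_functions"
proof -
  assume \<phi>: "\<phi> \<in> test_functions"
  have "periodic1 (dual \<nu> \<phi>)" unfolding dual_def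
    by (rule periodic_branch_sum)
      (use periodic_tau periodic_dE test_function_periodic[OF \<phi>] in \<open>simp add: periodic1_def\<close>)
  then show ?thesis using \<phi> CN_dual by (simp add: test_function_iff)
qed

text \<open>For a preimage \<open>x\<close> the integer \<open>E x - y\<close> has a residue modulo
  \<open>k\<close>, and this residue is the index of the branch that passes through \<open>x\<close>
  up to an integer shift.\<close>

lemma bij_betw_preimages:
  "bij_betw (\<lambda>\<epsilon>. frac (branch \<epsilon> y)) {..<k} {x. x \<in> {0..<1} \<and> E x - y \<in> \<int>}"
proof (rule bij_betw_imageI)
  have Efrac: "E (frac x) = E x - of_int (int k * \<lfloor>x\<rfloor>)" for x
    using E_shift_int[of "frac x" "\<lfloor>x\<rfloor>"] by (simp add: frac_def)
  show "inj_on (\<lambda>\<epsilon>. frac (branch \<epsilon> y)) {..<k}"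
  proof (rule inj_onI)
    fix \<epsilon> \<epsilon>' assume e: "\<epsilon> \<in> {..<k}" "\<epsilon>' \<in> {..<k}" "frac (branch \<epsilon> y) = frac (branch \<epsilon>' y)"
    then have "E (branch \<epsilon> y) - of_int (int k * \<lfloor>branch \<epsilon> y\<rfloor>) = E (branch \<epsilon>' y) - of_int (int k * \<lfloor>branch \<epsilon>' y\<rfloor>)"
      unfolding Efrac[symmetric] by simp
    then have "real_of_int (int \<epsilon> - int k * \<lfloor>branch \<epsilon> y\<rfloor>) = real_of_int (int \<epsilon>' - int k * \<lfloor>branch \<epsilon>' y\<rfloor>)"
      by (simp add: E_branch)
    then have "int \<epsilon> - int k * \<lfloor>branch \<epsilon> y\<rfloor> = int \<epsilon>' - int k * \<lfloor>branch \<epsilon>' y\<rfloor>" by (simp only: of_int_eq_iff)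
    then have "int \<epsilon> mod int k = int \<epsilon>' mod int k" by (metis mod_mult_self2 minus_mult_right diff_conv_add_uminus)
    then show "\<epsilon> = \<epsilon>'" using e by simp
  qed
  show "(\<lambda>\<epsilon>. frac (branch \<epsilon> y)) ` {..<k} = {x. x \<in> {0..<1} \<and> E x - y \<in> \<int>}"
  proof (intro equalityI subsetI)
    fix x assume "x \<in> (\<lambda>\<epsilon>. frac (branch \<epsilon> y)) ` {..<k}"
    then obtain \<epsilon> where x: "x = frac (branch \<epsilon> y)" by auto
    have "E x - y = of_int (int \<epsilon> - int k * \<lfloor>branch \<epsilon> y\<rfloor>)" unfolding x Efrac E_branch by simp
    then have "E x - y \<in> \<int>" by (metis Ints_of_int)
    then show "x \<in> {x. x \<in> {0..<1} \<and> E x - y \<in> \<int>}" by (simp add: x frac_lt_1)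
  next
    fix x assume "x \<in> {x. x \<in> {0..<1} \<and> E x - y \<in> \<int>}"
    then obtain i where x: "0 \<le> x" "x < 1" and i: "E x - y = of_int i" by (auto elim: Ints_cases)
    define \<epsilon> where "\<epsilon> = nat (i mod int k)"
    have \<epsilon>: "\<epsilon> < k" "int \<epsilon> = i - int k * (i div int k)"
      using k2 by (auto simp: \<epsilon>_def nat_less_iff minus_mult_div_eq_mod)
    have "real \<epsilon> = of_int i - real k * of_int (i div int k)" using arg_cong[OF \<epsilon>(2), of real_of_int] by simp
    then have "(y + real \<epsilon>) / real k + of_int (i div int k) = g x"
      using i k2 by (simp add: expanding_map_def field_simps)
    then have "x = branch \<epsilon> y + of_int (i div int k)"
      unfolding branch_def g_inv_shift_int[symmetric] by simp
    then have "frac x = frac (branch \<epsilon> y)" by (simp add: frac_def)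
    then have "frac (branch \<epsilon> y) = x" using x frac_eq by simp
    then show "x \<in> (\<lambda>\<epsilon>. frac (branch \<epsilon> y)) ` {..<k}" using \<epsilon>(1) by auto
  qed
qed

lemma dual_eq:
  assumes "periodic1 \<phi>"
  shows "cnj (transfer_adjoint k g \<tau> \<nu> (\<lambda>x. cnj (\<phi> x)) y) = dual \<nu> \<phi> y"
proof -
  define h where "h x = cis (\<nu> * \<tau> x) * of_real (1 / dE x) * \<phi> x" for x
  have h: "periodic1 h" using assms periodic_tau periodic_dE by (simp add: periodic1_def h_def)
  have "cnj (transfer_adjoint k g \<tau> \<nu> (\<lambda>x. cnj (\<phi> x)) y) = (\<Sum>x | x \<in> {0..<1} \<and> E x - y \<in> \<int>. h x)"
    by (simp add: transfer_adjoint_def h_def cis_cnj)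
  also have "\<dots> = (\<Sum>\<epsilon><k. h (frac (branch \<epsilon> y)))"
    by (rule sum.reindex_bij_betw[OF bij_betw_preimages, symmetric])
  also have "\<dots> = dual \<nu> \<phi> y" unfolding periodic1_frac[OF h] by (simp add: dual_def branch_sum_def h_def)
  finally show ?thesis .
qed

lemma transfer_op_eq:
  "transfer_op k g \<tau> \<nu> u \<phi> = (if \<phi> \<in> test_functions then u (dual \<nu> \<phi>) else 0)"
  using dual_eq[OF test_function_periodic] by (simp add: transfer_op_def)

text \<open>The change of variables along the branches moves the operator from the test function
  back to the exponential. The indices of the matrix entry change places and signs because the
  pairing contains no conjugation.\<close>

lemma fourier_coeff_dual:
  assumes \<phi>: "\<phi> \<in> test_functions"
  shows "((\<lambda>l. fourier_coeff \<phi> l * T 1 \<nu> (- l) (- p)) has_sum fourier_coeff (dual \<nu> \<phi>) p) UNIV"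
proof -
  define G where "G x = ee (- p) (E x) * cis (\<nu> * \<tau> x)" for x
  have tc: "continuous_on S \<tau>" for S by (rule continuous_on_subset[OF CN_continuous[OF CN_tau[of 0]]]) simp
  have Gc: "continuous_on UNIV G" unfolding G_def [abs_def]
    by (intro continuous_intros tc)
  have \<phi>c: "continuous_on UNIV \<phi>" using \<phi> by (intro CN_continuous[of 0]) (simp add: test_function_iff)
  have Gp: "periodic1 (\<lambda>x. G x * \<phi> x)"
    using periodic_tau test_function_periodic[OF \<phi>] periodic_E_compose[OF periodic1_ee[of "- p"]]
    by (simp add: periodic1_def G_def)
  have dc: "continuous_on UNIV (dual \<nu> \<phi>)" using dual_test[OF \<phi>] by (intro CN_continuous[of 0]) (simp add: test_function_iff)
  have "fourier_coeff (dual \<nu> \<phi>) p = integral {0..1} (\<lambda>y. ee (- p) y * dual \<nu> \<phi> y)"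
    unfolding fourier_coeff_ee by (intro LINT_continuous continuous_intros dc)
  also have "(\<lambda>y. ee (- p) y * dual \<nu> \<phi> y) = (\<lambda>y. \<Sum>\<epsilon><k. (1 / dE (branch \<epsilon> y)) *\<^sub>R (G (branch \<epsilon> y) * \<phi> (branch \<epsilon> y)))"
  proof
    fix y
    have "ee (- p) (E (branch \<epsilon> y)) = ee (- p) y" for \<epsilon>
      unfolding E_branch using ee_periodic[of "- p" y "int \<epsilon>"] by simp
    then show "ee (- p) y * dual \<nu> \<phi> y = (\<Sum>\<epsilon><k. (1 / dE (branch \<epsilon> y)) *\<^sub>R (G (branch \<epsilon> y) * \<phi> (branch \<epsilon> y)))"
      by (simp add: dual_def branch_sum_def G_def sum_distrib_left scaleR_conv_of_real mult_ac)
  qed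
  also have "integral {0..1} \<dots> = (\<Sum>\<epsilon><k. integral {0..1} (\<lambda>y. (1 / dE (branch \<epsilon> y)) *\<^sub>R (G (branch \<epsilon> y) * \<phi> (branch \<epsilon> y))))"
  proof (intro integral_sum integrable_continuous_real continuous_on_subset[OF CN_continuous[of 0]])
    have "dE x \<noteq> 0" for x using dE_pos[of x] by simp
    moreover have "CN 0 (\<lambda>x. G x * \<phi> x)" using Gc \<phi>c by (auto intro: continuous_on_mult)
    ultimately have "CN 0 (\<lambda>x. inverse (dE x) *\<^sub>R (G x * \<phi> x))"
      by (intro CN_scaleR CN_inverse CN_dE)
    from CN_compose[OF this CN_branch]
    show "CN 0 (\<lambda>y. (1 / dE (branch \<epsilon> y)) *\<^sub>R (G (branch \<epsilon> y) * \<phi> (branch \<epsilon> y)))" for \<epsilon>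
      by (simp add: divide_inverse)
  qed auto
  also have "\<dots> = integral {0..1} (\<lambda>x. G x * \<phi> x)"
    by (rule branch_change_of_variables[symmetric, OF continuous_on_mult[OF Gc \<phi>c] Gp])
  finally have eq: "fourier_coeff (dual \<nu> \<phi>) p = integral {0..1} (\<lambda>x. G x * \<phi> x)" .
  have Teq: "T 1 \<nu> (- l) (- p) = integral {0..1} (\<lambda>x. G x * ee l x)" for l
    unfolding T_eq_integral G_def by (simp add: ee_def cis_mult theta_def Phi_def algebra_simps)
  show ?thesis unfolding eq Teq
    by (rule fourier_integral_expansion[OF test_function_CB[OF \<phi>] test_function_periodic[OF \<phi>] Gc continuous_on_id])
qed

lemma transfer_op_dist:
  assumes R0: "R > 0" and c: "poly_bounded c"
  shows "transfer_op k g \<tau> \<nu> (dist_of_coeffs c) = dist_of_coeffs (Top 1 \<nu> c)"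
proof
  fix \<phi>
  show "transfer_op k g \<tau> \<nu> (dist_of_coeffs c) \<phi> = dist_of_coeffs (Top 1 \<nu> c) \<phi>"
  proof (cases "\<phi> \<in> test_functions")
    case True
    obtain K q where K: "K \<ge> 0" "\<And>j l. cmod (T 1 \<nu> j l * c l) \<le> K * (max 1 \<bar>real_of_int j\<bar>) ^ q / (max 1 \<bar>real_of_int l\<bar>)\<^sup>2"
      using Top_term_bound[OF R0 order.refl c] by blast
    obtain C where C: "C \<ge> 0" "\<And>l. cmod (fourier_coeff \<phi> l) \<le> C / (max 1 \<bar>real_of_int l\<bar>) ^ (q + 2)"
      using test_function_rapid[OF True] unfolding rapid_def by blast
    define A where "A p l = fourier_coeff \<phi> l * (T 1 \<nu> (- l) (- p) * c (- p))" for p l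
    have A: "cmod (A p l) \<le> (C * K) / (max 1 \<bar>real_of_int p\<bar>)\<^sup>2 / (max 1 \<bar>real_of_int l\<bar>)\<^sup>2" for p l
    proof -
      have nz: "max 1 \<bar>real_of_int p\<bar> \<noteq> 0" "max 1 \<bar>real_of_int l\<bar> \<noteq> 0" by linarith+
      have "cmod (A p l) \<le> C / (max 1 \<bar>real_of_int l\<bar>) ^ (q + 2) * (K * (max 1 \<bar>real_of_int l\<bar>) ^ q / (max 1 \<bar>real_of_int p\<bar>)\<^sup>2)"
        unfolding A_def norm_mult[of "fourier_coeff \<phi> l"]
        using K(2)[of "- l" "- p"] C by (intro mult_mono) auto
      also have "\<dots> = (C * K) / (max 1 \<bar>real_of_int p\<bar>)\<^sup>2 / (max 1 \<bar>real_of_int l\<bar>)\<^sup>2"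
        using nz by (simp add: power_add power2_eq_square field_simps)
      finally show ?thesis .
    qed
    have "transfer_op k g \<tau> \<nu> (dist_of_coeffs c) \<phi> = (\<Sum>\<^sub>\<infinity>p. fourier_coeff (dual \<nu> \<phi>) p * c (- p))"
      using True by (simp add: transfer_op_eq dist_of_coeffs_def dual_test)
    also have "\<dots> = (\<Sum>\<^sub>\<infinity>p. \<Sum>\<^sub>\<infinity>l. A p l)"
      unfolding infsumI[OF fourier_coeff_dual[OF True], symmetric] A_def
      by (simp add: infsum_cmult_left'[symmetric] mult.assoc)
    also have "\<dots> = (\<Sum>\<^sub>\<infinity>l. \<Sum>\<^sub>\<infinity>p. A p l)" by (rule int_double_sum_swap[OF A])
    also have "\<dots> = (\<Sum>\<^sub>\<infinity>l. fourier_coeff \<phi> l * Top 1 \<nu> c (- l))"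
    proof -
      have "(\<Sum>\<^sub>\<infinity>p. T 1 \<nu> (- l) (- p) * c (- p)) = Top 1 \<nu> c (- l)" for l
        unfolding Top_def by (rule infsum_reindex_bij_betw[of uminus UNIV UNIV]) (simp add: bij_uminus)
      then show ?thesis by (simp add: A_def infsum_cmult_right')
    qed
    finally show ?thesis using True by (simp add: dist_of_coeffs_def)
  qed (simp add: transfer_op_eq dist_of_coeffs_def)
qed

lemma resolvent_set_transfer_op:
  assumes R0: "R > 0" and m: "m < 0"
  shows "resolvent_set (sobolev m) (sobolev_norm m) (transfer_op k g \<tau> \<nu>) = wres (sob_weight m) (Top 1 \<nu>)"
  by (rule resolvent_set_eq_wres[OF sobolev_eq sobolev_norm_eq])
    (use m wop_Top[OF R0 order.refl m] transfer_op_dist[OF R0] wseq_poly_bounded[of _ m] sob_weight_nonneg in auto)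

end

text \<open>A geometric sum with ratio \<open>ee 1 (1 / real k)\<close>, which differs from 1 since
  \<open>k \<ge> 2\<close>. It provides the cancellation in \<open>dual_kernel\<close>.\<close>

lemma sum_roots_of_unity_shifted:
  assumes k: "k \<ge> (2::nat)"
  shows "(\<Sum>\<epsilon><k. ee 1 ((y + real \<epsilon>) / real k)) = 0"
proof -
  define w where "w = ee 1 (1 / real k)"
  have "2 * pi / real k \<le> pi" "0 < 2 * pi / real k" using k by (auto simp: field_simps)
  then have "cos (2 * pi / real k) < cos 0" by (intro cos_monotone_0_pi) auto
  then have w1: "w \<noteq> 1" by (auto simp: w_def ee_def complex_eq_iff)
  have pow: "ee 1 (real j * x) = ee 1 x ^ j" for j x
    by (induction j) (simp_all add: distrib_right ee_add_arg)
  have "w ^ k = 1" using pow[of k "1 / real k"] k ee_int[of 1 1] by (simp add: w_def)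
  then have "(w - 1) * (\<Sum>\<epsilon><k. w ^ \<epsilon>) = 0" by (simp add: power_diff_1_eq[symmetric])
  then have "(\<Sum>\<epsilon><k. w ^ \<epsilon>) = 0" using w1 by simp
  moreover have "ee 1 ((y + real \<epsilon>) / real k) = ee 1 (y / real k) * w ^ \<epsilon>" for \<epsilon>
    using pow[of \<epsilon> "1 / real k"] by (simp add: add_divide_distrib ee_add_arg w_def)
  ultimately show ?thesis by (simp add: sum_distrib_left[symmetric])
qed

lemma SUP_cmod_le:
  fixes A A' :: "complex set"
  assumes "bdd_above (cmod ` A)" "A' \<noteq> {}" "\<And>z. z \<in> A' \<Longrightarrow> cmod z > \<delta> \<Longrightarrow> z \<in> A"
  shows "(SUP z\<in>A'. cmod z) \<le> max \<delta> (SUP z\<in>A. cmod z)"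
proof (rule cSUP_least[OF assms(2)])
  fix z assume "z \<in> A'"
  then show "cmod z \<le> max \<delta> (SUP z\<in>A. cmod z)"
    using assms(3) cSUP_upper[OF _ assms(1), of z] by (cases "cmod z > \<delta>") auto
qed

section \<open>Nonempty spectrum and the spectral radius\<close>

context expanding_skew
begin

text \<open>The factors \<open>dE\<close> and \<open>cis (- \<nu> * \<tau> x)\<close> of the witness
  undo the weight of \<open>dual\<close>. There remains the sum of \<open>ee 1 (g x)\<close> over
  the branches, that is, of \<open>k\<close> equally spaced points of the unit circle.\<close>

lemma dual_kernel:
  obtains \<phi> where "\<phi> \<in> test_functions" "dual \<nu> \<phi> = (\<lambda>_. 0)" "\<phi> 0 \<noteq> 0"
proof
  define \<phi> where "\<phi> x = of_real (dE x) * cis (- \<nu> * \<tau> x) * ee 1 (g x)" for x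
  have "CN n \<phi>" for n
    unfolding \<phi>_def [abs_def] ee_def
    by (intro CN_mult CN_of_real CN_dE CN_cis CN_const CN_tau CN_g)
  moreover have "periodic1 \<phi>"
    using periodic_dE periodic_tau periodic1_ee[of 1] by (simp add: periodic1_def \<phi>_def g_shift)
  ultimately show "\<phi> \<in> test_functions" by (simp add: test_function_iff)
  have d: "dE x \<noteq> 0" for x using dE_pos[of x] by simp
  have "cis (\<nu> * \<tau> x) * of_real (1 / dE x) * \<phi> x = ee 1 (g x)" for x
  proof -
    have "cis (\<nu> * \<tau> x) * of_real (1 / dE x) * \<phi> x = (cis (\<nu> * \<tau> x) * cis (- \<nu> * \<tau> x)) * (of_real (1 / dE x) * of_real (dE x)) * ee 1 (g x)"
      unfolding \<phi>_def by (simp only: mult_ac)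
    also have "\<dots> = ee 1 (g x)" using d[of x] by (simp add: cis_mult)
    finally show ?thesis .
  qed
  then show "dual \<nu> \<phi> = (\<lambda>_. 0)"
    using sum_roots_of_unity_shifted[OF k2] by (simp add: dual_def branch_sum_def branch_def fun_eq_iff)
  show "\<phi> 0 \<noteq> 0" using d[of 0] by (metis \<phi>_def cis_neq_zero cmod_ee mult_eq_0_iff norm_zero of_real_eq_0_iff zero_neq_one)
qed

text \<open>An element of the kernel of the transpose annihilates the range. If 0 were a regular
  value the operator would be onto, so every unit sequence would pair to 0 with it, and all its
  Fourier coefficients would vanish.\<close>

lemma zero_in_spectrum:
  assumes R0: "R > 0" and m: "m < 0"
  shows "0 \<notin> wres (sob_weight m) (Top 1 \<nu>)"
proof
  assume "0 \<in> wres (sob_weight m) (Top 1 \<nu>)"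
  then obtain B where B: "wop (sob_weight m) (sob_weight m) B"
    "\<And>c. c \<in> wseq (sob_weight m) \<Longrightarrow> (\<lambda>n. 0 * B c n - Top 1 \<nu> (B c) n) = c" by (auto simp: wres_def)
  obtain \<phi> where \<phi>: "\<phi> \<in> test_functions" "dual \<nu> \<phi> = (\<lambda>_. 0)" "\<phi> 0 \<noteq> 0" by (rule dual_kernel)
  have "fourier_coeff \<phi> p = 0" for p
  proof -
    define c where "c n = (if n = - p then 1 else 0 :: complex)" for n
    have c: "c \<in> wseq (sob_weight m)"
    proof (rule summable_wseq(2))
      show "(\<lambda>n. (sob_weight m n * cmod (c n))\<^sup>2) summable_on UNIV"
        by (rule summable_on_cong_neutral[THEN iffD2, OF _ _ _ summable_on_finite[of "{- p}"]]) (auto simp: c_def)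
    qed
    define b where "b = B c"
    have "b \<in> wseq (sob_weight m)" unfolding b_def by (rule wop_in[OF B(1) c])
    then have b: "poly_bounded b" using wseq_poly_bounded[of b m] m by simp
    have "c = (\<lambda>n. - Top 1 \<nu> b n)" using B(2)[OF c] by (simp add: b_def)
    then have Tb: "Top 1 \<nu> b = (\<lambda>n. - c n)" by (auto simp: fun_eq_iff)
    have "dist_of_coeffs (Top 1 \<nu> b) \<phi> = dist_of_coeffs b (\<lambda>_. 0)"
      unfolding transfer_op_dist[OF R0 b, symmetric] by (simp add: transfer_op_eq \<phi>)
    also have "\<dots> = 0" by (simp add: dist_of_coeffs_def fourier_coeff_def)
    finally have "dist_of_coeffs (\<lambda>n. - c n) \<phi> = 0" unfolding Tb .
    then have "0 = (\<Sum>\<^sub>\<infinity>q. fourier_coeff \<phi> q * - c (- q))" by (simp add: dist_of_coeffs_def \<phi>(1))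
    also have "\<dots> = (\<Sum>\<^sub>\<infinity>q\<in>{p}. fourier_coeff \<phi> q * - c (- q))"
      by (rule infsum_cong_neutral) (auto simp: c_def)
    finally show ?thesis by (simp add: c_def)
  qed
  then have "\<phi> 0 = 0" using test_function_eq_fourier_series[OF \<phi>(1)] by (simp add: fourier_series_def fun_eq_iff)
  with \<phi>(3) show False by simp
qed

text \<open>Beyond the norm bound \<open>C\<close> the Neumann series converges. Together with
  \<open>zero_in_spectrum\<close> this makes the supremum in the spectral radius a genuine
  one.\<close>

lemma spectrum_bounded:
  assumes R0: "R > 0" and m: "m < 0"
  shows "bdd_above (cmod ` (- wres (sob_weight m) (Top 1 \<nu>)))"
proof -
  have w: "wop (sob_weight m) (sob_weight m) (Top 1 \<nu>)" by (rule wop_Top[OF R0 order.refl m])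
  obtain C where C: "C \<ge> 0" "\<And>c M. wnorm_le (sob_weight m) c M \<Longrightarrow> wnorm_le (sob_weight m) (Top 1 \<nu> c) (C * M)"
    using w by (auto simp: wop_def)
  have "cmod z \<le> C" if "z \<in> - wres (sob_weight m) (Top 1 \<nu>)" for z
    using neumann_wres[OF sob_weight_pos w C(2) C(1), of z] that by (meson ComplD not_le)
  then show ?thesis by (rule bdd_aboveI2)
qed

lemma transfer_spectral_radius_eq:
  assumes "R > 0" "m < 0"
  shows "transfer_spectral_radius k g \<tau> \<nu> m = (SUP z \<in> - wres (sob_weight m) (Top 1 \<nu>). cmod z)"
  unfolding transfer_spectral_radius_def spectral_radius_on_def resolvent_set_transfer_op[OF assms] ..

lemma transfer_spectral_radius_le:
  assumes R0: "R > 0" and m: "m < 0" "m' < 0"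
    and z: "\<And>z. cmod z > \<delta> \<Longrightarrow> z \<in> wres (sob_weight m) (Top 1 \<nu>) \<longleftrightarrow> z \<in> wres (sob_weight m') (Top 1 \<nu>)"
  shows "transfer_spectral_radius k g \<tau> \<nu> m' \<le> max \<delta> (transfer_spectral_radius k g \<tau> \<nu> m)"
  unfolding transfer_spectral_radius_eq[OF R0 m(1)] transfer_spectral_radius_eq[OF R0 m(2)]
  using zero_in_spectrum[OF R0 m(2)] z by (intro SUP_cmod_le spectrum_bounded R0 m) auto

lemma transfer_spectral_radius_leI:
  assumes R0: "R > 0" and m: "m < 0" and z: "\<And>z. cmod z > C \<Longrightarrow> z \<in> wres (sob_weight m) (Top 1 \<nu>)"
  shows "transfer_spectral_radius k g \<tau> \<nu> m \<le> C"
  unfolding transfer_spectral_radius_eq[OF R0 m]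
proof (rule cSUP_least)
  show "- wres (sob_weight m) (Top 1 \<nu>) \<noteq> {}" using zero_in_spectrum[OF R0 m] by auto
  show "cmod x \<le> C" if "x \<in> - wres (sob_weight m) (Top 1 \<nu>)" for x using z[of x] that by (meson ComplD not_le)
qed

text \<open>The spectra agree outside the disc of radius \<open>\<delta>\<close>, so each radius is
  at most the maximum of \<open>\<delta>\<close> and the other. A radius above
  \<open>\<delta>\<close> therefore forces equality.\<close>

lemma transfer_spectral_radius_independent:
  assumes R0: "R > 0" and \<delta>: "\<delta> > 0"
  shows "\<exists>m0<0. \<forall>\<nu>. \<forall>m\<le>m0. \<forall>m'\<le>m0. transfer_spectral_radius k g \<tau> \<nu> m > \<delta> \<longrightarrow>
    transfer_spectral_radius k g \<tau> \<nu> m' = transfer_spectral_radius k g \<tau> \<nu> m"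
proof -
  from resolvent_independent[OF R0 \<delta>] obtain m0 where "m0 < 0" and all: "\<forall>\<nu> m m' z. m \<le> m0 \<longrightarrow> m' \<le> m0 \<longrightarrow> cmod z > \<delta> \<longrightarrow>
      (z \<in> wres (sob_weight m) (Top 1 \<nu>) \<longleftrightarrow> z \<in> wres (sob_weight m') (Top 1 \<nu>))"
    by (elim exE conjE)
  note m0 = \<open>m0 < 0\<close> all[rule_format]
  show ?thesis
  proof (intro exI[of _ m0] conjI allI impI)
    fix \<nu> m m' assume mm: "m \<le> m0" "m' \<le> m0" and gt: "transfer_spectral_radius k g \<tau> \<nu> m > \<delta>"
    have "transfer_spectral_radius k g \<tau> \<nu> m' \<le> max \<delta> (transfer_spectral_radius k g \<tau> \<nu> m)"
      "transfer_spectral_radius k g \<tau> \<nu> m \<le> max \<delta> (transfer_spectral_radius k g \<tau> \<nu> m')"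
      by (rule transfer_spectral_radius_le[OF R0], use mm m0(1) in linarith, use mm m0(1) in linarith,
          rule m0(2), use mm in auto)+
    then show "transfer_spectral_radius k g \<tau> \<nu> m' = transfer_spectral_radius k g \<tau> \<nu> m" using gt by linarith
  qed (rule m0(1))
qed

text \<open>The exponent \<open>m0\<close> is the one beyond which spectra agree outside the radius
  \<open>1 / sqrt (E_min k g)\<close>. For each accuracy the resolvent bound holds at a possibly
  more negative exponent and is carried back to \<open>m0\<close> by this agreement, which makes
  both \<open>m0\<close> and \<open>h\<close> independent of the accuracy.\<close>

lemma transfer_spectral_radius_bound:
  assumes pc: "partially_captive k g \<tau> R"
  shows "\<exists>m0<0. \<exists>h. (h \<longlongrightarrow> 0) at_top \<and>
    (\<forall>\<nu>. \<forall>m\<le>m0. transfer_spectral_radius k g \<tau> \<nu> m \<le> 1 / sqrt (E_min k g) + h \<nu>)"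
proof -
  have R0: "R > 0" by (rule captive_radius_pos[OF pc])
  define \<rho> where "\<rho> = 1 / sqrt (E_min k g)"
  have \<rho>: "\<rho> > 0" using E_min by (simp add: \<rho>_def)
  from resolvent_independent[OF R0 \<rho>] obtain m0 where "m0 < 0" and all: "\<forall>\<nu> m m' z. m \<le> m0 \<longrightarrow> m' \<le> m0 \<longrightarrow> cmod z > \<rho> \<longrightarrow>
      (z \<in> wres (sob_weight m) (Top 1 \<nu>) \<longleftrightarrow> z \<in> wres (sob_weight m') (Top 1 \<nu>))"
    by (elim exE conjE)
  note m0 = \<open>m0 < 0\<close> all[rule_format]
  \<comment> \<open>The excess at the single exponent \<open>m0\<close>. It controls all
    \<open>m \<le> m0\<close>, as their radii can differ only below \<open>\<rho>\<close>.\<close>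
  define h where "h \<nu> = max 0 (transfer_spectral_radius k g \<tau> \<nu> m0 - \<rho>)" for \<nu>
  have "(h \<longlongrightarrow> 0) at_top"
  proof (rule tendstoI)
    fix \<eta> :: real assume \<eta>: "\<eta> > 0"
    then have "\<eta> / 2 > 0" by simp
    from spectral_gap_seq[OF pc this, folded \<rho>_def] obtain m1
      where m1: "\<forall>m\<le>m1. \<exists>\<nu>0. \<forall>\<nu>\<ge>\<nu>0. \<forall>z. cmod z > \<rho> + \<eta> / 2 \<longrightarrow> z \<in> wres (sob_weight m) (Top 1 \<nu>)"
      by (elim exE conjE)
    from m1[rule_format, of "min m0 m1"] obtain \<nu>0 where \<nu>0: "\<And>\<nu> z. \<nu> \<ge> \<nu>0 \<Longrightarrow> cmod z > \<rho> + \<eta> / 2 \<Longrightarrow> z \<in> wres (sob_weight (min m0 m1)) (Top 1 \<nu>)"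
      by auto
    have "transfer_spectral_radius k g \<tau> \<nu> m0 \<le> \<rho> + \<eta> / 2" if "\<nu> \<ge> \<nu>0" for \<nu>
    proof (rule transfer_spectral_radius_leI[OF R0 m0(1)])
      fix z assume z: "cmod z > \<rho> + \<eta> / 2"
      then have "cmod z > \<rho>" using \<eta> by linarith
      from m0(2)[OF _ _ this, of "min m0 m1" m0] show "z \<in> wres (sob_weight m0) (Top 1 \<nu>)" using \<nu>0[OF that z] by simp
    qed
    then have "dist (h \<nu>) 0 < \<eta>" if "\<nu> \<ge> \<nu>0" for \<nu> using that \<eta> unfolding h_def dist_real_def by (smt (verit) field_sum_of_halves)
    then show "\<forall>\<^sub>F \<nu> in at_top. dist (h \<nu>) 0 < \<eta>" unfolding eventually_at_top_linorder by blast
  qed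
  moreover have "transfer_spectral_radius k g \<tau> \<nu> m \<le> \<rho> + h \<nu>" if "m \<le> m0" for \<nu> m
  proof -
    have "transfer_spectral_radius k g \<tau> \<nu> m \<le> max \<rho> (transfer_spectral_radius k g \<tau> \<nu> m0)"
      using that m0(1) by (intro transfer_spectral_radius_le[OF R0] m0(2)) auto
    then show ?thesis by (simp add: h_def)
  qed
  ultimately show ?thesis using m0(1) unfolding \<rho>_def by blast
qed

end

theorem theorem2:
  fixes g \<tau> :: "real \<Rightarrow> real" and k :: nat and \<kappa> R :: real
  assumes "circle_diffeo_lift g"
    and "k \<ge> 2"
    and "smooth \<tau>" and "periodic1 \<tau>"
    and "E_min k g > 1"
    and "1 < \<kappa>" and "\<kappa> < E_min k g"
    and "R \<ge> 0" and "escape_radius k g \<tau> \<kappa> R"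
    and "partially_captive k g \<tau> R"
  shows "(\<forall>\<delta>>0. \<exists>m0<0. \<forall>\<nu>. \<forall>m\<le>m0. \<forall>m'\<le>m0.
            transfer_spectral_radius k g \<tau> \<nu> m > \<delta> \<longrightarrow>
            transfer_spectral_radius k g \<tau> \<nu> m' = transfer_spectral_radius k g \<tau> \<nu> m) \<and>
         (\<exists>m0<0. \<exists>h. (h \<longlongrightarrow> 0) at_top \<and>
            (\<forall>\<nu>. \<forall>m\<le>m0.
               transfer_spectral_radius k g \<tau> \<nu> m \<le> 1 / sqrt (E_min k g) + h \<nu>)) \<and>
         1 / sqrt (E_min k g) < 1"
proof -
  interpret expanding_skew g \<tau> k \<kappa> R
    by unfold_locales (use assms in auto)
  have "R > 0" by (rule captive_radius_pos[OF assms(10)])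
  moreover have "1 / sqrt (E_min k g) < 1" using assms(5) by simp
  ultimately show ?thesis
    using transfer_spectral_radius_independent transfer_spectral_radius_bound[OF assms(10)] by simp
qed

end
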